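(* Let $G=\mathrm{SL}(3,\mathbb{R})$, and let $H$ be a closed, connected subgroup of $AN$ that is compatible with $A$. The subgroup $H$ is a Cartan-decomposition subgroup of $G$ if and only if at least one of the following holds: (1) $\dim H\ge 3$; (2) $H=A$; (3) for some real $p\ne 0$, $H=\left\{\begin{pmatrix}1&s&t\\0&1&ps\\0&0&1\end{pmatrix}: s,t\in\mathbb{R}\right\}$; (4) for some real $p\neq 0$, $H=\left\{\begin{pmatrix}e^t&0&ps\\0&e^t&s\\0&0&e^{-2t}\end{pmatrix}: s,t\in\mathbb{R}\right\}$; (5) for some real $p\neq 0$, $H=\left\{\begin{pmatrix}e^{-2t}&s&ps\\0&e^t&0\\0&0&e^{t}\end{pmatrix}: s,t\in\mathbb{R}\right\}$; (6) $H=T\ltimes U_\omega$ for some (one-dimensional) one-parameter subgroup $T$ of $A$, with Lie algebra $\mathfrak t$, and some positive root $\omega$, and $\mathfrak t^+\smallsetminus\{0\}$ is not contained in the region $\mathcal C$ associated (as in the context) to $\omega$ and $\mathfrak t$.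
   Context: A closed subgroup $H$ of $G$ is a Cartan-decomposition subgroup of $G$ if $H$ is connected and there is a compact subset $C$ of $G$ with $CHC=G$. $A$ is the group of diagonal matrices in $\mathrm{SL}(3,\mathbb{R})$ with positive entries and $N$ is the group of upper-triangular matrices with $1$'s on the diagonal; $\mathfrak a,\mathfrak n$ are their Lie algebras. The positive roots are $\alpha(a)=a_1/a_2$, $\beta(a)=a_2/a_3$ (for $a=\mathrm{diag}(a_1,a_2,a_3)\in A$) and $\alpha+\beta$; the root spaces $\mathfrak u_\alpha,\mathfrak u_\beta,\mathfrak u_{\alpha+\beta}$ consist of the matrices whose only possibly nonzero entry is the $(1,2)$, $(2,3)$, $(1,3)$ entry respectively, and $U_\omega=\exp\mathfrak u_\omega$. A subgroup $H$ of $AN$ is compatible with $A$ if $H\subset T\,U\,C_N(T)$, where $T=A\cap(HN)$, $U=H\cap N$, and $C_N(T)$ is the centralizer of $T$ in $N$. Region $\mathcal C$: for a positive root $\omega$ and a one-dimensional subspace $\mathfrak t\subset\mathfrak a$, let $\mathfrak a_\omega=[\mathfrak u_\omega,\mathfrak u_{-\omega}]\cap\mathfrak a$ (a one-dimensional subspace). Choose rays (from $0$) $\mathfrak t^+\subset\mathfrak t$ and $\mathfrak a_\omega^+\subset\mathfrak a_\omega$ such that $\langle t\mid a\rangle\ge 0$ for all $t\in\mathfrak t^+$, $a\in\mathfrak a_\omega^+$, where $\langle\cdot\mid\cdot\rangle$ is the inner product on $\mathfrak a$ given by the Killing form. If $\mathfrak a_\omega^+$ (minus $0$) is contained in the interior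 of a Weyl chamber of $\mathfrak a$, then $\mathcal C$ is the interior of that Weyl chamber; if $\mathfrak a_\omega^+$ is the wall between two Weyl chambers $\mathcal C_1,\mathcal C_2$, then $\mathcal C$ is the interior of $\mathcal C_1\cup\mathfrak a_\omega^+\cup\mathcal C_2$. *)

theory Defs
  imports "HOL-Analysis.Analysis" "HOL-Algebra.Coset"
begin

type_synonym mat3 = "real^3^3"

definition SL3 :: "mat3 monoid" where
  "SL3 = \<lparr>carrier = {g. det g = 1}, mult = (**), one = mat 1\<rparr>"

lemma group_SL3: "group SL3"
proof (rule groupI)
  fix x assume "x \<in> carrier SL3"
  then have d: "det x = 1" by (simp add: SL3_def)
  then have "invertible x" by (simp add: invertible_det_nz)
  then obtain y where y: "y ** x = mat 1" unfolding invertible_def by blast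
  then have "det y * det x = 1" by (metis det_I det_mul)
  then show "\<exists>y\<in>carrier SL3. y \<otimes>\<^bsub>SL3\<^esub> x = \<one>\<^bsub>SL3\<^esub>"
    using y d by (auto simp: SL3_def)
qed (auto simp: SL3_def det_mul matrix_mul_assoc)

abbreviation set_prod :: "mat3 set \<Rightarrow> mat3 set \<Rightarrow> mat3 set" (infixl "\<odot>" 70) where
  "X \<odot> Y \<equiv> X <#>\<^bsub>SL3\<^esub> Y"

definition cartan_decomposition_subgroup :: "mat3 set \<Rightarrow> bool" where
  "cartan_decomposition_subgroup H \<longleftrightarrow>
     subgroup H SL3 \<and> closedin (top_of_set (carrier SL3)) H \<and> connected H \<and>
     (\<exists>C \<subseteq> carrier SL3. compact C \<and> C \<odot> H \<odot> C = carrier SL3)"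

definition mexp :: "mat3 \<Rightarrow> mat3" where
  "mexp X = (\<Sum>k. (1 / fact k) *\<^sub>R (((**) X ^^ k) (mat 1)))"

text \<open>The Lie algebra of a closed subgroup; the dimension of such a group is the dimension of
  this linear space.\<close>

definition lie_algebra :: "mat3 set \<Rightarrow> mat3 set" where
  "lie_algebra H = {X. \<forall>t. mexp (t *\<^sub>R X) \<in> H}"

definition lie_bracket :: "mat3 \<Rightarrow> mat3 \<Rightarrow> mat3" where
  "lie_bracket X Y = X ** Y - Y ** X"

definition A_grp :: "mat3 set" where
  "A_grp = {a \<in> carrier SL3. (\<forall>i j. i \<noteq> j \<longrightarrow> a $ i $ j = 0) \<and> (\<forall>i. a $ i $ i > 0)}"

text \<open>The order on the index type \<open>3\<close> is not usable for upper triangularity, since there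
  the numeral \<open>3\<close> equals \<open>0\<close>; hence the entries are listed.\<close>

definition N_grp :: "mat3 set" where
  "N_grp = {n. (\<forall>i. n $ i $ i = 1) \<and> n $ 2 $ 1 = 0 \<and> n $ 3 $ 1 = 0 \<and> n $ 3 $ 2 = 0}"

definition compatible_with_A :: "mat3 set \<Rightarrow> bool" where
  "compatible_with_A H \<longleftrightarrow>
     (let T = A_grp \<inter> (H \<odot> N_grp);
          U = H \<inter> N_grp;
          C = {n \<in> N_grp. \<forall>t \<in> T. n ** t = t ** n}
      in H \<subseteq> T \<odot> U \<odot> C)"

datatype pos_root = Alpha | Beta | AlphaBeta

fun root_row :: "pos_root \<Rightarrow> 3" where
  "root_row Alpha = 1" | "root_row Beta = 2" | "root_row AlphaBeta = 1"

fun root_col :: "pos_root \<Rightarrow> 3" where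
  "root_col Alpha = 2" | "root_col Beta = 3" | "root_col AlphaBeta = 3"

text \<open>The differential at the identity of the character \<open>a \<mapsto> a\<^sub>i / a\<^sub>j\<close> of \<open>A\<close>.\<close>

definition root_fun :: "pos_root \<Rightarrow> mat3 \<Rightarrow> real" where
  "root_fun \<omega> X = X $ root_row \<omega> $ root_row \<omega> - X $ root_col \<omega> $ root_col \<omega>"

definition root_space :: "pos_root \<Rightarrow> mat3 set" where
  "root_space \<omega> = {X. \<forall>i j. (i, j) \<noteq> (root_row \<omega>, root_col \<omega>) \<longrightarrow> X $ i $ j = 0}"

definition neg_root_space :: "pos_root \<Rightarrow> mat3 set" where
  "neg_root_space \<omega> = {X. \<forall>i j. (i, j) \<noteq> (root_col \<omega>, root_row \<omega>) \<longrightarrow> X $ i $ j = 0}"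

definition root_group :: "pos_root \<Rightarrow> mat3 set" where
  "root_group \<omega> = mexp ` root_space \<omega>"

definition a_alg :: "mat3 set" where
  "a_alg = lie_algebra A_grp"

definition a_root :: "pos_root \<Rightarrow> mat3 set" where
  "a_root \<omega> =
     span {lie_bracket X Y | X Y. X \<in> root_space \<omega> \<and> Y \<in> neg_root_space \<omega>} \<inter> a_alg"

text \<open>The trace of an endomorphism \<open>f\<close> of the finite-dimensional space \<open>V\<close>; it does not depend
  on the chosen basis.\<close>

definition trace_on :: "mat3 set \<Rightarrow> (mat3 \<Rightarrow> mat3) \<Rightarrow> real" where
  "trace_on V f =
     (let B = (SOME B. independent B \<and> span B = V) in \<Sum>b\<in>B. representation B (f b) b)"

definition sl3_alg :: "mat3 set" where
  "sl3_alg = {X. trace X = 0}"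

definition killing_form :: "mat3 \<Rightarrow> mat3 \<Rightarrow> real" where
  "killing_form X Y = trace_on sl3_alg (\<lambda>Z. lie_bracket X (lie_bracket Y Z))"

text \<open>Weyl chambers are closed, and interiors are taken relative to the Lie algebra of \<open>A\<close>.\<close>

definition weyl_chambers :: "mat3 set set" where
  "weyl_chambers = closure ` components {X \<in> a_alg. \<forall>\<omega>. root_fun \<omega> X \<noteq> 0}"

definition interior_a :: "mat3 set \<Rightarrow> mat3 set" where
  "interior_a S = top_of_set a_alg interior_of S"

definition is_ray :: "mat3 set \<Rightarrow> bool" where
  "is_ray R \<longleftrightarrow> (\<exists>v. v \<noteq> 0 \<and> R = {r *\<^sub>R v | r. r \<ge> 0})"

definition ray_choice :: "pos_root \<Rightarrow> mat3 set \<Rightarrow> mat3 set \<Rightarrow> mat3 set \<Rightarrow> bool" where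
  "ray_choice \<omega> \<tt> tplus aplus \<longleftrightarrow>
     is_ray tplus \<and> tplus \<subseteq> \<tt> \<and> is_ray aplus \<and> aplus \<subseteq> a_root \<omega> \<and>
     (\<forall>t \<in> tplus. \<forall>a \<in> aplus. killing_form t a \<ge> 0)"

definition is_region :: "mat3 set \<Rightarrow> mat3 set \<Rightarrow> bool" where
  "is_region aplus C \<longleftrightarrow>
     (\<exists>W \<in> weyl_chambers. aplus - {0} \<subseteq> interior_a W \<and> C = interior_a W) \<or>
     (\<exists>W1 \<in> weyl_chambers. \<exists>W2 \<in> weyl_chambers.
        W1 \<noteq> W2 \<and> aplus = W1 \<inter> W2 \<and> C = interior_a (W1 \<union> aplus \<union> W2))"

text \<open>Negating both rays, or (when the two lines are orthogonal) either of them, turns one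
  admissible choice into any other and does not affect whether the ray avoids the region, so
  the existential quantifier here expresses the informal ``choose rays''.\<close>

definition ray_not_in_region :: "pos_root \<Rightarrow> mat3 set \<Rightarrow> bool" where
  "ray_not_in_region \<omega> \<tt> \<longleftrightarrow>
     (\<exists>tplus aplus C. ray_choice \<omega> \<tt> tplus aplus \<and> is_region aplus C \<and> \<not> tplus - {0} \<subseteq> C)"

end

theory Submission
  imports Defs
begin

text \<open>
  By the Cartan decomposition \<open>G = K A\<^sup>+ K\<close>, the position of \<open>h\<close> in the Weyl chamber is known up to
  bounded error from the sizes of \<open>h\<close> and of its inverse. Hence a closed connected \<open>H\<close> is a
  Cartan-decomposition subgroup iff the pairs \<open>(ln \<parallel>h\<parallel>, ln \<parallel>h\<^sup>-\<^sup>1\<parallel>)\<close> are coarsely dense in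
  the cone \<open>x / 2 \<le> y \<le> 2 x\<close>. Since \<open>H\<close> is closed under inversion, the half \<open>x \<le> y \<le> 2 x\<close> of
  the cone suffices.

  A closed connected subgroup is determined by its Lie algebra, so it remains to go through
  the subalgebras of \<open>\<aa> + \<nn>\<close>. Compatibility with \<open>A\<close> puts the torus part in the normal form
  \<open>\<tau> + \<gamma> E\<^sub>\<omega>\<close> with \<open>\<gamma> = 0\<close> unless \<open>\<omega>(\<tau>) = 0\<close>, and in each case the group consists of explicit
  triangular matrices whose norms can be compared. For \<open>T U\<^sub>\<omega>\<close> the outcome depends only on whether
  the weight of \<open>T\<close> at the index not involved in \<open>\<omega>\<close> lies strictly between the other two: the coroot
  of \<open>\<omega>\<close> is never on a wall, so this says that \<open>\<tt>\<^sup>+\<close> lies in the region of the statement.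
\<close>

section \<open>Coordinates for matrices\<close>

text \<open>In the Cartan decomposition the size of \<open>h\<close> fixes the first diagonal entry,
  the size of the inverse the last one, and determinant one the middle one, called \<open>Z\<close>
  below. Density is proved by exhibiting an element for every pair \<open>X\<close>,
  \<open>Z\<close>; it is refuted by testing one edge of the half cone, Z = X or Z = 1. The obstacle
  is that compatibility speaks of group elements one at a time: the factor centralizing
  \<open>T\<close> that it provides for \<open>mexp (s X)\<close> comes with no continuity in
  \<open>s\<close>. A tangent vector has to be recovered by compactness, and it may carry a multiple
  \<gamma> of a root vector that cannot be removed. In such twisted groups an entry
  \<open>t * exp t\<close> outgrows the weight \<open>exp t\<close> by a factor only logarithmic in
  the size, and the estimates must follow this gain. Refutations are carried out on a product of two
  one-parameter groups whose closure contains \<open>H\<close>; hence the stability of coarse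
  density under closure, and the role of inclusions between Lie algebras in placing
  \<open>H\<close>.\<close>

lemma mat3_eq_iff:
  "(A::real^3^3) = B \<longleftrightarrow>
     A$1$1 = B$1$1 \<and> A$1$2 = B$1$2 \<and> A$1$3 = B$1$3 \<and>
     A$2$1 = B$2$1 \<and> A$2$2 = B$2$2 \<and> A$2$3 = B$2$3 \<and>
     A$3$1 = B$3$1 \<and> A$3$2 = B$3$2 \<and> A$3$3 = B$3$3"
  by (simp add: vec_eq_iff forall_3)

lemma mat_mult_3:
  "((A::mat3) ** (B::mat3)) $ i $ j = A$i$1 * B$1$j + A$i$2 * B$2$j + A$i$3 * B$3$j"
  by (simp add: matrix_matrix_mult_def sum_3)

definition mk :: "real \<Rightarrow> real \<Rightarrow> real \<Rightarrow> real \<Rightarrow> real \<Rightarrow> real \<Rightarrow> real \<Rightarrow> real \<Rightarrow> real \<Rightarrow> mat3" where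
  "mk a b c d e f g h i = vector [vector [a, b, c], vector [d, e, f], vector [g, h, i]]"

lemma mk_nth [simp]:
  "mk a b c d e f g h i $ 1 $ 1 = a" "mk a b c d e f g h i $ 1 $ 2 = b" "mk a b c d e f g h i $ 1 $ 3 = c"
  "mk a b c d e f g h i $ 2 $ 1 = d" "mk a b c d e f g h i $ 2 $ 2 = e" "mk a b c d e f g h i $ 2 $ 3 = f"
  "mk a b c d e f g h i $ 3 $ 1 = g" "mk a b c d e f g h i $ 3 $ 2 = h" "mk a b c d e f g h i $ 3 $ 3 = i"
  by (simp_all add: mk_def)

text \<open>The adjugate. On determinant one it is the inverse, and being polynomial in the entries
  it is continuous everywhere, with size controlled by 2 x 2 minors.\<close>

definition adj3 :: "mat3 \<Rightarrow> mat3" where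
  "adj3 A = mk
     (A$2$2 * A$3$3 - A$2$3 * A$3$2) (A$1$3 * A$3$2 - A$1$2 * A$3$3) (A$1$2 * A$2$3 - A$1$3 * A$2$2)
     (A$2$3 * A$3$1 - A$2$1 * A$3$3) (A$1$1 * A$3$3 - A$1$3 * A$3$1) (A$1$3 * A$2$1 - A$1$1 * A$2$3)
     (A$2$1 * A$3$2 - A$2$2 * A$3$1) (A$1$2 * A$3$1 - A$1$1 * A$3$2) (A$1$1 * A$2$2 - A$1$2 * A$2$1)"

lemma mat1_nth [simp]:
  "(mat 1 :: mat3) $ 1 $ 1 = 1" "(mat 1 :: mat3) $ 1 $ 2 = 0" "(mat 1 :: mat3) $ 1 $ 3 = 0"
  "(mat 1 :: mat3) $ 2 $ 1 = 0" "(mat 1 :: mat3) $ 2 $ 2 = 1" "(mat 1 :: mat3) $ 2 $ 3 = 0"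
  "(mat 1 :: mat3) $ 3 $ 1 = 0" "(mat 1 :: mat3) $ 3 $ 2 = 0" "(mat 1 :: mat3) $ 3 $ 3 = 1"
  by (simp_all add: mat_def)

lemma adj3_mult: "adj3 A ** A = det A *\<^sub>R mat 1" "A ** adj3 A = det A *\<^sub>R mat 1"
  unfolding mat3_eq_iff by (simp_all add: mat_mult_3 adj3_def det_3 algebra_simps)

lemma SL3_iff: "g \<in> carrier SL3 \<longleftrightarrow> det g = 1"
  by (simp add: SL3_def)

lemma mult_SL3 [simp]: "x \<otimes>\<^bsub>SL3\<^esub> y = x ** y"
  by (simp add: SL3_def)

lemma one_SL3 [simp]: "\<one>\<^bsub>SL3\<^esub> = mat 1"
  by (simp add: SL3_def)

lemma adj3_inverse:
  assumes "det g = 1" shows "adj3 g ** g = mat 1" "g ** adj3 g = mat 1"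
  using adj3_mult[of g] assms by simp_all

lemma det_adj3: assumes "det g = 1" shows "det (adj3 g) = 1"
  using adj3_inverse(1)[OF assms] assms by (metis det_I det_mul mult_cancel_left1 mult.commute)

lemma inv_SL3: assumes "det g = 1" shows "inv\<^bsub>SL3\<^esub> g = adj3 g"
proof -
  interpret group SL3 by (rule group_SL3)
  show ?thesis
    by (rule inv_equality) (use assms det_adj3 adj3_inverse in \<open>auto simp: SL3_iff\<close>)
qed

lemma adj3_unique: assumes "det g = 1" "h ** g = mat 1" shows "adj3 g = h"
  by (metis adj3_inverse(2) assms matrix_mul_assoc matrix_mul_lid matrix_mul_rid)

lemma adj3_mul: assumes "det g = 1" "det h = 1" shows "adj3 (g ** h) = adj3 h ** adj3 g"
proof (rule adj3_unique)
  show "det (g ** h) = 1" by (simp add: det_mul assms)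
  have "adj3 h ** adj3 g ** (g ** h) = adj3 h ** (adj3 g ** g) ** h" by (simp add: matrix_mul_assoc)
  then show "adj3 h ** adj3 g ** (g ** h) = mat 1" using assms by (simp add: adj3_inverse)
qed

lemma adj3_adj3: assumes "det g = 1" shows "adj3 (adj3 g) = g"
  by (rule adj3_unique) (use assms in \<open>auto simp: det_adj3 adj3_inverse\<close>)

lemma adj3_mat1 [simp]: "adj3 (mat 1) = mat 1"
  by (rule adj3_unique) auto

text \<open>The arguments are the diagonal, then the entries of the roots \<alpha>, \<beta> and
  \<alpha>+\<beta> in this order, so that the two simple roots precede the entry that their products
  feed.\<close>

definition ut :: "real \<Rightarrow> real \<Rightarrow> real \<Rightarrow> real \<Rightarrow> real \<Rightarrow> real \<Rightarrow> mat3" where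
  "ut a b c u v w = mk a u w 0 b v 0 0 c"

lemma ut_nth [simp]:
  "ut a b c u v w $ 1 $ 1 = a" "ut a b c u v w $ 1 $ 2 = u" "ut a b c u v w $ 1 $ 3 = w"
  "ut a b c u v w $ 2 $ 1 = 0" "ut a b c u v w $ 2 $ 2 = b" "ut a b c u v w $ 2 $ 3 = v"
  "ut a b c u v w $ 3 $ 1 = 0" "ut a b c u v w $ 3 $ 2 = 0" "ut a b c u v w $ 3 $ 3 = c"
  by (simp_all add: ut_def)

lemma ut_eq_iff: "ut a b c u v w = ut a' b' c' u' v' w' \<longleftrightarrow>
   a = a' \<and> b = b' \<and> c = c' \<and> u = u' \<and> v = v' \<and> w = w'"
  unfolding mat3_eq_iff by auto

lemma ut_mult: "ut a b c u v w ** ut a' b' c' u' v' w' =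
   ut (a * a') (b * b') (c * c') (a * u' + u * b') (b * v' + v * c') (a * w' + u * v' + w * c')"
  unfolding mat3_eq_iff by (simp add: mat_mult_3)

lemma ut_add: "ut a b c u v w + ut a' b' c' u' v' w' = ut (a+a') (b+b') (c+c') (u+u') (v+v') (w+w')"
  unfolding mat3_eq_iff by simp

lemma ut_diff: "ut a b c u v w - ut a' b' c' u' v' w' = ut (a-a') (b-b') (c-c') (u-u') (v-v') (w-w')"
  unfolding mat3_eq_iff by simp

lemma ut_scale: "r *\<^sub>R ut a b c u v w = ut (r * a) (r * b) (r * c) (r * u) (r * v) (r * w)"
  unfolding mat3_eq_iff by simp

lemma ut_one: "mat 1 = ut 1 1 1 0 0 0"
  unfolding mat3_eq_iff by simp

lemma ut_zero: "0 = ut 0 0 0 0 0 0"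
  unfolding mat3_eq_iff by simp

lemma ut_adj3: "adj3 (ut a b c u v w) = ut (b * c) (a * c) (a * b) (-(u * c)) (-(v * a)) (u * v - w * b)"
  unfolding mat3_eq_iff by (simp add: adj3_def)

lemma ut_det: "det (ut a b c u v w) = a * b * c"
  by (simp add: det_3)

lemma ut_lie_bracket: "lie_bracket (ut a b c u v w) (ut a' b' c' u' v' w') =
   ut 0 0 0 ((a-b) * u' - (a'-b') * u) ((b-c) * v' - (b'-c') * v) ((a-c) * w' - (a'-c') * w + u * v' - u' * v)"
  unfolding lie_bracket_def ut_mult ut_diff ut_eq_iff by (simp add: algebra_simps)

lemma ut_exhaust:
  assumes "X$2$1 = 0" "X$3$1 = 0" "X$3$2 = 0"
  shows "X = ut (X$1$1) (X$2$2) (X$3$3) (X$1$2) (X$2$3) (X$1$3)"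
  using assms unfolding mat3_eq_iff by simp

lemma A_grp_iff: "g \<in> A_grp \<longleftrightarrow> (\<exists>a b c. a > 0 \<and> b > 0 \<and> c > 0 \<and> a * b * c = 1 \<and> g = ut a b c 0 0 0)"
proof
  assume g: "g \<in> A_grp"
  have "(2::3) \<noteq> 1" "(3::3) \<noteq> 1" "(3::3) \<noteq> 2" "(1::3) \<noteq> 2" "(1::3) \<noteq> 3" "(2::3) \<noteq> 3" by simp_all
  then have "g = ut (g$1$1) (g$2$2) (g$3$3) 0 0 0"
    using g unfolding A_grp_def mat3_eq_iff by simp
  with g show "\<exists>a b c. a > 0 \<and> b > 0 \<and> c > 0 \<and> a * b * c = 1 \<and> g = ut a b c 0 0 0"
    unfolding A_grp_def
    by (intro exI[of _ "g$1$1"] exI[of _ "g$2$2"] exI[of _ "g$3$3"]) (auto simp: SL3_iff ut_det dest: arg_cong[of _ _ det])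
next
  assume "\<exists>a b c. a > 0 \<and> b > 0 \<and> c > 0 \<and> a * b * c = 1 \<and> g = ut a b c 0 0 0"
  then show "g \<in> A_grp" by (auto simp: A_grp_def SL3_iff ut_det forall_3)
qed

lemma N_grp_iff: "g \<in> N_grp \<longleftrightarrow> (\<exists>u v w. g = ut 1 1 1 u v w)"
proof
  assume g: "g \<in> N_grp"
  then have "g = ut 1 1 1 (g$1$2) (g$2$3) (g$1$3)"
    unfolding N_grp_def mat3_eq_iff by simp
  then show "\<exists>u v w. g = ut 1 1 1 u v w" by blast
qed (auto simp: N_grp_def forall_3)

lemma set_prod_iff: "x \<in> X \<odot> Y \<longleftrightarrow> (\<exists>a\<in>X. \<exists>b\<in>Y. x = a ** b)"
  by (simp add: set_mult_def) 

lemma AN_iff: "g \<in> A_grp \<odot> N_grp \<longleftrightarrow>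
  (\<exists>a b c u v w. a > 0 \<and> b > 0 \<and> c > 0 \<and> a * b * c = 1 \<and> g = ut a b c u v w)" (is "_ \<longleftrightarrow> ?R")
proof
  assume "g \<in> A_grp \<odot> N_grp"
  then obtain a b c u v w where *: "a > 0" "b > 0" "c > 0" "a*b*c = 1" "g = ut a b c 0 0 0 ** ut 1 1 1 u v w"
    unfolding set_prod_iff using A_grp_iff N_grp_iff by metis
  have "g = ut a b c (a * u) (b * v) (a * w)" using *(5) by (simp add: ut_mult)
  then show ?R using *(1-4) by blast
next
  assume ?R
  then obtain a b c u v w where *: "a > 0" "b > 0" "c > 0" "a * b * c = 1" "g = ut a b c u v w" by blast
  then have "g = ut a b c 0 0 0 ** ut 1 1 1 (u/a) (v/b) (w/a)" by (simp add: ut_mult ut_eq_iff)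
  moreover have "ut a b c 0 0 0 \<in> A_grp" "ut 1 1 1 (u/a) (v/b) (w/a) \<in> N_grp"
    using * by (auto simp: A_grp_iff N_grp_iff) 
  ultimately show "g \<in> A_grp \<odot> N_grp" unfolding set_prod_iff by blast
qed

section \<open>Norm bounds and continuity of the matrix operations\<close>

lemma entry_le_norm: "\<bar>(A::mat3) $ i $ j\<bar> \<le> norm A"
  using component_le_norm_cart[of "A$i" j] Finite_Cartesian_Product.norm_nth_le[of A i] by linarith

lemma norm_le_entries:
  "norm (A::mat3) \<le> \<bar>A$1$1\<bar> + \<bar>A$1$2\<bar> + \<bar>A$1$3\<bar> + \<bar>A$2$1\<bar> + \<bar>A$2$2\<bar> + \<bar>A$2$3\<bar> + \<bar>A$3$1\<bar> + \<bar>A$3$2\<bar> + \<bar>A$3$3\<bar>"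
proof -
  have "norm A \<le> (\<Sum>i\<in>UNIV. norm (A$i))" by (simp add: norm_vec_def L2_set_le_sum)
  also have "\<dots> \<le> (\<Sum>i\<in>UNIV. \<Sum>j\<in>UNIV. \<bar>A$i$j\<bar>)" by (intro sum_mono norm_le_l1_cart)
  finally show ?thesis by (simp add: sum_3)
qed

lemma norm_ut_le: "norm (ut a b c u v w) \<le> \<bar>a\<bar> + \<bar>b\<bar> + \<bar>c\<bar> + \<bar>u\<bar> + \<bar>v\<bar> + \<bar>w\<bar>"
  using norm_le_entries[of "ut a b c u v w"] by simp

lemma norm_ut_ge:
  "\<bar>a\<bar> \<le> norm (ut a b c u v w)" "\<bar>b\<bar> \<le> norm (ut a b c u v w)" "\<bar>c\<bar> \<le> norm (ut a b c u v w)"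
  "\<bar>u\<bar> \<le> norm (ut a b c u v w)" "\<bar>v\<bar> \<le> norm (ut a b c u v w)" "\<bar>w\<bar> \<le> norm (ut a b c u v w)"
  using entry_le_norm[of "ut a b c u v w" 1 1] entry_le_norm[of "ut a b c u v w" 2 2]
    entry_le_norm[of "ut a b c u v w" 3 3] entry_le_norm[of "ut a b c u v w" 1 2]
    entry_le_norm[of "ut a b c u v w" 2 3] entry_le_norm[of "ut a b c u v w" 1 3] by simp_all

text \<open>27 counts nine entries with three products each. Constants of this kind are never sharp;
  what matters is that they are uniform.\<close>

lemma norm_mult_le: "norm ((A::mat3) ** (B::mat3)) \<le> 27 * norm A * norm B"
proof -
  have e: "\<bar>(A ** B) $ i $ j\<bar> \<le> 3 * (norm A * norm B)" for i j
  proof -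
    have "\<bar>(A ** B) $ i $ j\<bar> \<le> \<bar>A$i$1\<bar> * \<bar>B$1$j\<bar> + \<bar>A$i$2\<bar> * \<bar>B$2$j\<bar> + \<bar>A$i$3\<bar> * \<bar>B$3$j\<bar>"
      unfolding mat_mult_3 abs_mult[symmetric] by linarith
    also have "\<dots> \<le> norm A * norm B + norm A * norm B + norm A * norm B"
      by (intro add_mono mult_mono entry_le_norm abs_ge_zero norm_ge_zero)
    finally show ?thesis by simp
  qed
  show ?thesis
    using norm_le_entries[of "A ** B"] e[of 1 1] e[of 1 2] e[of 1 3] e[of 2 1] e[of 2 2] e[of 2 3]
      e[of 3 1] e[of 3 2] e[of 3 3] by linarith
qed


lemma bounded_bilinear_mult: "bounded_bilinear ((**) :: mat3 \<Rightarrow> mat3 \<Rightarrow> mat3)"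
proof
  have "norm (a ** b) \<le> norm a * norm b * 27" for a b :: mat3
    using norm_mult_le[of a b] by simp
  then show "\<exists>K. \<forall>(a::mat3) (b::mat3). norm (a ** b) \<le> norm a * norm b * K" by blast
qed (auto simp: mat3_eq_iff mat_mult_3 algebra_simps)

lemmas continuous_on_mat_mult [continuous_intros] =
  bounded_bilinear.continuous_on[OF bounded_bilinear_mult]

lemmas tendsto_mat_mult [tendsto_intros] =
  bounded_bilinear.tendsto[OF bounded_bilinear_mult]

lemma tendsto_mat3_iff: "((f :: 'a \<Rightarrow> mat3) \<longlongrightarrow> l) F \<longleftrightarrow> (\<forall>i j. ((\<lambda>x. f x $ i $ j) \<longlongrightarrow> l $ i $ j) F)"
proof
  assume "\<forall>i j. ((\<lambda>x. f x $ i $ j) \<longlongrightarrow> l $ i $ j) F"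
  then have "((\<lambda>x. f x $ i) \<longlongrightarrow> l $ i) F" for i by (intro vec_tendstoI[of "\<lambda>x. f x $ i"]) simp
  then show "(f \<longlongrightarrow> l) F" by (rule vec_tendstoI)
qed (auto dest: tendsto_vec_nth)

lemma tendsto_mk [tendsto_intros]:
  assumes "(a \<longlongrightarrow> a') F" "(b \<longlongrightarrow> b') F" "(c \<longlongrightarrow> c') F" "(d \<longlongrightarrow> d') F"
    "(e \<longlongrightarrow> e') F" "(f \<longlongrightarrow> f') F" "(g \<longlongrightarrow> g') F" "(h \<longlongrightarrow> h') F" "(i \<longlongrightarrow> i') F"
  shows "((\<lambda>x. mk (a x) (b x) (c x) (d x) (e x) (f x) (g x) (h x) (i x)) \<longlongrightarrow> mk a' b' c' d' e' f' g' h' i') F"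
  unfolding tendsto_mat3_iff forall_3 using assms by simp

lemma tendsto_ut [tendsto_intros]:
  assumes "(a \<longlongrightarrow> a') F" "(b \<longlongrightarrow> b') F" "(c \<longlongrightarrow> c') F" "(u \<longlongrightarrow> u') F" "(v \<longlongrightarrow> v') F" "(w \<longlongrightarrow> w') F"
  shows "((\<lambda>x. ut (a x) (b x) (c x) (u x) (v x) (w x)) \<longlongrightarrow> ut a' b' c' u' v' w') F"
  unfolding ut_def using assms by (intro tendsto_intros)

lemma tendsto_adj3 [tendsto_intros]:
  assumes "(f \<longlongrightarrow> l) F" shows "((\<lambda>x. adj3 (f x)) \<longlongrightarrow> adj3 l) F"
  unfolding adj3_def using assms by (intro tendsto_intros)

lemma tendsto_det3 [tendsto_intros]:
  assumes "((f :: 'a \<Rightarrow> mat3) \<longlongrightarrow> l) F" shows "((\<lambda>x. det (f x)) \<longlongrightarrow> det l) F"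
  unfolding det_3 using assms by (intro tendsto_intros)

lemma continuous_on_det3 [continuous_intros]: "continuous_on S (f::'a::topological_space \<Rightarrow> mat3) \<Longrightarrow> continuous_on S (\<lambda>x. det (f x))"
  unfolding continuous_on_def by (auto intro: tendsto_intros)

lemma continuous_on_adj3 [continuous_intros]: "continuous_on S (f::'a::topological_space \<Rightarrow> mat3) \<Longrightarrow> continuous_on S (\<lambda>x. adj3 (f x))"
  unfolding continuous_on_def by (auto intro: tendsto_intros)

lemma closed_SL3: "closed (carrier SL3)"
proof -
  have "carrier SL3 = (\<lambda>g. det g) -` {1}" by (auto simp: SL3_iff)
  then show ?thesis by (auto intro!: closed_vimage continuous_intros)
qed

lemma norm_adj3_le: "norm (adj3 g) \<le> 18 * (norm g)\<^sup>2"
proof -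
  have p: "\<bar>g$i$j * g$k$l - g$m$n * g$p$q\<bar> \<le> 2 * (norm g)\<^sup>2" for i j k l m n p q
  proof -
    have "\<bar>g$i$j * g$k$l\<bar> \<le> norm g * norm g" "\<bar>g$m$n * g$p$q\<bar> \<le> norm g * norm g"
      unfolding abs_mult by (intro mult_mono entry_le_norm; simp)+
    then show ?thesis unfolding power2_eq_square by linarith
  qed
  have "norm (adj3 g) \<le> 2 * (norm g)\<^sup>2 + 2 * (norm g)\<^sup>2 + 2 * (norm g)\<^sup>2 + 2 * (norm g)\<^sup>2 + 2 * (norm g)\<^sup>2
     + 2 * (norm g)\<^sup>2 + 2 * (norm g)\<^sup>2 + 2 * (norm g)\<^sup>2 + 2 * (norm g)\<^sup>2"
    by (rule order_trans[OF norm_le_entries]) (unfold adj3_def mk_nth, intro add_mono p)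
  then show ?thesis by simp
qed

section \<open>The matrix exponential\<close>

definition mpow :: "mat3 \<Rightarrow> nat \<Rightarrow> mat3" where
  "mpow X k = ((**) X ^^ k) (mat 1)"

lemma mpow_0 [simp]: "mpow X 0 = mat 1" and mpow_Suc: "mpow X (Suc k) = X ** mpow X k"
  by (simp_all add: mpow_def)

lemma mpow_commute: assumes "X ** Y = Y ** X" shows "mpow X n ** Y = Y ** mpow X n"
proof (induction n)
  case (Suc n)
  have "mpow X (Suc n) ** Y = X ** (mpow X n ** Y)" by (simp add: mpow_Suc matrix_mul_assoc)
  also have "\<dots> = X ** Y ** mpow X n" by (simp add: Suc matrix_mul_assoc)
  also have "\<dots> = Y ** mpow X (Suc n)" by (simp add: mpow_Suc assms matrix_mul_assoc)
  finally show ?case .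
qed simp

lemma mpow_mult: assumes "X ** Y = Y ** X" shows "mpow (X ** Y) n = mpow X n ** mpow Y n"
proof (induction n)
  case (Suc n)
  have "mpow (X ** Y) (Suc n) = X ** (Y ** mpow X n) ** mpow Y n"
    by (simp add: mpow_Suc Suc matrix_mul_assoc)
  also have "\<dots> = mpow X (Suc n) ** mpow Y (Suc n)"
    by (simp add: mpow_commute[OF assms, symmetric] mpow_Suc matrix_mul_assoc)
  finally show ?case .
qed simp

lemma scaleR_mult_left: "(r *\<^sub>R (A::mat3)) ** (B::mat3) = r *\<^sub>R (A ** B)"
  and scaleR_mult_right: "(A::mat3) ** (r *\<^sub>R (B::mat3)) = r *\<^sub>R (A ** B)"
  by (simp_all add: bounded_bilinear.scaleR_left[OF bounded_bilinear_mult]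
      bounded_bilinear.scaleR_right[OF bounded_bilinear_mult])

lemma mpow_scale: "mpow (r *\<^sub>R X) k = (r ^ k) *\<^sub>R mpow X k"
  by (induction k) (simp_all add: mpow_Suc scaleR_mult_left scaleR_mult_right)

lemma mpow_entry_bound:
  assumes "\<And>i j. \<bar>X $ i $ j\<bar> \<le> b"
  shows "\<bar>mpow X k $ i $ j\<bar> \<le> (3 * b) ^ k"
proof (induction k arbitrary: i j)
  case 0
  show ?case by (simp add: mat_def)
next
  case (Suc k)
  have "b \<ge> 0" using assms[of 1 1] by linarith
  have "\<bar>mpow X (Suc k) $ i $ j\<bar> \<le> \<bar>X$i$1\<bar> * \<bar>mpow X k $1$j\<bar> + \<bar>X$i$2\<bar> * \<bar>mpow X k $2$j\<bar> + \<bar>X$i$3\<bar> * \<bar>mpow X k $3$j\<bar>"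
    unfolding mpow_Suc mat_mult_3 abs_mult[symmetric] by linarith
  also have "\<dots> \<le> b * (3 * b) ^ k + b * (3 * b) ^ k + b * (3 * b) ^ k"
    by (intro add_mono mult_mono assms Suc.IH \<open>b \<ge> 0\<close> abs_ge_zero)
  finally show ?case by (simp add: algebra_simps)
qed

lemma mpow_tendsto [tendsto_intros]:
  assumes "(f \<longlongrightarrow> X) F" shows "((\<lambda>x. mpow (f x) k) \<longlongrightarrow> mpow X k) F"
  by (induction k) (auto simp: mpow_Suc intro!: tendsto_intros assms)

lemma mexp_sums: "(\<lambda>k. (1 / fact k) *\<^sub>R mpow X k) sums mexp X"
proof -
  have b: "norm ((1 / fact k) *\<^sub>R mpow X k) \<le> 9 * (inverse (fact k) * (3 * norm X) ^ k)" for k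
  proof -
    have e: "\<bar>mpow X k $ i $ j\<bar> \<le> (3 * norm X) ^ k" for i j
      by (rule mpow_entry_bound) (rule entry_le_norm)
    have "norm (mpow X k) \<le> 9 * (3 * norm X) ^ k"
      using norm_le_entries[of "mpow X k"] e[of 1 1] e[of 1 2] e[of 1 3] e[of 2 1] e[of 2 2] e[of 2 3]
        e[of 3 1] e[of 3 2] e[of 3 3] by linarith
    then show ?thesis by (simp add: field_simps)
  qed
  have "summable (\<lambda>k. (1 / fact k) *\<^sub>R mpow X k)"
    by (rule summable_comparison_test'[OF summable_mult[OF summable_exp] b])
  then show ?thesis unfolding mexp_def mpow_def[symmetric] by (rule summable_sums)
qed

lemma mexp_entry_sums: "(\<lambda>k. mpow X k $ i $ j / fact k) sums (mexp X $ i $ j)"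
proof -
  have "(\<lambda>k. ((1 / fact k) *\<^sub>R mpow X k) $ i $ j) sums (mexp X $ i $ j)"
    by (intro bounded_linear.sums[OF bounded_linear_vec_nth] mexp_sums)
  then show ?thesis by simp
qed

text \<open>The summation bound is left free because Pascal's rule splits the sum in two, and the
  induction hypothesis is applied to one half with bound \<open>Suc M'\<close> and to the other with
  bound \<open>M'\<close>. Binomial coefficients beyond \<open>m\<close> vanish.\<close>

lemma mpow_binomial:
  assumes "m \<le> M" shows "mpow (mat 1 + Z) m = (\<Sum>k\<le>M. real (m choose k) *\<^sub>R mpow Z k)"
  using assms
proof (induction m arbitrary: M)
  case 0
  have "(\<Sum>k\<le>M. real (0 choose k) *\<^sub>R mpow Z k) = (\<Sum>k\<in>{0}. real (0 choose k) *\<^sub>R mpow Z k)"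
    by (rule sum.mono_neutral_right) (auto simp: binomial_eq_0)
  then show ?case by simp
next
  case (Suc m)
  then obtain M' where M': "M = Suc M'" "m \<le> M'" by (cases M) auto
  have "(\<Sum>k\<le>M. real (Suc m choose k) *\<^sub>R mpow Z k)
      = mat 1 + (\<Sum>k\<le>M'. real ((m choose k) + (m choose Suc k)) *\<^sub>R mpow Z (Suc k))"
    by (simp add: M' sum.atMost_Suc_shift del: sum.atMost_Suc)
  also have "\<dots> = (mat 1 + (\<Sum>k\<le>M'. real (m choose Suc k) *\<^sub>R mpow Z (Suc k)))
       + (\<Sum>k\<le>M'. real (m choose k) *\<^sub>R mpow Z (Suc k))"
    by (simp add: scaleR_add_left sum.distrib)
  also have "mat 1 + (\<Sum>k\<le>M'. real (m choose Suc k) *\<^sub>R mpow Z (Suc k)) = (\<Sum>k\<le>Suc M'. real (m choose k) *\<^sub>R mpow Z k)"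
    by (simp add: sum.atMost_Suc_shift del: sum.atMost_Suc)
  also have "\<dots> = mpow (mat 1 + Z) m" using M' by (intro Suc.IH[symmetric]) simp
  also have "(\<Sum>k\<le>M'. real (m choose k) *\<^sub>R mpow Z (Suc k)) = Z ** mpow (mat 1 + Z) m"
    unfolding Suc.IH[OF M'(2)]
    by (simp add: bounded_bilinear.sum_right[OF bounded_bilinear_mult] scaleR_mult_right mpow_Suc)
  also have "mpow (mat 1 + Z) m + Z ** mpow (mat 1 + Z) m = mpow (mat 1 + Z) (Suc m)"
    by (simp add: mpow_Suc bounded_bilinear.add_left[OF bounded_bilinear_mult])
  finally show ?case by simp
qed

text \<open>The quotient is the product of the factors \<open>1 - i / K n\<close> for i < k, divided
  by \<open>fact k\<close>, and each factor tends to 1.\<close>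

lemma choose_over_power_tendsto:
  assumes "filterlim K at_top F"
  shows "((\<lambda>n. real (K n choose k) / real (K n) ^ k) \<longlongrightarrow> 1 / fact k) F"
proof -
  have ev: "eventually (\<lambda>n. K n > 0) F" by (rule eventually_compose_filterlim[OF eventually_gt_at_top assms])
  have r: "filterlim (\<lambda>n. real (K n)) at_top F"
    by (rule filterlim_compose[OF filterlim_real_sequentially assms])
  have "((\<lambda>n. (\<Prod>i = 0..<k. 1 - real i / real (K n)) / fact k) \<longlongrightarrow> (\<Prod>i = 0..<k. 1 - 0) / fact k) F"
    by (intro tendsto_intros tendsto_divide_0[OF tendsto_const] filterlim_at_top_imp_at_infinity r) simp
  then have "((\<lambda>n. (\<Prod>i = 0..<k. 1 - real i / real (K n)) / fact k) \<longlongrightarrow> 1 / fact k) F" by simp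
  moreover have "eventually (\<lambda>n. (\<Prod>i = 0..<k. 1 - real i / real (K n)) / fact k = real (K n choose k) / real (K n) ^ k) F"
    using ev
  proof eventually_elim
    case (elim n)
    have "(\<Prod>i = 0..<k. 1 - real i / real (K n)) = (\<Prod>i = 0..<k. (real (K n) - real i) / real (K n))"
      using elim by (intro prod.cong) (auto simp: field_simps)
    then show ?case
      by (simp add: binomial_gbinomial gbinomial_prod_rev prod_dividef)
  qed
  ultimately show ?thesis by (rule Lim_transform_eventually)
qed

text \<open>Expanding the power binomially, this is Tannery's theorem entry by entry.\<close>

lemma mpow_tendsto_mexp:
  assumes K: "filterlim K at_top sequentially" and Y: "(\<lambda>n. real (K n) *\<^sub>R Z n) \<longlonglongrightarrow> Y"
  shows "(\<lambda>n. mpow (mat 1 + Z n) (K n)) \<longlonglongrightarrow> mexp Y"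
  unfolding tendsto_mat3_iff
proof (intro allI)
  fix i j :: 3
  define a where "a k n = real (K n choose k) * mpow (Z n) k $ i $ j" for k n
  define b where "b = norm Y + 1"
  have ev0: "eventually (\<lambda>n. K n > 0) sequentially" by (rule eventually_compose_filterlim[OF eventually_gt_at_top K])
  have a_alt: "a k n = real (K n choose k) / real (K n) ^ k * mpow (real (K n) *\<^sub>R Z n) k $ i $ j" if "K n > 0" for k n
    using that by (simp add: a_def mpow_scale)
  have lim: "(\<lambda>n. a k n) \<longlonglongrightarrow> mpow Y k $ i $ j / fact k" for k
  proof -
    have "(\<lambda>n. real (K n choose k) / real (K n) ^ k * mpow (real (K n) *\<^sub>R Z n) k $ i $ j)
        \<longlonglongrightarrow> 1 / fact k * mpow Y k $ i $ j"
      by (intro tendsto_intros choose_over_power_tendsto K Y)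
    moreover have "eventually (\<lambda>n. real (K n choose k) / real (K n) ^ k * mpow (real (K n) *\<^sub>R Z n) k $ i $ j = a k n) sequentially"
      using ev0 by eventually_elim (simp add: a_alt)
    ultimately show ?thesis using Lim_transform_eventually by fastforce
  qed
  have "eventually (\<lambda>n. norm (real (K n) *\<^sub>R Z n) < b) sequentially"
    by (rule order_tendstoD[OF tendsto_norm[OF Y]]) (simp add: b_def)
  then have ev: "eventually (\<lambda>n. norm (real (K n) *\<^sub>R Z n) < b \<and> K n > 0) sequentially"
    using ev0 by eventually_elim simp
  have bd: "norm (a k n) \<le> inverse (fact k) * (3 * b) ^ k" if "norm (real (K n) *\<^sub>R Z n) < b \<and> K n > 0" for k n
  proof -
    have "\<bar>mpow (real (K n) *\<^sub>R Z n) k $ i $ j\<bar> \<le> (3 * b) ^ k"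
      using that by (intro mpow_entry_bound) (meson entry_le_norm less_imp_le order_trans)
    moreover have "real (K n choose k) / real (K n) ^ k \<le> inverse (fact k)"
    proof -
      have "real ((K n choose k) * fact k) \<le> real (K n ^ k)"
        using binomial_fact_pow[of "K n" k] of_nat_mono by blast
      then show ?thesis using that by (simp add: field_simps)
    qed
    ultimately show ?thesis unfolding a_alt[OF conjunct2[OF that]] real_norm_def abs_mult
      by (intro mult_mono) auto
  qed
  have "eventually (\<lambda>(k, n). norm (a k n) \<le> inverse (fact k) * (3 * b) ^ k) (at_top \<times>\<^sub>F sequentially)"
    unfolding eventually_prod_filter
    by (rule exI[of _ "\<lambda>_. True"], rule exI, rule conjI[OF _ conjI[OF ev]]) (use bd in auto)
  from tannerys_theorem[OF lim this summable_exp]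
  have "(\<lambda>n. \<Sum>k. a k n) \<longlonglongrightarrow> (\<Sum>k. mpow Y k $ i $ j / fact k)" by simp
  moreover have "(\<Sum>k. a k n) = mpow (mat 1 + Z n) (K n) $ i $ j" for n
  proof -
    have "(\<Sum>k. a k n) = (\<Sum>k\<le>K n. a k n)"
      by (rule suminf_finite) (auto simp: a_def binomial_eq_0)
    also have "\<dots> = mpow (mat 1 + Z n) (K n) $ i $ j"
      by (simp add: mpow_binomial[OF order_refl] a_def)
    finally show ?thesis .
  qed
  moreover have "(\<Sum>k. mpow Y k $ i $ j / fact k) = mexp Y $ i $ j"
    by (rule sums_unique[symmetric, OF mexp_entry_sums])
  ultimately show "(\<lambda>n. mpow (mat 1 + Z n) (K n) $ i $ j) \<longlonglongrightarrow> mexp Y $ i $ j" by simp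
qed

lemma mpow_mat1 [simp]: "mpow (mat 1) n = mat 1"
  by (induction n) (simp_all add: mpow_Suc)

lemma mexp_0 [simp]: "mexp 0 = mat 1"
  using mpow_tendsto_mexp[of id "\<lambda>_. 0" 0]
  by (auto simp: filterlim_ident id_def LIMSEQ_const_iff)

text \<open>For commuting \<open>X\<close> and \<open>Y\<close>, the product of the n-th powers of
  \<open>1 + X / n\<close> and \<open>1 + Y / n\<close> is the n-th power of
  \<open>1 + (X + Y) / n + X ** Y / n^2\<close>, and the quadratic term does not survive the
  limit.\<close>

lemma mexp_add: assumes "X ** Y = Y ** X" shows "mexp X ** mexp Y = mexp (X + Y)"
proof -
  define r where "r n = 1 / real (Suc n)" for n
  have r0: "r \<longlonglongrightarrow> 0" unfolding r_def using LIMSEQ_inverse_real_of_nat by (simp add: inverse_eq_divide)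
  have r1: "real (Suc n) * r n = 1" for n by (simp add: r_def)
  have K: "filterlim Suc at_top sequentially" by (rule filterlim_Suc)
  have e: "(\<lambda>n. mpow (mat 1 + r n *\<^sub>R W) (Suc n)) \<longlonglongrightarrow> mexp W" for W
    by (intro mpow_tendsto_mexp K) (simp add: r1[unfolded of_nat_Suc])
  have "(\<lambda>n. mpow (mat 1 + (r n *\<^sub>R (X + Y) + (r n)\<^sup>2 *\<^sub>R (X ** Y))) (Suc n)) \<longlonglongrightarrow> mexp (X + Y)"
  proof (rule mpow_tendsto_mexp[OF K])
    have "(\<lambda>n. (X + Y) + r n *\<^sub>R (X ** Y)) \<longlonglongrightarrow> (X + Y) + 0 *\<^sub>R (X ** Y)"
      by (intro tendsto_intros r0)
    moreover have "real (Suc n) *\<^sub>R (r n *\<^sub>R (X + Y) + (r n)\<^sup>2 *\<^sub>R (X ** Y)) = (X + Y) + r n *\<^sub>R (X ** Y)" for n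
      unfolding scaleR_add_right scaleR_scaleR power2_eq_square mult.assoc[symmetric] r1 by simp
    ultimately show "(\<lambda>n. real (Suc n) *\<^sub>R (r n *\<^sub>R (X + Y) + (r n)\<^sup>2 *\<^sub>R (X ** Y))) \<longlonglongrightarrow> X + Y" by simp
  qed
  moreover have "mpow (mat 1 + (r n *\<^sub>R (X + Y) + (r n)\<^sup>2 *\<^sub>R (X ** Y))) (Suc n)
     = mpow (mat 1 + r n *\<^sub>R X) (Suc n) ** mpow (mat 1 + r n *\<^sub>R Y) (Suc n)" for n
  proof -
    have p: "(mat 1 + r n *\<^sub>R A) ** (mat 1 + r n *\<^sub>R B) = mat 1 + (r n *\<^sub>R (A + B) + (r n)\<^sup>2 *\<^sub>R (A ** B))" for A B :: mat3
      by (simp add: bounded_bilinear.add_left[OF bounded_bilinear_mult] bounded_bilinear.add_right[OF bounded_bilinear_mult]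
          scaleR_mult_left scaleR_mult_right power2_eq_square scaleR_add_right)
    show ?thesis
      by (subst mpow_mult[symmetric]) (simp_all add: p assms add.commute)
  qed
  ultimately have "(\<lambda>n. mpow (mat 1 + r n *\<^sub>R X) (Suc n) ** mpow (mat 1 + r n *\<^sub>R Y) (Suc n)) \<longlonglongrightarrow> mexp (X + Y)"
    by simp
  moreover have "(\<lambda>n. mpow (mat 1 + r n *\<^sub>R X) (Suc n) ** mpow (mat 1 + r n *\<^sub>R Y) (Suc n)) \<longlonglongrightarrow> mexp X ** mexp Y"
    by (intro tendsto_intros e)
  ultimately show ?thesis using LIMSEQ_unique by blast
qed

lemma mexp_add_scale: "mexp (s *\<^sub>R X) ** mexp (t *\<^sub>R X) = mexp ((s + t) *\<^sub>R X)"
  by (subst mexp_add) (simp_all add: scaleR_mult_left scaleR_mult_right scaleR_add_left)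

lemma mexp_minus: "mexp (- X) ** mexp X = mat 1"
  using mexp_add_scale[of "-1" X 1] by simp

text \<open>\<open>f t\<close> is the n-th power of \<open>f (t / n)\<close>, which is
  \<open>1 + t X / n\<close> up to o(1 / n), so the limit formula applies. Exponentials are computed
  in closed form this way: guess a one-parameter group and differentiate it at 0.\<close>

lemma mexp_unique:
  assumes add: "\<And>s t. f (s + t) = f s ** f t" and zero: "f 0 = mat 1"
    and deriv: "((\<lambda>s. (1 / s) *\<^sub>R (f s - mat 1)) \<longlongrightarrow> X) (at 0)"
  shows "f t = mexp (t *\<^sub>R X)"
proof (cases "t = 0")
  case False
  define r where "r n = t / real (Suc n)" for n
  have r0: "r \<longlonglongrightarrow> 0"
    unfolding r_def using tendsto_mult[OF tendsto_const[of t] LIMSEQ_inverse_real_of_nat] by (simp add: divide_inverse)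
  have rn: "r n \<noteq> 0" for n using False by (simp add: r_def)
  have f: "mpow (f s) n = f (real n * s)" for s n
    by (induction n) (simp_all add: mpow_Suc zero add[symmetric] algebra_simps)
  have "filterlim r (at 0) sequentially" using r0 rn by (simp add: filterlim_at)
  then have "(\<lambda>n. (1 / r n) *\<^sub>R (f (r n) - mat 1)) \<longlonglongrightarrow> X"
    using filterlim_compose[OF deriv] by blast
  then have "(\<lambda>n. t *\<^sub>R ((1 / r n) *\<^sub>R (f (r n) - mat 1))) \<longlonglongrightarrow> t *\<^sub>R X"
    by (intro tendsto_intros)
  then have "(\<lambda>n. real (Suc n) *\<^sub>R (f (r n) - mat 1)) \<longlonglongrightarrow> t *\<^sub>R X"
    using False by (simp add: r_def)
  from mpow_tendsto_mexp[OF filterlim_Suc this]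
  have "(\<lambda>n. mpow (f (r n)) (Suc n)) \<longlonglongrightarrow> mexp (t *\<^sub>R X)" by simp
  moreover have "mpow (f (r n)) (Suc n) = f t" for n
    unfolding f by (simp add: r_def del: of_nat_Suc)
  ultimately show ?thesis by (simp add: LIMSEQ_const_iff)
qed (simp add: zero)

text \<open>Each entry of \<open>mexp (s X)\<close> is an everywhere convergent power series in
  \<open>s\<close> whose linear coefficient is that entry of \<open>X\<close>.\<close>

lemma mexp_deriv: "((\<lambda>s. (1 / s) *\<^sub>R (mexp (s *\<^sub>R X) - mat 1)) \<longlongrightarrow> X) (at 0)"
  unfolding tendsto_mat3_iff
proof (intro allI)
  fix i j :: 3
  define c where "c k = mpow X k $ i $ j / fact k" for k
  have s: "(\<lambda>k. c k * x ^ k) sums (mexp (x *\<^sub>R X) $ i $ j)" for x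
    using mexp_entry_sums[of "x *\<^sub>R X" i j] by (simp add: mpow_scale c_def mult.commute)
  have "DERIV (\<lambda>x. \<Sum>n. c n * x ^ n) 0 :> (\<Sum>n. diffs c n * 0 ^ n)"
    by (rule termdiffs_strong_converges_everywhere) (use s sums_summable in blast)
  then have "DERIV (\<lambda>x. mexp (x *\<^sub>R X) $ i $ j) 0 :> X $ i $ j"
    unfolding powser_zero using s by (simp add: sums_iff diffs_def c_def mpow_Suc)
  then show "((\<lambda>s. ((1 / s) *\<^sub>R (mexp (s *\<^sub>R X) - mat 1)) $ i $ j) \<longlongrightarrow> X $ i $ j) (at 0)"
    unfolding DERIV_def by simp
qed

lemma mexp_conj: assumes "det g = 1" shows "mexp (g ** X ** adj3 g) = g ** mexp X ** adj3 g"
proof -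
  note gi = adj3_inverse[OF assms]
  define f where "f t = g ** mexp (t *\<^sub>R X) ** adj3 g" for t
  have "f 1 = mexp (1 *\<^sub>R (g ** X ** adj3 g))"
  proof (rule mexp_unique)
    show "f (s + t) = f s ** f t" for s t
    proof -
      have "f s ** f t = g ** mexp (s *\<^sub>R X) ** (adj3 g ** g) ** mexp (t *\<^sub>R X) ** adj3 g"
        by (simp add: f_def matrix_mul_assoc)
      also have "\<dots> = g ** (mexp (s *\<^sub>R X) ** mexp (t *\<^sub>R X)) ** adj3 g" by (simp add: gi matrix_mul_assoc)
      finally show ?thesis by (simp add: mexp_add_scale f_def)
    qed
    show "f 0 = mat 1" by (simp add: f_def gi)
    have "(1 / s) *\<^sub>R (f s - mat 1) = g ** ((1 / s) *\<^sub>R (mexp (s *\<^sub>R X) - mat 1)) ** adj3 g" for s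
      by (simp add: f_def scaleR_mult_left scaleR_mult_right gi
          bounded_bilinear.diff_left[OF bounded_bilinear_mult] bounded_bilinear.diff_right[OF bounded_bilinear_mult])
    then show "((\<lambda>s. (1 / s) *\<^sub>R (f s - mat 1)) \<longlongrightarrow> g ** X ** adj3 g) (at 0)"
      by (auto intro!: tendsto_intros mexp_deriv)
  qed
  then show ?thesis by (simp add: f_def)
qed

section \<open>Closed subgroups and their Lie algebras\<close>

lemmas mat_mult_diff_left = bounded_bilinear.diff_left[OF bounded_bilinear_mult]
lemmas mat_mult_diff_right = bounded_bilinear.diff_right[OF bounded_bilinear_mult]

lemma mexp_tendsto_1:
  assumes "(f \<longlongrightarrow> 0) F" shows "((\<lambda>x. mexp (f x *\<^sub>R X)) \<longlongrightarrow> mat 1) F"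
proof -
  have "((\<lambda>s. mat 1 + s *\<^sub>R ((1 / s) *\<^sub>R (mexp (s *\<^sub>R X) - mat 1))) \<longlongrightarrow> mat 1 + 0 *\<^sub>R X) (at 0)"
    by (intro tendsto_intros mexp_deriv)
  then have "((\<lambda>s. mexp (s *\<^sub>R X)) \<longlongrightarrow> mat 1) (at 0)"
    by (rule tendsto_eq_rhs[OF Lim_transform_eventually]) (auto simp: eventually_at_filter)
  then have "isCont (\<lambda>s. mexp (s *\<^sub>R X)) 0" by (simp add: isCont_def)
  then show ?thesis using isCont_tendsto_compose[OF _ assms] by fastforce
qed

text \<open>By the limit formula, high powers of \<open>mexp (X / n) ** mexp (Y / n)\<close> then
  tend to \<open>mexp (X + Y)\<close> even if \<open>X\<close> and \<open>Y\<close> do not commute;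
  this makes the Lie algebra closed under addition.\<close>

lemma mexp_prod_deriv:
  "((\<lambda>s. (1 / s) *\<^sub>R (mexp (s *\<^sub>R X) ** mexp (s *\<^sub>R Y) - mat 1)) \<longlongrightarrow> X + Y) (at 0)"
proof -
  have "((\<lambda>s. ((1 / s) *\<^sub>R (mexp (s *\<^sub>R X) - mat 1)) ** mexp (s *\<^sub>R Y) + (1 / s) *\<^sub>R (mexp (s *\<^sub>R Y) - mat 1))
     \<longlongrightarrow> X ** mat 1 + Y) (at 0)"
    by (intro tendsto_intros mexp_deriv mexp_tendsto_1 tendsto_ident_at)
  then show ?thesis
    by (simp add: scaleR_mult_left mat_mult_diff_left scaleR_diff_right)
qed

lemma subspace_limit_direction:
  fixes x :: "nat \<Rightarrow> 'a::euclidean_space"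
  assumes "\<And>n. x n \<noteq> 0" "\<And>n. x n \<in> V" "subspace V"
  obtains Z r where "strict_mono (r :: nat \<Rightarrow> nat)" "norm Z = 1" "Z \<in> V" "(\<lambda>n. (1 / norm (x (r n))) *\<^sub>R x (r n)) \<longlonglongrightarrow> Z"
proof -
  have "\<forall>n. (1 / norm (x n)) *\<^sub>R x n \<in> sphere 0 1" using assms(1) by simp
  then obtain Z r where Z: "Z \<in> sphere 0 1" "strict_mono (r :: nat \<Rightarrow> nat)"
    "((\<lambda>n. (1 / norm (x n)) *\<^sub>R x n) \<circ> r) \<longlonglongrightarrow> Z"
    by (rule seq_compactE[OF compact_imp_seq_compact[OF compact_sphere[of "0::'a" 1]]])
  have "Z \<in> V"
    by (rule closed_sequentially[OF closed_subspace[OF assms(3)] _ Z(3)])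
      (simp add: assms subspace_scale)
  with Z show ?thesis by (intro that[of r Z]) (auto simp: o_def)
qed

locale closed_sg =
  fixes H :: "mat3 set"
  assumes sg: "subgroup H SL3" and cl: "closedin (top_of_set (carrier SL3)) H"
begin

lemma closed_H: "closed H"
  using closedin_closed_trans[OF cl closed_SL3] .

lemma det_H: "g \<in> H \<Longrightarrow> det g = 1"
  using subgroup.subset[OF sg] by (auto simp: SL3_iff)

lemma one_H: "mat 1 \<in> H"
  using subgroup.one_closed[OF sg] by simp

lemma mult_H: "g \<in> H \<Longrightarrow> h \<in> H \<Longrightarrow> g ** h \<in> H"
  using subgroup.m_closed[OF sg] by simp

lemma adj3_H: "g \<in> H \<Longrightarrow> adj3 g \<in> H"
  using subgroup.m_inv_closed[OF sg, of g] inv_SL3[OF det_H, of g] by simp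

lemma mpow_H: "g \<in> H \<Longrightarrow> mpow g n \<in> H"
  by (induction n) (auto simp: mpow_Suc one_H mult_H)

abbreviation "lie \<equiv> lie_algebra H"

lemma lieI: "(\<And>t. mexp (t *\<^sub>R X) \<in> H) \<Longrightarrow> X \<in> lie"
  by (simp add: lie_algebra_def)

lemma mexp_lie: "X \<in> lie \<Longrightarrow> mexp (t *\<^sub>R X) \<in> H"
  by (simp add: lie_algebra_def)

lemma adj3_mexp: "X \<in> lie \<Longrightarrow> adj3 (mexp (t *\<^sub>R X)) = mexp ((- t) *\<^sub>R X)"
  using mexp_add_scale[of "-t" X t] by (intro adj3_unique det_H mexp_lie) auto

lemma mexp_limit_H:
  assumes "\<And>n. g n \<in> H" "filterlim K at_top sequentially" "(\<lambda>n. real (K n) *\<^sub>R (g n - mat 1)) \<longlonglongrightarrow> Y"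
  shows "mexp Y \<in> H"
proof -
  have "(\<lambda>n. mpow (g n) (K n)) \<longlonglongrightarrow> mexp Y" using mpow_tendsto_mexp[OF assms(2,3)] by simp
  then show ?thesis by (rule closed_sequentially[OF closed_H mpow_H[OF assms(1)]])
qed

text \<open>Near the identity \<open>g n\<close> is \<open>mat 1 + e n *\<^sub>R X\<close> up to o(e
  n). Raised to the integer part of t / e n it stays in \<open>H\<close> and tends to
  \<open>mexp (t *\<^sub>R X)\<close>. Negative t follow by inversion.\<close>

lemma limit_direction_lie:
  assumes g: "\<And>n. g n \<in> H" "\<And>n. g n \<noteq> mat 1" "g \<longlonglongrightarrow> mat 1"
    and X: "(\<lambda>n. (1 / norm (g n - mat 1)) *\<^sub>R (g n - mat 1)) \<longlonglongrightarrow> X"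
  shows "X \<in> lie"
proof -
  define e where "e n = norm (g n - mat 1)" for n
  have e0: "e n > 0" for n using g(2) by (simp add: e_def)
  have "(\<lambda>n. g n - mat 1) \<longlonglongrightarrow> mat 1 - mat 1" by (intro tendsto_intros g)
  then have e: "e \<longlonglongrightarrow> 0" unfolding e_def using tendsto_norm_zero by fastforce
  have pos: "mexp (t *\<^sub>R X) \<in> H" if "t > 0" for t
  proof -
    define K where "K n = nat \<lfloor>t / e n\<rfloor>" for n
    have K1: "real (K n) \<le> t / e n" "t / e n < real (K n) + 1" for n
      using that e0[of n] by (simp_all add: K_def)
    have "filterlim (\<lambda>n. inverse (e n)) at_top sequentially"
      by (rule filterlim_inverse_at_top[OF e]) (simp add: e0)
    from filterlim_tendsto_pos_mult_at_top[OF tendsto_const that this]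
    have "filterlim (\<lambda>n. t / e n) at_top sequentially" by (simp add: divide_inverse)
    from filterlim_tendsto_add_at_top[OF tendsto_const[of "- 1"] this]
    have "filterlim (\<lambda>n. t / e n - 1) at_top sequentially" by simp
    then have "filterlim (\<lambda>n. real (K n)) at_top sequentially"
      by (rule filterlim_at_top_mono) (use K1(2) in \<open>auto intro!: always_eventually less_imp_le simp: algebra_simps\<close>)
    then have Ktop: "filterlim K at_top sequentially"
      using filterlim_sequentially_iff_filterlim_real by blast
    have "(\<lambda>n. real (K n) * e n) \<longlonglongrightarrow> t"
    proof (rule tendsto_sandwich[of "\<lambda>n. t - e n" _ _ "\<lambda>_. t"])
      show "(\<lambda>n. t - e n) \<longlonglongrightarrow> t" using tendsto_diff[OF tendsto_const e, of t] by simp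
      show "eventually (\<lambda>n. t - e n \<le> real (K n) * e n) sequentially"
        using K1(2) e0 by (intro always_eventually allI) (simp add: pos_divide_less_eq algebra_simps less_imp_le)
      show "eventually (\<lambda>n. real (K n) * e n \<le> t) sequentially"
        using K1(1) e0 by (intro always_eventually allI) (simp add: pos_le_divide_eq)
    qed simp
    then have "(\<lambda>n. (real (K n) * e n) *\<^sub>R ((1 / e n) *\<^sub>R (g n - mat 1))) \<longlonglongrightarrow> t *\<^sub>R X"
      using X unfolding e_def[symmetric] by (intro tendsto_intros)
    then have "(\<lambda>n. real (K n) *\<^sub>R (g n - mat 1)) \<longlonglongrightarrow> t *\<^sub>R X"
      using e0 by (simp add: less_imp_neq[THEN not_sym])
    from mexp_limit_H[OF g(1) Ktop this] show ?thesis .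
  qed
  show ?thesis
  proof (rule lieI)
    fix t :: real
    consider "t > 0" | "t = 0" | "t < 0" by linarith
    then show "mexp (t *\<^sub>R X) \<in> H"
    proof cases
      case 3
      have h: "mexp ((- t) *\<^sub>R X) \<in> H" using pos[of "-t"] 3 by simp
      have "adj3 (mexp ((- t) *\<^sub>R X)) = mexp (t *\<^sub>R X)"
        using mexp_add_scale[of t X "-t"] by (intro adj3_unique det_H h) auto
      then show ?thesis using adj3_H[OF h] by simp
    qed (auto simp: pos one_H)
  qed
qed

lemma subspace_lie: "subspace lie"
proof (rule subspaceI)
  show "0 \<in> lie" by (rule lieI) (simp add: one_H)
next
  fix X Y assume XY: "X \<in> lie" "Y \<in> lie"
  show "X + Y \<in> lie"
  proof (rule lieI)
    fix t
    define r where "r n = 1 / real (Suc n)" for n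
    have r0: "r \<longlonglongrightarrow> 0" unfolding r_def using LIMSEQ_inverse_real_of_nat by (simp add: inverse_eq_divide)
    have "filterlim r (at 0) sequentially" using r0 by (simp add: filterlim_at r_def)
    then have "(\<lambda>n. (1 / r n) *\<^sub>R (mexp (r n *\<^sub>R (t *\<^sub>R X)) ** mexp (r n *\<^sub>R (t *\<^sub>R Y)) - mat 1)) \<longlonglongrightarrow> t *\<^sub>R X + t *\<^sub>R Y"
      using filterlim_compose[OF mexp_prod_deriv] by blast
    then have "(\<lambda>n. real (Suc n) *\<^sub>R (mexp (r n *\<^sub>R (t *\<^sub>R X)) ** mexp (r n *\<^sub>R (t *\<^sub>R Y)) - mat 1)) \<longlonglongrightarrow> t *\<^sub>R X + t *\<^sub>R Y"
      by (simp add: r_def)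
    then have "mexp (t *\<^sub>R X + t *\<^sub>R Y) \<in> H"
      by (rule mexp_limit_H[OF _ filterlim_Suc, rotated]) (auto intro!: mult_H simp: mexp_lie XY)
    then show "mexp (t *\<^sub>R (X + Y)) \<in> H" by (simp add: scaleR_add_right)
  qed
next
  fix c X assume "X \<in> lie"
  then show "c *\<^sub>R X \<in> lie" by (auto simp: lie_algebra_def)
qed

lemma Ad_lie: assumes "g \<in> H" "X \<in> lie" shows "g ** X ** adj3 g \<in> lie"
proof (rule lieI)
  fix t
  have "mexp (t *\<^sub>R (g ** X ** adj3 g)) = mexp (g ** (t *\<^sub>R X) ** adj3 g)"
    by (simp add: scaleR_mult_left scaleR_mult_right)
  also have "\<dots> = g ** mexp (t *\<^sub>R X) ** adj3 g" by (rule mexp_conj[OF det_H[OF assms(1)]])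
  finally show "mexp (t *\<^sub>R (g ** X ** adj3 g)) \<in> H"
    using assms by (simp add: mult_H adj3_H mexp_lie)
qed

text \<open>The bracket is the derivative at 0 of the conjugates of \<open>Y\<close> by
  \<open>mexp (s X)\<close>. The difference quotients lie in the Lie algebra, which is a subspace
  and hence closed.\<close>

lemma bracket_lie: assumes "X \<in> lie" "Y \<in> lie" shows "lie_bracket X Y \<in> lie"
proof -
  have "((\<lambda>s. ((1 / s) *\<^sub>R (mexp (s *\<^sub>R X) - mat 1)) ** Y ** mexp (s *\<^sub>R (- X))
      + Y ** ((1 / s) *\<^sub>R (mexp (s *\<^sub>R (- X)) - mat 1))) \<longlongrightarrow> X ** Y ** mat 1 + Y ** (- X)) (at 0)"
    by (intro tendsto_intros mexp_deriv mexp_tendsto_1 tendsto_ident_at)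
  moreover have "X ** Y ** mat 1 + Y ** (- X) = lie_bracket X Y"
    by (simp add: lie_bracket_def bounded_bilinear.minus_right[OF bounded_bilinear_mult])
  moreover have "((1 / s) *\<^sub>R (mexp (s *\<^sub>R X) - mat 1)) ** Y ** mexp (s *\<^sub>R (- X))
      + Y ** ((1 / s) *\<^sub>R (mexp (s *\<^sub>R (- X)) - mat 1)) \<in> lie" for s
  proof -
    have "((1 / s) *\<^sub>R (mexp (s *\<^sub>R X) - mat 1)) ** Y ** mexp (s *\<^sub>R (- X))
      + Y ** ((1 / s) *\<^sub>R (mexp (s *\<^sub>R (- X)) - mat 1))
      = (1 / s) *\<^sub>R (mexp (s *\<^sub>R X) ** Y ** adj3 (mexp (s *\<^sub>R X)) - Y)"
      by (simp add: adj3_mexp[OF assms(1)] scaleR_mult_left scaleR_mult_right mat_mult_diff_left mat_mult_diff_right scaleR_diff_right)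
    then show ?thesis
      using subspace_lie Ad_lie[OF mexp_lie[OF assms(1)] assms(2)] assms(2)
      by (simp add: subspace_scale subspace_diff)
  qed
  ultimately show ?thesis
    by (metis (no_types, lifting) Lim_in_closed_set always_eventually at_neq_bot closed_subspace subspace_lie)
qed

text \<open>The subspace \<open>V\<close> transmits linear relations shared by all
  \<open>g n - mat 1\<close> to the tangent vector.\<close>

lemma tangent_direction:
  assumes "\<And>n. g n \<in> H" "\<And>n. g n \<noteq> mat 1" "g \<longlonglongrightarrow> mat 1" "\<And>n. g n - mat 1 \<in> V" "subspace V"
  obtains Z where "Z \<in> lie" "Z \<in> V" "Z \<noteq> 0"
proof -
  obtain Z r where Z: "strict_mono (r :: nat \<Rightarrow> nat)" "norm Z = 1" "Z \<in> V"
    "(\<lambda>n. (1 / norm (g (r n) - mat 1)) *\<^sub>R (g (r n) - mat 1)) \<longlonglongrightarrow> Z"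
    by (rule subspace_limit_direction[of "\<lambda>n. g n - mat 1" V]) (use assms in auto)
  have "Z \<in> lie"
    by (rule limit_direction_lie[OF _ _ _ Z(4)])
      (use assms LIMSEQ_subseq_LIMSEQ[OF assms(3) Z(1)] in \<open>auto simp: o_def\<close>)
  then show ?thesis using Z that by force
qed

text \<open>An element of \<open>H\<close> near the identity but outside \<open>L\<close> is first moved by \<open>L\<close> as close to the
  identity as possible. The direction from the identity to the resulting points accumulates at some
  \<open>Z \<in> lie\<close>, and multiplying by \<open>mexp (- s Z)\<close> would bring them still closer.\<close>

lemma local_contained:
  assumes L: "subgroup L SL3" "closed L" "L \<subseteq> H" "\<And>X. X \<in> lie \<Longrightarrow> mexp X \<in> L"
  obtains e where "e > 0" "\<And>h. h \<in> H \<Longrightarrow> dist h (mat 1) < e \<Longrightarrow> h \<in> L"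
proof (rule ccontr)
  assume "\<not> thesis"
  then have "\<exists>h. h \<in> H \<and> dist h (mat 1) < 1 / real (Suc n) \<and> h \<notin> L" for n
    using that[of "1 / real (Suc n)"] by auto
  then obtain h where h: "\<And>n. h n \<in> H" "\<And>n. dist (h n) (mat 1) < 1 / real (Suc n)" "\<And>n. h n \<notin> L" by metis
  interpret L: closed_sg L
    by (intro closed_sg.intro L(1) closed_subset[OF subgroup.subset[OF L(1)] L(2)])
  \<comment> \<open>The right coset of \<open>L\<close> through \<open>h n\<close>. It avoids the
    identity because \<open>h n\<close> is not in \<open>L\<close>; \<open>x n\<close> will be a
    point of it closest to the identity.\<close>
  define S where "S n = {x. x ** adj3 (h n) \<in> L}" for n
  have "closed ((\<lambda>x. x ** adj3 (h n)) -` L)" for n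
    by (rule closed_vimage[OF L(2)]) (intro continuous_intros)
  then have clS: "closed (S n)" for n by (simp add: S_def vimage_def)
  have hS: "h n \<in> S n" for n
    using adj3_inverse(2)[OF det_H[OF h(1)]] by (simp add: S_def L.one_H)
  have "\<exists>x\<in>S n. infdist (mat 1) (S n) = dist (mat 1) x" for n
    using infdist_attains_inf[OF clS] hS by blast
  then obtain x where x: "\<And>n. x n \<in> S n" "\<And>n. infdist (mat 1) (S n) = dist (mat 1) (x n)" by metis
  have xdec: "x n = (x n ** adj3 (h n)) ** h n" for n
    using adj3_inverse(1)[OF det_H[OF h(1)]] by (metis matrix_mul_assoc matrix_mul_rid)
  have xH: "x n \<in> H" for n
    using xdec[of n] x(1)[of n] L(3) h(1)[of n] mult_H unfolding S_def by (metis mem_Collect_eq subsetD)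
  have x1: "x n \<noteq> mat 1" for n
  proof
    assume "x n = mat 1"
    then have "adj3 (h n) \<in> L" using x(1)[of n] by (simp add: S_def)
    from L.adj3_H[OF this] have "h n \<in> L" by (simp add: adj3_adj3[OF det_H[OF h(1)]])
    then show False using h(3) by blast
  qed
  have dx: "dist (x n) (mat 1) \<le> 1 / real (Suc n)" for n
    using infdist_le[OF hS, of "mat 1" n] h(2)[of n] x(2)[of n] by (simp add: dist_commute)
  have "(\<lambda>n. 1 / real (Suc n)) \<longlonglongrightarrow> 0" using LIMSEQ_inverse_real_of_nat by (simp add: inverse_eq_divide)
  then have "(\<lambda>n. dist (x n) (mat 1)) \<longlonglongrightarrow> 0"
    by (rule Lim_null_comparison[rotated]) (use dx in \<open>auto intro!: always_eventually simp del: of_nat_Suc\<close>)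
  then have xlim: "x \<longlonglongrightarrow> mat 1" by (rule tendsto_dist_iff[THEN iffD2])
  obtain Z r where Z: "strict_mono (r :: nat \<Rightarrow> nat)" "norm Z = 1"
    "(\<lambda>n. (1 / norm (x (r n) - mat 1)) *\<^sub>R (x (r n) - mat 1)) \<longlonglongrightarrow> Z"
    by (rule subspace_limit_direction[of "\<lambda>n. x n - mat 1" UNIV]) (use x1 in auto)
  define y where "y n = x (r n)" for n
  define s where "s n = norm (y n - mat 1)" for n
  have ylim: "y \<longlonglongrightarrow> mat 1" unfolding y_def using LIMSEQ_subseq_LIMSEQ[OF xlim Z(1)] by (simp add: o_def)
  have Zl: "Z \<in> lie"
    by (rule limit_direction_lie[of y]) (use xH x1 ylim Z(3) in \<open>auto simp: y_def\<close>)
  have s0: "s n > 0" for n using x1 by (simp add: s_def y_def)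
  have "(\<lambda>n. y n - mat 1) \<longlonglongrightarrow> mat 1 - mat 1" by (intro tendsto_intros ylim)
  then have slim: "s \<longlonglongrightarrow> 0" unfolding s_def using tendsto_norm_zero by fastforce
  then have "filterlim s (at 0) sequentially" using s0 by (auto simp: filterlim_at less_imp_neq[THEN not_sym])
  then have "(\<lambda>n. (1 / s n) *\<^sub>R (mexp (s n *\<^sub>R (- Z)) - mat 1)) \<longlonglongrightarrow> - Z"
    using filterlim_compose[OF mexp_deriv] by blast
  then have "(\<lambda>n. ((1 / s n) *\<^sub>R (mexp (s n *\<^sub>R (- Z)) - mat 1)) ** y n + (1 / s n) *\<^sub>R (y n - mat 1)) \<longlonglongrightarrow> (- Z) ** mat 1 + Z"
    using Z(3) ylim unfolding y_def[symmetric] s_def[symmetric] by (intro tendsto_intros)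
  moreover have "((1 / s n) *\<^sub>R (mexp (s n *\<^sub>R (- Z)) - mat 1)) ** y n + (1 / s n) *\<^sub>R (y n - mat 1)
     = (1 / s n) *\<^sub>R (mexp (s n *\<^sub>R (- Z)) ** y n - mat 1)" for n
    by (simp add: scaleR_mult_left mat_mult_diff_left scaleR_diff_right)
  ultimately have "(\<lambda>n. norm ((1 / s n) *\<^sub>R (mexp (s n *\<^sub>R (- Z)) ** y n - mat 1))) \<longlonglongrightarrow> 0"
    using tendsto_norm_zero by fastforce
  \<comment> \<open>The shifted point stays in the coset of \<open>y n\<close>, so by minimality its
    distance to the identity is at least \<open>s n\<close>; yet to first order the shift removes
    the whole difference.\<close>
  moreover have "1 \<le> norm ((1 / s n) *\<^sub>R (mexp (s n *\<^sub>R (- Z)) ** y n - mat 1))" for n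
  proof -
    have "mexp (s n *\<^sub>R (- Z)) \<in> L"
      by (rule L(4)) (use Zl subspace_lie in \<open>simp add: subspace_scale subspace_neg\<close>)
    then have "mexp (s n *\<^sub>R (- Z)) ** y n \<in> S (r n)"
      using x(1)[of "r n"] by (simp add: S_def y_def L.mult_H flip: matrix_mul_assoc)
    from infdist_le[OF this, of "mat 1"] have "s n \<le> norm (mexp (s n *\<^sub>R (- Z)) ** y n - mat 1)"
      using x(2)[of "r n"] by (simp add: s_def y_def dist_norm norm_minus_commute)
    then show ?thesis using s0[of n] unfolding norm_scaleR by (simp add: field_simps)
  qed
  ultimately show False using LIMSEQ_le_const[of _ 0 1] by fastforce
qed

text \<open>Translates of the neighbourhood from \<open>local_contained\<close> make
  \<open>L\<close> open in \<open>H\<close>. As it is also closed and nonempty, connectedness gives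
  equality.\<close>

lemma connected_contained:
  assumes "connected H"
    and L: "subgroup L SL3" "closed L" "L \<subseteq> H" "\<And>X. X \<in> lie \<Longrightarrow> mexp X \<in> L"
  shows "H = L"
proof -
  obtain e where e: "e > 0" "\<And>h. h \<in> H \<Longrightarrow> dist h (mat 1) < e \<Longrightarrow> h \<in> L"
    using local_contained[OF L] by blast
  have "openin (top_of_set H) L"
    unfolding openin_euclidean_subtopology_iff
  proof (intro conjI ballI L(3))
    fix l assume l: "l \<in> L"
    then have lH: "l \<in> H" using L(3) by blast
    have "isCont (\<lambda>x. adj3 l ** x) l"
      unfolding isCont_def by (intro tendsto_intros)
    then obtain d where d: "d > 0" "\<And>x. dist x l < d \<Longrightarrow> dist (adj3 l ** x) (adj3 l ** l) < e"
      unfolding continuous_at_eps_delta using e(1) by blast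
    show "\<exists>d>0. \<forall>x\<in>H. dist x l < d \<longrightarrow> x \<in> L"
    proof (intro exI[of _ d] conjI d ballI impI)
      fix x assume x: "x \<in> H" "dist x l < d"
      have "adj3 l ** x \<in> L"
        using d(2)[OF x(2)] e(2)[OF mult_H[OF adj3_H[OF lH] x(1)]] adj3_inverse(1)[OF det_H[OF lH]] by simp
      then have "l ** (adj3 l ** x) \<in> L" using l subgroup.m_closed[OF L(1)] by simp
      then show "x \<in> L" by (simp add: matrix_mul_assoc adj3_inverse(2)[OF det_H[OF lH]])
    qed
  qed
  moreover have "closedin (top_of_set H) L" using L(2,3) by (simp add: closed_subset)
  moreover have "L \<noteq> {}" using subgroup.one_closed[OF L(1)] by blast
  ultimately show ?thesis using assms(1) by (metis connected_clopen)
qed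

end

section \<open>Subgroups of \<open>AN\<close> compatible with \<open>A\<close>\<close>

lemma exp_diff_quotient_tendsto: "((\<lambda>s. (exp (s * a) - 1) / s) \<longlongrightarrow> (a::real)) (at 0)"
proof -
  have "((\<lambda>s. exp (s * a)) has_real_derivative a) (at 0)"
    by (auto intro!: derivative_eq_intros)
  then show ?thesis by (simp add: DERIV_def)
qed

lemma mexp_diag: "mexp (ut a b c 0 0 0) = ut (exp a) (exp b) (exp c) 0 0 0"
proof -
  have "(\<lambda>s. (1 / s) *\<^sub>R (ut (exp (s*a)) (exp (s*b)) (exp (s*c)) 0 0 0 - mat 1))
     = (\<lambda>s. ut ((exp (s*a) - 1) / s) ((exp (s*b) - 1) / s) ((exp (s*c) - 1) / s) 0 0 0)"
    by (simp add: ut_one ut_diff ut_scale)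
  then have "((\<lambda>s. (1 / s) *\<^sub>R (ut (exp (s*a)) (exp (s*b)) (exp (s*c)) 0 0 0 - mat 1)) \<longlongrightarrow> ut a b c 0 0 0) (at 0)"
    by (simp add: tendsto_ut exp_diff_quotient_tendsto)
  then have "(\<lambda>s. ut (exp (s*a)) (exp (s*b)) (exp (s*c)) 0 0 0) 1 = mexp (1 *\<^sub>R ut a b c 0 0 0)"
    by (intro mexp_unique) (simp_all add: ut_mult ut_one ut_eq_iff distrib_right exp_add)
  then show ?thesis by simp
qed

lemma mexp_unip: "mexp (ut 0 0 0 u v w) = ut 1 1 1 u v (w + u * v / 2)"
proof -
  let ?f = "\<lambda>s. ut 1 1 1 (s * u) (s * v) (s * w + s\<^sup>2 * u * v / 2)"
  have "((\<lambda>s. ut 0 0 0 u v (w + s * u * v / 2)) \<longlongrightarrow> ut 0 0 0 u v (w + 0 * u * v / 2)) (at 0)"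
    by (intro tendsto_intros) simp
  note lim = this
  have eq: "ut 0 0 0 u v (w + s * u * v / 2) = (1 / s) *\<^sub>R (?f s - mat 1)" if "s \<noteq> 0" for s
    using that by (simp add: ut_one ut_diff ut_scale ut_eq_iff power2_eq_square field_simps)
  have "((\<lambda>s. (1 / s) *\<^sub>R (?f s - mat 1)) \<longlongrightarrow> ut 0 0 0 u v (w + 0 * u * v / 2)) (at 0)"
    by (rule Lim_transform_eventually[OF lim]) (auto simp: eventually_at_filter eq)
  then have "?f 1 = mexp (1 *\<^sub>R ut 0 0 0 u v w)"
    by (intro mexp_unique) (simp_all add: ut_mult ut_one ut_eq_iff field_simps power2_eq_square)
  then show ?thesis by simp
qed

lemma mpow_ut: "\<exists>p q r. mpow (ut a b c u v w) k = ut (a^k) (b^k) (c^k) p q r \<and> (u = 0 \<longrightarrow> p = 0) \<and> (v = 0 \<longrightarrow> q = 0)"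
proof (induction k)
  case 0
  then show ?case by (auto simp: ut_one ut_eq_iff)
next
  case (Suc k)
  then obtain p q r where *: "mpow (ut a b c u v w) k = ut (a^k) (b^k) (c^k) p q r" "u = 0 \<longrightarrow> p = 0" "v = 0 \<longrightarrow> q = 0" by blast
  show ?case unfolding mpow_Suc *(1) ut_mult ut_eq_iff using *(2,3) by (auto intro!: exI)
qed

text \<open>Off the diagonal only vanishing is tracked, and only for the simple roots: the (1,3)
  entry of the exponential can be nonzero even if \<open>w\<close> is 0.\<close>

lemma mexp_ut: "\<exists>p q r. mexp (ut a b c u v w) = ut (exp a) (exp b) (exp c) p q r \<and> (u = 0 \<longrightarrow> p = 0) \<and> (v = 0 \<longrightarrow> q = 0)"
proof -
  let ?X = "ut a b c u v w"
  have n: "mpow ?X k $ 1 $ 1 = a^k" "mpow ?X k $ 2 $ 2 = b^k" "mpow ?X k $ 3 $ 3 = c^k"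
    "mpow ?X k $ 2 $ 1 = 0" "mpow ?X k $ 3 $ 1 = 0" "mpow ?X k $ 3 $ 2 = 0"
    "u = 0 \<Longrightarrow> mpow ?X k $ 1 $ 2 = 0" "v = 0 \<Longrightarrow> mpow ?X k $ 2 $ 3 = 0" for k
    using mpow_ut[of a b c u v w k] by auto
  have e: "(\<lambda>k. x ^ k / fact k) sums exp x" for x :: real
    using exp_converges[of x] by (simp add: divide_inverse mult.commute)
  have d: "mexp ?X $ 1 $ 1 = exp a" "mexp ?X $ 2 $ 2 = exp b" "mexp ?X $ 3 $ 3 = exp c"
    using mexp_entry_sums[of ?X 1 1] mexp_entry_sums[of ?X 2 2] mexp_entry_sums[of ?X 3 3] e
    by (auto simp: n intro: sums_unique2)
  have z0: "mexp ?X $ i $ j = 0" if "\<And>k. mpow ?X k $ i $ j = 0" for i j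
    using mexp_entry_sums[of ?X i j] that by (simp add: sums_iff)
  have z: "mexp ?X $ 2 $ 1 = 0" "mexp ?X $ 3 $ 1 = 0" "mexp ?X $ 3 $ 2 = 0"
    "u = 0 \<Longrightarrow> mexp ?X $ 1 $ 2 = 0" "v = 0 \<Longrightarrow> mexp ?X $ 2 $ 3 = 0"
    by (rule z0, rule n, assumption?)+
  have "mexp ?X = ut (exp a) (exp b) (exp c) (mexp ?X $ 1 $ 2) (mexp ?X $ 2 $ 3) (mexp ?X $ 1 $ 3)"
    using ut_exhaust[of "mexp ?X"] z d by simp
  then show ?thesis using z(4,5) by blast
qed

lemma mexp_tendsto_line:
  assumes "(f \<longlongrightarrow> l) F" shows "((\<lambda>x. mexp (f x *\<^sub>R X)) \<longlongrightarrow> mexp (l *\<^sub>R X)) F"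
proof -
  have "((\<lambda>x. mexp ((f x - l) *\<^sub>R X) ** mexp (l *\<^sub>R X)) \<longlongrightarrow> mat 1 ** mexp (l *\<^sub>R X)) F"
    using assms by (intro tendsto_intros mexp_tendsto_1) (simp add: LIM_zero_iff)
  then show ?thesis by (simp add: mexp_add_scale)
qed

context closed_sg
begin

lemma subgroup_subset:
  assumes "L \<subseteq> H" "mat 1 \<in> L" "\<And>x y. x \<in> L \<Longrightarrow> y \<in> L \<Longrightarrow> x ** y \<in> L" "\<And>x. x \<in> L \<Longrightarrow> adj3 x \<in> L"
  shows "subgroup L SL3"
proof (rule group.subgroupI[OF group_SL3])
  show "L \<subseteq> carrier SL3" using assms(1) det_H by (auto simp: SL3_iff)
  fix x assume "x \<in> L"
  then show "inv\<^bsub>SL3\<^esub> x \<in> L" using assms(1,4) inv_SL3[OF det_H] by auto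
qed (use assms in auto)

text \<open>By pigeonhole, some bounded range of the parameter \<open>r\<close> already meets infinitely many \<open>s\<close>;
  an accumulation point of these elements yields a tangent direction.\<close>

lemma tangent_from_plane:
  assumes DE: "D ** E = E ** D"
    and ex: "\<And>s. \<exists>r. mexp (s *\<^sub>R D) ** mexp (r *\<^sub>R E) \<in> H"
    and inj: "\<And>s r. mexp (s *\<^sub>R D) ** mexp (r *\<^sub>R E) = mat 1 \<Longrightarrow> s = 0 \<and> r = 0"
    and V: "subspace V" "\<And>s r. mexp (s *\<^sub>R D) ** mexp (r *\<^sub>R E) - mat 1 \<in> V"
  obtains Z where "Z \<in> lie" "Z \<in> V" "Z \<noteq> 0"
proof -
  define g where "g s r = mexp (s *\<^sub>R D) ** mexp (r *\<^sub>R E)" for s r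
  have comm: "mexp (r *\<^sub>R E) ** mexp (s *\<^sub>R D) = mexp (s *\<^sub>R D) ** mexp (r *\<^sub>R E)" for s r
    using DE by (simp add: mexp_add scaleR_mult_left scaleR_mult_right add.commute)
  have g_add: "g s r ** g s' r' = g (s + s') (r + r')" for s r s' r'
  proof -
    have "g s r ** g s' r' = mexp (s *\<^sub>R D) ** (mexp (r *\<^sub>R E) ** mexp (s' *\<^sub>R D)) ** mexp (r' *\<^sub>R E)"
      by (simp add: g_def matrix_mul_assoc)
    also have "\<dots> = (mexp (s *\<^sub>R D) ** mexp (s' *\<^sub>R D)) ** (mexp (r *\<^sub>R E) ** mexp (r' *\<^sub>R E))"
      unfolding comm by (simp add: matrix_mul_assoc)
    finally show ?thesis by (simp add: g_def mexp_add_scale)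
  qed
  have g00: "g 0 0 = mat 1" by (simp add: g_def)
  obtain r where r: "\<And>s. g s (r s) \<in> H" using ex unfolding g_def by metis
  have "\<exists>K. infinite {s \<in> {0..1}. \<bar>r s\<bar> \<le> real K}"
  proof (rule ccontr)
    assume "\<not> ?thesis"
    then have "countable (\<Union>K. {s \<in> {0..1}. \<bar>r s\<bar> \<le> real K})"
      by (intro countable_UN countableI_type countable_finite) auto
    moreover have "(\<Union>K. {s \<in> {0..1}. \<bar>r s\<bar> \<le> real K}) = {0..1}"
      using real_arch_simple by auto
    ultimately show False using uncountable_closed_interval[of 0 "1::real"] by simp
  qed
  then obtain K where K: "infinite {s \<in> {0..1}. \<bar>r s\<bar> \<le> real K}" by blast
  define T where "T = (\<lambda>s. (s, r s)) ` {s \<in> {0..1}. \<bar>r s\<bar> \<le> real K}"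
  have "infinite T" unfolding T_def using K by (subst finite_image_iff) (auto intro: inj_onI)
  moreover have "T \<subseteq> {0..1} \<times> {- real K..real K}" by (auto simp: T_def)
  moreover have "compact ({0..1::real} \<times> {- real K..real K})" by (intro compact_Times compact_Icc)
  ultimately obtain p where "p islimpt T" using Heine_Borel_imp_Bolzano_Weierstrass by blast
  then obtain f where f: "\<And>n. f n \<in> T - {p}" "f \<longlonglongrightarrow> p" unfolding islimpt_sequential by blast
  obtain s0 r0 where p: "p = (s0, r0)" by (cases p)
  have fs: "(\<lambda>n. fst (f n)) \<longlonglongrightarrow> s0" "(\<lambda>n. snd (f n)) \<longlonglongrightarrow> r0"
    using tendsto_fst[OF f(2)] tendsto_snd[OF f(2)] by (simp_all add: p)
  have fH: "g (fst (f n)) (snd (f n)) \<in> H" for n using f(1)[of n] r by (auto simp: T_def)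
  have "(\<lambda>n. g (fst (f n)) (snd (f n))) \<longlonglongrightarrow> g s0 r0"
    unfolding g_def by (intro tendsto_intros mexp_tendsto_line fs)
  then have gH: "g s0 r0 \<in> H" by (rule closed_sequentially[OF closed_H fH])
  have "adj3 (g s0 r0) = g (- s0) (- r0)"
    by (rule adj3_unique) (auto simp: det_H gH g_add g00)
  then have gH': "g (- s0) (- r0) \<in> H" using adj3_H[OF gH] by simp
  \<comment> \<open>The accumulation point is translated to the identity; injectivity of the
    parametrization keeps the translates different from it.\<close>
  define h where "h n = g (fst (f n) - s0) (snd (f n) - r0)" for n
  have "h n \<in> H" for n using mult_H[OF fH[of n] gH'] by (simp add: g_add h_def)
  moreover have "h n \<noteq> mat 1" for n
    using inj[of "fst (f n) - s0" "snd (f n) - r0"] f(1)[of n] by (auto simp: h_def g_def p prod_eq_iff)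
  moreover have "h \<longlonglongrightarrow> mat 1"
  proof -
    have "h \<longlonglongrightarrow> g (s0 - s0) (r0 - r0)"
      unfolding h_def g_def by (intro tendsto_intros mexp_tendsto_line fs)
    then show ?thesis by (simp add: g00)
  qed
  moreover have "h n - mat 1 \<in> V" for n using V(2) by (simp add: h_def g_def)
  ultimately show ?thesis using tangent_direction[OF _ _ _ _ V(1)] that by metis
qed

end

section \<open>Consequences of compatibility for the Lie algebra\<close>

locale AN_sg = closed_sg +
  assumes conn: "connected H" and AN: "H \<subseteq> A_grp \<odot> N_grp" and compat: "compatible_with_A H"
begin

lemma HE:
  assumes "g \<in> H"
  obtains a b c u v w where "a > 0" "b > 0" "c > 0" "a * b * c = 1" "g = ut a b c u v w"
  using assms AN AN_iff by blast

lemma lieE: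
  assumes "X \<in> lie"
  obtains a b c u v w where "X = ut a b c u v w" "a + b + c = 0"
proof -
  have lim: "((\<lambda>s. (1 / s) *\<^sub>R (mexp (s *\<^sub>R X) - mat 1)) \<longlongrightarrow> X) (at 0)" by (rule mexp_deriv)
  have "mexp (s *\<^sub>R X) $ 2 $ 1 = 0 \<and> mexp (s *\<^sub>R X) $ 3 $ 1 = 0 \<and> mexp (s *\<^sub>R X) $ 3 $ 2 = 0" for s
    using HE[OF mexp_lie[OF assms, of s]] by (metis ut_nth)
  then have "X $ 2 $ 1 = 0" "X $ 3 $ 1 = 0" "X $ 3 $ 2 = 0"
    using lim unfolding tendsto_mat3_iff forall_3 by (simp_all add: tendsto_const_iff)
  then have X: "X = ut (X$1$1) (X$2$2) (X$3$3) (X$1$2) (X$2$3) (X$1$3)" by (rule ut_exhaust)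
  obtain p q r where "mexp X = ut (exp (X$1$1)) (exp (X$2$2)) (exp (X$3$3)) p q r"
    using mexp_ut[of "X$1$1" "X$2$2" "X$3$3" "X$1$2" "X$2$3" "X$1$3"] X by auto
  then have "exp (X$1$1) * exp (X$2$2) * exp (X$3$3) = 1"
    using det_H[OF mexp_lie[OF assms, of 1]] by (simp add: ut_det)
  then have "X$1$1 + X$2$2 + X$3$3 = 0" by (simp flip: exp_add)
  with X show ?thesis using that by blast
qed

text \<open>Every element of the Lie algebra contributes its exponentiated diagonal to
  \<open>T\<close>. A unipotent matrix commuting with all of these can have a nonzero entry only at
  a root that vanishes on the whole Lie algebra, whence the last clause.\<close>

lemma mexp_decomposition:
  assumes X: "ut a b c x y z \<in> lie"
  obtains u p q r where "u \<in> H" "u \<in> N_grp"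
    "mexp (s *\<^sub>R ut a b c x y z) = ut (exp (s*a)) (exp (s*b)) (exp (s*c)) 0 0 0 ** u ** ut 1 1 1 p q r"
    "\<forall>a' b' c' x' y' z'. ut a' b' c' x' y' z' \<in> lie \<longrightarrow>
       (a' = b' \<or> p = 0) \<and> (b' = c' \<or> q = 0) \<and> (a' = c' \<or> r = 0)"
proof -
  \<comment> \<open>Multiplying the exponential by a suitable element of \<open>N_grp\<close> leaves
    exactly its diagonal.\<close>
  have T: "ut (exp a') (exp b') (exp c') 0 0 0 \<in> A_grp \<inter> (H \<odot> N_grp)" if X': "ut a' b' c' x' y' z' \<in> lie" for a' b' c' x' y' z'
  proof -
    obtain p q r where m: "mexp (ut a' b' c' x' y' z') = ut (exp a') (exp b') (exp c') p q r"
      using mexp_ut by blast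
    have mH: "ut (exp a') (exp b') (exp c') p q r \<in> H" using mexp_lie[OF X', of 1] m by simp
    have d: "exp a' * exp b' * exp c' = 1" using det_H[OF mH] by (simp add: ut_det)
    have "\<exists>n\<in>N_grp. ut (exp a') (exp b') (exp c') 0 0 0 = ut (exp a') (exp b') (exp c') p q r ** n"
    proof
      show "ut 1 1 1 (- p / exp a') (- q / exp b') (- (p * (- q / exp b') + r) / exp a') \<in> N_grp"
        by (auto simp: N_grp_iff)
      show "ut (exp a') (exp b') (exp c') 0 0 0 = ut (exp a') (exp b') (exp c') p q r **
          ut 1 1 1 (- p / exp a') (- q / exp b') (- (p * (- q / exp b') + r) / exp a')"
        by (simp add: ut_mult ut_eq_iff)
    qed
    moreover have "ut (exp a') (exp b') (exp c') 0 0 0 \<in> A_grp"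
      unfolding A_grp_iff by (intro exI[of _ "exp a'"] exI[of _ "exp b'"] exI[of _ "exp c'"]) (simp add: d)
    ultimately show ?thesis using mH unfolding Int_iff set_prod_iff by blast
  qed
  have sX: "mexp (s *\<^sub>R ut a b c x y z) \<in> H" by (rule mexp_lie[OF X])
  let ?T = "A_grp \<inter> (H \<odot> N_grp)"
  have "mexp (s *\<^sub>R ut a b c x y z) \<in> ?T \<odot> (H \<inter> N_grp) \<odot> {n \<in> N_grp. \<forall>t \<in> ?T. n ** t = t ** n}"
    using compat sX unfolding compatible_with_A_def Let_def by blast
  from set_prod_iff[THEN iffD1, OF this] obtain tu n where n0: "tu \<in> ?T \<odot> (H \<inter> N_grp)"
    "n \<in> {n \<in> N_grp. \<forall>t \<in> ?T. n ** t = t ** n}" "mexp (s *\<^sub>R ut a b c x y z) = tu ** n" by blast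
  from set_prod_iff[THEN iffD1, OF n0(1)] obtain t u where "t \<in> ?T" "u \<in> H \<inter> N_grp" "tu = t ** u" by blast
  with n0 have tun: "t \<in> ?T" "u \<in> H \<inter> N_grp" "n \<in> N_grp" "\<forall>t \<in> ?T. n ** t = t ** n"
    "mexp (s *\<^sub>R ut a b c x y z) = t ** u ** n" by simp_all
  obtain p q r where n: "n = ut 1 1 1 p q r" using tun(3) N_grp_iff by blast
  obtain p' q' r' where u: "u = ut 1 1 1 p' q' r'" using tun(2) N_grp_iff by blast
  obtain a1 b1 c1 where t: "t = ut a1 b1 c1 0 0 0" using tun(1) A_grp_iff by blast
  obtain p2 q2 r2 where "mexp (s *\<^sub>R ut a b c x y z) = ut (exp (s*a)) (exp (s*b)) (exp (s*c)) p2 q2 r2"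
    unfolding ut_scale using mexp_ut by blast
  then have "a1 = exp (s*a)" "b1 = exp (s*b)" "c1 = exp (s*c)"
    using tun(5) by (simp_all add: t u n ut_mult ut_eq_iff)
  then have e: "mexp (s *\<^sub>R ut a b c x y z) = ut (exp (s*a)) (exp (s*b)) (exp (s*c)) 0 0 0 ** u ** ut 1 1 1 p q r"
    using tun(5) by (simp add: t n)
  have co: "(a' = b' \<or> p = 0) \<and> (b' = c' \<or> q = 0) \<and> (a' = c' \<or> r = 0)" if "ut a' b' c' x' y' z' \<in> lie" for a' b' c' x' y' z'
    using bspec[OF tun(4) T[OF that]] by (auto simp: n ut_mult ut_eq_iff)
  show ?thesis by (rule that[OF _ _ e]) (use tun(2) co in \<open>simp_all del: ut_nth\<close>)
qed

text \<open>No root vanishes on the whole Lie algebra, so the centralizing factor in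
  \<open>mexp_decomposition\<close> is trivial and \<open>u\<close> can be divided off within
  \<open>H\<close>.\<close>

lemma diag_part_lie:
  assumes "\<exists>X\<in>lie. X$1$1 \<noteq> X$2$2" "\<exists>X\<in>lie. X$2$2 \<noteq> X$3$3" "\<exists>X\<in>lie. X$1$1 \<noteq> X$3$3"
    and X: "ut a b c x y z \<in> lie"
  shows "ut a b c 0 0 0 \<in> lie"
proof (rule lieI)
  fix s
  obtain u p q r where u: "u \<in> H" "u \<in> N_grp"
    "mexp (s *\<^sub>R ut a b c x y z) = ut (exp (s*a)) (exp (s*b)) (exp (s*c)) 0 0 0 ** u ** ut 1 1 1 p q r"
    and *: "\<forall>a' b' c' x' y' z'. ut a' b' c' x' y' z' \<in> lie \<longrightarrow>
       (a' = b' \<or> p = 0) \<and> (b' = c' \<or> q = 0) \<and> (a' = c' \<or> r = 0)"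
    by (rule mexp_decomposition[where s = s, OF X])
  have "p = 0" "q = 0" "r = 0"
    using assms(1-3) * by (metis lieE ut_nth)+
  then have "mexp (s *\<^sub>R ut a b c x y z) = ut (exp (s*a)) (exp (s*b)) (exp (s*c)) 0 0 0 ** u"
    using u(3) by (simp flip: ut_one)
  then have "ut (exp (s*a)) (exp (s*b)) (exp (s*c)) 0 0 0 = mexp (s *\<^sub>R ut a b c x y z) ** adj3 u"
    by (simp add: adj3_inverse det_H u(1) flip: matrix_mul_assoc)
  then have "ut (exp (s*a)) (exp (s*b)) (exp (s*c)) 0 0 0 \<in> H"
    by (simp add: mult_H adj3_H u(1) mexp_lie X)
  then show "mexp (s *\<^sub>R ut a b c 0 0 0) \<in> H" by (simp add: ut_scale mexp_diag)
qed


lemma closed_sublevel: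
  assumes "i \<noteq> j"
  shows "closed {h \<in> H. h $ i $ j = 0}"
proof -
  have "{h \<in> H. h $ i $ j = 0} = H \<inter> ((\<lambda>h. h $ i $ j) -` {0})" by auto
  then show ?thesis by (auto intro!: closed_Int closed_H closed_vimage continuous_intros)
qed

text \<open>For upper triangular matrices the vanishing of the (1,2) or of the (2,3) entry passes to
  products and inverses, because no other off-diagonal entry enters these; for the (1,3) entry this
  fails. Connectedness spreads the relation from the Lie algebra to \<open>H\<close>.\<close>

lemma H_entry:
  assumes ij: "i = 1 \<and> j = 2 \<or> i = 2 \<and> j = 3"
    and "\<And>X. X \<in> lie \<Longrightarrow> X $ i $ j = 0" "h \<in> H"
  shows "h $ i $ j = 0"
proof -
  let ?L = "{h \<in> H. h $ i $ j = 0}"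
  have "H = ?L"
  proof (rule connected_contained[OF conn])
    show "subgroup ?L SL3"
    proof (rule subgroup_subset)
      show "mat 1 \<in> ?L" using ij by (auto simp: one_H)
    next
      fix x y assume xy: "x \<in> ?L" "y \<in> ?L"
      then have xyH: "x \<in> H" "y \<in> H" by simp_all
      obtain a b c u v w where x: "x = ut a b c u v w" by (rule HE[OF xyH(1)])
      obtain a' b' c' u' v' w' where y: "y = ut a' b' c' u' v' w'" by (rule HE[OF xyH(2)])
      have "(x ** y) $ i $ j = 0" using xy ij by (auto simp: x y ut_mult)
      then show "x ** y \<in> ?L" using xy by (simp add: mult_H)
    next
      fix x assume xy: "x \<in> ?L"
      then have xH: "x \<in> H" by simp
      obtain a b c u v w where x: "x = ut a b c u v w" by (rule HE[OF xH])
      have "adj3 x $ i $ j = 0" using xy ij by (auto simp: x ut_adj3)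
      then show "adj3 x \<in> ?L" using xy by (simp add: adj3_H)
    qed blast
    show "closed ?L" by (rule closed_sublevel) (use ij in auto)
    show "mexp X \<in> ?L" if X: "X \<in> lie" for X
    proof -
      obtain a b c u v w where x: "X = ut a b c u v w" by (rule lieE[OF X])
      have "X $ i $ j = 0" using assms(2) X by blast
      then have "mexp X $ i $ j = 0" using mexp_ut[of a b c u v w] ij by (auto simp: x)
      then show ?thesis using mexp_lie[OF X, of 1] by simp
    qed
  qed blast
  then show ?thesis using assms(3) by blast
qed

lemma lie_scale: "ut a b c u v w \<in> lie \<Longrightarrow> ut (r*a) (r*b) (r*c) (r*u) (r* v) (r*w) \<in> lie"
  using subspace_scale[OF subspace_lie, of "ut a b c u v w" r] by (simp add: ut_scale)

lemma lie_comb: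
  "ut a b c u v w \<in> lie \<Longrightarrow> ut a' b' c' u' v' w' \<in> lie \<Longrightarrow>
   ut (a + r*a') (b + r*b') (c + r*c') (u + r*u') (v + r* v') (w + r*w') \<in> lie"
  using subspace_add[OF subspace_lie _ lie_scale] by (fastforce simp: ut_add)

text \<open>Subtracting an element from its conjugate by a unipotent one removes the diagonal. Thus
  a unipotent element of \<open>H\<close> yields nilpotent elements of the Lie algebra even if no
  one-parameter group of \<open>H\<close> through it is known.\<close>

lemma lie_Ad_unip:
  assumes "ut 1 1 1 p q r \<in> H" "ut a b c u v w \<in> lie"
  shows "ut 0 0 0 (p*(b-a)) (q*(c-b)) (r*(c-a) + p* v - q*(u + p*(b-a))) \<in> lie"
proof -
  have "ut 1 1 1 p q r ** ut a b c u v w ** adj3 (ut 1 1 1 p q r) - ut a b c u v w \<in> lie"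
    by (intro subspace_diff[OF subspace_lie] Ad_lie assms)
  moreover have "ut 1 1 1 p q r ** ut a b c u v w ** adj3 (ut 1 1 1 p q r) - ut a b c u v w
     = ut 0 0 0 (p*(b-a)) (q*(c-b)) (r*(c-a) + p* v - q*(u + p*(b-a)) + p*q*(a-a))"
    unfolding ut_adj3 ut_mult ut_diff ut_eq_iff by (simp add: algebra_simps)
  ultimately show ?thesis by simp
qed

text \<open>\<open>r\<close> depends on \<open>s\<close> without any control, so a tangent vector
  \<open>Z\<close> is taken from \<open>tangent_from_plane\<close>. The subspace \<open>?V\<close>
  and the proportionality hypothesis force \<open>Z = k D + t E\<close>, and if \<open>k\<close> is
  nonzero \<open>Z\<close> is rescaled.\<close>

lemma twisted_diag_lie:
  assumes D: "D = ut a b c 0 0 0" and D0: "a \<noteq> 0" and E: "E = ut 0 0 0 p q r" "E \<noteq> 0"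
    and pq: "p * q = 0" and comm: "D ** E = E ** D"
    and ex: "\<And>s. \<exists>r. mexp (s *\<^sub>R D) ** mexp (r *\<^sub>R E) \<in> H"
    and propor: "\<And>a' b' c' u v w. ut a' b' c' u v w \<in> lie \<Longrightarrow> \<exists>k. a' = k * a \<and> b' = k * b \<and> c' = k * c"
  shows "\<exists>\<gamma>. D + \<gamma> *\<^sub>R E \<in> lie"
proof -
  \<comment> \<open>As p * q = 0, the matrix \<open>E\<close> squares to zero and
    \<open>mexp (t E)\<close> is \<open>1 + t E\<close>.\<close>
  have g: "mexp (s *\<^sub>R D) ** mexp (t *\<^sub>R E) = ut (exp (s*a)) (exp (s*b)) (exp (s*c)) 0 0 0 + t *\<^sub>R (mexp (s *\<^sub>R D) ** E)" for s t
    using pq unfolding D E by (auto simp: ut_scale mexp_diag mexp_unip ut_mult ut_add ut_eq_iff algebra_simps)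
  have DE: "\<exists>k. mexp (s *\<^sub>R D) ** E = k *\<^sub>R E" for s
  proof -
    have e: "(a = b \<or> p = 0) \<and> (b = c \<or> q = 0) \<and> (a = c \<or> r = 0)"
      using comm unfolding D E ut_mult ut_eq_iff by auto
    show ?thesis
    proof (cases "p = 0")
      case True
      with e E(2) show ?thesis
        unfolding D E by (intro exI[of _ "if r = 0 then exp (s*b) else exp (s*a)"]) (auto simp: ut_scale mexp_diag ut_mult ut_eq_iff)
    next
      case False
      with e pq show ?thesis
        unfolding D E by (intro exI[of _ "exp (s*a)"]) (auto simp: ut_scale mexp_diag ut_mult ut_eq_iff)
    qed
  qed
  let ?V = "{X. \<exists>x y z t. X = ut x y z (t*p) (t*q) (t*r)}"
  have "subspace ?V"
  proof (rule subspaceI)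
    show "0 \<in> ?V" by (auto simp: ut_zero ut_eq_iff)
  next
    fix X Y assume "X \<in> ?V" "Y \<in> ?V"
    then show "X + Y \<in> ?V" by (auto simp: ut_add ut_eq_iff distrib_right[symmetric])
  next
    fix c X assume "X \<in> ?V"
    then show "c *\<^sub>R X \<in> ?V" by (auto simp: ut_scale ut_eq_iff mult.assoc[symmetric])
  qed
  obtain Z where Z: "Z \<in> lie" "Z \<in> ?V" "Z \<noteq> 0"
  proof (rule tangent_from_plane[OF comm ex _ \<open>subspace ?V\<close>])
    fix s t assume "mexp (s *\<^sub>R D) ** mexp (t *\<^sub>R E) = mat 1"
    then show "s = 0 \<and> t = 0"
      using D0 E(2) unfolding D E ut_zero ut_one by (auto simp: ut_scale mexp_diag mexp_unip ut_mult ut_eq_iff)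
  next
    fix s t
    obtain k where k: "mexp (s *\<^sub>R D) ** E = k *\<^sub>R E" using DE by blast
    show "mexp (s *\<^sub>R D) ** mexp (t *\<^sub>R E) - mat 1 \<in> ?V"
      unfolding g k unfolding E ut_scale ut_add ut_one ut_diff
      by (auto simp: ut_eq_iff mult.assoc[symmetric])
  qed
  then obtain x y z t where Z': "Z = ut x y z (t*p) (t*q) (t*r)" by blast
  obtain k where k: "x = k * a" "y = k * b" "z = k * c" using propor[of x y z] Z(1) Z' by blast
  have Zeq: "Z = k *\<^sub>R D + t *\<^sub>R E" by (simp add: Z' D E k ut_scale ut_add)
  show ?thesis
  proof (cases "k = 0")
    \<comment> \<open>The tangent vector is a multiple of \<open>E\<close>, so the exponentials of
      multiples of \<open>E\<close> lie in \<open>H\<close> and can be cancelled.\<close>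
    case True
    then have "t \<noteq> 0" using Z(3) Zeq by auto
    then have "(1 / t) *\<^sub>R Z = E" using True Zeq by simp
    then have Elie: "E \<in> lie" using subspace_scale[OF subspace_lie Z(1)] by metis
    have "D \<in> lie"
    proof (rule lieI)
      fix s
      obtain \<rho> where r: "mexp (s *\<^sub>R D) ** mexp (\<rho> *\<^sub>R E) \<in> H" using ex by blast
      have "mexp (s *\<^sub>R D) ** mexp (\<rho> *\<^sub>R E) ** mexp ((- \<rho>) *\<^sub>R E) \<in> H"
        by (rule mult_H[OF r mexp_lie[OF Elie]])
      moreover have "mexp (\<rho> *\<^sub>R E) ** mexp ((- \<rho>) *\<^sub>R E) = mat 1"
        unfolding mexp_add_scale by simp
      ultimately show "mexp (s *\<^sub>R D) \<in> H" by (simp flip: matrix_mul_assoc)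
    qed
    then show ?thesis by (intro exI[of _ 0]) simp
  next
    case False
    then have "(1 / k) *\<^sub>R Z = D + (t / k) *\<^sub>R E" by (simp add: Zeq scaleR_add_right)
    then show ?thesis using subspace_scale[OF subspace_lie Z(1)] by metis
  qed
qed

end

section \<open>The torus part when a root vanishes on the whole Lie algebra\<close>

context AN_sg
begin

lemma lie_E13:
  assumes "ut 0 0 0 0 0 w \<in> lie" "w \<noteq> 0"
  shows "ut 0 0 0 0 0 r \<in> lie"
  using lie_scale[OF assms(1), of "r / w"] assms(2) by simp

text \<open>
  Compatibility writes \<open>mexp (s X)\<close> as \<open>t u c\<close> with \<open>u \<in> H \<inter> N\<close> and \<open>c \<in> U\<^sub>\<alpha>\<close>. The factors \<open>u\<close> and \<open>c\<close>
  commute, so that \<open>t c \<in> H\<close>, unless \<open>u\<close> has a nonzero (2,3) entry. In that case conjugating \<open>X\<close> by \<open>u\<close>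
  shows that either the Lie algebra contains \<open>\<uu>\<^sub>\<beta> + \<uu>\<^sub>\<alpha>\<^sub>+\<^sub>\<beta>\<close>, or \<open>c = 1\<close> because the (1,2)
  entries vanish on \<open>H\<close>.
\<close>

lemma centralized_diag_lie_alpha:
  assumes eq: "\<And>a b c u v w. ut a b c u v w \<in> lie \<Longrightarrow> a = b"
    and X: "ut a b c x y z \<in> lie" "a \<noteq> 0"
  shows "\<exists>\<gamma>. ut 1 1 (-2) \<gamma> 0 0 \<in> lie"
proof -
  have sum0: "a' + b' + c' = 0" if "ut a' b' c' u v w \<in> lie" for a' b' c' u v w
    using lieE[OF that] by (metis ut_nth)
  have "ut (1/a*a) (1/a*b) (1/a*c) (1/a*x) (1/a*y) (1/a*z) \<in> lie" by (rule lie_scale[OF X(1)])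
  moreover have "b = a" "c = -2 * a" using eq[OF X(1)] sum0[OF X(1)] by auto
  ultimately obtain x y z where X1: "ut 1 1 (-2) x y z \<in> lie" using X(2) by auto
  let ?D = "ut 1 1 (-2) 0 0 0" and ?E = "ut 0 0 0 1 0 0"
  have fin: ?thesis if "\<And>s. \<exists>r. mexp (s *\<^sub>R ?D) ** mexp (r *\<^sub>R ?E) \<in> H"
  proof -
    have "\<exists>\<gamma>. ?D + \<gamma> *\<^sub>R ?E \<in> lie"
    proof (rule twisted_diag_lie[OF refl _ refl _ _ _ that])
      fix a' b' c' u v w assume "ut a' b' c' u v w \<in> lie"
      from eq[OF this] sum0[OF this] show "\<exists>k. a' = k * 1 \<and> b' = k * 1 \<and> c' = k * -2"
        by (intro exI[of _ a']) simp
    qed (auto simp: ut_mult ut_zero ut_eq_iff)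
    then show ?thesis by (simp add: ut_scale ut_add)
  qed
  have dec: "\<exists>u p. u \<in> H \<and> u \<in> N_grp \<and> mexp (s *\<^sub>R ut 1 1 (-2) x y z) = mexp (s *\<^sub>R ?D) ** u ** mexp (p *\<^sub>R ?E)" for s
  proof -
    obtain u p q r where u: "u \<in> H" "u \<in> N_grp"
      "mexp (s *\<^sub>R ut 1 1 (-2) x y z) = ut (exp (s*1)) (exp (s*1)) (exp (s*(-2))) 0 0 0 ** u ** ut 1 1 1 p q r"
      "\<forall>a' b' c' x' y' z'. ut a' b' c' x' y' z' \<in> lie \<longrightarrow> (a' = b' \<or> p = 0) \<and> (b' = c' \<or> q = 0) \<and> (a' = c' \<or> r = 0)"
      by (rule mexp_decomposition[where s = s, OF X1])
    have "q = 0" "r = 0" using u(4)[rule_format, OF X1] by auto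
    then show ?thesis using u(1,2,3) by (intro exI[of _ u] exI[of _ p]) (simp add: ut_scale mexp_diag mexp_unip)
  qed
  consider (A) "\<And>X. X \<in> lie \<Longrightarrow> X $ 1 $ 2 = 0"
    | (B) "\<And>p q r. ut 1 1 1 p q r \<in> H \<Longrightarrow> q = 0"
    | (C) Y p q r where "Y \<in> lie" "Y $ 1 $ 2 \<noteq> 0" "ut 1 1 1 p q r \<in> H" "q \<noteq> 0" by blast
  then show ?thesis
  proof cases
    case A
    show ?thesis
    proof (rule fin)
      fix s
      obtain u p where u: "u \<in> H" "u \<in> N_grp" "mexp (s *\<^sub>R ut 1 1 (-2) x y z) = mexp (s *\<^sub>R ?D) ** u ** mexp (p *\<^sub>R ?E)"
        using dec by blast
      obtain p' q' r' where u': "u = ut 1 1 1 p' q' r'" using u(2) N_grp_iff by blast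
      have z: "h $ 1 $ 2 = 0" if "h \<in> H" for h by (rule H_entry[OF _ A that]) simp_all
      have "p' = 0" using z[OF u(1)] u' by simp
      moreover have "p + p' = 0" using z[OF mexp_lie[OF X1, of s]] unfolding u(3) u' by (simp add: ut_scale mexp_diag mexp_unip ut_mult flip: distrib_left)
      ultimately have "mexp (s *\<^sub>R ut 1 1 (-2) x y z) ** adj3 u = mexp (s *\<^sub>R ?D)"
        by (simp add: u(3) adj3_inverse det_H[OF u(1)] flip: matrix_mul_assoc)
      then have "mexp (s *\<^sub>R ?D) \<in> H" using mult_H[OF mexp_lie[OF X1] adj3_H[OF u(1)]] by metis
      then show "\<exists>r. mexp (s *\<^sub>R ?D) ** mexp (r *\<^sub>R ?E) \<in> H" by (intro exI[of _ 0]) simp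
    qed
  next
    case B
    show ?thesis
    proof (rule fin)
      fix s
      obtain u p where u: "u \<in> H" "u \<in> N_grp" "mexp (s *\<^sub>R ut 1 1 (-2) x y z) = mexp (s *\<^sub>R ?D) ** u ** mexp (p *\<^sub>R ?E)"
        using dec by blast
      obtain p' q' r' where u': "u = ut 1 1 1 p' q' r'" using u(2) N_grp_iff by blast
      have "q' = 0" using B u(1) u' by blast
      then have c: "u ** mexp (p *\<^sub>R ?E) = mexp (p *\<^sub>R ?E) ** u" by (simp add: u' ut_scale mexp_unip ut_mult ut_eq_iff)
      have "mexp (s *\<^sub>R ut 1 1 (-2) x y z) ** adj3 u = mexp (s *\<^sub>R ?D) ** (u ** mexp (p *\<^sub>R ?E)) ** adj3 u"
        by (simp add: u(3) matrix_mul_assoc)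
      also have "\<dots> = mexp (s *\<^sub>R ?D) ** mexp (p *\<^sub>R ?E)"
        unfolding c by (simp add: adj3_inverse det_H[OF u(1)] flip: matrix_mul_assoc)
      finally have "mexp (s *\<^sub>R ?D) ** mexp (p *\<^sub>R ?E) \<in> H"
        using mult_H[OF mexp_lie[OF X1] adj3_H[OF u(1)]] by metis
      then show "\<exists>r. mexp (s *\<^sub>R ?D) ** mexp (r *\<^sub>R ?E) \<in> H" by blast
    qed
  next
    case C
    define v1 v2 where "v1 = q * (-2 - 1)" and "v2 = r * (-2 - 1) + p * y - q * (x + p * (1 - 1))"
    have V: "ut 0 0 0 0 v1 v2 \<in> lie" using lie_Ad_unip[OF C(3) X1] by (simp add: v1_def v2_def)
    have v1: "v1 \<noteq> 0" using C(4) by (simp add: v1_def)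
    obtain a b c u v w where Y: "Y = ut a b c u v w" by (rule lieE[OF C(1)])
    have ab: "a = b" and u0: "u \<noteq> 0" using eq C(1,2) Y by auto
    \<comment> \<open>The bracket agrees with \<open>b - c\<close> times the element in
      \<open>V\<close> except in the (1,3) entry, where it exceeds it by
      \<open>u * v1\<close>.\<close>
    have "ut 0 0 0 0 ((b-c) * v1) ((b-c) * v2 + u * v1) \<in> lie"
      using bracket_lie[OF C(1) V] by (simp add: Y ut_lie_bracket ab)
    from lie_comb[OF this V, of "-(b-c)"] have "ut 0 0 0 0 0 (u * v1) \<in> lie" by (simp add: algebra_simps)
    then have e13: "ut 0 0 0 0 0 r \<in> lie" for r using lie_E13 u0 v1 by simp
    have "ut 1 1 (-2) x 0 (z - y / v1 * v2) \<in> lie"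
      using lie_comb[OF X1 V, of "- (y / v1)"] v1 by simp
    from lie_comb[OF this e13[of "- (z - y / v1 * v2)"], of 1] show ?thesis by auto
  qed
qed

text \<open>The argument for \<alpha> reflected in the antidiagonal: the centralizing factor now
  lies in the root group of \<beta>, and what keeps it from commuting with \<open>u\<close> is a
  nonzero (1,2) entry of \<open>u\<close>.\<close>

lemma centralized_diag_lie_beta:
  assumes eq: "\<And>a b c u v w. ut a b c u v w \<in> lie \<Longrightarrow> b = c"
    and X: "ut a b c x y z \<in> lie" "a \<noteq> 0"
  shows "\<exists>\<gamma>. ut (-2) 1 1 0 \<gamma> 0 \<in> lie"
proof -
  have sum0: "a' + b' + c' = 0" if "ut a' b' c' u v w \<in> lie" for a' b' c' u v w
    using lieE[OF that] by (metis ut_nth)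
  have bc: "b = c" "a = -2 * c" "c \<noteq> 0" using eq[OF X(1)] sum0[OF X(1)] X(2) by auto
  moreover have "ut (1/c*a) (1/c*b) (1/c*c) (1/c*x) (1/c*y) (1/c*z) \<in> lie" by (rule lie_scale[OF X(1)])
  ultimately obtain x y z where X1: "ut (-2) 1 1 x y z \<in> lie" by auto
  let ?D = "ut (-2) 1 1 0 0 0" and ?E = "ut 0 0 0 0 1 0"
  have fin: ?thesis if "\<And>s. \<exists>r. mexp (s *\<^sub>R ?D) ** mexp (r *\<^sub>R ?E) \<in> H"
  proof -
    have "\<exists>\<gamma>. ?D + \<gamma> *\<^sub>R ?E \<in> lie"
    proof (rule twisted_diag_lie[OF refl _ refl _ _ _ that])
      fix a' b' c' u v w assume "ut a' b' c' u v w \<in> lie"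
      from eq[OF this] sum0[OF this] show "\<exists>k. a' = k * -2 \<and> b' = k * 1 \<and> c' = k * 1"
        by (intro exI[of _ b']) simp
    qed (auto simp: ut_mult ut_zero ut_eq_iff)
    then show ?thesis by (simp add: ut_scale ut_add)
  qed
  have dec: "\<exists>u p. u \<in> H \<and> u \<in> N_grp \<and> mexp (s *\<^sub>R ut (-2) 1 1 x y z) = mexp (s *\<^sub>R ?D) ** u ** mexp (p *\<^sub>R ?E)" for s
  proof -
    obtain u p q r where u: "u \<in> H" "u \<in> N_grp"
      "mexp (s *\<^sub>R ut (-2) 1 1 x y z) = ut (exp (s*(-2))) (exp (s*1)) (exp (s*1)) 0 0 0 ** u ** ut 1 1 1 p q r"
      "\<forall>a' b' c' x' y' z'. ut a' b' c' x' y' z' \<in> lie \<longrightarrow> (a' = b' \<or> p = 0) \<and> (b' = c' \<or> q = 0) \<and> (a' = c' \<or> r = 0)"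
      by (rule mexp_decomposition[where s = s, OF X1])
    have "p = 0" "r = 0" using u(4)[rule_format, OF X1] by auto
    then show ?thesis using u(1,2,3) by (intro exI[of _ u] exI[of _ q]) (simp add: ut_scale mexp_diag mexp_unip)
  qed
  consider (A) "\<And>X. X \<in> lie \<Longrightarrow> X $ 2 $ 3 = 0"
    | (B) "\<And>p q r. ut 1 1 1 p q r \<in> H \<Longrightarrow> p = 0"
    | (C) Y p q r where "Y \<in> lie" "Y $ 2 $ 3 \<noteq> 0" "ut 1 1 1 p q r \<in> H" "p \<noteq> 0" by blast
  then show ?thesis
  proof cases
    case A
    show ?thesis
    proof (rule fin)
      fix s
      obtain u p where u: "u \<in> H" "u \<in> N_grp" "mexp (s *\<^sub>R ut (-2) 1 1 x y z) = mexp (s *\<^sub>R ?D) ** u ** mexp (p *\<^sub>R ?E)"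
        using dec by blast
      obtain p' q' r' where u': "u = ut 1 1 1 p' q' r'" using u(2) N_grp_iff by blast
      have z: "h $ 2 $ 3 = 0" if "h \<in> H" for h by (rule H_entry[OF _ A that]) simp_all
      have "q' = 0" using z[OF u(1)] u' by simp
      moreover have "p + q' = 0" using z[OF mexp_lie[OF X1, of s]] unfolding u(3) u' by (simp add: ut_scale mexp_diag mexp_unip ut_mult flip: distrib_left)
      ultimately have "mexp (s *\<^sub>R ut (-2) 1 1 x y z) ** adj3 u = mexp (s *\<^sub>R ?D)"
        by (simp add: u(3) adj3_inverse det_H[OF u(1)] flip: matrix_mul_assoc)
      then have "mexp (s *\<^sub>R ?D) \<in> H" using mult_H[OF mexp_lie[OF X1] adj3_H[OF u(1)]] by metis
      then show "\<exists>r. mexp (s *\<^sub>R ?D) ** mexp (r *\<^sub>R ?E) \<in> H" by (intro exI[of _ 0]) simp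
    qed
  next
    case B
    show ?thesis
    proof (rule fin)
      fix s
      obtain u p where u: "u \<in> H" "u \<in> N_grp" "mexp (s *\<^sub>R ut (-2) 1 1 x y z) = mexp (s *\<^sub>R ?D) ** u ** mexp (p *\<^sub>R ?E)"
        using dec by blast
      obtain p' q' r' where u': "u = ut 1 1 1 p' q' r'" using u(2) N_grp_iff by blast
      have "p' = 0" using B u(1) u' by blast
      then have c: "u ** mexp (p *\<^sub>R ?E) = mexp (p *\<^sub>R ?E) ** u" by (simp add: u' ut_scale mexp_unip ut_mult ut_eq_iff)
      have "mexp (s *\<^sub>R ut (-2) 1 1 x y z) ** adj3 u = mexp (s *\<^sub>R ?D) ** (u ** mexp (p *\<^sub>R ?E)) ** adj3 u"
        by (simp add: u(3) matrix_mul_assoc)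
      also have "\<dots> = mexp (s *\<^sub>R ?D) ** mexp (p *\<^sub>R ?E)"
        unfolding c by (simp add: adj3_inverse det_H[OF u(1)] flip: matrix_mul_assoc)
      finally have "mexp (s *\<^sub>R ?D) ** mexp (p *\<^sub>R ?E) \<in> H"
        using mult_H[OF mexp_lie[OF X1] adj3_H[OF u(1)]] by metis
      then show "\<exists>r. mexp (s *\<^sub>R ?D) ** mexp (r *\<^sub>R ?E) \<in> H" by blast
    qed
  next
    case C
    define v1 v2 where "v1 = p * (1 - -2)" and "v2 = r * (1 - -2) + p * y - q * (x + p * (1 - -2))"
    have V: "ut 0 0 0 v1 0 v2 \<in> lie" using lie_Ad_unip[OF C(3) X1] by (simp add: v1_def v2_def)
    have v1: "v1 \<noteq> 0" using C(4) by (simp add: v1_def)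
    obtain a b c u v w where Y: "Y = ut a b c u v w" by (rule lieE[OF C(1)])
    have bc: "b = c" and v0: "v \<noteq> 0" using eq C(1,2) Y by auto
    have "ut 0 0 0 ((a-c) * v1) 0 ((a-c) * v2 - v1 * v) \<in> lie"
      using bracket_lie[OF C(1) V] by (simp add: Y ut_lie_bracket bc)
    from lie_comb[OF this V, of "-(a-c)"] have "ut 0 0 0 0 0 (- (v1 * v)) \<in> lie" by (simp add: algebra_simps)
    then have e13: "ut 0 0 0 0 0 r \<in> lie" for r using lie_E13 v0 v1 by simp
    have "ut (-2) 1 1 0 y (z - x / v1 * v2) \<in> lie"
      using lie_comb[OF X1 V, of "- (x / v1)"] v1 by simp
    from lie_comb[OF this e13[of "- (z - x / v1 * v2)"], of 1] show ?thesis by auto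
  qed
qed

text \<open>The root group of \<alpha>+\<beta> is central in \<open>N_grp\<close>, so the
  centralizing factor always commutes with \<open>u\<close> and the case distinction of the simple
  roots disappears.\<close>

lemma centralized_diag_lie_alpha_beta:
  assumes eq: "\<And>a b c u v w. ut a b c u v w \<in> lie \<Longrightarrow> a = c"
    and X: "ut a b c x y z \<in> lie" "a \<noteq> 0"
  shows "\<exists>\<gamma>. ut 1 (-2) 1 0 0 \<gamma> \<in> lie"
proof -
  have sum0: "a' + b' + c' = 0" if "ut a' b' c' u v w \<in> lie" for a' b' c' u v w
    using lieE[OF that] by (metis ut_nth)
  have "ut (1/a*a) (1/a*b) (1/a*c) (1/a*x) (1/a*y) (1/a*z) \<in> lie" by (rule lie_scale[OF X(1)])
  moreover have "c = a" "b = -2 * a" using eq[OF X(1)] sum0[OF X(1)] by auto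
  ultimately obtain x y z where X1: "ut 1 (-2) 1 x y z \<in> lie" using X(2) by auto
  let ?D = "ut 1 (-2) 1 0 0 0" and ?E = "ut 0 0 0 0 0 1"
  have "\<exists>\<gamma>. ?D + \<gamma> *\<^sub>R ?E \<in> lie"
  proof (rule twisted_diag_lie[OF refl _ refl])
    fix s
    obtain u p q r where u: "u \<in> H" "u \<in> N_grp"
      "mexp (s *\<^sub>R ut 1 (-2) 1 x y z) = ut (exp (s*1)) (exp (s*(-2))) (exp (s*1)) 0 0 0 ** u ** ut 1 1 1 p q r"
      "\<forall>a' b' c' x' y' z'. ut a' b' c' x' y' z' \<in> lie \<longrightarrow> (a' = b' \<or> p = 0) \<and> (b' = c' \<or> q = 0) \<and> (a' = c' \<or> r = 0)"
      by (rule mexp_decomposition[where s = s, OF X1])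
    have pq: "p = 0" "q = 0" using u(4)[rule_format, OF X1] by auto
    obtain p' q' r' where u': "u = ut 1 1 1 p' q' r'" using u(2) N_grp_iff by blast
    have c: "u ** mexp (r *\<^sub>R ?E) = mexp (r *\<^sub>R ?E) ** u" by (simp add: u' ut_scale mexp_unip ut_mult ut_eq_iff)
    have u3: "mexp (s *\<^sub>R ut 1 (-2) 1 x y z) = mexp (s *\<^sub>R ?D) ** u ** mexp (r *\<^sub>R ?E)"
      using u(3) by (simp add: pq ut_scale mexp_diag mexp_unip)
    have "mexp (s *\<^sub>R ut 1 (-2) 1 x y z) ** adj3 u = mexp (s *\<^sub>R ?D) ** (u ** mexp (r *\<^sub>R ?E)) ** adj3 u"
      by (simp only: u3 matrix_mul_assoc)
    also have "\<dots> = mexp (s *\<^sub>R ?D) ** mexp (r *\<^sub>R ?E)"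
      unfolding c by (simp add: adj3_inverse det_H[OF u(1)] flip: matrix_mul_assoc)
    finally have "mexp (s *\<^sub>R ?D) ** mexp (r *\<^sub>R ?E) \<in> H"
      using mult_H[OF mexp_lie[OF X1] adj3_H[OF u(1)]] by metis
    then show "\<exists>r. mexp (s *\<^sub>R ?D) ** mexp (r *\<^sub>R ?E) \<in> H" by blast
  next
    fix a' b' c' u v w assume "ut a' b' c' u v w \<in> lie"
    from eq[OF this] sum0[OF this] show "\<exists>k. a' = k * 1 \<and> b' = k * -2 \<and> c' = k * 1"
      by (intro exI[of _ a']) simp
  qed (auto simp: ut_mult ut_zero ut_eq_iff)
  then show ?thesis by (simp add: ut_scale ut_add)
qed

end

section \<open>Cartan decomposition and coarse density\<close>

abbreviation matches :: "real \<Rightarrow> real \<Rightarrow> real \<Rightarrow> mat3 \<Rightarrow> bool" where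
  "matches M X Y h \<equiv> norm h \<le> M * X \<and> X \<le> M * norm h \<and> norm (adj3 h) \<le> M * Y \<and> Y \<le> M * norm (adj3 h)"

text \<open>Up to constants, such an \<open>h\<close> has diagonal part \<open>X\<close>,
  \<open>Z\<close>, \<open>1 / (X * Z)\<close> in the Cartan decomposition. Thus \<open>Z\<close> is
  the middle entry, and Z \<ge> 1 selects the half of the chamber that inversion carries to the
  other half.\<close>

definition coarsely_dense :: "mat3 set \<Rightarrow> bool" where
  "coarsely_dense H \<longleftrightarrow> (\<exists>M. \<forall>X Z. 1 \<le> Z \<and> Z \<le> X \<longrightarrow>
     (\<exists>h\<in>H. matches M X (X * Z) h))"

definition SO3 :: "mat3 set" where
  "SO3 = {k. transpose k ** k = mat 1 \<and> det k = 1}"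

lemma transpose_nth: "transpose A $ i $ j = A $ j $ i"
  by (simp add: transpose_def)

lemma SO3_adj3: "k \<in> SO3 \<Longrightarrow> adj3 k = transpose k"
  by (intro adj3_unique) (auto simp: SO3_def)

lemma SO3_det: "k \<in> SO3 \<Longrightarrow> det k = 1"
  by (simp add: SO3_def)

lemma SO3_transpose: "k \<in> SO3 \<Longrightarrow> transpose k \<in> SO3"
  using adj3_inverse(2)[of k] SO3_adj3[of k] by (simp add: SO3_def transpose_transpose)

lemma SO3_mult: "k \<in> SO3 \<Longrightarrow> l \<in> SO3 \<Longrightarrow> k ** l \<in> SO3"
proof -
  assume k: "k \<in> SO3" and l: "l \<in> SO3"
  have "transpose (k ** l) ** (k ** l) = transpose l ** (transpose k ** k) ** l"
    by (simp add: matrix_transpose_mul matrix_mul_assoc)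
  then show ?thesis using k l by (simp add: SO3_def det_mul)
qed

lemma SO3_norm: assumes "k \<in> SO3" shows "norm k \<le> 9"
proof -
  have e: "transpose k ** k = mat 1" using assms by (simp add: SO3_def)
  have s: "(k$1$j)\<^sup>2 + (k$2$j)\<^sup>2 + (k$3$j)\<^sup>2 = 1" for j
    using arg_cong[OF e, of "\<lambda>m. m $ j $ j"] by (simp add: mat_mult_3 transpose_nth mat_def power2_eq_square)
  have e1: "\<bar>k$i$j\<bar> \<le> 1" for i j
  proof -
    have "(k$i$j)\<^sup>2 \<le> 1"
      using exhaust_3[of i] s[of j] zero_le_power2[of "k$1$j"] zero_le_power2[of "k$2$j"] zero_le_power2[of "k$3$j"]
      by (smt (verit))
    then show ?thesis by (simp add: abs_square_le_1)
  qed
  then show ?thesis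
    using norm_le_entries[of k] e1[of 1 1] e1[of 1 2] e1[of 1 3] e1[of 2 1] e1[of 2 2] e1[of 2 3]
      e1[of 3 1] e1[of 3 2] e1[of 3 3] by linarith
qed

lemma continuous_on_transpose [continuous_intros]:
  "continuous_on S f \<Longrightarrow> continuous_on S (\<lambda>x. transpose (f x :: mat3))"
  unfolding transpose_def by (intro continuous_intros)

lemma compact_SO3: "compact SO3"
proof -
  have "SO3 = (\<lambda>k. (transpose k ** k, det k)) -` {(mat 1, 1)}" by (auto simp: SO3_def)
  moreover have "closed \<dots>" by (intro closed_vimage continuous_intros)
  ultimately have "closed SO3" by simp
  moreover have "bounded SO3" using SO3_norm by (auto intro!: boundedI)
  ultimately show ?thesis by (simp add: compact_eq_bounded_closed)
qed

text \<open>Over the unit circle the left side has maximum \<open>sqrt (P^2 + Q^2)\<close>, attained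
  in the direction of (P, Q).\<close>

lemma maximal_direction:
  fixes P Q :: real
  assumes "\<And>c s. c\<^sup>2 + s\<^sup>2 = 1 \<Longrightarrow> c * P + s * Q \<le> P"
  shows "Q = 0"
proof (rule ccontr)
  assume Q: "Q \<noteq> 0"
  define \<rho> where "\<rho> = sqrt (P\<^sup>2 + Q\<^sup>2)"
  have r2: "\<rho>\<^sup>2 = P\<^sup>2 + Q\<^sup>2" by (simp add: \<rho>_def)
  have r: "\<rho> > 0" using Q by (simp add: \<rho>_def sum_power2_gt_zero_iff)
  have "(P / \<rho>)\<^sup>2 + (Q / \<rho>)\<^sup>2 = 1"
    using r by (simp add: power_divide r2[symmetric] add_divide_distrib[symmetric])
  from assms[OF this] have "(P\<^sup>2 + Q\<^sup>2) / \<rho> \<le> P" by (simp add: power2_eq_square add_divide_distrib)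
  then have "\<rho> * \<rho> / \<rho> \<le> P" using r2 by (simp add: power2_eq_square)
  then have "\<rho> \<le> P" using r by simp
  then have "\<rho>\<^sup>2 \<le> P\<^sup>2" using r by (intro power_mono) auto
  then show False using Q r2 by simp
qed

text \<open>Maximising a linear functional with distinct positive weights over both rotations
  diagonalises the matrix and orders its diagonal, all in one step.\<close>

lemma cartan_decomposition:
  assumes "det g = 1"
  obtains k l a b c where "k \<in> SO3" "l \<in> SO3" "k ** g ** l = ut a b c 0 0 0"
    "a \<ge> b" "b \<ge> c" "c > 0" "a * b * c = 1"
proof -
  define F where "F m = 3 * m$1$1 + 2 * m$2$2 + m$3$3" for m :: mat3
  have "compact (SO3 \<times> SO3)" by (intro compact_Times compact_SO3)
  moreover have "(mat 1, mat 1) \<in> SO3 \<times> SO3" by (simp add: SO3_def transpose_mat)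
  moreover have "continuous_on (SO3 \<times> SO3) (\<lambda>(k, l). F (k ** g ** l))"
    unfolding F_def case_prod_beta by (intro continuous_intros)
  ultimately obtain kl where kl: "kl \<in> SO3 \<times> SO3"
    "\<And>x. x \<in> SO3 \<times> SO3 \<Longrightarrow> (\<lambda>(k, l). F (k ** g ** l)) x \<le> (\<lambda>(k, l). F (k ** g ** l)) kl"
    using continuous_attains_sup[of "SO3 \<times> SO3"] by blast
  obtain k l where kl_eq: "kl = (k, l)" by (cases kl)
  have k: "k \<in> SO3" and l: "l \<in> SO3" using kl(1) kl_eq by auto
  define m where "m = k ** g ** l"
  have mx: "F (r ** m ** r') \<le> F m" if "r \<in> SO3" "r' \<in> SO3" for r r'
  proof -
    have "r ** m ** r' = (r ** k) ** g ** (l ** r')" by (simp add: m_def matrix_mul_assoc)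
    then show ?thesis using kl(2)[of "(r ** k, l ** r')"] kl_eq that k l by (simp add: SO3_mult m_def)
  qed
  have I: "mat 1 \<in> SO3" by (simp add: SO3_def transpose_mat)
  have R12: "mk c (-s) 0 s c 0 0 0 1 \<in> SO3" if "c\<^sup>2 + s\<^sup>2 = 1" for c s
    using that unfolding SO3_def mat3_eq_iff by (simp add: mat_mult_3 transpose_nth det_3 power2_eq_square algebra_simps)
  have R13: "mk c 0 (-s) 0 1 0 s 0 c \<in> SO3" if "c\<^sup>2 + s\<^sup>2 = 1" for c s
    using that unfolding SO3_def mat3_eq_iff by (simp add: mat_mult_3 transpose_nth det_3 power2_eq_square algebra_simps)
  have R23: "mk 1 0 0 0 c (-s) 0 s c \<in> SO3" if "c\<^sup>2 + s\<^sup>2 = 1" for c s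
    using that unfolding SO3_def mat3_eq_iff by (simp add: mat_mult_3 transpose_nth det_3 power2_eq_square algebra_simps)
  \<comment> \<open>Along a rotation the functional is \<open>c * P + s * Q\<close> plus a constant,
    so \<open>Q\<close> vanishes at the maximum. Rotating on the left and on the right gives two
    independent equations because the two weights differ.\<close>
  have "2 * m$1$2 - 3 * m$2$1 = 0"
    by (rule maximal_direction[of "3 * m$1$1 + 2 * m$2$2"])
      (use mx[OF R12 I] in \<open>auto simp: F_def mat_mult_3 algebra_simps\<close>)
  moreover have "3 * m$1$2 - 2 * m$2$1 = 0"
    by (rule maximal_direction[of "3 * m$1$1 + 2 * m$2$2"])
      (use mx[OF I R12] in \<open>auto simp: F_def mat_mult_3 algebra_simps\<close>)
  ultimately have z12: "m$1$2 = 0" "m$2$1 = 0" by linarith+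
  have "m$1$3 - 3 * m$3$1 = 0"
    by (rule maximal_direction[of "3 * m$1$1 + m$3$3"])
      (use mx[OF R13 I] in \<open>auto simp: F_def mat_mult_3 algebra_simps\<close>)
  moreover have "3 * m$1$3 - m$3$1 = 0"
    by (rule maximal_direction[of "3 * m$1$1 + m$3$3"])
      (use mx[OF I R13] in \<open>auto simp: F_def mat_mult_3 algebra_simps\<close>)
  ultimately have z13: "m$1$3 = 0" "m$3$1 = 0" by linarith+
  have "m$2$3 - 2 * m$3$2 = 0"
    by (rule maximal_direction[of "2 * m$2$2 + m$3$3"])
      (use mx[OF R23 I] in \<open>auto simp: F_def mat_mult_3 algebra_simps\<close>)
  moreover have "2 * m$2$3 - m$3$2 = 0"
    by (rule maximal_direction[of "2 * m$2$2 + m$3$3"])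
      (use mx[OF I R23] in \<open>auto simp: F_def mat_mult_3 algebra_simps\<close>)
  ultimately have z23: "m$2$3 = 0" "m$3$2 = 0" by linarith+
  define a b c where "a = m$1$1" and "b = m$2$2" and "c = m$3$3"
  have m: "m = ut a b c 0 0 0" using ut_exhaust[of m] z12 z13 z23 by (simp add: a_def b_def c_def)
  have "det m = 1" using assms SO3_det[OF k] SO3_det[OF l] by (simp add: m_def det_mul)
  then have abc: "a * b * c = 1" by (simp add: m ut_det)
  note S = mat_mult_3 F_def m
  \<comment> \<open>Conjugation by a quarter turn exchanges two diagonal entries, so the larger one
    must carry the larger weight.\<close>
  have ab: "b \<le> a" using mx[OF R12[of 0 1] R12[of 0 "-1"]] by (simp add: S)
  have bc: "c \<le> b" using mx[OF R23[of 0 1] R23[of 0 "-1"]] by (simp add: S)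
  \<comment> \<open>A half turn negates \<open>b\<close> and \<open>c\<close>. Hence
    \<open>b\<close> cannot be negative, and the determinant then settles the sign of
    \<open>c\<close>.\<close>
  have bc0: "0 \<le> 2 * b + c" using mx[OF R23[of "-1" 0] I] by (simp add: S)
  have a0: "a > 0"
  proof (rule ccontr)
    assume "\<not> a > 0"
    then have "a \<le> 0" "b * c \<ge> 0" using ab bc by (auto intro: mult_nonpos_nonpos)
    then show False using abc mult_nonpos_nonneg[of a "b * c"] by (simp add: mult.assoc)
  qed
  have "c > 0"
  proof (rule ccontr)
    assume c: "\<not> c > 0"
    have "c \<noteq> 0" using abc by auto
    then have "c < 0" "b > 0" using c bc0 by auto
    then have "a * b * c < 0" using a0 by (simp add: mult_pos_neg)
    then show False using abc by simp
  qed
  then show ?thesis using that[OF k l] m ab bc abc by (simp add: m_def)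
qed

lemma norm_mult3_le:
  assumes "norm a \<le> A" "norm b \<le> B" "norm c \<le> C"
  shows "norm ((a::mat3) ** (b::mat3) ** (c::mat3)) \<le> 729 * A * B * C"
proof -
  have "norm (a ** b ** c) \<le> 27 * norm (a ** b) * norm c" by (rule norm_mult_le)
  also have "\<dots> \<le> 27 * (27 * norm a * norm b) * norm c"
    by (intro mult_right_mono mult_left_mono norm_mult_le) auto
  also have "\<dots> = 729 * (norm a * norm b * norm c)" by simp
  also have "norm a * norm b * norm c \<le> A * B * C"
  proof -
    have "0 \<le> A" "0 \<le> B" using assms norm_ge_zero[of a] norm_ge_zero[of b] by linarith+
    then show ?thesis by (intro mult_mono assms mult_nonneg_nonneg norm_ge_zero)
  qed
  finally show ?thesis by simp
qed

text \<open>59049 is 729 * 9 * 9, from a product of three factors of which two are orthogonal with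
  norm at most 9; the factor 3 counts diagonal entries. The first entry measures \<open>h\<close>,
  the last one its inverse.\<close>

lemma cartan_decomposition_sizes:
  assumes "det h = 1"
  obtains k l a b c where "k \<in> SO3" "l \<in> SO3" "k ** h ** l = ut a b c 0 0 0"
    "a \<ge> b" "b \<ge> c" "c > 0" "a * b * c = 1"
    "a \<le> 59049 * norm h" "norm h \<le> 3 * 59049 * a"
    "1 / c \<le> 59049 * norm (adj3 h)" "norm (adj3 h) \<le> 3 * 59049 * (1 / c)"
proof -
  obtain k l a b c where *: "k \<in> SO3" "l \<in> SO3" "k ** h ** l = ut a b c 0 0 0"
    "a \<ge> b" "b \<ge> c" "c > 0" "a * b * c = 1"
    by (rule cartan_decomposition[OF assms])
  note T = SO3_transpose[OF *(1)] SO3_transpose[OF *(2)]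
  have tk: "transpose k ** k = mat 1" "k ** transpose k = mat 1" and tl: "transpose l ** l = mat 1" "l ** transpose l = mat 1"
    using *(1,2) T by (simp_all add: SO3_def transpose_transpose)
  have h: "h = transpose k ** ut a b c 0 0 0 ** transpose l"
  proof -
    have "transpose k ** (k ** h ** l) ** transpose l = (transpose k ** k) ** h ** (l ** transpose l)"
      by (simp add: matrix_mul_assoc)
    then show ?thesis by (simp add: tk tl *(3))
  qed
  have aE: "adj3 (ut a b c 0 0 0) = ut (1/a) (1/b) (1/c) 0 0 0"
    using *(4-7) by (intro adj3_unique) (auto simp: ut_det ut_mult ut_one ut_eq_iff)
  have dE: "det (ut a b c 0 0 0) = 1" using *(7) by (simp add: ut_det)
  have ah: "adj3 h = l ** ut (1/a) (1/b) (1/c) 0 0 0 ** k"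
    unfolding h using dE SO3_det[OF T(1)] SO3_det[OF T(2)]
    by (simp add: adj3_mul det_mul aE SO3_adj3 T transpose_transpose matrix_mul_assoc)
  have aE': "ut (1/a) (1/b) (1/c) 0 0 0 = transpose l ** adj3 h ** transpose k"
  proof -
    have "transpose l ** adj3 h ** transpose k = (transpose l ** l) ** ut (1/a) (1/b) (1/c) 0 0 0 ** (k ** transpose k)"
      by (simp add: ah matrix_mul_assoc)
    then show ?thesis by (simp add: tk tl)
  qed
  note N = SO3_norm[OF *(1)] SO3_norm[OF *(2)] SO3_norm[OF T(1)] SO3_norm[OF T(2)]
  have "a \<le> norm (ut a b c 0 0 0)" using norm_ut_ge(1)[of a b c 0 0 0] by simp
  also have "\<dots> \<le> 729 * 9 * norm h * 9" unfolding *(3)[symmetric] by (intro norm_mult3_le N order_refl)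
  finally have 1: "a \<le> 59049 * norm h" by simp
  have "norm (ut a b c 0 0 0) \<le> 3 * a" using norm_ut_le[of a b c 0 0 0] *(4-6) by simp
  then have "norm h \<le> 729 * 9 * (3 * a) * 9" unfolding h by (intro norm_mult3_le N)
  then have 2: "norm h \<le> 3 * 59049 * a" by simp
  have "1 / c \<le> norm (ut (1/a) (1/b) (1/c) 0 0 0)" using norm_ut_ge(3)[of "1/c" "1/a" "1/b" 0 0 0] *(6) by simp
  also have "\<dots> \<le> 729 * 9 * norm (adj3 h) * 9" unfolding aE' by (intro norm_mult3_le N order_refl)
  finally have 3: "1 / c \<le> 59049 * norm (adj3 h)" by simp
  have "1 / a \<le> 1 / c" "1 / b \<le> 1 / c" using *(4-6) by (auto intro!: divide_left_mono)
  then have "norm (ut (1/a) (1/b) (1/c) 0 0 0) \<le> 3 * (1 / c)"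
    using norm_ut_le[of "1/a" "1/b" "1/c" 0 0 0] *(4-6) by simp
  then have "norm (adj3 h) \<le> 729 * 9 * (3 * (1 / c)) * 9" unfolding ah by (intro norm_mult3_le N)
  then have 4: "norm (adj3 h) \<le> 3 * 59049 * (1 / c)" by simp
  show ?thesis by (rule that[OF * 1 2 3 4])
qed

text \<open>Only diagonal matrices are tested: the compact factors change sizes by bounded factors,
  so the \<open>h\<close> in a factorization of \<open>?D\<close> has the sizes of
  \<open>?D\<close>.\<close>

lemma cds_imp_coarsely_dense:
  assumes "cartan_decomposition_subgroup H"
  shows "coarsely_dense H"
proof -
  obtain C where C: "C \<subseteq> carrier SL3" "compact C" "C \<odot> H \<odot> C = carrier SL3"
    and HS: "subgroup H SL3"
    using assms unfolding cartan_decomposition_subgroup_def by blast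
  obtain R0 where R0: "\<And>c. c \<in> C \<Longrightarrow> norm c \<le> R0"
    using compact_imp_bounded[OF C(2)] unfolding bounded_iff by blast
  \<comment> \<open>Bounds the elements of \<open>C\<close> and, through
    \<open>norm_adj3_le\<close>, their inverses.\<close>
  define R where "R = max 1 (max R0 (18 * R0\<^sup>2))"
  have R: "norm c \<le> R" "norm (adj3 c) \<le> R" if "c \<in> C" for c
  proof -
    show "norm c \<le> R" using R0[OF that] by (simp add: R_def)
    have "(norm c)\<^sup>2 \<le> R0\<^sup>2" using R0[OF that] by (intro power_mono) auto
    then show "norm (adj3 c) \<le> R" using norm_adj3_le[of c] by (simp add: R_def)
  qed
  have R1: "R \<ge> 1" by (simp add: R_def)
  define M where "M = 729 * R * 3 * R"
  have MM: "729 * R * R \<le> M" using R1 by (simp add: M_def)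
  show ?thesis unfolding coarsely_dense_def
  proof (intro exI[of _ M] allI impI)
    fix X Z :: real assume XZ: "1 \<le> Z \<and> Z \<le> X"
    let ?D = "ut X Z (1 / (X * Z)) 0 0 0"
    have dD: "det ?D = 1" using XZ by (simp add: ut_det)
    have aD: "adj3 ?D = ut (1/X) (1/Z) (X * Z) 0 0 0"
      using XZ by (simp add: ut_adj3)
    have "?D \<in> C \<odot> H \<odot> C" using C(3) dD by (simp add: SL3_iff)
    from set_prod_iff[THEN iffD1, OF this] obtain x c2 where x: "x \<in> C \<odot> H" "c2 \<in> C" "?D = x ** c2" by blast
    from set_prod_iff[THEN iffD1, OF x(1)] obtain c1 h where c: "c1 \<in> C" "h \<in> H" "x = c1 ** h" by blast
    have D: "?D = c1 ** h ** c2" using x c by simp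
    have d1: "det c1 = 1" "det c2 = 1" "det h = 1"
      using c x C(1) subgroup.subset[OF HS] by (auto simp: SL3_iff)
    have h: "h = adj3 c1 ** ?D ** adj3 c2"
    proof -
      have "adj3 c1 ** (c1 ** h ** c2) ** adj3 c2 = (adj3 c1 ** c1) ** h ** (c2 ** adj3 c2)"
        by (simp add: matrix_mul_assoc)
      then show ?thesis using d1 by (simp add: D adj3_inverse)
    qed
    have ah: "adj3 h = c2 ** adj3 ?D ** c1"
    proof -
      have "adj3 ?D = adj3 c2 ** adj3 h ** adj3 c1" unfolding D using d1 by (simp add: adj3_mul det_mul matrix_mul_assoc)
      then have "c2 ** adj3 ?D ** c1 = (c2 ** adj3 c2) ** adj3 h ** (adj3 c1 ** c1)" by (simp add: matrix_mul_assoc)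
      then show ?thesis using d1 by (simp add: adj3_inverse)
    qed
    have aD': "adj3 ?D = adj3 c2 ** adj3 h ** adj3 c1" unfolding D using d1 by (simp add: adj3_mul det_mul matrix_mul_assoc)
    have XZ1: "1 \<le> X * Z" using XZ mult_mono[of 1 X 1 Z] by simp
    have nD: "norm ?D \<le> 3 * X" "X \<le> norm ?D"
    proof -
      have "\<bar>1 / (X * Z)\<bar> \<le> 1" using XZ1 by simp
      then show "norm ?D \<le> 3 * X" using norm_ut_le[of X Z "1/(X*Z)" 0 0 0] XZ by linarith
      show "X \<le> norm ?D" using norm_ut_ge(1)[of X Z "1/(X*Z)" 0 0 0] by simp
    qed
    have nA: "norm (adj3 ?D) \<le> 3 * (X * Z)" "X * Z \<le> norm (adj3 ?D)"
    proof -
      have "1 / X \<le> X * Z" "1 / Z \<le> X * Z" using XZ XZ1 by (auto intro: order_trans[of _ 1])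
      then show "norm (adj3 ?D) \<le> 3 * (X * Z)" unfolding aD using norm_ut_le[of "1/X" "1/Z" "X*Z" 0 0 0] XZ by simp
      show "X * Z \<le> norm (adj3 ?D)" unfolding aD using norm_ut_ge(3)[of "X*Z" "1/X" "1/Z" 0 0 0] by simp
    qed
    show "\<exists>h\<in>H. matches M X (X * Z) h"
    proof (intro bexI[OF _ c(2)] conjI)
      have "norm h \<le> 729 * R * (3 * X) * R" unfolding h by (intro norm_mult3_le R c x nD)
      then show "norm h \<le> M * X" by (simp add: M_def mult_ac)
      have "norm (adj3 h) \<le> 729 * R * (3 * (X * Z)) * R" unfolding ah by (intro norm_mult3_le R c x nA)
      then show "norm (adj3 h) \<le> M * (X * Z)" by (simp add: M_def mult_ac)
      have "X \<le> 729 * R * norm h * R" using nD(2) unfolding D by (rule order_trans) (intro norm_mult3_le R c x order_refl)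
      also have "\<dots> \<le> M * norm h" using mult_right_mono[OF MM, of "norm h"] by (simp add: mult_ac)
      finally show "X \<le> M * norm h" .
      have "X * Z \<le> 729 * R * norm (adj3 h) * R" using nA(2) unfolding aD' by (rule order_trans) (intro norm_mult3_le R c x order_refl)
      also have "\<dots> \<le> M * norm (adj3 h)" using mult_right_mono[OF MM, of "norm (adj3 h)"] by (simp add: mult_ac)
      finally show "X * Z \<le> M * norm (adj3 h)" .
    qed
  qed
qed

text \<open>The two diagonal parts have comparable first and last entries, so their quotient
  \<open>B\<close> is bounded, and orthogonal matrices surround it. \<open>Q\<close> collects
  \<open>M\<close>, the loss 59049 on one side and 3 * 59049 on the other.\<close>

lemma comparable_factor:
  assumes "det g = 1" "det h = 1" "M \<ge> 1"
    and "norm g \<le> M * norm h" "norm h \<le> M * norm g"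
    and "norm (adj3 g) \<le> M * norm (adj3 h)" "norm (adj3 h) \<le> M * norm (adj3 g)"
  obtains x y where "g = x ** h ** y" "det x = 1" "det y = 1"
    "norm x \<le> 59049 * (3 * (3 * 59049\<^sup>2 * M)\<^sup>2)" "norm y \<le> 59049 * (3 * (3 * 59049\<^sup>2 * M)\<^sup>2)"
proof -
  define Q where "Q = 3 * 59049\<^sup>2 * M"
  have Q1: "Q \<ge> 1" using assms(3) by (simp add: Q_def)
  obtain k l a b c where g: "k \<in> SO3" "l \<in> SO3" "k ** g ** l = ut a b c 0 0 0"
    "a \<ge> b" "b \<ge> c" "c > 0" "a * b * c = 1"
    and gs: "a \<le> 59049 * norm g" "norm g \<le> 3 * 59049 * a"
    "1 / c \<le> 59049 * norm (adj3 g)" "norm (adj3 g) \<le> 3 * 59049 * (1 / c)"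
    by (rule cartan_decomposition_sizes[OF assms(1)])
  obtain k' l' a' b' c' where h: "k' \<in> SO3" "l' \<in> SO3" "k' ** h ** l' = ut a' b' c' 0 0 0"
    "a' \<ge> b'" "b' \<ge> c'" "c' > 0" "a' * b' * c' = 1"
    and hs: "a' \<le> 59049 * norm h" "norm h \<le> 3 * 59049 * a'"
    "1 / c' \<le> 59049 * norm (adj3 h)" "norm (adj3 h) \<le> 3 * 59049 * (1 / c')"
    by (rule cartan_decomposition_sizes[OF assms(2)])
  have pos: "a > 0" "b > 0" "c > 0" "a' > 0" "b' > 0" "c' > 0" using g h by auto
  have chain: "p \<le> Q * q" if "p \<le> 59049 * n" "n \<le> M * n'" "n' \<le> 3 * 59049 * q" for p q n n' :: real
  proof -
    have "M * n' \<le> M * (3 * 59049 * q)" using that(3) assms(3) by (intro mult_left_mono) auto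
    then show ?thesis using that by (simp add: Q_def)
  qed
  have aa: "a \<le> Q * a'" "a' \<le> Q * a" using chain gs hs assms by blast+
  have "1 / c \<le> Q * (1 / c')" "1 / c' \<le> Q * (1 / c)" using chain gs hs assms by blast+
  then have cc: "c' \<le> Q * c" "c \<le> Q * c'" using pos by (simp_all add: field_simps)
  have r: "a / a' \<le> Q" "a' / a \<le> Q" "c / c' \<le> Q" "c' / c \<le> Q"
    using aa cc pos by (simp_all add: field_simps)
  \<comment> \<open>By determinant one the middle quotient is the product of two quotients already
    bounded, which costs the square.\<close>
  have "b = 1 / (a * c)" "b' = 1 / (a' * c')" using g(7) h(7) pos by (auto simp: field_simps)
  then have "b / b' = (a' / a) * (c' / c)" using pos by simp
  also have "\<dots> \<le> Q * Q" using r pos Q1 by (intro mult_mono) auto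
  finally have bb: "b / b' \<le> Q\<^sup>2" by (simp add: power2_eq_square)
  have Q2: "Q \<le> Q\<^sup>2" using Q1 by (simp add: power2_eq_square)
  define B where "B = ut (a / a') (b / b') (c / c') 0 0 0"
  have nB: "norm B \<le> 3 * Q\<^sup>2"
    using norm_ut_le[of "a/a'" "b/b'" "c/c'" 0 0 0] r bb Q2 pos unfolding B_def by simp
  have dB: "det B = 1" using g(7) h(7) by (simp add: B_def ut_det)
  have BE: "B ** ut a' b' c' 0 0 0 = ut a b c 0 0 0" using pos by (simp add: B_def ut_mult)
  note T = SO3_transpose[OF g(1)] SO3_transpose[OF g(2)]
  have tk: "transpose k ** k = mat 1" and tl: "l ** transpose l = mat 1"
    using g(1,2) T by (simp_all add: SO3_def transpose_transpose)
  have "g = (transpose k ** k) ** g ** (l ** transpose l)" by (simp add: tk tl)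
  also have "\<dots> = transpose k ** (k ** g ** l) ** transpose l" by (simp add: matrix_mul_assoc)
  also have "\<dots> = transpose k ** (B ** (k' ** h ** l')) ** transpose l" unfolding g(3) h(3) BE ..
  also have "\<dots> = (transpose k ** B ** k') ** h ** (l' ** transpose l)" by (simp add: matrix_mul_assoc)
  finally have eq: "g = (transpose k ** B ** k') ** h ** (l' ** transpose l)" .
  have "norm (transpose k ** B ** k') \<le> 729 * 9 * (3 * Q\<^sup>2) * 9"
    by (intro norm_mult3_le SO3_norm T h nB)
  then have n1: "norm (transpose k ** B ** k') \<le> 59049 * (3 * Q\<^sup>2)" by simp
  have "norm (l' ** transpose l) \<le> 9" by (intro SO3_norm SO3_mult h T)
  also have "9 \<le> 59049 * (3 * Q\<^sup>2)" using Q2 Q1 by simp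
  finally have n2: "norm (l' ** transpose l) \<le> 59049 * (3 * Q\<^sup>2)" .
  show ?thesis
    by (rule that[OF eq _ _ n1[unfolded Q_def] n2[unfolded Q_def]])
      (simp_all add: det_mul dB SO3_det g(1,2) h(1,2))
qed

text \<open>For the converse every \<open>g\<close> is compared with some \<open>h\<close> of the
  same sizes, and \<open>C\<close> is the whole norm ball of determinant one matrices that receives
  the factors from \<open>comparable_factor\<close>.\<close>

theorem cds_iff_coarsely_dense:
  assumes "subgroup H SL3" "closedin (top_of_set (carrier SL3)) H" "connected H"
  shows "cartan_decomposition_subgroup H \<longleftrightarrow> coarsely_dense H"
proof
  assume "coarsely_dense H"
  then obtain M0 where M0: "\<And>X Z. 1 \<le> Z \<Longrightarrow> Z \<le> X \<Longrightarrow>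
     (\<exists>h\<in>H. matches M0 X (X * Z) h)"
    unfolding coarsely_dense_def by blast
  interpret closed_sg H using assms(1,2) by (rule closed_sg.intro)
  define M where "M = max 1 M0"
  have M: "\<exists>h\<in>H. norm h \<le> M * X \<and> X \<le> M * norm h \<and>
            norm (adj3 h) \<le> M * Y \<and> Y \<le> M * norm (adj3 h)" if XY: "1 \<le> X" "X \<le> Y" "Y \<le> X * X" for X Y
  proof -
    have "M0 * t \<le> M * t" if "t \<ge> 0" for t using that by (intro mult_right_mono) (auto simp: M_def)
    moreover have "1 \<le> Y / X" "Y / X \<le> X" "X * (Y / X) = Y" using XY by (auto simp: field_simps)
    ultimately show ?thesis using M0[of "Y / X" X] XY by (smt (verit) norm_ge_zero)
  qed
  define M' where "M' = 3 * 59049 * M"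
  have M'1: "M' \<ge> 1" by (simp add: M'_def M_def)
  define R where "R = 59049 * (3 * (3 * 59049\<^sup>2 * M')\<^sup>2)"
  define C where "C = {c \<in> carrier SL3. norm c \<le> R}"
  have "closed C"
  proof -
    have "C = carrier SL3 \<inter> cball 0 R" by (auto simp: C_def)
    then show ?thesis by (simp add: closed_Int closed_SL3)
  qed
  moreover have "bounded C" by (rule boundedI[of _ R]) (simp add: C_def)
  ultimately have "compact C" by (simp add: compact_eq_bounded_closed)
  moreover have "C \<odot> H \<odot> C = carrier SL3"
  proof (intro equalityI subsetI)
    fix x assume "x \<in> C \<odot> H \<odot> C"
    from set_prod_iff[THEN iffD1, OF this] obtain y c2 where x: "y \<in> C \<odot> H" "c2 \<in> C" "x = y ** c2" by blast
    from set_prod_iff[THEN iffD1, OF x(1)] obtain c1 h where c: "c1 \<in> C" "h \<in> H" "y = c1 ** h" by blast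
    show "x \<in> carrier SL3" using x c det_H by (simp add: C_def SL3_iff det_mul)
  next
    fix g assume "g \<in> carrier SL3"
    then have dg: "det g = 1" by (simp add: SL3_iff)
    obtain k l a b c where g: "a \<ge> b" "b \<ge> c" "c > 0" "a * b * c = 1"
      and gs: "a \<le> 59049 * norm g" "norm g \<le> 3 * 59049 * a"
      "1 / c \<le> 59049 * norm (adj3 g)" "norm (adj3 g) \<le> 3 * 59049 * (1 / c)"
      by (rule cartan_decomposition_sizes[OF dg])
    have pos: "a > 0" "b > 0" using g by auto
    have ca: "1 / c = a * b" "a = (1 / b) * (1 / c)" using g(4) pos g(3) by (auto simp: field_simps)
    have "\<exists>h\<in>H. norm h \<le> M * a \<and> a \<le> M * norm h \<and> norm (adj3 h) \<le> M * (1/c) \<and> 1/c \<le> M * norm (adj3 h)"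
    proof (cases "b \<ge> 1")
      case True
      have "1 \<le> a" "a \<le> 1 / c" "1 / c \<le> a * a" using True g pos unfolding ca(1) by (auto intro: mult_left_mono)
      then show ?thesis using M by blast
    next
      \<comment> \<open>The middle entry is below 1, so it is the inverse of \<open>g\<close> that
        lies in the half covered by coarse density.\<close>
      case False
      have "c \<le> 1" "1 \<le> 1 / b" "1 / b \<le> 1 / c" using False g pos by (auto intro!: divide_left_mono)
      then have "1 \<le> 1 / c" "1 / c \<le> a" "a \<le> (1/c) * (1/c)"
        using g(3) ca(2) mult_right_mono[of 1 "1/b" "1/c"] mult_right_mono[of "1/b" "1/c" "1/c"] by auto
      from M[OF this] obtain h where "h \<in> H" "norm h \<le> M * (1/c)" "1/c \<le> M * norm h"
            "norm (adj3 h) \<le> M * a" "a \<le> M * norm (adj3 h)" by blast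
      then show ?thesis by (intro bexI[of _ "adj3 h"]) (auto simp: adj3_H adj3_adj3 det_H)
    qed
    then obtain h where h: "h \<in> H" "norm h \<le> M * a" "a \<le> M * norm h" "norm (adj3 h) \<le> M * (1/c)" "1/c \<le> M * norm (adj3 h)"
      by blast
    have M0': "M \<ge> 0" by (simp add: M_def)
    have up: "n \<le> M' * n'" if "n \<le> 3 * 59049 * q" "q \<le> M * n'" for n n' q :: real
      using that by (simp add: M'_def)
    have dn: "n \<le> M' * n'" if "n \<le> M * q" "q \<le> 59049 * n'" "0 \<le> n'" for n n' q :: real
    proof -
      have "M * q \<le> M * (59049 * n')" using that(2) M0' by (rule mult_left_mono)
      also have "\<dots> \<le> M' * n'" using that(3) M0' by (simp add: M'_def mult_right_mono)
      finally show ?thesis using that(1) by simp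
    qed
    obtain x y where xy: "g = x ** h ** y" "det x = 1" "det y = 1" "norm x \<le> R" "norm y \<le> R"
      unfolding R_def
      by (rule comparable_factor[OF dg det_H[OF h(1)] M'1 up[OF gs(2) h(3)] dn[OF h(2) gs(1) norm_ge_zero]
            up[OF gs(4) h(5)] dn[OF h(4) gs(3) norm_ge_zero]])
    then have "x \<in> C" "y \<in> C" by (auto simp: C_def SL3_iff)
    then show "g \<in> C \<odot> H \<odot> C" using xy(1) h(1) set_prod_iff by metis
  qed
  ultimately show "cartan_decomposition_subgroup H"
    unfolding cartan_decomposition_subgroup_def using assms by (intro conjI exI[of _ C]) (auto simp: C_def)
qed (rule cds_imp_coarsely_dense)

section \<open>Norm estimates\<close>

text \<open>The two lists are the entries of \<open>ut a b c u v w\<close> and, up to sign, of its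
  adjugate, zeros left out. All of them must obey the upper bound, while a single one has to reach
  the lower bound.\<close>

abbreviation comparable :: "real \<Rightarrow> real \<Rightarrow> real \<Rightarrow> real \<Rightarrow> real \<Rightarrow> real \<Rightarrow> real \<Rightarrow> real \<Rightarrow> real \<Rightarrow> bool" where
  "comparable K X Y a b c u v w \<equiv>
     (\<forall>x\<in>{a, b, c, u, v, w}. \<bar>x\<bar> \<le> K * X) \<and> (\<exists>x\<in>{a, b, c, u, v, w}. X \<le> K * \<bar>x\<bar>) \<and>
     (\<forall>x\<in>{b*c, a*c, a*b, u*c, v * a, u * v - w*b}. \<bar>x\<bar> \<le> K * Y) \<and>
     (\<exists>x\<in>{b*c, a*c, a*b, u*c, v * a, u * v - w*b}. Y \<le> K * \<bar>x\<bar>)"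

text \<open>Reflection in the antidiagonal. It preserves the norm, commutes with \<open>adj3\<close>
  and exchanges the simple roots, so estimates for \<alpha> yield estimates for \<beta>.\<close>

definition flip :: "mat3 \<Rightarrow> mat3" where
  "flip g = mk (g$3$3) (g$2$3) (g$1$3) (g$3$2) (g$2$2) (g$1$2) (g$3$1) (g$2$1) (g$1$1)"

lemma flip_ut [simp]: "flip (ut a b c u v w) = ut c b a v u w"
  by (simp add: mat3_eq_iff flip_def)

lemma flip_adj3: "adj3 (flip g) = flip (adj3 g)"
  by (simp add: mat3_eq_iff flip_def adj3_def)

lemma flip_flip [simp]: "flip (flip g) = g"
  by (simp add: mat3_eq_iff flip_def)

lemma norm_flip [simp]: "norm (flip g) = norm g"
  by (simp add: norm_eq_sqrt_inner inner_vec_def sum_3 flip_def algebra_simps)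

lemma coarsely_dense_flip: "coarsely_dense (flip ` H) \<longleftrightarrow> coarsely_dense H"
  by (simp add: coarsely_dense_def flip_adj3)

lemma coarsely_denseI:
  assumes "K > 0"
    and "\<And>X Z. 1 \<le> Z \<Longrightarrow> Z \<le> X \<Longrightarrow> \<exists>a b c u v w. ut a b c u v w \<in> H \<and>
      comparable K X (X*Z) a b c u v w"
  shows "coarsely_dense H"
  unfolding coarsely_dense_def
proof (intro exI[of _ "6 * K"] allI impI)
  have up: "norm (ut a b c u v w) \<le> 6 * K * X" if "\<forall>x\<in>{a, b, c, u, v, w}. \<bar>x\<bar> \<le> K * X" for a b c u v w X
  proof -
    have "\<bar>a\<bar> \<le> K * X" "\<bar>b\<bar> \<le> K * X" "\<bar>c\<bar> \<le> K * X" "\<bar>u\<bar> \<le> K * X" "\<bar>v\<bar> \<le> K * X" "\<bar>w\<bar> \<le> K * X"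
      using that by blast+
    then have "norm (ut a b c u v w) \<le> K * X + K * X + K * X + K * X + K * X + K * X"
      by (intro order_trans[OF norm_ut_le] add_mono)
    then show ?thesis by simp
  qed
  have dn: "X \<le> 6 * K * norm (ut a b c u v w)" if ex: "\<exists>x\<in>{a, b, c, u, v, w}. X \<le> K * \<bar>x\<bar>" for a b c u v w X
  proof -
    obtain x where x: "x \<in> {a, b, c, u, v, w}" "X \<le> K * \<bar>x\<bar>" by (rule bexE[OF ex])
    have "\<bar>x\<bar> \<le> norm (ut a b c u v w)" using x(1) by (elim insertE emptyE) (simp_all only: norm_ut_ge)
    then have "K * \<bar>x\<bar> \<le> K * norm (ut a b c u v w)" using assms(1) by (intro mult_left_mono) auto
    moreover have "0 \<le> K * norm (ut a b c u v w)" using assms(1) by simp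
    ultimately show ?thesis using x(2) by linarith
  qed
  fix X Z :: real assume XZ: "1 \<le> Z \<and> Z \<le> X"
  obtain a b c u v w where h: "ut a b c u v w \<in> H"
      "\<forall>x\<in>{a, b, c, u, v, w}. \<bar>x\<bar> \<le> K * X" "\<exists>x\<in>{a, b, c, u, v, w}. X \<le> K * \<bar>x\<bar>"
      "\<forall>x\<in>{b*c, a*c, a*b, u*c, v * a, u * v - w*b}. \<bar>x\<bar> \<le> K * (X*Z)"
      "\<exists>x\<in>{b*c, a*c, a*b, u*c, v * a, u * v - w*b}. X*Z \<le> K * \<bar>x\<bar>"
    using assms(2)[of Z X] XZ by blast
  show "\<exists>h\<in>H. matches (6 * K) X (X * Z) h"
    unfolding bex_simps
  proof (intro bexI[OF _ h(1)] conjI)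
    show "norm (ut a b c u v w) \<le> 6 * K * X" by (rule up[OF h(2)])
    show "X \<le> 6 * K * norm (ut a b c u v w)" by (rule dn[OF h(3)])
    show "norm (adj3 (ut a b c u v w)) \<le> 6 * K * (X * Z)"
      unfolding ut_adj3 by (rule up) (use h(4) in simp)
    show "X * Z \<le> 6 * K * norm (adj3 (ut a b c u v w))"
      unfolding ut_adj3 by (rule dn) (use h(5) in simp)
  qed
qed

section \<open>Families that are coarsely dense\<close>

lemma coarsely_dense_A_grp:
  assumes "A_grp \<subseteq> H" shows "coarsely_dense H"
proof (rule coarsely_denseI[of 1])
  fix X Z :: real assume XZ: "1 \<le> Z" "Z \<le> X"
  have 1: "1 \<le> X * Z" using XZ mult_mono[of 1 X 1 Z] by simp
  have "1 / (X * Z) \<le> 1" "1 / X \<le> 1" "1 / Z \<le> 1" using XZ 1 by simp_all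
  then have i: "1 / (X * Z) \<le> X" "1 / X \<le> X * Z" "1 / Z \<le> X * Z" using XZ 1 by linarith+
  have m: "ut X Z (1 / (X * Z)) 0 0 0 \<in> H"
    using XZ assms A_grp_iff by (intro subsetD[OF assms]) (auto intro!: exI)
  show "\<exists>a b c u v w. ut a b c u v w \<in> H \<and>
      comparable 1 X (X*Z) a b c u v w"
    by (intro exI conjI, rule m) (use XZ 1 i in \<open>auto simp: abs_mult intro: order_trans\<close>)
qed simp

text \<open>The choice s = sqrt (X * Z) keeps the simple root entries of order at most
  \<open>X\<close> while the minor \<open>u * v - w\<close> is of order
  \<open>s * s = X * Z\<close>; the free entry \<open>t\<close> supplies the size
  \<open>X\<close>.\<close>

lemma coarsely_dense_unipotent:
  assumes "p \<noteq> 0" "\<And>s t. ut 1 1 1 s (p * s) t \<in> H"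
  shows "coarsely_dense H"
proof (rule coarsely_denseI[of "1 + \<bar>p\<bar> + 1 / \<bar>p\<bar>"])
  let ?K = "1 + \<bar>p\<bar> + 1 / \<bar>p\<bar>"
  show "?K > 0" by (simp add: add_pos_nonneg)
  fix X Z :: real assume XZ: "1 \<le> Z" "Z \<le> X"
  have 1: "1 \<le> X * Z" "X \<le> X * Z" using XZ mult_mono[of 1 X 1 Z] mult_left_mono[of 1 Z X] by simp_all
  define s where "s = sqrt (X * Z)"
  have s2: "s * s = X * Z" using 1 by (simp add: s_def)
  have s0: "0 \<le> s" using 1 by (simp add: s_def)
  have "s \<le> sqrt (X * X)" unfolding s_def using XZ by (intro real_sqrt_le_mono mult_left_mono) auto
  then have sX: "s \<le> X" using XZ by simp
  \<comment> \<open>The sign makes \<open>p * s * s\<close> and \<open>- t\<close> add up in the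
    minor instead of cancelling.\<close>
  define t where "t = - sgn p * X"
  have at: "\<bar>t\<bar> = X" using assms(1) XZ by (simp add: t_def abs_mult abs_sgn_eq)
  have cof: "s * (p * s) - t * 1 = sgn p * (\<bar>p\<bar> * (X * Z) + X)"
  proof -
    have "s * (p * s) = (sgn p * \<bar>p\<bar>) * (s * s)" by (simp add: sgn_mult_abs)
    then show ?thesis unfolding s2 by (simp add: t_def algebra_simps)
  qed
  have acof: "\<bar>s * (p * s) - t * 1\<bar> = \<bar>p\<bar> * (X * Z) + X"
    unfolding cof using assms(1) XZ 1 by (simp add: abs_mult abs_sgn_eq add_nonneg_nonneg)
  have K1: "x \<le> ?K * x" "\<bar>p\<bar> * x \<le> ?K * x" if "x \<ge> 0" for x
    using that by (simp_all add: algebra_simps)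
  have ps: "\<bar>p * s\<bar> \<le> \<bar>p\<bar> * X" using sX s0 by (simp add: abs_mult mult_left_mono)
  have pX: "\<bar>p\<bar> * X \<le> \<bar>p\<bar> * (X * Z)" using 1 by (intro mult_left_mono) auto
  have "\<bar>p * s\<bar> \<le> ?K * X" using ps K1(2)[of X] XZ by linarith
  moreover have "\<bar>p * s\<bar> \<le> ?K * (X * Z)" using ps pX K1(2)[of "X*Z"] 1 by linarith
  moreover have "\<bar>s\<bar> \<le> ?K * (X * Z)" using sX s0 1 K1(1)[of "X*Z"] by linarith
  moreover have "\<bar>p\<bar> * (X * Z) + X \<le> ?K * (X * Z)"
    using 1 by (simp add: distrib_right add_increasing2)
  moreover have "X * Z \<le> ?K * (\<bar>p\<bar> * (X * Z) + X)"
  proof -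
    have "X * Z = 1 / \<bar>p\<bar> * (\<bar>p\<bar> * (X * Z))" using assms(1) by simp
    also have "\<dots> \<le> ?K * (\<bar>p\<bar> * (X * Z) + X)" using XZ 1 by (intro mult_mono) auto
    finally show ?thesis .
  qed
  moreover have "1 \<le> ?K * X" "1 \<le> ?K * (X * Z)" "X \<le> ?K * X" "s \<le> ?K * X"
    using K1(1)[of X] K1(1)[of "X*Z"] XZ 1 sX by linarith+
  moreover have "\<bar>s\<bar> = s" "\<bar>1::real\<bar> = 1" using s0 by simp_all
  moreover have "\<bar>s * (p * s) - t\<bar> = \<bar>p\<bar> * (X * Z) + X" using acof by simp
  ultimately have
    "\<bar>1::real\<bar> \<le> ?K * X \<and> \<bar>s\<bar> \<le> ?K * X \<and> \<bar>p * s\<bar> \<le> ?K * X \<and> \<bar>t\<bar> \<le> ?K * X"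
    "X \<le> ?K * \<bar>t\<bar>"
    "\<bar>1::real\<bar> \<le> ?K * (X * Z) \<and> \<bar>s\<bar> \<le> ?K * (X * Z) \<and> \<bar>p * s\<bar> \<le> ?K * (X * Z) \<and> \<bar>s * (p * s) - t\<bar> \<le> ?K * (X * Z)"
    "X * Z \<le> ?K * \<bar>s * (p * s) - t\<bar>"
    by (simp_all only: at simp_thms)
  note B = this
  show "\<exists>a b c u v w. ut a b c u v w \<in> H \<and>
      comparable ?K X (X*Z) a b c u v w"
    by (intro exI conjI, rule assms(2)[of s t]; simp only: ball_simps bex_simps mult_1_left mult_1_right; insert B) blast+
qed

text \<open>Since the weights add up to zero, a nonzero \<open>c\<close> not strictly between the
  others is extreme on its own side of 0: both \<open>a / c\<close> and \<open>b / c\<close> are at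
  most 1. Hence the \<open>t\<close> with \<open>exp (t * c) = Z\<close> makes \<open>Z\<close> the
  largest of the three exponentials.\<close>

lemma extreme_weight:
  fixes a b c Z :: real
  assumes "a + b + c = 0" "c \<noteq> 0" "\<not> (a < c \<and> c < b)" "\<not> (b < c \<and> c < a)" "Z \<ge> 1"
  obtains t where "exp (t * c) = Z" "exp (t * a) \<le> Z" "exp (t * b) \<le> Z"
    "exp (t * a) * exp (t * c) \<le> Z\<^sup>2" "exp (t * b) * exp (t * c) \<le> Z\<^sup>2" "exp (t * a) * exp (t * b) \<le> Z\<^sup>2"
proof -
  define t where "t = ln Z / c"
  have tc: "t * c = ln Z" using assms(2) by (simp add: t_def)
  have l: "ln Z \<ge> 0" using assms(5) by simp
  have le: "a / c \<le> 1" "b / c \<le> 1"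
    using assms(1-4) by (cases "c > 0"; auto simp: field_simps)+
  have "t * a = ln Z * (a / c)" "t * b = ln Z * (b / c)" by (simp_all add: t_def)
  then have ab: "t * a \<le> ln Z" "t * b \<le> ln Z"
    using mult_left_mono[OF le(1) l] mult_left_mono[OF le(2) l] by simp_all
  have Z: "exp (ln Z) = Z" using assms(5) by simp
  have ea: "exp (t * c) = Z" "exp (t * a) \<le> Z" "exp (t * b) \<le> Z"
    using ab Z tc by (metis exp_le_cancel_iff)+
  have "x * y \<le> Z\<^sup>2" if "x \<le> Z" "y \<le> Z" "0 \<le> x" "0 \<le> y" for x y
    unfolding power2_eq_square using that assms(5) by (intro mult_mono) auto
  with ea show ?thesis by (intro that[of t]) auto
qed

text \<open>The entry \<open>s = X\<close> gives the size of the matrix, and its product with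
  \<open>exp (t * c) = Z\<close> is the dominant minor.\<close>

lemma coarsely_dense_root_alpha:
  assumes "a + b + c = 0" "c \<noteq> 0" "\<not> (a < c \<and> c < b)" "\<not> (b < c \<and> c < a)"
    and "\<And>t s. ut (exp (t*a)) (exp (t*b)) (exp (t*c)) s 0 0 \<in> H"
  shows "coarsely_dense H"
proof (rule coarsely_denseI[of 1])
  fix X Z :: real assume XZ: "1 \<le> Z" "Z \<le> X"
  obtain t where t: "exp (t * c) = Z" "exp (t * a) \<le> Z" "exp (t * b) \<le> Z"
    "exp (t * a) * exp (t * c) \<le> Z\<^sup>2" "exp (t * b) * exp (t * c) \<le> Z\<^sup>2" "exp (t * a) * exp (t * b) \<le> Z\<^sup>2"
    using extreme_weight[OF assms(1-4) XZ(1)] by blast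
  have z: "Z\<^sup>2 \<le> X * Z" unfolding power2_eq_square using XZ by (intro mult_right_mono) auto
  show "\<exists>a b c u v w. ut a b c u v w \<in> H \<and>
      comparable 1 X (X*Z) a b c u v w"
    by (intro exI conjI, rule assms(5)[of t X]) (use t z XZ in \<open>auto simp: abs_mult\<close>)
qed simp

lemma coarsely_dense_root_beta:
  assumes "a + b + c = 0" "a \<noteq> 0" "\<not> (b < a \<and> a < c)" "\<not> (c < a \<and> a < b)"
    and "\<And>t s. ut (exp (t*a)) (exp (t*b)) (exp (t*c)) 0 s 0 \<in> H"
  shows "coarsely_dense H"
proof -
  have "coarsely_dense (flip ` H)"
    by (rule coarsely_dense_root_alpha[of c b a]) (use assms imageI[OF assms(5), of flip] in auto)
  then show ?thesis by (simp add: coarsely_dense_flip)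
qed

text \<open>As for \<alpha>, with the minor \<open>w * b\<close> in the dominant role.\<close>

lemma coarsely_dense_root_alpha_beta:
  assumes "a + b + c = 0" "b \<noteq> 0" "\<not> (a < b \<and> b < c)" "\<not> (c < b \<and> b < a)"
    and "\<And>t s. ut (exp (t*a)) (exp (t*b)) (exp (t*c)) 0 0 s \<in> H"
  shows "coarsely_dense H"
proof (rule coarsely_denseI[of 1])
  fix X Z :: real assume XZ: "1 \<le> Z" "Z \<le> X"
  have "a + c + b = 0" using assms(1) by simp
  obtain t where t: "exp (t * b) = Z" "exp (t * a) \<le> Z" "exp (t * c) \<le> Z"
    "exp (t * a) * exp (t * b) \<le> Z\<^sup>2" "exp (t * c) * exp (t * b) \<le> Z\<^sup>2" "exp (t * a) * exp (t * c) \<le> Z\<^sup>2"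
    using extreme_weight[OF \<open>a + c + b = 0\<close> assms(2-4) XZ(1)] by blast
  have z: "Z\<^sup>2 \<le> X * Z" unfolding power2_eq_square using XZ by (intro mult_right_mono) auto
  show "\<exists>a b c u v w. ut a b c u v w \<in> H \<and>
      comparable 1 X (X*Z) a b c u v w"
    by (intro exI conjI, rule assms(5)[of t X]) (use t z XZ in \<open>auto simp: abs_mult mult.commute\<close>)
qed simp

text \<open>With \<open>s = X\<close> and \<open>t = ln Z\<close> the minor \<open>v * a\<close> is
  \<open>X * Z\<close>.\<close>

lemma coarsely_dense_ker_alpha:
  assumes "\<And>t s. ut (exp t) (exp t) (exp (-2*t)) 0 s (p * s) \<in> H"
  shows "coarsely_dense H"
proof (rule coarsely_denseI[of "1 + \<bar>p\<bar>"])
  fix X Z :: real assume XZ: "1 \<le> Z" "Z \<le> X"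
  have Z: "exp (ln Z) = Z" using XZ by simp
  have "-2 * ln Z = - (ln Z + ln Z)" by simp
  then have e: "exp (-2 * ln Z) = 1 / Z\<^sup>2"
    unfolding exp_minus exp_add Z by (simp only: exp_minus exp_add Z power2_eq_square inverse_eq_divide)
  have m: "ut Z Z (1 / Z\<^sup>2) 0 X (p * X) \<in> H" using assms[of "ln Z" X] e Z by simp
  have z: "Z * Z \<le> X * Z" "X \<le> X * Z"
    using XZ mult_left_mono[of 1 Z X] by (auto intro: mult_right_mono)
  have i: "1 / Z\<^sup>2 \<le> 1" "1 / Z \<le> 1" using XZ by simp_all
  have K: "x \<le> (1 + \<bar>p\<bar>) * x" "\<bar>p\<bar> * x \<le> (1 + \<bar>p\<bar>) * x" if "x \<ge> 0" for x
    using that by (simp_all add: algebra_simps)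
  have B1: "1 / Z\<^sup>2 \<le> (1 + \<bar>p\<bar>) * X" "Z \<le> (1 + \<bar>p\<bar>) * X" "X \<le> (1 + \<bar>p\<bar>) * X"
    "1 / Z \<le> (1 + \<bar>p\<bar>) * (X * Z)" "Z * Z \<le> (1 + \<bar>p\<bar>) * (X * Z)" "X * Z \<le> (1 + \<bar>p\<bar>) * (X * Z)"
    using K(1)[of X] K(1)[of "X * Z"] XZ z i by linarith+
  have B2: "\<bar>p * X\<bar> \<le> (1 + \<bar>p\<bar>) * X" "\<bar>p * X * Z\<bar> \<le> (1 + \<bar>p\<bar>) * (X * Z)"
    using K(2)[of X] K(2)[of "X * Z"] XZ by (simp_all add: abs_mult mult.assoc)
  have B3: "Z / Z\<^sup>2 = 1 / Z" using XZ by (simp add: power2_eq_square)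
  show "\<exists>a b c u v w. ut a b c u v w \<in> H \<and>
      comparable (1 + \<bar>p\<bar>) X (X*Z) a b c u v w"
    by (intro exI conjI, rule m) (use XZ B1 B2 in \<open>auto simp: B3 abs_mult\<close>)
qed simp

lemma coarsely_dense_ker_beta:
  assumes "\<And>t s. ut (exp (-2*t)) (exp t) (exp t) s 0 (p * s) \<in> H"
  shows "coarsely_dense H"
proof -
  have "coarsely_dense (flip ` H)"
    by (rule coarsely_dense_ker_alpha) (use imageI[OF assms, of flip] in auto)
  then show ?thesis by (simp add: coarsely_dense_flip)
qed

lemma linear_times_exp:
  fixes Z :: real
  assumes "1 \<le> Z"
  obtains t where "t \<ge> 0" "(1 + t) * exp t = Z"
proof -
  have "Z \<le> (1 + Z) * exp Z"
  proof -
    have "Z * 1 \<le> (1 + Z) * exp Z" using assms by (intro mult_mono) auto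
    then show ?thesis by simp
  qed
  then have "\<exists>t\<ge>0. t \<le> Z \<and> (1 + t) * exp t = Z"
    by (intro IVT') (use assms in \<open>auto intro!: continuous_intros\<close>)
  then show ?thesis using that by blast
qed

text \<open>Meant for the diagonal exp t, exp t, exp (-2 t) with twisted entry
  \<open>\<gamma> * t * exp t\<close> and a free simple root entry \<open>X\<close>. The competing
  minors are \<open>X * exp t\<close> and \<open>\<gamma> * t * exp t * X\<close>, together of order
  \<open>X * (1 + t) * exp t\<close>; \<open>t\<close> is chosen to make the latter equal to
  \<open>X * Z\<close>.\<close>

lemma twisted_bounds:
  fixes X Z \<gamma> :: real
  assumes "1 \<le> Z" "Z \<le> X" "\<gamma> \<noteq> 0"
  defines "K \<equiv> 2 + 2 * \<bar>\<gamma>\<bar> + 2 / \<bar>\<gamma>\<bar>"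
  obtains t where "K > 0" "exp t \<le> K * X" "exp (-2*t) \<le> K * X" "\<bar>\<gamma> * t * exp t\<bar> \<le> K * X" "X \<le> K * X"
    "exp t * exp t \<le> K * (X * Z)" "exp (-2*t) * exp t \<le> K * (X * Z)" "X * exp t \<le> K * (X * Z)"
    "\<bar>\<gamma> * t * exp t * exp (-2*t)\<bar> \<le> K * (X * Z)" "\<bar>\<gamma> * t * exp t * X\<bar> \<le> K * (X * Z)"
    "X * Z \<le> K * (X * exp t) \<or> X * Z \<le> K * \<bar>\<gamma> * t * exp t * X\<bar>"
proof -
  obtain t where t: "t \<ge> 0" "(1 + t) * exp t = Z" by (rule linear_times_exp[OF assms(1)])
  have K0: "K > 0" unfolding K_def using assms(3) by (simp add: add_pos_nonneg)
  have te0: "t * exp t \<ge> 0" using t(1) by simp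
  have sum: "exp t + t * exp t = Z" using t(2) by (simp add: distrib_right)
  have eZ: "exp t \<le> Z" "t * exp t \<le> Z" using sum te0 exp_ge_zero[of t] by linarith+
  have em: "exp (-2*t) \<le> 1" using t(1) by simp
  have XZ: "X \<le> X * Z" "1 \<le> X" using assms(1,2) mult_left_mono[of 1 Z X] by simp_all
  then have "1 \<le> X * Z" by linarith
  note XZ = XZ this
  have K1: "x \<le> K * x" "\<bar>\<gamma>\<bar> * x \<le> K * x" if "x \<ge> 0" for x
    using that assms(3) by (simp_all add: K_def algebra_simps add_nonneg_nonneg)
  have a: "\<bar>\<gamma> * t * exp t\<bar> = \<bar>\<gamma>\<bar> * (t * exp t)" using t(1) by (simp add: abs_mult)
  have a1: "\<bar>\<gamma> * t * exp t\<bar> \<le> \<bar>\<gamma>\<bar> * Z" unfolding a using eZ by (intro mult_left_mono) auto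
  have gX: "\<bar>\<gamma>\<bar> * Z \<le> \<bar>\<gamma>\<bar> * X" using assms(2) by (intro mult_left_mono) auto
  have 1: "exp t \<le> K * X" "exp (-2*t) \<le> K * X" "X \<le> K * X" using eZ em K1(1)[of X] XZ assms(2) by linarith+
  have 2: "\<bar>\<gamma> * t * exp t\<bar> \<le> K * X" using a1 gX K1(2)[of X] XZ by linarith
  have "exp t * exp t \<le> X * Z" using eZ assms(1,2) by (intro mult_mono) auto
  then have 3: "exp t * exp t \<le> K * (X * Z)" using K1(1)[of "X*Z"] XZ by linarith
  have "exp (-2*t) * exp t \<le> 1 * Z" using eZ em assms(1) by (intro mult_mono) auto
  then have 4: "exp (-2*t) * exp t \<le> K * (X * Z)" using K1(1)[of "X*Z"] XZ assms(1,2) by linarith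
  have "X * exp t \<le> X * Z" using eZ XZ by (intro mult_left_mono) auto
  then have 5: "X * exp t \<le> K * (X * Z)" using K1(1)[of "X*Z"] XZ by linarith
  have "\<bar>\<gamma> * t * exp t * exp (-2*t)\<bar> \<le> \<bar>\<gamma> * t * exp t\<bar> * 1" unfolding abs_mult[of _ "exp (-2*t)"] using em by (intro mult_left_mono) auto
  then have 6: "\<bar>\<gamma> * t * exp t * exp (-2*t)\<bar> \<le> K * (X * Z)"
    using 2 mult_left_mono[OF XZ(1), of K] K0 by linarith
  have "\<bar>\<gamma> * t * exp t * X\<bar> \<le> \<bar>\<gamma>\<bar> * Z * X" unfolding abs_mult[of _ X] using a1 XZ by (intro mult_mono) auto
  also have "\<bar>\<gamma>\<bar> * Z * X = \<bar>\<gamma>\<bar> * (X * Z)" by simp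
  also have "\<dots> \<le> K * (X * Z)" using K1(2)[of "X*Z"] XZ by linarith
  finally have 7: "\<bar>\<gamma> * t * exp t * X\<bar> \<le> K * (X * Z)" .
  have "Z \<le> 2 * exp t \<or> Z \<le> 2 * (t * exp t)" using sum by linarith
  then have 8: "X * Z \<le> K * (X * exp t) \<or> X * Z \<le> K * \<bar>\<gamma> * t * exp t * X\<bar>"
  proof
    assume "Z \<le> 2 * exp t"
    then have "X * Z \<le> 2 * (X * exp t)" using XZ by (simp add: mult_left_mono)
    also have "\<dots> \<le> K * (X * exp t)" using XZ by (intro mult_right_mono) (auto simp: K_def)
    finally show ?thesis ..
  next
    assume "Z \<le> 2 * (t * exp t)"
    then have "X * Z \<le> X * (2 * (t * exp t))" using XZ by (intro mult_left_mono) auto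
    also have "\<dots> = (2 / \<bar>\<gamma>\<bar>) * \<bar>\<gamma> * t * exp t * X\<bar>" using assms(3) t(1) XZ by (simp add: abs_mult field_simps)
    also have "\<dots> \<le> K * \<bar>\<gamma> * t * exp t * X\<bar>" by (intro mult_right_mono) (auto simp: K_def)
    finally show ?thesis ..
  qed
  show ?thesis by (rule that[OF K0 1(1,2) 2 1(3) 3 4 5 6 7 8])
qed

lemma coarsely_dense_twisted_alpha:
  assumes "\<gamma> \<noteq> 0" "\<And>t s. ut (exp t) (exp t) (exp (-2*t)) (\<gamma> * t * exp t) s 0 \<in> H"
  shows "coarsely_dense H"
proof (rule coarsely_denseI[of "2 + 2 * \<bar>\<gamma>\<bar> + 2 / \<bar>\<gamma>\<bar>"])
  show "2 + 2 * \<bar>\<gamma>\<bar> + 2 / \<bar>\<gamma>\<bar> > 0" by (simp add: add_pos_nonneg)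
  fix X Z :: real assume XZ: "1 \<le> Z" "Z \<le> X"
  show "\<exists>a b c u v w. ut a b c u v w \<in> H \<and>
      comparable (2 + 2 * \<bar>\<gamma>\<bar> + 2 / \<bar>\<gamma>\<bar>) X (X*Z) a b c u v w"
  proof (rule twisted_bounds[OF XZ assms(1)])
    fix t
    let ?K = "2 + 2 * \<bar>\<gamma>\<bar> + 2 / \<bar>\<gamma>\<bar>"
    assume K: "?K > 0" and t: "exp t \<le> ?K * X" "exp (-2*t) \<le> ?K * X" "\<bar>\<gamma> * t * exp t\<bar> \<le> ?K * X" "X \<le> ?K * X"
    "exp t * exp t \<le> ?K * (X * Z)" "exp (-2*t) * exp t \<le> ?K * (X * Z)" "X * exp t \<le> ?K * (X * Z)"
    "\<bar>\<gamma> * t * exp t * exp (-2*t)\<bar> \<le> ?K * (X * Z)" "\<bar>\<gamma> * t * exp t * X\<bar> \<le> ?K * (X * Z)"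
    "X * Z \<le> ?K * (X * exp t) \<or> X * Z \<le> ?K * \<bar>\<gamma> * t * exp t * X\<bar>"
    define L where "L = ?K"
    define G where "G = \<gamma> * t * exp t"
    have m: "ut (exp t) (exp t) (exp (-2*t)) G X 0 \<in> H" using assms(2)[of t X] by (simp add: G_def)
    have XZ0: "0 \<le> L * X" "0 \<le> L * (X * Z)" using XZ K by (simp_all add: L_def)
    have a: "\<bar>exp t * exp t\<bar> = exp t * exp t" "\<bar>exp (-2*t) * exp t\<bar> = exp (-2*t) * exp t"
      "\<bar>exp t * exp (-2*t)\<bar> = exp (-2*t) * exp t" "\<bar>X * exp t\<bar> = X * exp t" "\<bar>X\<bar> = X" "\<bar>exp (-2*t)\<bar> = exp (-2*t)" "\<bar>exp t\<bar> = exp t"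
      "\<bar>X * G - 0 * exp t\<bar> = \<bar>G * X\<bar>" "\<bar>G * X - 0 * exp t\<bar> = \<bar>G * X\<bar>" "\<bar>0::real\<bar> = 0"
      using XZ by (simp_all add: abs_mult mult.commute)
    show ?thesis
      unfolding L_def[symmetric]
      by (intro exI conjI, rule m; simp only: ball_simps bex_simps a; insert t[folded L_def G_def] XZ0) blast+
  qed
qed

lemma coarsely_dense_twisted_beta:
  assumes "\<gamma> \<noteq> 0" "\<And>t s. ut (exp (-2*t)) (exp t) (exp t) s (\<gamma> * t * exp t) 0 \<in> H"
  shows "coarsely_dense H"
proof -
  have "coarsely_dense (flip ` H)"
    by (rule coarsely_dense_twisted_alpha[OF assms(1)]) (use imageI[OF assms(2), of flip] in auto)
  then show ?thesis by (simp add: coarsely_dense_flip)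
qed

lemma coarsely_dense_mono: "coarsely_dense H \<Longrightarrow> H \<subseteq> H' \<Longrightarrow> coarsely_dense H'"
  unfolding coarsely_dense_def by (meson subsetD)

section \<open>Families that are not coarsely dense\<close>

abbreviation cofactors_le :: "real \<Rightarrow> real \<Rightarrow> real \<Rightarrow> real \<Rightarrow> real \<Rightarrow> real \<Rightarrow> real \<Rightarrow> bool" where
  "cofactors_le B a b c u v w \<equiv> \<forall>x\<in>{b*c, a*c, a*b, u*c, v * a, u * v - w*b}. \<bar>x\<bar> \<le> B"

text \<open>The test Z = X asks for an inverse of order \<open>X^2\<close>, on the wall of the
  chamber where the first two diagonal entries agree. A bound with arbitrarily small quadratic part
  excludes this for large \<open>X\<close>.\<close>

lemma not_coarsely_denseI:
  assumes "\<And>\<epsilon>::real. \<epsilon> > 0 \<Longrightarrow> \<exists>K\<ge>0. \<forall>h\<in>H. norm (adj3 h) \<le> \<epsilon> * (norm h)\<^sup>2 + K * norm h"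
  shows "\<not> coarsely_dense H"
proof
  assume "coarsely_dense H"
  then obtain M where M: "\<And>X Z. 1 \<le> Z \<Longrightarrow> Z \<le> X \<Longrightarrow>
     (\<exists>h\<in>H. matches M X (X * Z) h)"
    unfolding coarsely_dense_def by blast
  have M0: "M > 0"
  proof (rule ccontr)
    assume "\<not> M > 0"
    obtain h :: mat3 where "1 \<le> M * norm h" using M[of 1 1] by auto
    moreover have "M * norm h \<le> 0" using \<open>\<not> M > 0\<close> by (simp add: mult_nonpos_nonneg)
    ultimately show False by simp
  qed
  \<comment> \<open>Three comparisons of sizes cost \<open>M ^ 3\<close>; this \<epsilon> leaves
    half of \<open>X * X\<close> to be covered by the linear term.\<close>
  define \<epsilon> where "\<epsilon> = 1 / (2 * M ^ 3)"
  have "\<epsilon> > 0" using M0 by (simp add: \<epsilon>_def)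
  then obtain K where K: "K \<ge> 0" "\<And>h. h \<in> H \<Longrightarrow> norm (adj3 h) \<le> \<epsilon> * (norm h)\<^sup>2 + K * norm h"
    using assms by meson
  define X where "X = 2 * K * M\<^sup>2 + 1"
  have X: "1 \<le> X" using K(1) by (simp add: X_def)
  then obtain h where h: "h \<in> H" "norm h \<le> M * X" "X * X \<le> M * norm (adj3 h)"
    using M[of X X] by auto
  have "norm (adj3 h) \<le> \<epsilon> * (M * X)\<^sup>2 + K * (M * X)"
    by (rule order_trans[OF K(2)[OF h(1)]])
      (intro add_mono mult_left_mono power_mono h(2) K(1) norm_ge_zero, use \<open>\<epsilon> > 0\<close> in simp)
  then have "M * norm (adj3 h) \<le> M * (\<epsilon> * (M * X)\<^sup>2 + K * (M * X))"
    using M0 by (intro mult_left_mono) auto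
  also have "\<dots> = X * X / 2 + K * M\<^sup>2 * X"
    using M0 by (simp add: \<epsilon>_def field_simps power2_eq_square power3_eq_cube)
  finally have "X * X \<le> X * X / 2 + K * M\<^sup>2 * X" using h(3) by linarith
  then have "X * X \<le> (2 * K * M\<^sup>2) * X" by simp
  then have "X \<le> 2 * K * M\<^sup>2" using X by (simp add: mult_le_cancel_right)
  then show False by (simp add: X_def)
qed

lemma not_coarsely_dense_entriesI:
  assumes "\<And>\<epsilon>::real. \<epsilon> > 0 \<Longrightarrow> \<exists>K\<ge>0. \<forall>h\<in>H. \<exists>a b c u v w. h = ut a b c u v w \<and>
    cofactors_le (norm h * (\<epsilon> * norm h + K)) a b c u v w"
  shows "\<not> coarsely_dense H"
proof (rule not_coarsely_denseI)
  fix \<epsilon> :: real assume "\<epsilon> > 0"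
  then obtain K where K: "K \<ge> 0" "\<forall>h\<in>H. \<exists>a b c u v w. h = ut a b c u v w \<and>
    cofactors_le (norm h * (\<epsilon> / 6 * norm h + K)) a b c u v w"
    using assms[of "\<epsilon> / 6"] by auto
  show "\<exists>K\<ge>0. \<forall>h\<in>H. norm (adj3 h) \<le> \<epsilon> * (norm h)\<^sup>2 + K * norm h"
  proof (intro exI[of _ "6 * K"] conjI ballI)
    fix h assume "h \<in> H"
    then obtain a b c u v w where h: "h = ut a b c u v w"
      and B: "cofactors_le (norm h * (\<epsilon> / 6 * norm h + K)) a b c u v w"
      using K(2) by blast
    let ?B = "norm h * (\<epsilon> / 6 * norm h + K)"
    have "\<bar>b*c\<bar> \<le> ?B" "\<bar>a*c\<bar> \<le> ?B" "\<bar>a*b\<bar> \<le> ?B" "\<bar>-(u*c)\<bar> \<le> ?B" "\<bar>-(v * a)\<bar> \<le> ?B" "\<bar>u * v - w*b\<bar> \<le> ?B"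
      using B by simp_all
    then have "norm (adj3 h) \<le> ?B + ?B + ?B + ?B + ?B + ?B"
      unfolding h ut_adj3 by (intro order_trans[OF norm_ut_le] add_mono)
    then show "norm (adj3 h) \<le> \<epsilon> * (norm h)\<^sup>2 + 6 * K * norm h"
      by (simp add: power2_eq_square algebra_simps)
  qed (use K(1) in simp)
qed

lemma not_coarsely_dense_linear:
  assumes "K \<ge> 0" "\<And>h. h \<in> H \<Longrightarrow> \<exists>a b c u v w. h = ut a b c u v w \<and>
    cofactors_le (K * norm h) a b c u v w"
  shows "\<not> coarsely_dense H"
proof (rule not_coarsely_dense_entriesI, rule exI[of _ K], rule conjI[OF assms(1)], rule ballI)
  fix \<epsilon> :: real and h assume e: "\<epsilon> > 0" and "h \<in> H"
  then obtain a b c u v w where h: "h = ut a b c u v w"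
    and B: "cofactors_le (K * norm h) a b c u v w"
    using assms(2) by blast
  have "K * norm h \<le> norm h * (\<epsilon> * norm h + K)" using e by (simp add: distrib_left mult.commute)
  with B have "cofactors_le (norm h * (\<epsilon> * norm h + K)) a b c u v w"
    using order_trans by blast
  with h show "\<exists>a b c u v w. h = ut a b c u v w \<and>
    cofactors_le (norm h * (\<epsilon> * norm h + K)) a b c u v w" by blast
qed

text \<open>With v = 0 the minor \<open>u * v - w * b\<close> reduces to \<open>- w\<close>, so all
  minors are entries up to sign.\<close>

lemma not_coarsely_dense_unip_12_13:
  assumes "\<And>h. h \<in> H \<Longrightarrow> \<exists>u w. h = ut 1 1 1 u 0 w" shows "\<not> coarsely_dense H"
proof (rule not_coarsely_dense_linear[of 1])
  fix h assume "h \<in> H"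
  then obtain u w where h: "h = ut 1 1 1 u 0 w" using assms by blast
  show "\<exists>a b c u v w. h = ut a b c u v w \<and>
    cofactors_le (1 * norm h) a b c u v w"
    by (intro exI conjI, rule h) (use norm_ut_ge[where a = 1 and b = 1 and c = 1 and u = u and v = 0 and w = w] in \<open>auto simp: h\<close>)
qed simp

lemma not_coarsely_dense_unip_23_13:
  assumes "\<And>h. h \<in> H \<Longrightarrow> \<exists>v w. h = ut 1 1 1 0 v w"
  shows "\<not> coarsely_dense H"
proof -
  have "\<not> coarsely_dense (flip ` H)"
    by (rule not_coarsely_dense_unip_12_13) (use assms in force)
  then show ?thesis by (simp add: coarsely_dense_flip)
qed

text \<open>These elements preserve a nondegenerate form, so \<open>h\<close> and its inverse have comparable norms.\<close>

lemma not_coarsely_dense_orthogonal: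
  assumes "p \<noteq> 0" "q \<noteq> 0"
    and "\<And>h. h \<in> H \<Longrightarrow> \<exists>s t. h = ut (exp t) 1 (exp (-t)) (p * s * exp t) (q * s) (p * q * s\<^sup>2 / 2 * exp t)"
  shows "\<not> coarsely_dense H"
proof (rule not_coarsely_dense_linear[of "1 + \<bar>p / q\<bar> + \<bar>q / p\<bar>"])
  let ?K = "1 + \<bar>p / q\<bar> + \<bar>q / p\<bar>"
  fix h assume "h \<in> H"
  then obtain s t where h: "h = ut (exp t) 1 (exp (-t)) (p * s * exp t) (q * s) (p * q * s\<^sup>2 / 2 * exp t)" using assms by blast
  note n = norm_ut_ge[where a = "exp t" and b = 1 and c = "exp (-t)" and u = "p * s * exp t" and v = "q * s" and w = "p * q * s\<^sup>2 / 2 * exp t", folded h]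
  have K: "x \<le> ?K * n" "\<bar>p / q\<bar> * x \<le> ?K * n" "\<bar>q / p\<bar> * x \<le> ?K * n" if "0 \<le> x" "x \<le> n" for x n
  proof -
    show "x \<le> ?K * n" using mult_mono[of 1 ?K x n] that by simp
    show "\<bar>p / q\<bar> * x \<le> ?K * n" by (intro mult_mono that) (use that in auto)
    show "\<bar>q / p\<bar> * x \<le> ?K * n" by (intro mult_mono that) (use that in auto)
  qed
  have et: "exp t * exp (-t) = 1" by (simp flip: exp_add)
  have 1: "\<bar>1 * exp (-t)\<bar> \<le> ?K * norm h" "\<bar>exp t * exp (-t)\<bar> \<le> ?K * norm h" "\<bar>exp t * 1\<bar> \<le> ?K * norm h"
    using K(1)[OF _ n(1)] K(1)[OF _ n(2)] K(1)[OF _ n(3)] by (simp_all add: et)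
  \<comment> \<open>The minors \<open>u * c\<close> and \<open>v * a\<close> are multiples of the
    entries \<open>v\<close> and \<open>u\<close>: inversion exchanges the two up to the factors
    \<open>p / q\<close> and \<open>q / p\<close>.\<close>
  have "p * s * exp t * exp (-t) = p * s * (exp t * exp (-t))" by simp
  also have "\<dots> = p / q * (q * s)" unfolding et using assms(2) by simp
  finally have "\<bar>p * s * exp t * exp (-t)\<bar> = \<bar>p / q\<bar> * \<bar>q * s\<bar>" by (simp only: abs_mult)
  then have 2: "\<bar>p * s * exp t * exp (-t)\<bar> \<le> ?K * norm h" using K(2)[OF _ n(5)] by simp
  have "q * s * exp t = q / p * (p * s * exp t)" using assms(1) by simp
  then have "\<bar>q * s * exp t\<bar> = \<bar>q / p\<bar> * \<bar>p * s * exp t\<bar>" by (simp only: abs_mult)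
  then have 3: "\<bar>q * s * exp t\<bar> \<le> ?K * norm h" using K(3)[OF _ n(4)] by simp
  have w: "p * s * exp t * (q * s) - p * q * s\<^sup>2 / 2 * exp t * 1 = p * q * s\<^sup>2 / 2 * exp t"
    by (simp add: power2_eq_square)
  have 4: "\<bar>p * s * exp t * (q * s) - p * q * s\<^sup>2 / 2 * exp t * 1\<bar> \<le> ?K * norm h"
    unfolding w by (rule K(1)[OF abs_ge_zero n(6)])
  show "\<exists>a b c u v w. h = ut a b c u v w \<and>
    cofactors_le (?K * norm h) a b c u v w"
    by (intro exI conjI, rule h) (use 1 2 3 4 in blast)
qed simp

text \<open>Inversion replaces \<open>s\<close> by \<open>- s\<close>: the minor
  \<open>u * v - w\<close> is \<open>w - 2 * s * r\<close>, and \<open>s * r\<close> is a fixed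
  multiple of the entry \<open>s * p\<close>.\<close>

lemma not_coarsely_dense_unip_line:
  assumes "p \<noteq> 0"
    and "\<And>h. h \<in> H \<Longrightarrow> \<exists>s. h = ut 1 1 1 (s * p) (s * q) (s * r + s * p * (s * q) / 2)"
  shows "\<not> coarsely_dense H"
proof (rule not_coarsely_dense_linear[of "1 + 2 * \<bar>r / p\<bar>"])
  let ?K = "1 + 2 * \<bar>r / p\<bar>"
  fix h assume "h \<in> H"
  then obtain s where h: "h = ut 1 1 1 (s * p) (s * q) (s * r + s * p * (s * q) / 2)" using assms by blast
  note n = norm_ut_ge[where a = 1 and b = 1 and c = 1 and u = "s * p" and v = "s * q" and w = "s * r + s * p * (s * q) / 2", folded h]
  have w: "s * p * (s * q) - (s * r + s * p * (s * q) / 2) * 1 = (s * r + s * p * (s * q) / 2) - 2 * (r / p * (s * p))"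
    using assms(1) by (simp add: field_simps)
  have tri: "\<bar>x - 2 * y\<bar> \<le> \<bar>x\<bar> + 2 * \<bar>y\<bar>" for x y :: real by linarith
  have "\<bar>s * p * (s * q) - (s * r + s * p * (s * q) / 2) * 1\<bar> \<le> \<bar>s * r + s * p * (s * q) / 2\<bar> + 2 * \<bar>r / p * (s * p)\<bar>"
    unfolding w by (rule tri)
  also have "\<dots> \<le> norm h + 2 * (\<bar>r / p\<bar> * norm h)"
    unfolding abs_mult[of "r / p"] by (intro add_mono mult_left_mono n) auto
  finally have 4: "\<bar>s * p * (s * q) - (s * r + s * p * (s * q) / 2) * 1\<bar> \<le> ?K * norm h" by (simp add: algebra_simps)
  have K: "x \<le> ?K * norm h" if "x \<le> norm h" for x
    using that by (simp add: distrib_right add_increasing2)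
  have 1: "\<bar>1 * 1\<bar> \<le> ?K * norm h" "\<bar>s * p * 1\<bar> \<le> ?K * norm h" "\<bar>s * q * 1\<bar> \<le> ?K * norm h"
    using K[OF n(1)] K[OF n(4)] K[OF n(5)] by simp_all
  show "\<exists>a b c u v w. h = ut a b c u v w \<and>
    cofactors_le (?K * norm h) a b c u v w"
    by (intro exI conjI, rule h) (use 1 4 in blast)
qed simp

text \<open>One of the outer weights exceeds \<open>t * c\<close> by at least |t| times the gap
  \<open>d\<close>, which beats \<open>- ln \<epsilon>\<close> for large |t|; the constant covers
  the remaining compact range.\<close>

lemma interior_weight:
  fixes a b c \<epsilon> :: real
  assumes "b < c" "c < a" "\<epsilon> > 0"
  obtains K where "K \<ge> 0" "\<And>t. exp (t * c) \<le> \<epsilon> * max (exp (t * a)) (exp (t * b)) + K"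
proof -
  define d where "d = min (a - c) (c - b)"
  have d: "d > 0" using assms by (simp add: d_def)
  define T where "T = max 0 (- ln \<epsilon> / d)"
  define K where "K = exp (T * \<bar>c\<bar>)"
  have "exp (t * c) \<le> \<epsilon> * max (exp (t * a)) (exp (t * b)) + K" for t
  proof (cases "\<bar>t\<bar> \<le> T")
    case True
    have "t * c \<le> \<bar>t\<bar> * \<bar>c\<bar>" by (metis abs_ge_self abs_mult)
    also have "\<dots> \<le> T * \<bar>c\<bar>" using True by (intro mult_right_mono) auto
    finally have "exp (t * c) \<le> K" by (simp add: K_def)
    moreover have "0 \<le> \<epsilon> * max (exp (t * a)) (exp (t * b))" using assms(3) by (intro mult_nonneg_nonneg) (auto simp: le_max_iff_disj)
    ultimately show ?thesis by linarith
  next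
    case False
    then have "- ln \<epsilon> / d \<le> \<bar>t\<bar>" by (simp add: T_def)
    then have l: "- ln \<epsilon> \<le> \<bar>t\<bar> * d" using d by (simp add: field_simps)
    obtain x where x: "x = a \<or> x = b" "\<bar>t\<bar> * d \<le> t * x - t * c"
    proof (cases "t \<ge> 0")
      case True
      then have "t * d \<le> t * (a - c)" by (intro mult_left_mono) (auto simp: d_def)
      then show ?thesis using that[of a] True by (simp add: right_diff_distrib)
    next
      case False
      then have "(-t) * d \<le> (-t) * (c - b)" by (intro mult_left_mono) (auto simp: d_def)
      then show ?thesis using that[of b] False by (simp add: right_diff_distrib)
    qed
    have "exp (t * c) \<le> exp (ln \<epsilon> + t * x)" using l x(2) by simp
    also have "\<dots> = \<epsilon> * exp (t * x)" using assms(3) by (simp add: exp_add)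
    also have "\<dots> \<le> \<epsilon> * max (exp (t * a)) (exp (t * b))" using x(1) assms(3) by (intro mult_left_mono) auto
    finally show ?thesis by (simp add: K_def add_increasing2)
  qed
  then show ?thesis using that[of K] by (simp add: K_def)
qed

text \<open>\<open>n\<close> stands for the norm of a matrix with these entries. All minors except
  \<open>exp (t * a) * exp (t * b)\<close> contain the factor \<open>exp (t * c)\<close> of the
  middle weight, which is small against \<open>n\<close>.\<close>

lemma interior_weight_bounds:
  fixes a b c \<epsilon> :: real
  assumes "a + b + c = 0" "b < c \<and> c < a \<or> a < c \<and> c < b" "\<epsilon> > 0"
  obtains K where "K \<ge> 0" "\<And>t s n. exp (t * a) \<le> n \<Longrightarrow> exp (t * b) \<le> n \<Longrightarrow> \<bar>s\<bar> \<le> n \<Longrightarrow>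
     \<bar>exp (t * b) * exp (t * c)\<bar> \<le> n * (\<epsilon> * n + K) \<and> \<bar>exp (t * a) * exp (t * c)\<bar> \<le> n * (\<epsilon> * n + K) \<and>
     \<bar>exp (t * a) * exp (t * b)\<bar> \<le> n * (\<epsilon> * n + K) \<and> \<bar>s * exp (t * c)\<bar> \<le> n * (\<epsilon> * n + K)"
proof -
  have "\<exists>K\<ge>0. \<forall>t. exp (t * c) \<le> \<epsilon> * max (exp (t * a)) (exp (t * b)) + K"
    using assms(2)
  proof
    assume "b < c \<and> c < a"
    then show ?thesis using interior_weight[of b c a \<epsilon>] assms(3) by metis
  next
    assume "a < c \<and> c < b"
    then show ?thesis using interior_weight[of a c b \<epsilon>] assms(3) by (metis max.commute)
  qed
  then obtain K where K: "K \<ge> 0" "\<And>t. exp (t * c) \<le> \<epsilon> * max (exp (t * a)) (exp (t * b)) + K" by blast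
  show ?thesis
  proof (rule that[of "K + 1"])
    fix t s n :: real assume n: "exp (t * a) \<le> n" "exp (t * b) \<le> n" "\<bar>s\<bar> \<le> n"
    have n0: "n > 0" using n(1) exp_gt_zero[of "t * a"] by linarith
    have "exp (t * c) \<le> \<epsilon> * n + K"
    proof -
      have "\<epsilon> * max (exp (t * a)) (exp (t * b)) \<le> \<epsilon> * n" using n assms(3) by (intro mult_left_mono) auto
      then show ?thesis using K(2)[of t] by linarith
    qed
    then have c: "exp (t * c) \<le> \<epsilon> * n + (K + 1)" by simp
    have m: "\<bar>x * exp (t * c)\<bar> \<le> n * (\<epsilon> * n + (K + 1))" if "\<bar>x\<bar> \<le> n" for x
      unfolding abs_mult using that c n0 by (intro mult_mono) auto
    \<comment> \<open>The outer weights have opposite signs, so one of these two factors is at most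
      1.\<close>
    have "exp (t * a) * exp (t * b) \<le> n * 1"
    proof (cases "t * a \<le> 0")
      case True
      then have "exp (t * b) * exp (t * a) \<le> n * 1" using n n0 by (intro mult_mono) auto
      then show ?thesis by (simp add: mult.commute)
    next
      case False
      then have "t * b \<le> 0" using assms(1,2)
        by (smt (verit, ccfv_SIG) mult_neg_neg mult_nonneg_nonpos mult_nonpos_nonneg mult_pos_pos)
      then show ?thesis using n n0 by (intro mult_mono) auto
    qed
    also have "\<dots> \<le> n * (\<epsilon> * n + (K + 1))" using n0 K(1) assms(3) by (intro mult_left_mono) auto
    finally have "\<bar>exp (t * a) * exp (t * b)\<bar> \<le> n * (\<epsilon> * n + (K + 1))" by simp
    then show "\<bar>exp (t * b) * exp (t * c)\<bar> \<le> n * (\<epsilon> * n + (K + 1)) \<and> \<bar>exp (t * a) * exp (t * c)\<bar> \<le> n * (\<epsilon> * n + (K + 1)) \<and>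
     \<bar>exp (t * a) * exp (t * b)\<bar> \<le> n * (\<epsilon> * n + (K + 1)) \<and> \<bar>s * exp (t * c)\<bar> \<le> n * (\<epsilon> * n + (K + 1))"
      using m[of "exp (t * b)"] m[of "exp (t * a)"] m[of s] n by simp
  qed (use K(1) in simp)
qed

lemma not_coarsely_dense_root_alpha:
  assumes "a + b + c = 0" "b < c \<and> c < a \<or> a < c \<and> c < b"
    and "\<And>h. h \<in> H \<Longrightarrow> \<exists>t s. h = ut (exp (t*a)) (exp (t*b)) (exp (t*c)) s 0 0"
  shows "\<not> coarsely_dense H"
proof (rule not_coarsely_dense_entriesI)
  fix \<epsilon> :: real assume e: "\<epsilon> > 0"
  have sum0: "a + b + c = 0" using assms(1) by simp
  obtain K where K: "K \<ge> 0" "\<And>t s n. exp (t * a) \<le> n \<Longrightarrow> exp (t * b) \<le> n \<Longrightarrow> \<bar>s\<bar> \<le> n \<Longrightarrow>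
     \<bar>exp (t * b) * exp (t * c)\<bar> \<le> n * (\<epsilon> * n + K) \<and> \<bar>exp (t * a) * exp (t * c)\<bar> \<le> n * (\<epsilon> * n + K) \<and>
     \<bar>exp (t * a) * exp (t * b)\<bar> \<le> n * (\<epsilon> * n + K) \<and> \<bar>s * exp (t * c)\<bar> \<le> n * (\<epsilon> * n + K)"
    using interior_weight_bounds[OF sum0 assms(2) e] by blast
  show "\<exists>K\<ge>0. \<forall>h\<in>H. \<exists>a b c u v w. h = ut a b c u v w \<and>
    cofactors_le (norm h * (\<epsilon> * norm h + K)) a b c u v w"
  proof (rule exI[of _ K], rule conjI[OF K(1)], rule ballI)
    fix h assume "h \<in> H"
    then obtain t s where h: "h = ut (exp (t*a)) (exp (t*b)) (exp (t*c)) s 0 0" using assms(3) by blast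
    have n: "exp (t*a) \<le> norm h" "exp (t*b) \<le> norm h" "exp (t*c) \<le> norm h" "\<bar>s\<bar> \<le> norm h"
      using norm_ut_ge(1)[where a = "exp (t*a)" and b = "exp (t*b)" and c = "exp (t*c)" and u = s and v = 0 and w = 0, folded h] norm_ut_ge(2)[where a = "exp (t*a)" and b = "exp (t*b)" and c = "exp (t*c)" and u = s and v = 0 and w = 0, folded h] norm_ut_ge(3)[where a = "exp (t*a)" and b = "exp (t*b)" and c = "exp (t*c)" and u = s and v = 0 and w = 0, folded h] norm_ut_ge(4)[where a = "exp (t*a)" and b = "exp (t*b)" and c = "exp (t*c)" and u = s and v = 0 and w = 0, folded h] by simp_all
    have z: "0 \<le> norm h * (\<epsilon> * norm h + K)" using K(1) e by simp
    show "\<exists>a b c u v w. h = ut a b c u v w \<and>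
      cofactors_le (norm h * (\<epsilon> * norm h + K)) a b c u v w"
      by (intro exI conjI, rule h) (use K(2)[of t "norm h" s] n z in \<open>simp add: mult.commute[of "exp _" "exp _"]\<close>)
  qed
qed

lemma not_coarsely_dense_root_beta:
  assumes "a + b + c = 0" "c < a \<and> a < b \<or> b < a \<and> a < c"
    and "\<And>h. h \<in> H \<Longrightarrow> \<exists>t s. h = ut (exp (t*a)) (exp (t*b)) (exp (t*c)) 0 s 0"
  shows "\<not> coarsely_dense H"
proof -
  have "\<not> coarsely_dense (flip ` H)"
    by (rule not_coarsely_dense_root_alpha[of c b a]) (use assms in \<open>force+\<close>)
  then show ?thesis by (simp add: coarsely_dense_flip)
qed

lemma not_coarsely_dense_root_alpha_beta:
  assumes "a + b + c = 0" "c < b \<and> b < a \<or> a < b \<and> b < c"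
    and "\<And>h. h \<in> H \<Longrightarrow> \<exists>t s. h = ut (exp (t*a)) (exp (t*b)) (exp (t*c)) 0 0 s"
  shows "\<not> coarsely_dense H"
proof (rule not_coarsely_dense_entriesI)
  fix \<epsilon> :: real assume e: "\<epsilon> > 0"
  have sum0: "a + c + b = 0" using assms(1) by simp
  obtain K where K: "K \<ge> 0" "\<And>t s n. exp (t * a) \<le> n \<Longrightarrow> exp (t * c) \<le> n \<Longrightarrow> \<bar>s\<bar> \<le> n \<Longrightarrow>
     \<bar>exp (t * c) * exp (t * b)\<bar> \<le> n * (\<epsilon> * n + K) \<and> \<bar>exp (t * a) * exp (t * b)\<bar> \<le> n * (\<epsilon> * n + K) \<and>
     \<bar>exp (t * a) * exp (t * c)\<bar> \<le> n * (\<epsilon> * n + K) \<and> \<bar>s * exp (t * b)\<bar> \<le> n * (\<epsilon> * n + K)"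
    using interior_weight_bounds[OF sum0 assms(2) e] by blast
  show "\<exists>K\<ge>0. \<forall>h\<in>H. \<exists>a b c u v w. h = ut a b c u v w \<and>
    cofactors_le (norm h * (\<epsilon> * norm h + K)) a b c u v w"
  proof (rule exI[of _ K], rule conjI[OF K(1)], rule ballI)
    fix h assume "h \<in> H"
    then obtain t s where h: "h = ut (exp (t*a)) (exp (t*b)) (exp (t*c)) 0 0 s" using assms(3) by blast
    have n: "exp (t*a) \<le> norm h" "exp (t*b) \<le> norm h" "exp (t*c) \<le> norm h" "\<bar>s\<bar> \<le> norm h"
      using norm_ut_ge(1)[where a = "exp (t*a)" and b = "exp (t*b)" and c = "exp (t*c)" and u = 0 and v = 0 and w = s, folded h] norm_ut_ge(2)[where a = "exp (t*a)" and b = "exp (t*b)" and c = "exp (t*c)" and u = 0 and v = 0 and w = s, folded h] norm_ut_ge(3)[where a = "exp (t*a)" and b = "exp (t*b)" and c = "exp (t*c)" and u = 0 and v = 0 and w = s, folded h] norm_ut_ge(6)[where a = "exp (t*a)" and b = "exp (t*b)" and c = "exp (t*c)" and u = 0 and v = 0 and w = s, folded h] by simp_all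
    have z: "0 \<le> norm h * (\<epsilon> * norm h + K)" using K(1) e by simp
    show "\<exists>a b c u v w. h = ut a b c u v w \<and>
      cofactors_le (norm h * (\<epsilon> * norm h + K)) a b c u v w"
      by (intro exI conjI, rule h) (use K(2)[of t "norm h" s] n z in \<open>simp add: mult.commute[of "exp _" "exp _"]\<close>)
  qed
qed

text \<open>The twisted entry is |\<gamma> t| times \<open>exp t\<close>, so beyond |t| = 1 /
  (\<epsilon> |\<gamma>|) it makes \<open>exp t\<close> at most
  \<open>\<epsilon> * n\<close>.\<close>

lemma twisted_entry_bounds:
  fixes \<gamma> \<epsilon> :: real
  assumes "\<gamma> \<noteq> 0" "\<epsilon> > 0"
  obtains K where "K \<ge> 0" "\<And>t s n. exp t \<le> n \<Longrightarrow> exp (-2*t) \<le> n \<Longrightarrow> \<bar>\<gamma> * t * exp t\<bar> \<le> n \<Longrightarrow> \<bar>s\<bar> \<le> n \<Longrightarrow>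
     \<bar>exp t * exp (-2*t)\<bar> \<le> n * (\<epsilon> * n + K) \<and> \<bar>exp t * exp t\<bar> \<le> n * (\<epsilon> * n + K) \<and>
     \<bar>s * exp t\<bar> \<le> n * (\<epsilon> * n + K) \<and> \<bar>\<gamma> * t * exp t * exp (-2*t)\<bar> \<le> n * (\<epsilon> * n + K)"
proof -
  define T where "T = 1 / (\<epsilon> * \<bar>\<gamma>\<bar>)"
  define K where "K = exp T + 2 * \<bar>\<gamma>\<bar>"
  show ?thesis
  proof (rule that[of K])
    show "K \<ge> 0" by (simp add: K_def add_nonneg_nonneg)
    fix t s n :: real
    assume n: "exp t \<le> n" "exp (-2*t) \<le> n" "\<bar>\<gamma> * t * exp t\<bar> \<le> n" "\<bar>s\<bar> \<le> n"
    have n1: "n \<ge> 1"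
    proof (cases "t \<ge> 0")
      case True
      then show ?thesis using n(1) one_le_exp_iff[of t] by linarith
    next
      case False
      then show ?thesis using n(2) one_le_exp_iff[of "-2*t"] by linarith
    qed
    have "exp t \<le> \<epsilon> * n + exp T"
    proof (cases "\<bar>t\<bar> \<le> T")
      case True
      then have "exp t \<le> exp T" by simp
      then show ?thesis using assms(2) n1 by (simp add: add_increasing)
    next
      case False
      then have "1 \<le> \<epsilon> * (\<bar>\<gamma>\<bar> * \<bar>t\<bar>)" using assms by (simp add: T_def field_simps)
      then have "1 * exp t \<le> \<epsilon> * (\<bar>\<gamma>\<bar> * \<bar>t\<bar>) * exp t" by (intro mult_right_mono) auto
      also have "\<dots> = \<epsilon> * \<bar>\<gamma> * t * exp t\<bar>" by (simp add: abs_mult)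
      also have "\<dots> \<le> \<epsilon> * n" using n(3) assms(2) by (intro mult_left_mono) auto
      finally show ?thesis by (simp add: add_increasing2)
    qed
    then have et: "exp t \<le> \<epsilon> * n + K" by (simp add: K_def add_increasing2)
    have m: "\<bar>x * exp t\<bar> \<le> n * (\<epsilon> * n + K)" if "\<bar>x\<bar> \<le> n" for x
      unfolding abs_mult using that et n1 by (intro mult_mono) auto
    have "\<bar>t\<bar> * exp (- t) \<le> exp (-2*t) + 1"
    proof (cases "t \<ge> 0")
      case True
      have "t \<le> exp t" using exp_ge_add_one_self[of t] by linarith
      then have "t * exp (- t) \<le> exp t * exp (- t)" by (intro mult_right_mono) auto
      then show ?thesis using True by (simp flip: exp_add add: add_increasing)
    next
      case False
      have "- t \<le> exp (- t)" using exp_ge_add_one_self[of "- t"] by linarith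
      then have "(- t) * exp (- t) \<le> exp (- t) * exp (- t)" by (intro mult_right_mono) auto
      then show ?thesis using False by (simp flip: exp_add)
    qed
    then have "\<bar>\<gamma>\<bar> * (\<bar>t\<bar> * exp (- t)) \<le> \<bar>\<gamma>\<bar> * (n + n)"
      using n(2) n1 by (intro mult_left_mono) auto
    moreover have "exp t * exp (-2*t) = exp (- t)" by (simp flip: exp_add)
    then have "\<bar>\<gamma> * t * exp t * exp (-2*t)\<bar> = \<bar>\<gamma>\<bar> * (\<bar>t\<bar> * exp (- t))"
      by (simp add: abs_mult mult.assoc)
    moreover have "\<bar>\<gamma>\<bar> * (n + n) \<le> n * (\<epsilon> * n + K)"
    proof -
      have "n * (2 * \<bar>\<gamma>\<bar>) \<le> n * (\<epsilon> * n + K)" using n1 assms(2) by (intro mult_left_mono) (auto simp: K_def add_increasing)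
      then show ?thesis by (simp add: algebra_simps)
    qed
    ultimately have "\<bar>\<gamma> * t * exp t * exp (-2*t)\<bar> \<le> n * (\<epsilon> * n + K)" by linarith
    then show "\<bar>exp t * exp (-2*t)\<bar> \<le> n * (\<epsilon> * n + K) \<and> \<bar>exp t * exp t\<bar> \<le> n * (\<epsilon> * n + K) \<and>
     \<bar>s * exp t\<bar> \<le> n * (\<epsilon> * n + K) \<and> \<bar>\<gamma> * t * exp t * exp (-2*t)\<bar> \<le> n * (\<epsilon> * n + K)"
      using m[of "exp t"] m[of "exp (-2*t)"] m[of s] n by (simp add: mult.commute)
  qed
qed

lemma not_coarsely_dense_twisted_alpha:
  assumes "\<gamma> \<noteq> 0"
    and "\<And>h. h \<in> H \<Longrightarrow> \<exists>t s. h = ut (exp t) (exp t) (exp (-2*t)) (\<gamma> * t * exp t) 0 s"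
  shows "\<not> coarsely_dense H"
proof (rule not_coarsely_dense_entriesI)
  fix \<epsilon> :: real assume e: "\<epsilon> > 0"
  obtain K where K: "K \<ge> 0" "\<And>t s n. exp t \<le> n \<Longrightarrow> exp (-2*t) \<le> n \<Longrightarrow> \<bar>\<gamma> * t * exp t\<bar> \<le> n \<Longrightarrow> \<bar>s\<bar> \<le> n \<Longrightarrow>
     \<bar>exp t * exp (-2*t)\<bar> \<le> n * (\<epsilon> * n + K) \<and> \<bar>exp t * exp t\<bar> \<le> n * (\<epsilon> * n + K) \<and>
     \<bar>s * exp t\<bar> \<le> n * (\<epsilon> * n + K) \<and> \<bar>\<gamma> * t * exp t * exp (-2*t)\<bar> \<le> n * (\<epsilon> * n + K)"
    using twisted_entry_bounds[OF assms(1) e] by blast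
  show "\<exists>K\<ge>0. \<forall>h\<in>H. \<exists>a b c u v w. h = ut a b c u v w \<and>
    cofactors_le (norm h * (\<epsilon> * norm h + K)) a b c u v w"
  proof (rule exI[of _ K], rule conjI[OF K(1)], rule ballI)
    fix h assume "h \<in> H"
    then obtain t s where h: "h = ut (exp t) (exp t) (exp (-2*t)) (\<gamma> * t * exp t) 0 s" using assms(2) by blast
    have n: "exp t \<le> norm h" "exp (-2*t) \<le> norm h" "\<bar>\<gamma> * t * exp t\<bar> \<le> norm h" "\<bar>s\<bar> \<le> norm h"
      using norm_ut_ge(1)[where a = "(exp t)" and b = "(exp t)" and c = "(exp (-2*t))" and u = "(\<gamma> * t * exp t)" and v = "0" and w = "s", folded h]
        norm_ut_ge(2)[where a = "(exp t)" and b = "(exp t)" and c = "(exp (-2*t))" and u = "(\<gamma> * t * exp t)" and v = "0" and w = "s", folded h]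
        norm_ut_ge(3)[where a = "(exp t)" and b = "(exp t)" and c = "(exp (-2*t))" and u = "(\<gamma> * t * exp t)" and v = "0" and w = "s", folded h]
        norm_ut_ge(4)[where a = "(exp t)" and b = "(exp t)" and c = "(exp (-2*t))" and u = "(\<gamma> * t * exp t)" and v = "0" and w = "s", folded h]
        norm_ut_ge(6)[where a = "(exp t)" and b = "(exp t)" and c = "(exp (-2*t))" and u = "(\<gamma> * t * exp t)" and v = "0" and w = "s", folded h] by simp_all
    have z: "0 \<le> norm h * (\<epsilon> * norm h + K)" using K(1) e by simp
    show "\<exists>a b c u v w. h = ut a b c u v w \<and>
      cofactors_le (norm h * (\<epsilon> * norm h + K)) a b c u v w"
      by (intro exI conjI, rule h) (use K(2)[of t "norm h" s] n z in \<open>simp add: mult.commute[of "exp (- (2 * t))" "exp t"]\<close>)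
  qed
qed

lemma not_coarsely_dense_twisted_beta:
  assumes "\<gamma> \<noteq> 0"
    and "\<And>h. h \<in> H \<Longrightarrow> \<exists>t s. h = ut (exp (-2*t)) (exp t) (exp t) 0 (\<gamma> * t * exp t) s"
  shows "\<not> coarsely_dense H"
proof -
  have "\<not> coarsely_dense (flip ` H)"
    by (rule not_coarsely_dense_twisted_alpha[OF assms(1)]) (use assms(2) in force)
  then show ?thesis by (simp add: coarsely_dense_flip)
qed

text \<open>The nonzero minors are, up to order and sign, those of the group twisted along \<alpha>,
  so the same bounds serve.\<close>

lemma not_coarsely_dense_twisted_alpha_beta_12:
  assumes "\<gamma> \<noteq> 0"
    and "\<And>h. h \<in> H \<Longrightarrow> \<exists>t s. h = ut (exp t) (exp (-2*t)) (exp t) s 0 (\<gamma> * t * exp t)"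
  shows "\<not> coarsely_dense H"
proof (rule not_coarsely_dense_entriesI)
  fix \<epsilon> :: real assume e: "\<epsilon> > 0"
  obtain K where K: "K \<ge> 0" "\<And>t s n. exp t \<le> n \<Longrightarrow> exp (-2*t) \<le> n \<Longrightarrow> \<bar>\<gamma> * t * exp t\<bar> \<le> n \<Longrightarrow> \<bar>s\<bar> \<le> n \<Longrightarrow>
     \<bar>exp t * exp (-2*t)\<bar> \<le> n * (\<epsilon> * n + K) \<and> \<bar>exp t * exp t\<bar> \<le> n * (\<epsilon> * n + K) \<and>
     \<bar>s * exp t\<bar> \<le> n * (\<epsilon> * n + K) \<and> \<bar>\<gamma> * t * exp t * exp (-2*t)\<bar> \<le> n * (\<epsilon> * n + K)"
    using twisted_entry_bounds[OF assms(1) e] by blast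
  show "\<exists>K\<ge>0. \<forall>h\<in>H. \<exists>a b c u v w. h = ut a b c u v w \<and>
    cofactors_le (norm h * (\<epsilon> * norm h + K)) a b c u v w"
  proof (rule exI[of _ K], rule conjI[OF K(1)], rule ballI)
    fix h assume "h \<in> H"
    then obtain t s where h: "h = ut (exp t) (exp (-2*t)) (exp t) s 0 (\<gamma> * t * exp t)" using assms(2) by blast
    have n: "exp t \<le> norm h" "exp (-2*t) \<le> norm h" "\<bar>\<gamma> * t * exp t\<bar> \<le> norm h" "\<bar>s\<bar> \<le> norm h"
      using norm_ut_ge(1)[where a = "(exp t)" and b = "(exp (-2*t))" and c = "(exp t)" and u = "s" and v = "0" and w = "(\<gamma> * t * exp t)", folded h]
        norm_ut_ge(2)[where a = "(exp t)" and b = "(exp (-2*t))" and c = "(exp t)" and u = "s" and v = "0" and w = "(\<gamma> * t * exp t)", folded h]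
        norm_ut_ge(3)[where a = "(exp t)" and b = "(exp (-2*t))" and c = "(exp t)" and u = "s" and v = "0" and w = "(\<gamma> * t * exp t)", folded h]
        norm_ut_ge(6)[where a = "(exp t)" and b = "(exp (-2*t))" and c = "(exp t)" and u = "s" and v = "0" and w = "(\<gamma> * t * exp t)", folded h]
        norm_ut_ge(4)[where a = "(exp t)" and b = "(exp (-2*t))" and c = "(exp t)" and u = "s" and v = "0" and w = "(\<gamma> * t * exp t)", folded h] by simp_all
    have z: "0 \<le> norm h * (\<epsilon> * norm h + K)" using K(1) e by simp
    show "\<exists>a b c u v w. h = ut a b c u v w \<and>
      cofactors_le (norm h * (\<epsilon> * norm h + K)) a b c u v w"
      by (intro exI conjI, rule h) (use K(2)[of t "norm h" s] n z in \<open>simp add: mult.commute[of "exp (- (2 * t))" "exp t"]\<close>)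
  qed
qed

lemma not_coarsely_dense_twisted_alpha_beta_23:
  assumes "\<gamma> \<noteq> 0"
    and "\<And>h. h \<in> H \<Longrightarrow> \<exists>t s. h = ut (exp t) (exp (-2*t)) (exp t) 0 s (\<gamma> * t * exp t)"
  shows "\<not> coarsely_dense H"
proof -
  have "\<not> coarsely_dense (flip ` H)"
    by (rule not_coarsely_dense_twisted_alpha_beta_12[OF assms(1)]) (use assms(2) in force)
  then show ?thesis by (simp add: coarsely_dense_flip)
qed

text \<open>These elements stay near the walls of the chamber, where one size is about the square of
  the other; the test Z = 1, which asks for equal sizes, fails for large \<open>X\<close>.\<close>

lemma not_coarsely_dense_wall:
  assumes "\<And>h. h \<in> H \<Longrightarrow> (\<exists>d\<ge>1. norm h \<le> 3 * d \<and> d\<^sup>2 \<le> norm (adj3 h)) \<or> (\<exists>d\<ge>1. norm (adj3 h) \<le> 3 * d \<and> d\<^sup>2 \<le> norm h)"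
  shows "\<not> coarsely_dense H"
proof
  assume "coarsely_dense H"
  then obtain M where M: "\<And>X Z. 1 \<le> Z \<Longrightarrow> Z \<le> X \<Longrightarrow>
     (\<exists>h\<in>H. matches M X (X * Z) h)"
    unfolding coarsely_dense_def by blast
  have M0: "M > 0"
  proof (rule ccontr)
    assume "\<not> M > 0"
    obtain h :: mat3 where "1 \<le> M * norm h" using M[of 1 1] by auto
    moreover have "M * norm h \<le> 0" using \<open>\<not> M > 0\<close> by (simp add: mult_nonpos_nonneg)
    ultimately show False by simp
  qed
  define X where "X = 9 * M ^ 3 + 1"
  have X1: "X \<ge> 1" using M0 by (simp add: X_def)
  obtain h where h: "h \<in> H" "norm h \<le> M * X" "X \<le> M * norm h" "norm (adj3 h) \<le> M * X" "X \<le> M * norm (adj3 h)"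
    using M[of 1 X] X1 by auto
  have False if "d \<ge> 1" "x \<le> 3 * d" "d\<^sup>2 \<le> y" "X \<le> M * x" "y \<le> M * X" for d x y
  proof -
    have "X \<le> M * (3 * d)" using that(2,4) mult_left_mono[OF that(2), of M] M0 by linarith
    then have "X\<^sup>2 \<le> (M * (3 * d))\<^sup>2" using X1 by (intro power_mono) auto
    also have "\<dots> = 9 * M\<^sup>2 * d\<^sup>2" by (simp add: power_mult_distrib)
    also have "\<dots> \<le> 9 * M\<^sup>2 * (M * X)" using that(3,5) by (intro mult_left_mono) auto
    finally have "X * X \<le> (9 * M ^ 3) * X" by (simp add: power2_eq_square power3_eq_cube mult_ac)
    then have "X \<le> 9 * M ^ 3" using X1 by (simp add: mult_le_cancel_right)
    then show False by (simp add: X_def)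
  qed
  then show False using assms[OF h(1)] h by blast
qed

text \<open>A diagonal group with two equal weights moves along the walls of the chamber; the sign
  of \<open>t\<close> decides along which one.\<close>

lemma not_coarsely_dense_singular_diag:
  assumes "\<And>h. h \<in> H \<Longrightarrow> \<exists>t. h = ut (exp t) (exp t) (exp (-2*t)) 0 0 0 \<or>
     h = ut (exp (-2*t)) (exp t) (exp t) 0 0 0 \<or> h = ut (exp t) (exp (-2*t)) (exp t) 0 0 0"
  shows "\<not> coarsely_dense H"
proof (rule not_coarsely_dense_wall)
  fix h assume "h \<in> H"
  then obtain t where "h = ut (exp t) (exp t) (exp (-2*t)) 0 0 0 \<or>
     h = ut (exp (-2*t)) (exp t) (exp t) 0 0 0 \<or> h = ut (exp t) (exp (-2*t)) (exp t) 0 0 0" using assms by blast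
  moreover define E where "E = exp t"
  define F where "F = exp (-t)"
  have EF: "E > 0" "F > 0" "E * F = 1" by (simp_all add: E_def F_def flip: exp_add)
  have F2: "exp (-2*t) = F * F" by (simp add: F_def flip: exp_add)
  ultimately have h: "h = ut E E (F*F) 0 0 0 \<or> h = ut (F*F) E E 0 0 0 \<or> h = ut E (F*F) E 0 0 0" by (simp add: E_def)
  have FE: "F * F * E = F" "E * (F * F) = F" using EF(3) by (simp_all add: mult.assoc mult.commute[of F E] mult.left_commute[of E F])
  have a: "adj3 h = ut F F (E*E) 0 0 0 \<or> adj3 h = ut (E*E) F F 0 0 0 \<or> adj3 h = ut F (E*E) F 0 0 0"
    using h by (auto simp: ut_adj3 FE)
  have n: "norm h \<le> 2 * E + F * F" "F * F \<le> norm h"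
    using h norm_ut_le[of E E "F*F" 0 0 0] norm_ut_le[of "F*F" E E 0 0 0] norm_ut_le[of E "F*F" E 0 0 0]
      norm_ut_ge(3)[of "F*F" E E 0 0 0] norm_ut_ge(1)[of "F*F" E E 0 0 0] norm_ut_ge(2)[of "F*F" E E 0 0 0] EF by auto
  have m: "norm (adj3 h) \<le> 2 * F + E * E" "E * E \<le> norm (adj3 h)"
    using a norm_ut_le[of F F "E*E" 0 0 0] norm_ut_le[of "E*E" F F 0 0 0] norm_ut_le[of F "E*E" F 0 0 0]
      norm_ut_ge(3)[of "E*E" F F 0 0 0] norm_ut_ge(1)[of "E*E" F F 0 0 0] norm_ut_ge(2)[of "E*E" F F 0 0 0] EF by auto
  show "(\<exists>d\<ge>1. norm h \<le> 3 * d \<and> d\<^sup>2 \<le> norm (adj3 h)) \<or> (\<exists>d\<ge>1. norm (adj3 h) \<le> 3 * d \<and> d\<^sup>2 \<le> norm h)"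
  proof (cases "E \<ge> 1")
    case True
    then have "F \<le> 1" using EF mult_right_mono[of 1 E F] by simp
    then have "F * F \<le> E" using True EF mult_mono[of F 1 F 1] by simp
    then show ?thesis using True n m by (intro disjI1 exI[of _ E]) (simp add: power2_eq_square)
  next
    case False
    then have "F \<ge> 1" using EF mult_right_mono[of E 1 F] by simp
    moreover have "E * E \<le> F" using False \<open>F \<ge> 1\<close> EF mult_mono[of E 1 E 1] by simp
    ultimately show ?thesis using n m by (intro disjI2 exI[of _ F]) (simp add: power2_eq_square)
  qed
qed

section \<open>Weyl chambers\<close>

lemma a_alg_iff: "X \<in> a_alg \<longleftrightarrow> (\<exists>a b c. a + b + c = 0 \<and> X = ut a b c 0 0 0)"
proof
  assume "X \<in> a_alg"
  then have m: "mexp (t *\<^sub>R X) \<in> A_grp" for t by (simp add: a_alg_def lie_algebra_def)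
  have "mexp (s *\<^sub>R X) $ 2 $ 1 = 0 \<and> mexp (s *\<^sub>R X) $ 3 $ 1 = 0 \<and> mexp (s *\<^sub>R X) $ 3 $ 2 = 0
     \<and> mexp (s *\<^sub>R X) $ 1 $ 2 = 0 \<and> mexp (s *\<^sub>R X) $ 2 $ 3 = 0 \<and> mexp (s *\<^sub>R X) $ 1 $ 3 = 0" for s
    using m[of s] unfolding A_grp_iff by auto
  then have "X $ 2 $ 1 = 0" "X $ 3 $ 1 = 0" "X $ 3 $ 2 = 0" "X $ 1 $ 2 = 0" "X $ 2 $ 3 = 0" "X $ 1 $ 3 = 0"
    using mexp_deriv[of X] unfolding tendsto_mat3_iff forall_3 by (simp_all add: tendsto_const_iff)
  then have X: "X = ut (X$1$1) (X$2$2) (X$3$3) 0 0 0" using ut_exhaust[of X] by simp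
  have "mexp X = ut (exp (X$1$1)) (exp (X$2$2)) (exp (X$3$3)) 0 0 0"
    using mexp_diag[of "X$1$1" "X$2$2" "X$3$3"] X by simp
  moreover have "det (mexp X) = 1" using m[of 1] by (simp add: A_grp_def SL3_iff)
  ultimately have "exp (X$1$1) * exp (X$2$2) * exp (X$3$3) = 1" by (simp add: ut_det)
  then have "X$1$1 + X$2$2 + X$3$3 = 0" by (simp flip: exp_add)
  with X show "\<exists>a b c. a + b + c = 0 \<and> X = ut a b c 0 0 0" by blast
next
  assume "\<exists>a b c. a + b + c = 0 \<and> X = ut a b c 0 0 0"
  then obtain a b c where X: "a + b + c = 0" "X = ut a b c 0 0 0" by blast
  have "mexp (t *\<^sub>R X) \<in> A_grp" for t
  proof -
    have "exp (t * a) * exp (t * b) * exp (t * c) = exp (t * (a + b + c))"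
      by (simp add: exp_add distrib_left)
    then have "exp (t * a) * exp (t * b) * exp (t * c) = 1" by (simp add: X(1))
    then show ?thesis unfolding A_grp_iff X(2)
      by (intro exI[of _ "exp (t * a)"] exI[of _ "exp (t * b)"] exI[of _ "exp (t * c)"]) (simp add: ut_scale mexp_diag)
  qed
  then show "X \<in> a_alg" by (simp add: a_alg_def lie_algebra_def)
qed

lemma subspace_a_alg: "subspace a_alg"
proof (rule subspaceI)
  show "0 \<in> a_alg" unfolding a_alg_iff ut_zero by (intro exI[of _ 0]) simp
next
  fix X Y assume "X \<in> a_alg" "Y \<in> a_alg"
  then obtain a b c a' b' c' where "a + b + c = 0" "X = ut a b c 0 0 0" "a' + b' + c' = 0" "Y = ut a' b' c' 0 0 0"
    unfolding a_alg_iff by blast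
  then show "X + Y \<in> a_alg" unfolding a_alg_iff
    by (intro exI[of _ "a + a'"] exI[of _ "b + b'"] exI[of _ "c + c'"]) (simp add: ut_add)
next
  fix r X assume "X \<in> a_alg"
  then obtain a b c where "a + b + c = 0" "X = ut a b c 0 0 0" unfolding a_alg_iff by blast
  then show "r *\<^sub>R X \<in> a_alg" unfolding a_alg_iff
    by (intro exI[of _ "r * a"] exI[of _ "r * b"] exI[of _ "r * c"]) (simp add: ut_scale flip: distrib_left)
qed

text \<open>Expanding each basis in the other turns both traces into the same double sum of products
  of coefficients. The arbitrarily chosen basis in \<open>trace_on\<close> can thus be replaced by
  an explicit one.\<close>

lemma trace_on_basis:
  assumes D: "independent D" "span D = V" and f: "linear f" "\<And>x. x \<in> V \<Longrightarrow> f x \<in> V"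
  shows "trace_on V f = (\<Sum>d\<in>D. representation D (f d) d)"
proof -
  define B where "B = (SOME B. independent B \<and> span B = V)"
  have "independent B \<and> span B = V" unfolding B_def by (rule someI[of _ D]) (use D in simp)
  then have B: "independent B" "span B = V" by simp_all
  have fin: "finite B" "finite D" using B(1) D(1) independent_imp_finite by blast+
  have BV: "b \<in> V" if "b \<in> B" for b using that span_base B(2) by blast
  have DV: "d \<in> V" if "d \<in> D" for d using that span_base D(2) by blast
  have fB: "f d \<in> span B" if "d \<in> D" for d using f(2)[OF DV[OF that]] B(2) by simp
  have BD: "b \<in> span D" if "b \<in> B" for b using BV[OF that] D(2) by simp
  have 1: "representation B (f b) b = (\<Sum>d\<in>D. representation D b d * representation B (f d) b)" if "b \<in> B" for b
  proof -
    have e: "(\<Sum>d\<in>D. representation D b d *\<^sub>R d) = b"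
      by (rule sum_representation_eq[OF D(1) _ fin(2) order_refl]) (use BV[OF that] D(2) in simp)
    have "f b = f (\<Sum>d\<in>D. representation D b d *\<^sub>R d)" unfolding e ..
    also have "\<dots> = (\<Sum>d\<in>D. representation D b d *\<^sub>R f d)"
      by (simp add: linear_sum[OF f(1)] linear_cmul[OF f(1)])
    finally have "representation B (f b) b = representation B (\<Sum>d\<in>D. representation D b d *\<^sub>R f d) b"
      by (rule arg_cong[where f = "\<lambda>x. representation B x b"])
    also have "\<dots> = (\<Sum>d\<in>D. representation B (representation D b d *\<^sub>R f d) b)"
      by (subst representation_sum[OF B(1)]) (auto intro: span_scale fB)
    also have "\<dots> = (\<Sum>d\<in>D. representation D b d * representation B (f d) b)"
      by (intro sum.cong) (auto simp: representation_scale[OF B(1)] fB)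
    finally show ?thesis .
  qed
  have 2: "representation D (f d) d = (\<Sum>b\<in>B. representation D b d * representation B (f d) b)" if "d \<in> D" for d
  proof -
    have e: "(\<Sum>b\<in>B. representation B (f d) b *\<^sub>R b) = f d"
      by (rule sum_representation_eq[OF B(1) _ fin(1) order_refl]) (use f(2)[OF DV[OF that]] B(2) in simp)
    have "representation D (f d) d = representation D (\<Sum>b\<in>B. representation B (f d) b *\<^sub>R b) d" unfolding e ..
    also have "\<dots> = (\<Sum>b\<in>B. representation D (representation B (f d) b *\<^sub>R b) d)"
      by (subst representation_sum[OF D(1)]) (auto intro: span_scale BD)
    also have "\<dots> = (\<Sum>b\<in>B. representation D b d * representation B (f d) b)"
      by (intro sum.cong) (auto simp: representation_scale[OF D(1)] BD)
    finally show ?thesis .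
  qed
  have "trace_on V f = (\<Sum>b\<in>B. representation B (f b) b)"
    unfolding trace_on_def Let_def B_def ..
  also have "\<dots> = (\<Sum>b\<in>B. \<Sum>d\<in>D. representation D b d * representation B (f d) b)"
    by (rule sum.cong[OF refl 1])
  also have "\<dots> = (\<Sum>d\<in>D. \<Sum>b\<in>B. representation D b d * representation B (f d) b)" by (rule sum.swap)
  also have "\<dots> = (\<Sum>d\<in>D. representation D (f d) d)" by (rule sum.cong[OF refl 2[symmetric]])
  finally show ?thesis .
qed

text \<open>The vectors are orthogonal, which settles independence, and they are eigenvectors of the
  adjoint action of every diagonal matrix, so the trace can be read off.\<close>

definition sl3_basis :: "mat3 set" where
  "sl3_basis = {mk 0 1 0 0 0 0 0 0 0, mk 0 0 0 1 0 0 0 0 0, mk 0 0 0 0 0 1 0 0 0, mk 0 0 0 0 0 0 0 1 0,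
     mk 0 0 1 0 0 0 0 0 0, mk 0 0 0 0 0 0 1 0 0, mk 1 0 0 0 (-1) 0 0 0 0, mk 1 0 0 0 1 0 0 0 (-2)}"

lemma mk_eq_iff: "mk a b c d e f g h i = mk a' b' c' d' e' f' g' h' i' \<longleftrightarrow>
   a = a' \<and> b = b' \<and> c = c' \<and> d = d' \<and> e = e' \<and> f = f' \<and> g = g' \<and> h = h' \<and> i = i'"
  unfolding mat3_eq_iff by auto

lemma inner_mk: "inner (mk a b c d e f g h i) (mk a' b' c' d' e' f' g' h' i') =
   a * a' + b * b' + c * c' + d * d' + e * e' + f * f' + g * g' + h * h' + i * i'"
  by (simp add: inner_vec_def sum_3)

lemma mk_zero: "0 = mk 0 0 0 0 0 0 0 0 0"
  unfolding mat3_eq_iff by simp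

lemma sl3_basis: "independent sl3_basis" "span sl3_basis = sl3_alg"
proof -
  show "independent sl3_basis"
  proof (rule pairwise_orthogonal_independent)
    show "pairwise orthogonal sl3_basis"
      unfolding sl3_basis_def pairwise_def orthogonal_def by (simp add: inner_mk mk_eq_iff)
    show "0 \<notin> sl3_basis" unfolding sl3_basis_def mk_zero by (simp add: mk_eq_iff)
  qed
  have sub: "subspace sl3_alg"
    unfolding sl3_alg_def by (rule subspaceI) (auto simp: trace_def sum.distrib sum_distrib_left[symmetric])
  show "span sl3_basis = sl3_alg"
  proof (intro equalityI span_minimal sub subsetI)
    fix X assume "X \<in> sl3_basis"
    then show "X \<in> sl3_alg" by (auto simp: sl3_basis_def sl3_alg_def trace_def sum_3)
  next
    fix X assume "X \<in> sl3_alg"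
    then have t: "X$1$1 + X$2$2 + X$3$3 = 0" by (simp add: sl3_alg_def trace_def sum_3)
    have "X = X$1$2 *\<^sub>R mk 0 1 0 0 0 0 0 0 0 + X$2$1 *\<^sub>R mk 0 0 0 1 0 0 0 0 0 + X$2$3 *\<^sub>R mk 0 0 0 0 0 1 0 0 0
       + X$3$2 *\<^sub>R mk 0 0 0 0 0 0 0 1 0 + X$1$3 *\<^sub>R mk 0 0 1 0 0 0 0 0 0 + X$3$1 *\<^sub>R mk 0 0 0 0 0 0 1 0 0
       + ((X$1$1 - X$2$2) / 2) *\<^sub>R mk 1 0 0 0 (-1) 0 0 0 0 + ((X$1$1 + X$2$2) / 2) *\<^sub>R mk 1 0 0 0 1 0 0 0 (-2)" (is "X = ?R")
      unfolding mat3_eq_iff using t by (simp add: field_simps)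
    moreover have "?R \<in> span sl3_basis"
      by (intro span_add span_scale span_base) (simp_all add: sl3_basis_def)
    ultimately show "X \<in> span sl3_basis" by simp
  qed
qed

text \<open>A root vector has as eigenvalue the product of the values of its root on the two
  matrices. Opposite roots give the factor 2, and the two diagonal basis vectors are killed.\<close>

lemma killing_form_diag:
  "killing_form (ut a b c 0 0 0) (ut a' b' c' 0 0 0)
     = 2 * ((a - b) * (a' - b') + (b - c) * (b' - c') + (a - c) * (a' - c'))"
proof -
  define f where "f Z = lie_bracket (ut a b c 0 0 0) (lie_bracket (ut a' b' c' 0 0 0) Z)" for Z
  have lin: "linear f"
    unfolding f_def by (rule linearI) (simp_all add: lie_bracket_def mat3_eq_iff mat_mult_3 algebra_simps)
  have fV: "f x \<in> sl3_alg" for x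
    unfolding f_def sl3_alg_def by (simp add: trace_def sum_3 lie_bracket_def mat_mult_3 algebra_simps)
  note rep = representation_scale[OF sl3_basis(1) span_base] representation_basis[OF sl3_basis(1)] representation_zero
  have r: "representation sl3_basis (f d) d = l" if "d \<in> sl3_basis" "f d = l *\<^sub>R d" for d l
    using that by (simp add: rep)
  have "killing_form (ut a b c 0 0 0) (ut a' b' c' 0 0 0) = (\<Sum>d\<in>sl3_basis. representation sl3_basis (f d) d)"
    unfolding killing_form_def f_def[symmetric]
    by (rule trace_on_basis[OF sl3_basis lin fV])
  also have "\<dots> = (\<Sum>d\<in>sl3_basis. if d = mk 0 1 0 0 0 0 0 0 0 \<or> d = mk 0 0 0 1 0 0 0 0 0 then (a - b) * (a' - b')
      else if d = mk 0 0 0 0 0 1 0 0 0 \<or> d = mk 0 0 0 0 0 0 0 1 0 then (b - c) * (b' - c')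
      else if d = mk 0 0 1 0 0 0 0 0 0 \<or> d = mk 0 0 0 0 0 0 1 0 0 then (a - c) * (a' - c') else 0)"
  proof (rule sum.cong[OF refl], rule r)
    fix d assume "d \<in> sl3_basis"
    then show "f d = (if d = mk 0 1 0 0 0 0 0 0 0 \<or> d = mk 0 0 0 1 0 0 0 0 0 then (a - b) * (a' - b')
      else if d = mk 0 0 0 0 0 1 0 0 0 \<or> d = mk 0 0 0 0 0 0 0 1 0 then (b - c) * (b' - c')
      else if d = mk 0 0 1 0 0 0 0 0 0 \<or> d = mk 0 0 0 0 0 0 1 0 0 then (a - c) * (a' - c') else 0) *\<^sub>R d"
      unfolding sl3_basis_def f_def lie_bracket_def
      by (elim insertE emptyE) (simp_all only: mk_eq_iff, simp_all add: mat3_eq_iff mat_mult_3 algebra_simps)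
  qed
  also have "\<dots> = 2 * ((a - b) * (a' - b') + (b - c) * (b' - c') + (a - c) * (a' - c'))"
    unfolding sl3_basis_def by (simp add: mk_eq_iff)
  finally show ?thesis .
qed

text \<open>The bracket of the elementary matrices for \<omega> and its negative, hence a spanning
  vector of \<open>a_root \<omega>\<close>.\<close>

definition coroot :: "pos_root \<Rightarrow> mat3" where
  "coroot \<omega> = (case \<omega> of Alpha \<Rightarrow> ut 1 (-1) 0 0 0 0 | Beta \<Rightarrow> ut 0 1 (-1) 0 0 0 | AlphaBeta \<Rightarrow> ut 1 0 (-1) 0 0 0)"

text \<open>At this index the coroot has the entry 0, strictly between its entries 1 and -1 at the
  other two.\<close>

fun other_index :: "pos_root \<Rightarrow> 3" where
  "other_index Alpha = 3" | "other_index Beta = 1" | "other_index AlphaBeta = 2"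

text \<open>On trace zero matrices of size three the Killing form is 6 times the trace form.\<close>

lemma killing_form_coroot:
  assumes "X \<in> a_alg"
  shows "killing_form X (r *\<^sub>R coroot \<omega>) = 6 * r * root_fun \<omega> X"
proof -
  obtain a b c where X: "X = ut a b c 0 0 0" using assms a_alg_iff by blast
  show ?thesis
    by (cases \<omega>) (simp_all add: X coroot_def ut_scale killing_form_diag root_fun_def algebra_simps)
qed

lemma coroot_a_alg: "coroot \<omega> \<in> a_alg"
  unfolding a_alg_iff by (cases \<omega>) (auto simp: coroot_def ut_eq_iff)

lemma a_root_eq: "a_root \<omega> = range (\<lambda>r. r *\<^sub>R coroot \<omega>)"
proof -
  have n: "(2::3) \<noteq> 1" "(3::3) \<noteq> 1" "(3::3) \<noteq> 2" "(1::3) \<noteq> 2" "(1::3) \<noteq> 3" "(2::3) \<noteq> 3" by simp_all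
  have "{lie_bracket X Y | X Y. X \<in> root_space \<omega> \<and> Y \<in> neg_root_space \<omega>} = range (\<lambda>r. r *\<^sub>R coroot \<omega>)"
  proof (intro equalityI subsetI)
    fix Z assume "Z \<in> {lie_bracket X Y | X Y. X \<in> root_space \<omega> \<and> Y \<in> neg_root_space \<omega>}"
    then obtain X Y where XY: "X \<in> root_space \<omega>" "Y \<in> neg_root_space \<omega>" "Z = lie_bracket X Y" by blast
    have "Z = (X $ root_row \<omega> $ root_col \<omega> * Y $ root_col \<omega> $ root_row \<omega>) *\<^sub>R coroot \<omega>"
      using XY(1,2) unfolding XY(3) lie_bracket_def root_space_def neg_root_space_def
      by (cases \<omega>) (simp_all add: mat3_eq_iff mat_mult_3 coroot_def forall_3)
    then show "Z \<in> range (\<lambda>r. r *\<^sub>R coroot \<omega>)" by blast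
  next
    fix Z assume "Z \<in> range (\<lambda>r. r *\<^sub>R coroot \<omega>)"
    then obtain r where Z: "Z = r *\<^sub>R coroot \<omega>" by blast
    define X :: mat3 where "X = (\<chi> i j. if (i, j) = (root_row \<omega>, root_col \<omega>) then r else 0)"
    define Y :: mat3 where "Y = (\<chi> i j. if (i, j) = (root_col \<omega>, root_row \<omega>) then 1 else 0)"
    have "X \<in> root_space \<omega>" "Y \<in> neg_root_space \<omega>" by (auto simp: X_def Y_def root_space_def neg_root_space_def)
    moreover have "Z = lie_bracket X Y"
      unfolding Z lie_bracket_def by (cases \<omega>) (simp_all add: mat3_eq_iff mat_mult_3 coroot_def X_def Y_def)
    ultimately show "Z \<in> {lie_bracket X Y | X Y. X \<in> root_space \<omega> \<and> Y \<in> neg_root_space \<omega>}" by blast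
  qed
  moreover have "range (\<lambda>r. r *\<^sub>R coroot \<omega>) = span {coroot \<omega>}" by (simp add: span_singleton)
  moreover have "span {coroot \<omega>} \<subseteq> a_alg" using coroot_a_alg subspace_a_alg by (intro span_minimal) auto
  ultimately show ?thesis unfolding a_root_def by (simp add: span_span Int_absorb2)
qed

section \<open>Chambers as orderings of the diagonal entries\<close>

definition regular_set :: "mat3 set" where
  "regular_set = {X \<in> a_alg. \<forall>\<omega>. root_fun \<omega> X \<noteq> 0}"

definition chamber :: "3 \<Rightarrow> 3 \<Rightarrow> 3 \<Rightarrow> mat3 set" where
  "chamber p q r = {X \<in> a_alg. X $ p $ p > X $ q $ q \<and> X $ q $ q > X $ r $ r}"

lemma regular_set_iff:
  "X \<in> regular_set \<longleftrightarrow> X \<in> a_alg \<and> X$1$1 \<noteq> X$2$2 \<and> X$2$2 \<noteq> X$3$3 \<and> X$1$1 \<noteq> X$3$3"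
proof -
  have "(\<forall>\<omega>. P \<omega>) \<longleftrightarrow> P Alpha \<and> P Beta \<and> P AlphaBeta" for P by (metis pos_root.exhaust)
  then show ?thesis by (auto simp: regular_set_def root_fun_def)
qed

lemma regular_set_distinct:
  assumes "X \<in> regular_set" "p \<noteq> q" shows "X $ p $ p \<noteq> X $ q $ q"
  using assms exhaust_3[of p] exhaust_3[of q] unfolding regular_set_iff by auto

lemma convex_chamber: "convex (chamber p q r)"
proof (rule convexI)
  fix X Y u v assume XY: "X \<in> chamber p q r" "Y \<in> chamber p q r" and uv: "0 \<le> u" "0 \<le> (v::real)" "u + v = 1"
  have "u * X$q$q + v * Y$q$q < u * X$p$p + v * Y$p$p"  "u * X$r$r + v * Y$r$r < u * X$q$q + v * Y$q$q"
    using XY uv unfolding chamber_def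
    by (cases "u = 0"; simp add: add_less_le_mono mult_strict_left_mono mult_left_mono less_imp_le)+
  then show "u *\<^sub>R X + v *\<^sub>R Y \<in> chamber p q r"
    using XY subspace_a_alg by (simp add: chamber_def subspace_add subspace_scale)
qed

lemma chamber_regular:
  assumes "p \<noteq> q" "q \<noteq> r" "p \<noteq> r" shows "chamber p q r \<subseteq> regular_set"
proof
  fix X assume X: "X \<in> chamber p q r"
  have "{p, q, r} = UNIV"
    using assms UNIV_3 exhaust_3[of p] exhaust_3[of q] exhaust_3[of r] by auto
  have "inj_on (\<lambda>p. X $ p $ p) {p, q, r}" using X by (auto simp: chamber_def)
  then have "inj (\<lambda>p. X $ p $ p)" unfolding \<open>{p, q, r} = UNIV\<close> .
  then show "X \<in> regular_set" using X unfolding regular_set_iff chamber_def by (auto dest: injD)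
qed

lemma connected_same_sign:
  assumes "connected T" "T \<subseteq> regular_set" "X \<in> T" "Y \<in> T" "p \<noteq> q" "X $ p $ p > X $ q $ q"
  shows "Y $ p $ p > Y $ q $ q"
proof (rule ccontr)
  assume n: "\<not> Y $ p $ p > Y $ q $ q"
  let ?f = "\<lambda>X :: mat3. X $ p $ p - X $ q $ q"
  have "connected (?f ` T)" by (intro connected_continuous_image continuous_intros assms(1))
  then have "{?f Y..?f X} \<subseteq> ?f ` T" using assms(3,4) by (intro connected_contains_Icc) auto
  moreover have "0 \<in> {?f Y..?f X}" using n assms(6) by simp
  ultimately obtain Z where "Z \<in> T" "?f Z = 0" by (metis (no_types, lifting) image_iff subsetD)
  then show False using regular_set_distinct assms(2,5) by force
qed

lemma chamber_component:
  assumes "p \<noteq> q" "q \<noteq> r" "p \<noteq> r" "X \<in> chamber p q r"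
  shows "connected_component_set regular_set X = chamber p q r"
proof (intro equalityI subsetI)
  fix Y assume "Y \<in> connected_component_set regular_set X"
  then obtain T where T: "connected T" "T \<subseteq> regular_set" "X \<in> T" "Y \<in> T"
    by (auto simp: connected_component_def)
  then have "Y \<in> a_alg" by (auto simp: regular_set_def)
  then show "Y \<in> chamber p q r"
    using connected_same_sign[OF T] assms by (simp add: chamber_def)
next
  fix Y assume "Y \<in> chamber p q r"
  then show "Y \<in> connected_component_set regular_set X"
    using connected_component_maximal[OF assms(4) convex_connected[OF convex_chamber] chamber_regular[OF assms(1-3)]] by blast
qed

lemma chamber_in_components:
  assumes "p \<noteq> q" "q \<noteq> r" "p \<noteq> r" "X \<in> chamber p q r"
  shows "chamber p q r \<in> components regular_set"
  using chamber_component[OF assms] chamber_regular[OF assms(1-3)] assms(4)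
  by (metis componentsI subsetD)

lemma chamber_open_part:
  obtains Q where "open Q" "chamber p q r = a_alg \<inter> Q"
proof (rule that)
  show "open {X :: mat3. X $ p $ p > X $ q $ q \<and> X $ q $ q > X $ r $ r}"
    by (intro open_Collect_conj open_Collect_less continuous_intros)
qed (auto simp: chamber_def)

text \<open>The chamber is relatively open, so a component with \<open>X\<close> in its closure
  already meets it, and components that meet are equal.\<close>

lemma component_eq_chamber:
  assumes "p \<noteq> q" "q \<noteq> r" "p \<noteq> r" "X \<in> chamber p q r" "K \<in> components regular_set" "X \<in> closure K"
  shows "K = chamber p q r"
proof -
  obtain Q where Q: "open Q" "chamber p q r = a_alg \<inter> Q" by (rule chamber_open_part)
  have "Q \<inter> closure K \<noteq> {}" using assms(4,6) Q by blast
  then have "Q \<inter> K \<noteq> {}" using open_Int_closure_eq_empty[OF Q(1), of K] by blast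
  moreover have "K \<subseteq> a_alg" using in_components_subset[OF assms(5)] by (auto simp: regular_set_def)
  ultimately have "K \<inter> chamber p q r \<noteq> {}" using Q(2) by blast
  then show ?thesis using components_nonoverlap[OF assms(5) chamber_in_components[OF assms(1-4)]] by blast
qed

lemma weyl_chambers_eq: "weyl_chambers = closure ` components regular_set"
  by (simp add: weyl_chambers_def regular_set_def)

lemma chamber_subset_interior: "chamber p q r \<subseteq> interior_a (closure (chamber p q r))"
proof -
  obtain Q where "open Q" "chamber p q r = a_alg \<inter> Q" by (rule chamber_open_part)
  then have "openin (top_of_set a_alg) (chamber p q r)" by (auto simp: openin_open)
  then show ?thesis unfolding interior_a_def by (intro interior_of_maximal closure_subset)
qed

lemma closure_chamber_subset: "closure (chamber p q r) \<subseteq> {X. X $ p $ p \<ge> X $ q $ q \<and> X $ q $ q \<ge> X $ r $ r}"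
proof (rule closure_minimal)
  show "closed {X :: mat3. X $ p $ p \<ge> X $ q $ q \<and> X $ q $ q \<ge> X $ r $ r}"
    by (intro closed_Collect_conj closed_Collect_le continuous_intros)
qed (auto simp: chamber_def)

text \<open>An interior point may be moved slightly against \<open>D\<close> and stays in the
  closure, where the weak inequalities hold; moving back makes them strict.\<close>

lemma interior_chamber_subset:
  assumes "D \<in> chamber p q r"
  shows "interior_a (closure (chamber p q r)) \<subseteq> chamber p q r"
proof
  fix X assume "X \<in> interior_a (closure (chamber p q r))"
  then obtain T where T: "openin (top_of_set a_alg) T" "X \<in> T" "T \<subseteq> closure (chamber p q r)"
    unfolding interior_a_def interior_of_def by blast
  then obtain e where e: "e > 0" "ball X e \<inter> a_alg \<subseteq> T" unfolding openin_contains_ball by blast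
  have Xa: "X \<in> a_alg" using T(1,2) openin_imp_subset by blast
  define s where "s = e / (norm D + 1) / 2"
  have nz: "norm D + 1 > 0" by (simp add: add_nonneg_pos)
  have s0: "s > 0" using e(1) nz by (simp add: s_def)
  have "s * norm D \<le> s * (norm D + 1)" using s0 by simp
  also have "\<dots> = e / 2"
    unfolding s_def using nz by (metis less_irrefl nonzero_eq_divide_eq times_divide_eq_left)
  finally have "dist X (X - s *\<^sub>R D) < e" using e(1) s0 by (simp add: dist_norm)
  moreover have "X - s *\<^sub>R D \<in> a_alg"
    using Xa assms subspace_a_alg by (simp add: chamber_def subspace_diff subspace_scale)
  ultimately have "X - s *\<^sub>R D \<in> ball X e \<inter> a_alg" by (simp only: Int_iff mem_ball simp_thms)
  then have "X - s *\<^sub>R D \<in> closure (chamber p q r)" using e(2) T(3) by blast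
  from subsetD[OF closure_chamber_subset this] have "X $ p $ p - s * D $ p $ p \<ge> X $ q $ q - s * D $ q $ q" "X $ q $ q - s * D $ q $ q \<ge> X $ r $ r - s * D $ r $ r"
    by auto
  moreover have "s * D $ p $ p > s * D $ q $ q" "s * D $ q $ q > s * D $ r $ r"
    using assms s0 by (auto simp: chamber_def)
  ultimately show "X \<in> chamber p q r" using Xa by (simp add: chamber_def)
qed

lemma coroot_chamber:
  "r > 0 \<Longrightarrow> r *\<^sub>R coroot \<omega> \<in> chamber (root_row \<omega>) (other_index \<omega>) (root_col \<omega>)"
  "r < 0 \<Longrightarrow> r *\<^sub>R coroot \<omega> \<in> chamber (root_col \<omega>) (other_index \<omega>) (root_row \<omega>)"
  using subspace_scale[OF subspace_a_alg coroot_a_alg, of r \<omega>]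
  by (cases \<omega>; simp add: chamber_def coroot_def)+

lemma root_indices_distinct:
  "root_row \<omega> \<noteq> other_index \<omega>" "other_index \<omega> \<noteq> root_col \<omega>" "root_row \<omega> \<noteq> root_col \<omega>"
  by (cases \<omega>; simp)+

text \<open>The Killing form pairs with the coroot as a positive multiple of \<omega>, so up to a
  common sign the rays are the coroot and a vector on which \<omega> is nonnegative. The region
  being the chamber of the coroot, that vector lies in it exactly when its entry at \<open>k\<close>
  is strictly between the other two.\<close>

lemma ray_not_in_region_iff:
  fixes \<omega> :: pos_root and \<tau> :: mat3
  assumes "\<tau> \<in> a_alg" "\<tau> \<noteq> 0"
  defines "i \<equiv> root_row \<omega>" and "j \<equiv> root_col \<omega>" and "k \<equiv> other_index \<omega>"
  shows "ray_not_in_region \<omega> (span {\<tau>}) \<longleftrightarrow>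
    \<not> (\<tau>$i$i < \<tau>$k$k \<and> \<tau>$k$k < \<tau>$j$j \<or> \<tau>$j$j < \<tau>$k$k \<and> \<tau>$k$k < \<tau>$i$i)" (is "_ \<longleftrightarrow> \<not> ?B")
proof
  note d = root_indices_distinct[of \<omega>, folded i_def j_def k_def]
  note cc = coroot_chamber[of _ \<omega>, folded i_def j_def k_def]
  assume "\<not> ?B"
  \<comment> \<open>The sign for which the ray pairs nonnegatively with the coroot.\<close>
  define v where "v = (if \<tau>$i$i \<ge> \<tau>$j$j then \<tau> else - \<tau>)"
  have v0: "v \<noteq> 0" using assms(2) by (simp add: v_def)
  have va: "v \<in> a_alg" using assms(1) subspace_neg[OF subspace_a_alg] by (simp add: v_def)
  have vij: "v$i$i \<ge> v$j$j" by (auto simp: v_def)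
  have vB: "v \<notin> chamber i k j" using \<open>\<not> ?B\<close> by (auto simp: v_def chamber_def split: if_splits)
  define W where "W = closure (chamber i k j)"
  define tp ap where "tp = {r *\<^sub>R v | r. r \<ge> 0}" and "ap = {r *\<^sub>R coroot \<omega> | r. r \<ge> 0}"
  have co: "coroot \<omega> \<in> chamber i k j" using cc(1)[of 1] by simp
  have co0: "coroot \<omega> \<noteq> 0" using co by (auto simp: chamber_def)
  have "ray_choice \<omega> (span {\<tau>}) tp ap"
    unfolding ray_choice_def
  proof (intro conjI ballI)
    show "is_ray tp" "is_ray ap" using v0 co0 unfolding is_ray_def tp_def ap_def by blast+
    show "tp \<subseteq> span {\<tau>}"
    proof
      fix x assume "x \<in> tp"
      then obtain r where "x = r *\<^sub>R v" by (auto simp: tp_def)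
      then show "x \<in> span {\<tau>}" by (simp add: v_def span_scale span_base span_neg)
    qed
    show "ap \<subseteq> a_root \<omega>" by (auto simp: ap_def a_root_eq)
    fix t a assume "t \<in> tp" "a \<in> ap"
    then obtain r s where rs: "t = r *\<^sub>R v" "r \<ge> 0" "a = s *\<^sub>R coroot \<omega>" "s \<ge> 0" by (auto simp: tp_def ap_def)
    have "root_fun \<omega> t \<ge> 0" using rs(2) vij by (simp add: rs(1) root_fun_def i_def j_def mult_left_mono)
    then show "killing_form t a \<ge> 0"
      using rs va subspace_scale[OF subspace_a_alg va] by (simp add: killing_form_coroot)
  qed
  moreover have "is_region ap (interior_a W)"
    unfolding is_region_def
  proof (intro disjI1 bexI conjI refl)
    show "W \<in> weyl_chambers" unfolding W_def weyl_chambers_eq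
      by (intro imageI chamber_in_components[OF _ _ _ co]) (use d in auto)
    show "ap - {0} \<subseteq> interior_a W"
    proof
      fix x assume "x \<in> ap - {0}"
      then obtain r where "x = r *\<^sub>R coroot \<omega>" "r > 0" by (auto simp: ap_def le_less)
      then show "x \<in> interior_a W" using cc(1) chamber_subset_interior unfolding W_def by blast
    qed
  qed simp
  moreover have "\<not> tp - {0} \<subseteq> interior_a W"
  proof -
    have "v \<in> tp - {0}" using v0 by (auto simp: tp_def intro!: exI[of _ 1])
    then show ?thesis using vB interior_chamber_subset[OF co] unfolding W_def by blast
  qed
  ultimately show "ray_not_in_region \<omega> (span {\<tau>})" unfolding ray_not_in_region_def by blast
next
  note d = root_indices_distinct[of \<omega>, folded i_def j_def k_def]
  note cc = coroot_chamber[of _ \<omega>, folded i_def j_def k_def]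
  assume "ray_not_in_region \<omega> (span {\<tau>})"
  then obtain tp ap C where rc: "ray_choice \<omega> (span {\<tau>}) tp ap" and reg: "is_region ap C" and nC: "\<not> tp - {0} \<subseteq> C"
    unfolding ray_not_in_region_def by blast
  obtain v where v: "v \<noteq> 0" "tp = {r *\<^sub>R v | r. r \<ge> 0}" using rc unfolding ray_choice_def is_ray_def by blast
  obtain w where w: "w \<noteq> 0" "ap = {r *\<^sub>R w | r. r \<ge> 0}" using rc unfolding ray_choice_def is_ray_def by blast
  have vtp: "v \<in> tp" and wap: "w \<in> ap" unfolding v w by (auto intro!: exI[of _ 1])
  obtain r where r: "w = r *\<^sub>R coroot \<omega>" using rc wap unfolding ray_choice_def a_root_eq by blast
  obtain s where s: "v = s *\<^sub>R \<tau>" using rc vtp unfolding ray_choice_def span_singleton by blast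
  have r0: "r \<noteq> 0" and s0: "s \<noteq> 0" using r w(1) s v(1) by auto
  have va: "v \<in> a_alg" using s assms(1) subspace_scale[OF subspace_a_alg] by simp
  have "killing_form v w \<ge> 0" using rc vtp wap unfolding ray_choice_def by blast
  then have kf: "r * (v$i$i - v$j$j) \<ge> 0" by (simp add: r killing_form_coroot[OF va] root_fun_def i_def j_def mult.assoc)
  \<comment> \<open>The open chamber of the chosen coroot ray; it is contained in every admissible
    region.\<close>
  define P where "P = (if r > 0 then chamber i k j else chamber j k i)"
  have wP: "w \<in> P" using cc[of r] r0 by (auto simp: P_def r)
  have Keq: "K = P" if "K \<in> components regular_set" "w \<in> closure K" for K
    using component_eq_chamber[of i k j w K] component_eq_chamber[of j k i w K] that wP d
    by (auto simp: P_def split: if_splits)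
  have PC: "P \<subseteq> C"
    using reg unfolding is_region_def
  proof
    assume "\<exists>W\<in>weyl_chambers. ap - {0} \<subseteq> interior_a W \<and> C = interior_a W"
    then obtain K where K: "K \<in> components regular_set" "ap - {0} \<subseteq> interior_a (closure K)" "C = interior_a (closure K)"
      unfolding weyl_chambers_eq by blast
    have "w \<in> interior_a (closure K)" using K(2) wap w(1) by blast
    then have "w \<in> closure K" unfolding interior_a_def by (rule subsetD[OF interior_of_subset])
    then have "K = P" using Keq K(1) by blast
    then show ?thesis using chamber_subset_interior[of i k j] chamber_subset_interior[of j k i]
      unfolding K(3) by (simp add: P_def)
  next
    \<comment> \<open>The wall alternative cannot occur: \<open>w\<close> would lie in the closures
      of two different components, but it belongs to the open chamber \<open>P\<close>.\<close>
    assume "\<exists>W1\<in>weyl_chambers. \<exists>W2\<in>weyl_chambers. W1 \<noteq> W2 \<and> ap = W1 \<inter> W2 \<and> C = interior_a (W1 \<union> ap \<union> W2)"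
    then obtain K1 K2 where K: "K1 \<in> components regular_set" "K2 \<in> components regular_set"
      "closure K1 \<noteq> closure K2" "ap = closure K1 \<inter> closure K2"
      unfolding weyl_chambers_eq by blast
    have "w \<in> closure K1" "w \<in> closure K2" using wap K(4) by blast+
    from Keq[OF K(1) this(1)] Keq[OF K(2) this(2)] have "K1 = K2" by simp
    then show ?thesis using K(3) by simp
  qed
  show "\<not> ?B"
  proof
    assume B: ?B
    obtain x where x: "x \<in> tp" "x \<noteq> 0" "x \<notin> C" using nC by blast
    then obtain q where q: "x = q *\<^sub>R v" "q > 0" unfolding v by (auto simp: le_less)
    have vB: "v$i$i < v$k$k \<and> v$k$k < v$j$j \<or> v$j$j < v$k$k \<and> v$k$k < v$i$i"
      using B s0 by (cases "s > 0") (auto simp: s)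
    have "v \<in> P"
    proof (cases "r > 0")
      case True
      then have "v$i$i \<ge> v$j$j" using kf by (simp add: zero_le_mult_iff)
      then show ?thesis using True vB va by (auto simp: P_def chamber_def)
    next
      case False
      then have "v$i$i \<le> v$j$j" using kf r0 by (simp add: zero_le_mult_iff)
      then show ?thesis using False vB va by (auto simp: P_def chamber_def)
    qed
    then have "x \<in> P" using q subspace_scale[OF subspace_a_alg va] by (auto simp: P_def chamber_def split: if_splits)
    then show False using PC x(3) by blast
  qed
qed

section \<open>Subgroups generated by two one-parameter groups\<close>

lemma dim_ge_3:
  fixes x y z :: "'a::euclidean_space"
  assumes "\<And>r s t. r *\<^sub>R x + s *\<^sub>R y + t *\<^sub>R z = 0 \<Longrightarrow> r = 0 \<and> s = 0 \<and> t = 0" "x \<in> S" "y \<in> S" "z \<in> S"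
  shows "3 \<le> dim S"
proof -
  have z: "z \<noteq> 0" using assms(1)[of 0 0 1] by auto
  have y: "y \<notin> span {z}"
  proof
    assume "y \<in> span {z}"
    then obtain k where "y = k *\<^sub>R z" unfolding span_singleton by blast
    then show False using assms(1)[of 0 1 "-k"] by simp
  qed
  have x: "x \<notin> span {y, z}"
  proof
    assume "x \<in> span {y, z}"
    then obtain k l where "x - k *\<^sub>R y = l *\<^sub>R z" unfolding span_insert[of y] span_singleton by blast
    then show False using assms(1)[of 1 "-k" "-l"] by (simp add: algebra_simps)
  qed
  have n: "y \<noteq> z" "x \<noteq> y" "x \<noteq> z" using x y span_base[of _ "{y, z}"] span_base[of z "{z}"] by auto
  have "independent {x, y, z}" using x y z n by (simp add: independent_insert)
  then have "card {x, y, z} \<le> dim S" using assms(2-4) by (intro independent_card_le_dim) auto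
  then show ?thesis using n by simp
qed

lemma dim_le_2:
  fixes x y :: "'a::euclidean_space"
  assumes "S \<subseteq> span {x, y}"
  shows "dim S \<le> 2"
proof -
  have "dim S \<le> card {x, y}" using assms by (intro dim_le_card) auto
  also have "\<dots> \<le> 2" by (simp add: card_insert_if)
  finally show ?thesis .
qed

text \<open>Both sizes are continuous, so nearby elements of \<open>S\<close> serve with twice the
  constant. Non-density can thus be checked on explicit products instead of their closures.\<close>

lemma coarsely_dense_closure:
  assumes "coarsely_dense (closure S)"
  shows "coarsely_dense S"
proof -
  obtain M where M: "\<And>X Z. 1 \<le> Z \<Longrightarrow> Z \<le> X \<Longrightarrow>
     (\<exists>h\<in>closure S. matches M X (X * Z) h)"
    using assms unfolding coarsely_dense_def by blast
  show ?thesis unfolding coarsely_dense_def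
  proof (intro exI[of _ "2 * M"] allI impI)
    fix X Z :: real assume XZ: "1 \<le> Z \<and> Z \<le> X"
    then obtain h where h: "h \<in> closure S" "norm h \<le> M * X" "X \<le> M * norm h"
      "norm (adj3 h) \<le> M * (X * Z)" "X * Z \<le> M * norm (adj3 h)" using M by blast
    have "0 < X" "0 < X * Z" using XZ by auto
    then have "0 < M * norm h" "0 < M * norm (adj3 h)" using h by linarith+
    then have n: "0 < norm h" "0 < norm (adj3 h)" "0 < M"
      by (auto simp: zero_less_mult_iff not_less[symmetric])
    obtain f where f: "\<And>n. f n \<in> S" "f \<longlonglongrightarrow> h" using h(1) unfolding closure_sequential by blast
    have l: "(\<lambda>n. norm (f n)) \<longlonglongrightarrow> norm h" "(\<lambda>n. norm (adj3 (f n))) \<longlonglongrightarrow> norm (adj3 h)"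
      by (intro tendsto_intros f)+
    have "eventually (\<lambda>n. norm (f n) < 2 * norm h \<and> norm (f n) > norm h / 2
        \<and> norm (adj3 (f n)) < 2 * norm (adj3 h) \<and> norm (adj3 (f n)) > norm (adj3 h) / 2) sequentially"
      by (intro eventually_conj order_tendstoD[OF l(1)] order_tendstoD[OF l(2)]) (use n in auto)
    then obtain m where m: "norm (f m) < 2 * norm h" "norm (f m) > norm h / 2"
        "norm (adj3 (f m)) < 2 * norm (adj3 h)" "norm (adj3 (f m)) > norm (adj3 h) / 2"
      unfolding eventually_sequentially by blast
    have "M * (norm h / 2) \<le> M * norm (f m)" "M * (norm (adj3 h) / 2) \<le> M * norm (adj3 (f m))"
      using m n by (auto intro!: mult_left_mono)
    then show "\<exists>h\<in>S. matches (2 * M) X (X * Z) h"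
      using m h f(1)[of m] by (intro bexI[of _ "f m"] conjI) auto
  qed
qed

lemma subgroup_SL3I:
  assumes "L \<subseteq> carrier SL3" "mat 1 \<in> L" "\<And>x y. x \<in> L \<Longrightarrow> y \<in> L \<Longrightarrow> x ** y \<in> L" "\<And>x. x \<in> L \<Longrightarrow> adj3 x \<in> L"
  shows "subgroup L SL3"
proof (rule group.subgroupI[OF group_SL3])
  fix x assume x: "x \<in> L"
  then have "det x = 1" using assms(1) by (auto simp: SL3_iff)
  then show "inv\<^bsub>SL3\<^esub> x \<in> L" using assms(4)[OF x] inv_SL3 by simp
qed (use assms in auto)

lemma closed_sg_closure:
  assumes "subgroup L SL3"
  shows "closed_sg (closure L)"
proof (rule closed_sg.intro)
  have LS: "L \<subseteq> carrier SL3" by (rule subgroup.subset[OF assms])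
  have cS: "closure L \<subseteq> carrier SL3" by (rule closure_minimal[OF LS closed_SL3])
  show "closedin (top_of_set (carrier SL3)) (closure L)" using cS by (simp add: closed_subset)
  show "subgroup (closure L) SL3"
  proof (rule subgroup_SL3I[OF cS])
    show "mat 1 \<in> closure L" using subgroup.one_closed[OF assms] closure_subset by auto
  next
    fix x y assume "x \<in> closure L" "y \<in> closure L"
    then obtain f g where f: "\<And>n. f n \<in> L" "f \<longlonglongrightarrow> x" and g: "\<And>n. g n \<in> L" "g \<longlonglongrightarrow> y"
      unfolding closure_sequential by blast
    have "(\<lambda>n. f n ** g n) \<longlonglongrightarrow> x ** y" by (intro tendsto_intros f g)
    moreover have "f n ** g n \<in> L" for n using subgroup.m_closed[OF assms f(1) g(1)] by simp
    ultimately show "x ** y \<in> closure L"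
      unfolding closure_sequential by (intro exI[of _ "\<lambda>n. f n ** g n"]) simp
  next
    fix x assume "x \<in> closure L"
    then obtain f where f: "\<And>n. f n \<in> L" "f \<longlonglongrightarrow> x"
      unfolding closure_sequential by blast
    have "(\<lambda>n. adj3 (f n)) \<longlonglongrightarrow> adj3 x" by (intro tendsto_intros f)
    moreover have "adj3 (f n) \<in> L" for n
    proof -
      have "det (f n) = 1" using f(1)[of n] LS by (auto simp: SL3_iff)
      then show ?thesis using subgroup.m_inv_closed[OF assms f(1)[of n]] inv_SL3 by simp
    qed
    ultimately show "adj3 x \<in> closure L"
      unfolding closure_sequential by (intro exI[of _ "\<lambda>n. adj3 (f n)"]) simp
  qed
qed

text \<open>Apart from \<open>A_grp\<close>, the groups of dimension at most two in the case
  analysis are handled through products of this form; \<open>W = 0\<close> covers single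
  one-parameter groups.\<close>

definition two_exp :: "mat3 \<Rightarrow> mat3 \<Rightarrow> mat3 set" where
  "two_exp Y W = {mexp (t *\<^sub>R Y) ** mexp (s *\<^sub>R W) | t s. True}"

lemma two_expI: "mexp (t *\<^sub>R Y) ** mexp (s *\<^sub>R W) \<in> two_exp Y W"
  by (auto simp: two_exp_def)

lemma det_mexp_ut:
  assumes "a + b + c = 0" shows "det (mexp (t *\<^sub>R ut a b c u v w)) = 1"
proof -
  obtain p q r where "mexp (ut (t*a) (t*b) (t*c) (t*u) (t * v) (t*w)) = ut (exp (t*a)) (exp (t*b)) (exp (t*c)) p q r"
    using mexp_ut by blast
  then have "det (mexp (t *\<^sub>R ut a b c u v w)) = exp (t * (a + b + c))"
    by (simp add: ut_scale ut_det distrib_left exp_add)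
  then show ?thesis by (simp add: assms)
qed

text \<open>The last hypothesis says that the first one-parameter group normalizes the
  second.\<close>

lemma subgroup_two_exp:
  assumes dY: "\<And>t. det (mexp (t *\<^sub>R Y)) = 1" and dW: "\<And>t. det (mexp (t *\<^sub>R W)) = 1"
    and comm: "\<And>s t. \<exists>s'. mexp (s *\<^sub>R W) ** mexp (t *\<^sub>R Y) = mexp (t *\<^sub>R Y) ** mexp (s' *\<^sub>R W)"
  shows "subgroup (two_exp Y W) SL3"
proof (rule subgroup_SL3I)
  show "two_exp Y W \<subseteq> carrier SL3" by (auto simp: two_exp_def SL3_iff det_mul dY dW)
  show "mat 1 \<in> two_exp Y W" using two_expI[of 0 Y 0 W] by simp
next
  fix x y assume "x \<in> two_exp Y W" "y \<in> two_exp Y W"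
  then obtain t s t' s' where xy: "x = mexp (t *\<^sub>R Y) ** mexp (s *\<^sub>R W)" "y = mexp (t' *\<^sub>R Y) ** mexp (s' *\<^sub>R W)"
    by (auto simp: two_exp_def)
  obtain r where r: "mexp (s *\<^sub>R W) ** mexp (t' *\<^sub>R Y) = mexp (t' *\<^sub>R Y) ** mexp (r *\<^sub>R W)" using comm by blast
  have "x ** y = mexp (t *\<^sub>R Y) ** (mexp (s *\<^sub>R W) ** mexp (t' *\<^sub>R Y)) ** mexp (s' *\<^sub>R W)"
    by (simp add: xy matrix_mul_assoc)
  also have "\<dots> = (mexp (t *\<^sub>R Y) ** mexp (t' *\<^sub>R Y)) ** (mexp (r *\<^sub>R W) ** mexp (s' *\<^sub>R W))"
    unfolding r by (simp add: matrix_mul_assoc)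
  also have "\<dots> = mexp ((t + t') *\<^sub>R Y) ** mexp ((r + s') *\<^sub>R W)" by (simp only: mexp_add_scale)
  finally show "x ** y \<in> two_exp Y W" using two_expI by simp
next
  fix x assume "x \<in> two_exp Y W"
  then obtain t s where x: "x = mexp (t *\<^sub>R Y) ** mexp (s *\<^sub>R W)" by (auto simp: two_exp_def)
  have "adj3 x = mexp ((- s) *\<^sub>R W) ** mexp ((- t) *\<^sub>R Y)"
  proof (rule adj3_unique)
    show "det x = 1" by (simp add: x det_mul dY dW)
    have "mexp ((- s) *\<^sub>R W) ** mexp ((- t) *\<^sub>R Y) ** x
        = mexp ((- s) *\<^sub>R W) ** (mexp ((- t) *\<^sub>R Y) ** mexp (t *\<^sub>R Y)) ** mexp (s *\<^sub>R W)"
      by (simp only: x matrix_mul_assoc)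
    also have "\<dots> = mat 1" unfolding mexp_add_scale by (simp add: mexp_minus)
    finally show "mexp ((- s) *\<^sub>R W) ** mexp ((- t) *\<^sub>R Y) ** x = mat 1" .
  qed
  then show "adj3 x \<in> two_exp Y W" using comm[of "-s" "-t"] two_expI by metis
qed

context closed_sg
begin

text \<open>\<open>H \<inter> L\<close> is a closed subgroup of \<open>H\<close> containing all
  one-parameter groups of \<open>H\<close>, hence it is all of \<open>H\<close>.\<close>

lemma connected_subset:
  assumes "connected H" "closed_sg L" "lie \<subseteq> lie_algebra L"
  shows "H \<subseteq> L"
proof -
  interpret L: closed_sg L by fact
  have "H = H \<inter> L"
  proof (rule connected_contained[OF assms(1)])
    show "subgroup (H \<inter> L) SL3"
      by (rule subgroup_subset) (auto simp: one_H L.one_H mult_H L.mult_H adj3_H L.adj3_H)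
    show "closed (H \<inter> L)" by (intro closed_Int closed_H L.closed_H)
    fix X assume "X \<in> lie"
    then show "mexp X \<in> H \<inter> L" using mexp_lie[of X 1] L.mexp_lie[of X 1] assms(3) by auto
  qed blast
  then show ?thesis by blast
qed

lemma subset_closure_two_exp:
  assumes "connected H" "subgroup (two_exp Y W) SL3" "lie \<subseteq> span {Y, W}"
  shows "H \<subseteq> closure (two_exp Y W)"
proof (rule connected_subset[OF assms(1) closed_sg_closure[OF assms(2)]])
  interpret L: closed_sg "closure (two_exp Y W)" by (rule closed_sg_closure[OF assms(2)])
  have "mexp (t *\<^sub>R Y) \<in> closure (two_exp Y W)" "mexp (t *\<^sub>R W) \<in> closure (two_exp Y W)" for t
    using two_expI[of t Y 0 W] two_expI[of 0 Y t W] closure_subset by auto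
  then have "{Y, W} \<subseteq> L.lie" by (auto intro: L.lieI)
  then have "span {Y, W} \<subseteq> L.lie" by (intro span_minimal L.subspace_lie)
  then show "lie \<subseteq> L.lie" using assms(3) by blast
qed

lemma eq_two_exp:
  assumes "connected H" "subgroup (two_exp Y W) SL3" "lie \<subseteq> span {Y, W}" "closed (two_exp Y W)" "Y \<in> lie" "W \<in> lie"
  shows "H = two_exp Y W"
proof
  show "H \<subseteq> two_exp Y W" using subset_closure_two_exp[OF assms(1-3)] assms(4) by simp
  show "two_exp Y W \<subseteq> H" using assms(5,6) by (auto simp: two_exp_def intro: mult_H mexp_lie)
qed

lemma not_coarsely_dense_two_exp:
  assumes "connected H" "subgroup (two_exp Y W) SL3" "lie \<subseteq> span {Y, W}" "\<not> coarsely_dense (two_exp Y W)"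
  shows "\<not> coarsely_dense H"
proof
  assume "coarsely_dense H"
  from coarsely_dense_closure[OF coarsely_dense_mono[OF this subset_closure_two_exp[OF assms(1-3)]]]
  show False using assms(4) by contradiction
qed

end

section \<open>Explicit two-parameter groups: closed forms, closedness, group property\<close>

lemma mexp_ker_alpha: "mexp (ut a a c g 0 0) = ut (exp a) (exp a) (exp c) (g * exp a) 0 0"
proof -
  have "mexp (ut a a c 0 0 0) ** mexp (ut 0 0 0 g 0 0) = mexp (ut a a c 0 0 0 + ut 0 0 0 g 0 0)"
    by (rule mexp_add) (simp add: ut_mult ut_eq_iff)
  then show ?thesis by (simp add: ut_add mexp_diag mexp_unip ut_mult mult.commute)
qed

lemma mexp_ker_beta: "mexp (ut a b b 0 g 0) = ut (exp a) (exp b) (exp b) 0 (g * exp b) 0"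
proof -
  have "mexp (ut a b b 0 0 0) ** mexp (ut 0 0 0 0 g 0) = mexp (ut a b b 0 0 0 + ut 0 0 0 0 g 0)"
    by (rule mexp_add) (simp add: ut_mult ut_eq_iff)
  then show ?thesis by (simp add: ut_add mexp_diag mexp_unip ut_mult mult.commute)
qed

lemma mexp_ker_alpha_beta: "mexp (ut a b a 0 0 g) = ut (exp a) (exp b) (exp a) 0 0 (g * exp a)"
proof -
  have "mexp (ut a b a 0 0 0) ** mexp (ut 0 0 0 0 0 g) = mexp (ut a b a 0 0 0 + ut 0 0 0 0 0 g)"
    by (rule mexp_add) (simp add: ut_mult ut_eq_iff)
  then show ?thesis by (simp add: ut_add mexp_diag mexp_unip ut_mult mult.commute)
qed

abbreviation (input) AN :: "mat3 set" where "AN \<equiv> A_grp \<odot> N_grp"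

lemma closed_AN: "closed AN"
proof -
  have "AN = carrier SL3 \<inter> {g. g$2$1 = 0 \<and> g$3$1 = 0 \<and> g$3$2 = 0 \<and> 0 \<le> g$1$1 \<and> 0 \<le> g$2$2 \<and> 0 \<le> g$3$3}"
    (is "_ = _ \<inter> ?S")
  proof (intro equalityI subsetI)
    fix g assume "g \<in> AN"
    then show "g \<in> carrier SL3 \<inter> ?S" unfolding AN_iff by (auto simp: SL3_iff ut_det)
  next
    fix g assume g: "g \<in> carrier SL3 \<inter> ?S"
    have e: "g = ut (g$1$1) (g$2$2) (g$3$3) (g$1$2) (g$2$3) (g$1$3)" by (rule ut_exhaust) (use g in auto)
    \<comment> \<open>Nonnegative diagonal entries are a closed condition, and with product 1 they
      are automatically positive.\<close>
    have p: "g$1$1 * g$2$2 * g$3$3 = 1" using g by (auto simp: SL3_iff det_3)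
    then have "g$1$1 \<noteq> 0" "g$2$2 \<noteq> 0" "g$3$3 \<noteq> 0" by auto
    then have q: "0 < g$1$1" "0 < g$2$2" "0 < g$3$3" using g by auto
    show "g \<in> AN" unfolding AN_iff by (intro exI conjI) (rule q p e)+
  qed
  moreover have "closed ?S"
    by (intro closed_Collect_conj closed_Collect_eq closed_Collect_le continuous_intros)
  ultimately show ?thesis using closed_SL3 by (simp add: closed_Int)
qed

lemma AN_diag_pos: "g \<in> AN \<Longrightarrow> g$1$1 > 0 \<and> g$2$2 > 0 \<and> g$3$3 > 0"
  unfolding AN_iff by auto

text \<open>\<open>L\<close> is the fixed point set of a continuous retraction \<open>f\<close> of
  the closed set \<open>AN\<close>.\<close>

lemma closed_parametrized:
  assumes "L \<subseteq> AN" "\<And>x. x \<in> L \<Longrightarrow> f x = x" "\<And>x. x \<in> AN \<Longrightarrow> f x \<in> L" "continuous_on AN f"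
  shows "closed L"
proof -
  have "L = {x \<in> AN. f x - x = 0}" using assms(1-3) by force
  moreover have "closed {x \<in> AN. f x - x = 0}"
    by (intro continuous_closed_preimage_constant closed_AN continuous_intros assms(4))
  ultimately show ?thesis by simp
qed

lemma continuous_on_ut [continuous_intros]:
  assumes "continuous_on S a" "continuous_on S b" "continuous_on S c" "continuous_on S u" "continuous_on S v" "continuous_on S w"
  shows "continuous_on S (\<lambda>x. ut (a x) (b x) (c x) (u x) (v x) (w x))"
  using assms unfolding continuous_on_def by (auto intro!: tendsto_intros)

lemma continuous_on_log_diag [continuous_intros]:
  "continuous_on AN (\<lambda>x. ln (x$1$1))" "continuous_on AN (\<lambda>x. ln (x$2$2))" "continuous_on AN (\<lambda>x. ln (x$3$3))"
  by (intro continuous_intros; use AN_diag_pos in force)+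

lemma exp_AN: "a + b + c = 0 \<Longrightarrow> ut (exp (t*a)) (exp (t*b)) (exp (t*c)) u v w \<in> AN"
  unfolding AN_iff
  by (intro exI[of _ "exp (t*a)"] exI[of _ "exp (t*b)"] exI[of _ "exp (t*c)"] exI[of _ u] exI[of _ v] exI[of _ w])
    (simp flip: exp_add distrib_left)

lemma closed_A_grp: "closed A_grp"
proof (rule closed_parametrized[where f = "\<lambda>x. ut (x$1$1) (x$2$2) (x$3$3) 0 0 0"])
  show "A_grp \<subseteq> AN" by (metis A_grp_iff AN_iff subsetI)
  show "ut (x$1$1) (x$2$2) (x$3$3) 0 0 0 = x" if "x \<in> A_grp" for x using that unfolding A_grp_iff by auto
  show "ut (x$1$1) (x$2$2) (x$3$3) 0 0 0 \<in> A_grp" if x: "x \<in> AN" for x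
  proof -
    obtain a b c u v w where "a > 0" "b > 0" "c > 0" "a * b * c = 1" "x = ut a b c u v w"
      using x AN_iff by blast
    then show ?thesis unfolding A_grp_iff by (intro exI[of _ a] exI[of _ b] exI[of _ c]) simp
  qed
qed (intro continuous_intros)

definition root_vec :: "pos_root \<Rightarrow> mat3" where
  "root_vec \<omega> = (case \<omega> of Alpha \<Rightarrow> ut 0 0 0 1 0 0 | Beta \<Rightarrow> ut 0 0 0 0 1 0 | AlphaBeta \<Rightarrow> ut 0 0 0 0 0 1)"

lemma root_space_eq: "root_space \<omega> = range (\<lambda>s. s *\<^sub>R root_vec \<omega>)"
proof (intro equalityI subsetI)
  fix X assume "X \<in> root_space \<omega>"
  then have "X = (X $ root_row \<omega> $ root_col \<omega>) *\<^sub>R root_vec \<omega>"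
    unfolding root_space_def by (cases \<omega>) (simp_all add: mat3_eq_iff root_vec_def)
  then show "X \<in> range (\<lambda>s. s *\<^sub>R root_vec \<omega>)" by blast
next
  fix X assume "X \<in> range (\<lambda>s. s *\<^sub>R root_vec \<omega>)"
  then show "X \<in> root_space \<omega>"
    unfolding root_space_def by (cases \<omega>) (auto simp: root_vec_def forall_3)
qed

lemma set_prod_root_group: "mexp ` span {\<tau>} \<odot> root_group \<omega> = two_exp \<tau> (root_vec \<omega>)"
proof -
  have "x \<in> mexp ` span {\<tau>} \<odot> root_group \<omega> \<longleftrightarrow> x \<in> two_exp \<tau> (root_vec \<omega>)" for x
    unfolding set_prod_iff two_exp_def root_group_def root_space_eq span_singleton by auto
  then show ?thesis by blast
qed

lemma two_exp_alpha:
  "two_exp (ut a b c 0 0 0) (ut 0 0 0 1 0 0) = {ut (exp (t*a)) (exp (t*b)) (exp (t*c)) s 0 0 | t s. True}"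
proof (intro equalityI subsetI)
  fix x assume "x \<in> {ut (exp (t*a)) (exp (t*b)) (exp (t*c)) s 0 0 | t s. True}"
  then obtain t s where "x = ut (exp (t*a)) (exp (t*b)) (exp (t*c)) s 0 0" by blast
  then have "x = mexp (t *\<^sub>R ut a b c 0 0 0) ** mexp ((s / exp (t*a)) *\<^sub>R ut 0 0 0 1 0 0)"
    by (simp add: ut_scale mexp_diag mexp_unip ut_mult)
  then show "x \<in> two_exp (ut a b c 0 0 0) (ut 0 0 0 1 0 0)" using two_expI by simp
qed (auto simp: two_exp_def ut_scale mexp_diag mexp_unip ut_mult)

lemma two_exp_beta:
  "two_exp (ut a b c 0 0 0) (ut 0 0 0 0 1 0) = {ut (exp (t*a)) (exp (t*b)) (exp (t*c)) 0 s 0 | t s. True}"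
proof (intro equalityI subsetI)
  fix x assume "x \<in> {ut (exp (t*a)) (exp (t*b)) (exp (t*c)) 0 s 0 | t s. True}"
  then obtain t s where "x = ut (exp (t*a)) (exp (t*b)) (exp (t*c)) 0 s 0" by blast
  then have "x = mexp (t *\<^sub>R ut a b c 0 0 0) ** mexp ((s / exp (t*b)) *\<^sub>R ut 0 0 0 0 1 0)"
    by (simp add: ut_scale mexp_diag mexp_unip ut_mult)
  then show "x \<in> two_exp (ut a b c 0 0 0) (ut 0 0 0 0 1 0)" using two_expI by simp
qed (auto simp: two_exp_def ut_scale mexp_diag mexp_unip ut_mult)

lemma two_exp_alpha_beta:
  "two_exp (ut a b c 0 0 0) (ut 0 0 0 0 0 1) = {ut (exp (t*a)) (exp (t*b)) (exp (t*c)) 0 0 s | t s. True}"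
proof (intro equalityI subsetI)
  fix x assume "x \<in> {ut (exp (t*a)) (exp (t*b)) (exp (t*c)) 0 0 s | t s. True}"
  then obtain t s where "x = ut (exp (t*a)) (exp (t*b)) (exp (t*c)) 0 0 s" by blast
  then have "x = mexp (t *\<^sub>R ut a b c 0 0 0) ** mexp ((s / exp (t*a)) *\<^sub>R ut 0 0 0 0 0 1)"
    by (simp add: ut_scale mexp_diag mexp_unip ut_mult)
  then show "x \<in> two_exp (ut a b c 0 0 0) (ut 0 0 0 0 0 1)" using two_expI by simp
qed (auto simp: two_exp_def ut_scale mexp_diag mexp_unip ut_mult)

lemma two_exp_ker_alpha:
  "two_exp (ut 1 1 (-2) 0 0 0) (ut 0 0 0 0 1 p) = {ut (exp t) (exp t) (exp (-2*t)) 0 s (p * s) | t s. True}"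
proof (intro equalityI subsetI)
  fix x assume "x \<in> {ut (exp t) (exp t) (exp (-2*t)) 0 s (p * s) | t s. True}"
  then obtain t s where "x = ut (exp t) (exp t) (exp (-2*t)) 0 s (p * s)" by blast
  then have "x = mexp (t *\<^sub>R ut 1 1 (-2) 0 0 0) ** mexp ((s / exp t) *\<^sub>R ut 0 0 0 0 1 p)"
    by (simp add: ut_scale mexp_diag mexp_unip ut_mult ut_eq_iff mult.commute)
  then show "x \<in> two_exp (ut 1 1 (-2) 0 0 0) (ut 0 0 0 0 1 p)" using two_expI by simp
next
  fix x assume "x \<in> two_exp (ut 1 1 (-2) 0 0 0) (ut 0 0 0 0 1 p)"
  then obtain t s where "x = mexp (t *\<^sub>R ut 1 1 (-2) 0 0 0) ** mexp (s *\<^sub>R ut 0 0 0 0 1 p)"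
    by (auto simp: two_exp_def)
  then have "x = ut (exp t) (exp t) (exp (-2*t)) 0 (exp t * s) (p * (exp t * s))"
    by (simp add: ut_scale mexp_diag mexp_unip ut_mult ut_eq_iff)
  then show "x \<in> {ut (exp t) (exp t) (exp (-2*t)) 0 s (p * s) | t s. True}" by blast
qed

lemma two_exp_ker_beta:
  "two_exp (ut (-2) 1 1 0 0 0) (ut 0 0 0 1 0 p) = {ut (exp (-2*t)) (exp t) (exp t) s 0 (p * s) | t s. True}"
proof (intro equalityI subsetI)
  fix x assume "x \<in> {ut (exp (-2*t)) (exp t) (exp t) s 0 (p * s) | t s. True}"
  then obtain t s where "x = ut (exp (-2*t)) (exp t) (exp t) s 0 (p * s)" by blast
  then have "x = mexp (t *\<^sub>R ut (-2) 1 1 0 0 0) ** mexp ((s / exp (-2*t)) *\<^sub>R ut 0 0 0 1 0 p)"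
    by (simp add: ut_scale mexp_diag mexp_unip ut_mult ut_eq_iff mult.commute)
  then show "x \<in> two_exp (ut (-2) 1 1 0 0 0) (ut 0 0 0 1 0 p)" using two_expI by simp
next
  fix x assume "x \<in> two_exp (ut (-2) 1 1 0 0 0) (ut 0 0 0 1 0 p)"
  then obtain t s where "x = mexp (t *\<^sub>R ut (-2) 1 1 0 0 0) ** mexp (s *\<^sub>R ut 0 0 0 1 0 p)"
    by (auto simp: two_exp_def)
  then have "x = ut (exp (-2*t)) (exp t) (exp t) (exp (-2*t) * s) 0 (p * (exp (-2*t) * s))"
    by (simp add: ut_scale mexp_diag mexp_unip ut_mult ut_eq_iff)
  then show "x \<in> {ut (exp (-2*t)) (exp t) (exp t) s 0 (p * s) | t s. True}" by blast
qed

lemma two_exp_unipotent: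
  "two_exp (ut 0 0 0 1 p 0) (ut 0 0 0 0 0 1) = {ut 1 1 1 s (p * s) t | s t. True}"
proof (intro equalityI subsetI)
  fix x assume "x \<in> {ut 1 1 1 s (p * s) t | s t. True}"
  then obtain s t where "x = ut 1 1 1 s (p * s) t" by blast
  then have "x = mexp (s *\<^sub>R ut 0 0 0 1 p 0) ** mexp ((t - s * (s * p) / 2) *\<^sub>R ut 0 0 0 0 0 1)"
    by (simp add: ut_scale mexp_unip ut_mult ut_eq_iff)
  then show "x \<in> two_exp (ut 0 0 0 1 p 0) (ut 0 0 0 0 0 1)" using two_expI by simp
next
  fix x assume "x \<in> two_exp (ut 0 0 0 1 p 0) (ut 0 0 0 0 0 1)"
  then obtain t s where "x = mexp (t *\<^sub>R ut 0 0 0 1 p 0) ** mexp (s *\<^sub>R ut 0 0 0 0 0 1)"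
    by (auto simp: two_exp_def)
  then have "x = ut 1 1 1 t (p * t) (s + t * (t * p) / 2)"
    by (simp add: ut_scale mexp_unip ut_mult ut_eq_iff)
  then show "x \<in> {ut 1 1 1 s (p * s) t | s t. True}" by blast
qed

lemma closed_root:
  fixes a b c :: real
  assumes "a + b + c = 0" "ut a b c 0 0 0 \<noteq> 0"
  shows "closed (two_exp (ut a b c 0 0 0) (root_vec \<omega>))"
proof -
  define n where "n = a\<^sup>2 + b\<^sup>2 + c\<^sup>2"
  have "a \<noteq> 0 \<or> b \<noteq> 0 \<or> c \<noteq> 0" using assms(2) by (auto simp: ut_zero)
  then have n: "n \<noteq> 0" unfolding n_def by (metis add_nonneg_eq_0_iff power_eq_0_iff zero_le_power2 add_nonneg_nonneg)
  \<comment> \<open>Recovers \<open>t\<close> from the diagonal: the logarithms are \<open>t\<close>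
    times (a, b, c), and \<open>n\<close> is the squared length of (a, b, c).\<close>
  define T where "T x = (a * ln (x$1$1) + b * ln (x$2$2) + c * ln (x$3$3)) / n" for x :: mat3
  have Tc: "continuous_on AN T" unfolding T_def by (intro continuous_intros) (simp add: n)
  have T: "T (ut (exp (t*a)) (exp (t*b)) (exp (t*c)) u v w) = t" for t u v w
  proof -
    have "a * (t*a) + b * (t*b) + c * (t*c) = t * n" by (simp add: n_def power2_eq_square algebra_simps)
    then show ?thesis using n by (simp add: T_def)
  qed
  show ?thesis
  proof (cases \<omega>)
    case Alpha
    show ?thesis unfolding Alpha root_vec_def pos_root.case two_exp_alpha
      by (rule closed_parametrized[where f = "\<lambda>x. ut (exp (T x * a)) (exp (T x * b)) (exp (T x * c)) (x$1$2) 0 0"])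
        (use exp_AN[OF assms(1)] T in \<open>auto intro!: continuous_intros Tc\<close>)
  next
    case Beta
    show ?thesis unfolding Beta root_vec_def pos_root.case two_exp_beta
      by (rule closed_parametrized[where f = "\<lambda>x. ut (exp (T x * a)) (exp (T x * b)) (exp (T x * c)) 0 (x$2$3) 0"])
        (use exp_AN[OF assms(1)] T in \<open>auto intro!: continuous_intros Tc\<close>)
  next
    case AlphaBeta
    show ?thesis unfolding AlphaBeta root_vec_def pos_root.case two_exp_alpha_beta
      by (rule closed_parametrized[where f = "\<lambda>x. ut (exp (T x * a)) (exp (T x * b)) (exp (T x * c)) 0 0 (x$1$3)"])
        (use exp_AN[OF assms(1)] T in \<open>auto intro!: continuous_intros Tc\<close>)
  qed
qed

lemma closed_ker_alpha: "closed (two_exp (ut 1 1 (-2) 0 0 0) (ut 0 0 0 0 1 p))"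
  unfolding two_exp_ker_alpha
proof (rule closed_parametrized[where f = "\<lambda>x. ut (exp (ln (x$1$1))) (exp (ln (x$1$1))) (exp (-2 * ln (x$1$1))) 0 (x$2$3) (p * x$2$3)"])
  show "{ut (exp t) (exp t) (exp (-2*t)) 0 s (p * s) | t s. True} \<subseteq> AN"
    using exp_AN[of 1 1 "-2"] by (auto simp: mult.commute)
qed (auto intro!: continuous_intros)

lemma closed_ker_beta: "closed (two_exp (ut (-2) 1 1 0 0 0) (ut 0 0 0 1 0 p))"
  unfolding two_exp_ker_beta
proof (rule closed_parametrized[where f = "\<lambda>x. ut (exp (-2 * ln (x$2$2))) (exp (ln (x$2$2))) (exp (ln (x$2$2))) (x$1$2) 0 (p * x$1$2)"])
  show "{ut (exp (-2*t)) (exp t) (exp t) s 0 (p * s) | t s. True} \<subseteq> AN"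
    using exp_AN[of "-2" 1 1] by (auto simp: mult.commute)
qed (auto intro!: continuous_intros)

lemma closed_unipotent: "closed (two_exp (ut 0 0 0 1 p 0) (ut 0 0 0 0 0 1))"
  unfolding two_exp_unipotent
proof (rule closed_parametrized[where f = "\<lambda>x. ut 1 1 1 (x$1$2) (p * x$1$2) (x$1$3)"])
  show "{ut 1 1 1 s (p * s) t | s t. True} \<subseteq> AN"
    using exp_AN[of 0 0 0] by auto
qed (auto intro!: continuous_intros)

lemma subgroup_root:
  assumes "a + b + c = 0"
  shows "subgroup (two_exp (ut a b c 0 0 0) (root_vec \<omega>)) SL3"
proof (rule subgroup_two_exp)
  show "det (mexp (t *\<^sub>R ut a b c 0 0 0)) = 1" for t by (rule det_mexp_ut[OF assms])
  show "det (mexp (t *\<^sub>R root_vec \<omega>)) = 1" for t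
    by (cases \<omega>) (simp_all add: root_vec_def ut_scale mexp_unip ut_det)
  show "\<exists>s'. mexp (s *\<^sub>R root_vec \<omega>) ** mexp (t *\<^sub>R ut a b c 0 0 0) = mexp (t *\<^sub>R ut a b c 0 0 0) ** mexp (s' *\<^sub>R root_vec \<omega>)" for s t
  proof (cases \<omega>)
    case Alpha
    show ?thesis by (rule exI[of _ "s * exp (t*b) / exp (t*a)"])
        (simp add: Alpha root_vec_def ut_scale mexp_unip mexp_diag ut_mult)
  next
    case Beta
    show ?thesis by (rule exI[of _ "s * exp (t*c) / exp (t*b)"])
        (simp add: Beta root_vec_def ut_scale mexp_unip mexp_diag ut_mult)
  next
    case AlphaBeta
    show ?thesis by (rule exI[of _ "s * exp (t*c) / exp (t*a)"])
        (simp add: AlphaBeta root_vec_def ut_scale mexp_unip mexp_diag ut_mult)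
  qed
qed

lemma subgroup_ker_alpha: "subgroup (two_exp (ut 1 1 (-2) 0 0 0) (ut 0 0 0 0 1 p)) SL3"
proof (rule subgroup_two_exp)
  show "\<exists>s'. mexp (s *\<^sub>R ut 0 0 0 0 1 p) ** mexp (t *\<^sub>R ut 1 1 (-2) 0 0 0) = mexp (t *\<^sub>R ut 1 1 (-2) 0 0 0) ** mexp (s' *\<^sub>R ut 0 0 0 0 1 p)" for s t
    by (rule exI[of _ "s * exp (t*(-2)) / exp t"]) (simp add: ut_scale mexp_unip mexp_diag ut_mult ut_eq_iff)
qed (simp_all add: det_mexp_ut)

lemma subgroup_ker_beta: "subgroup (two_exp (ut (-2) 1 1 0 0 0) (ut 0 0 0 1 0 p)) SL3"
proof (rule subgroup_two_exp)
  show "\<exists>s'. mexp (s *\<^sub>R ut 0 0 0 1 0 p) ** mexp (t *\<^sub>R ut (-2) 1 1 0 0 0) = mexp (t *\<^sub>R ut (-2) 1 1 0 0 0) ** mexp (s' *\<^sub>R ut 0 0 0 1 0 p)" for s t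
    by (rule exI[of _ "s * exp t / exp (t*(-2))"]) (simp add: ut_scale mexp_unip mexp_diag ut_mult ut_eq_iff)
qed (simp_all add: det_mexp_ut)

text \<open>The hypothesis says that the two generators commute.\<close>

lemma subgroup_unip:
  assumes "u * v' = u' * v"
  shows "subgroup (two_exp (ut 0 0 0 u v w) (ut 0 0 0 u' v' w')) SL3"
proof (rule subgroup_two_exp)
  have "s * u' * (t * v) = t * u * (s * v')" for s t
  proof -
    have "s * u' * (t * v) = s * t * (u' * v)" by simp
    also have "\<dots> = t * u * (s * v')" unfolding assms[symmetric] by simp
    finally show ?thesis .
  qed
  then show "\<exists>s'. mexp (s *\<^sub>R ut 0 0 0 u' v' w') ** mexp (t *\<^sub>R ut 0 0 0 u v w) = mexp (t *\<^sub>R ut 0 0 0 u v w) ** mexp (s' *\<^sub>R ut 0 0 0 u' v' w')" for s t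
    by (intro exI[of _ s]) (simp add: ut_scale mexp_unip ut_mult ut_eq_iff)
qed (simp_all add: det_mexp_ut)

text \<open>The simple roots agree on diag(1, 0, -1), so conjugation rescales the line of the second
  generator.\<close>

lemma subgroup_orthogonal: "subgroup (two_exp (ut 1 0 (-1) 0 0 0) (ut 0 0 0 u v 0)) SL3"
proof (rule subgroup_two_exp)
  show "\<exists>s'. mexp (s *\<^sub>R ut 0 0 0 u v 0) ** mexp (t *\<^sub>R ut 1 0 (-1) 0 0 0) = mexp (t *\<^sub>R ut 1 0 (-1) 0 0 0) ** mexp (s' *\<^sub>R ut 0 0 0 u v 0)" for s t
    by (rule exI[of _ "s * exp (- t)"])
      (simp add: ut_scale mexp_unip mexp_diag ut_mult ut_eq_iff exp_minus field_simps)
qed (simp_all add: det_mexp_ut)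

lemma subgroup_twisted_alpha: "subgroup (two_exp (ut 1 1 (-2) g 0 0) (ut 0 0 0 0 0 1)) SL3"
proof (rule subgroup_two_exp)
  show "\<exists>s'. mexp (s *\<^sub>R ut 0 0 0 0 0 1) ** mexp (t *\<^sub>R ut 1 1 (-2) g 0 0) = mexp (t *\<^sub>R ut 1 1 (-2) g 0 0) ** mexp (s' *\<^sub>R ut 0 0 0 0 0 1)" for s t
    by (rule exI[of _ "s * exp (t*(-2)) / exp t"]) (simp add: ut_scale mexp_unip mexp_ker_alpha ut_mult ut_eq_iff)
qed (simp_all add: det_mexp_ut)

lemma subgroup_twisted_beta: "subgroup (two_exp (ut (-2) 1 1 0 g 0) (ut 0 0 0 0 0 1)) SL3"
proof (rule subgroup_two_exp)
  show "\<exists>s'. mexp (s *\<^sub>R ut 0 0 0 0 0 1) ** mexp (t *\<^sub>R ut (-2) 1 1 0 g 0) = mexp (t *\<^sub>R ut (-2) 1 1 0 g 0) ** mexp (s' *\<^sub>R ut 0 0 0 0 0 1)" for s t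
    by (rule exI[of _ "s * exp t / exp (t*(-2))"]) (simp add: ut_scale mexp_unip mexp_ker_beta ut_mult ut_eq_iff)
qed (simp_all add: det_mexp_ut)

lemma subgroup_twisted_alpha_beta_12: "subgroup (two_exp (ut 1 (-2) 1 0 0 g) (ut 0 0 0 1 0 0)) SL3"
proof (rule subgroup_two_exp)
  show "\<exists>s'. mexp (s *\<^sub>R ut 0 0 0 1 0 0) ** mexp (t *\<^sub>R ut 1 (-2) 1 0 0 g) = mexp (t *\<^sub>R ut 1 (-2) 1 0 0 g) ** mexp (s' *\<^sub>R ut 0 0 0 1 0 0)" for s t
    by (rule exI[of _ "s * exp (t*(-2)) / exp t"]) (simp add: ut_scale mexp_unip mexp_ker_alpha_beta ut_mult ut_eq_iff)
qed (simp_all add: det_mexp_ut)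

lemma subgroup_twisted_alpha_beta_23: "subgroup (two_exp (ut 1 (-2) 1 0 0 g) (ut 0 0 0 0 1 0)) SL3"
proof (rule subgroup_two_exp)
  show "\<exists>s'. mexp (s *\<^sub>R ut 0 0 0 0 1 0) ** mexp (t *\<^sub>R ut 1 (-2) 1 0 0 g) = mexp (t *\<^sub>R ut 1 (-2) 1 0 0 g) ** mexp (s' *\<^sub>R ut 0 0 0 0 1 0)" for s t
    by (rule exI[of _ "s * exp t / exp (t*(-2))"]) (simp add: ut_scale mexp_unip mexp_ker_alpha_beta ut_mult ut_eq_iff)
qed (simp_all add: det_mexp_ut)

definition strictly_between :: "real \<Rightarrow> real \<Rightarrow> real \<Rightarrow> bool" where
  "strictly_between x y z \<longleftrightarrow> (x < y \<and> y < z) \<or> (z < y \<and> y < x)"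

fun other_weight :: "pos_root \<Rightarrow> real \<Rightarrow> real \<Rightarrow> real \<Rightarrow> bool" where
  "other_weight Alpha a b c = strictly_between a c b"
| "other_weight Beta a b c = strictly_between b a c"
| "other_weight AlphaBeta a b c = strictly_between a b c"

lemma ray_not_in_region_ut:
  assumes "a + b + c = 0" "ut a b c 0 0 0 \<noteq> 0"
  shows "ray_not_in_region \<omega> (span {ut a b c 0 0 0}) \<longleftrightarrow> \<not> other_weight \<omega> a b c"
proof -
  have "ut a b c 0 0 0 \<in> a_alg" using assms(1) a_alg_iff by blast
  from ray_not_in_region_iff[OF this assms(2), of \<omega>] show ?thesis
    by (cases \<omega>) (auto simp: strictly_between_def)
qed

lemma coarsely_dense_root:
  assumes s: "a + b + c = 0" and n0: "ut a b c 0 0 0 \<noteq> 0" and nb: "\<not> other_weight \<omega> a b c"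
    and H: "two_exp (ut a b c 0 0 0) (root_vec \<omega>) \<subseteq> H"
  shows "coarsely_dense H"
proof -
  have nz: "a \<noteq> 0 \<or> b \<noteq> 0 \<or> c \<noteq> 0" using n0 by (auto simp: ut_zero)
  show ?thesis
  proof (cases \<omega>)
    case Alpha
    \<comment> \<open>If \<open>c\<close> were 0, the other two weights would be opposite and
      nonzero, with 0 strictly between them.\<close>
    have "c \<noteq> 0" using nb s nz by (auto simp: Alpha strictly_between_def)
    with H nb show ?thesis
      by (intro coarsely_dense_root_alpha[OF s]) (auto simp: Alpha root_vec_def two_exp_alpha strictly_between_def)
  next
    case Beta
    have "a \<noteq> 0" using nb s nz by (auto simp: Beta strictly_between_def)
    with H nb show ?thesis
      by (intro coarsely_dense_root_beta[OF s]) (auto simp: Beta root_vec_def two_exp_beta strictly_between_def)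
  next
    case AlphaBeta
    have "b \<noteq> 0" using nb s nz by (auto simp: AlphaBeta strictly_between_def)
    with H nb show ?thesis
      by (intro coarsely_dense_root_alpha_beta[OF s]) (auto simp: AlphaBeta root_vec_def two_exp_alpha_beta strictly_between_def)
  qed
qed

lemma not_coarsely_dense_root:
  assumes "a + b + c = 0" "other_weight \<omega> a b c"
  shows "\<not> coarsely_dense (two_exp (ut a b c 0 0 0) (root_vec \<omega>))"
proof (cases \<omega>)
  case Alpha
  show ?thesis unfolding Alpha root_vec_def pos_root.case two_exp_alpha
    by (rule not_coarsely_dense_root_alpha[OF assms(1)]) (use assms(2) in \<open>auto simp: Alpha strictly_between_def\<close>)
next
  case Beta
  show ?thesis unfolding Beta root_vec_def pos_root.case two_exp_beta
    by (rule not_coarsely_dense_root_beta[OF assms(1)]) (use assms(2) in \<open>auto simp: Beta strictly_between_def\<close>)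
next
  case AlphaBeta
  show ?thesis unfolding AlphaBeta root_vec_def pos_root.case two_exp_alpha_beta
    by (rule not_coarsely_dense_root_alpha_beta[OF assms(1)]) (use assms(2) in \<open>auto simp: AlphaBeta strictly_between_def\<close>)
qed

section \<open>Classification\<close>

text \<open>The list of the statement in terms of \<open>two_exp\<close>. All entries but the first
  are explicit families; for the dimension entry density comes out of the case analysis, so each
  classification lemma proves it together with the implication from density to the list.\<close>

definition listed :: "mat3 set \<Rightarrow> bool" where
  "listed H \<longleftrightarrow> dim (lie_algebra H) \<ge> 3 \<or> H = A_grp
    \<or> (\<exists>p. p \<noteq> 0 \<and> H = two_exp (ut 0 0 0 1 p 0) (ut 0 0 0 0 0 1))
    \<or> (\<exists>p. p \<noteq> 0 \<and> H = two_exp (ut 1 1 (-2) 0 0 0) (ut 0 0 0 0 1 p))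
    \<or> (\<exists>p. p \<noteq> 0 \<and> H = two_exp (ut (-2) 1 1 0 0 0) (ut 0 0 0 1 0 p))
    \<or> (\<exists>a b c \<omega>. a + b + c = 0 \<and> ut a b c 0 0 0 \<noteq> 0 \<and> \<not> other_weight \<omega> a b c \<and>
         H = two_exp (ut a b c 0 0 0) (root_vec \<omega>))"

lemma span2I: "X = k *\<^sub>R Y + l *\<^sub>R W \<Longrightarrow> X \<in> span {Y, W}"
  by (simp add: span_add span_scale span_base)

context AN_sg
begin

lemma sum0: "ut a b c u v w \<in> lie \<Longrightarrow> a + b + c = 0"
  using lieE by (metis ut_nth)

lemma two_exp_subset: "Y \<in> lie \<Longrightarrow> W \<in> lie \<Longrightarrow> two_exp Y W \<subseteq> H"
  by (auto simp: two_exp_def intro: mult_H mexp_lie)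

lemma lie_bracket_unip:
  assumes "ut 0 0 0 u v w \<in> lie" "ut 0 0 0 u' v' w' \<in> lie"
  shows "ut 0 0 0 0 0 (u * v' - u' * v) \<in> lie"
  using bracket_lie[OF assms] by (simp add: ut_lie_bracket)

text \<open>The bracket of two nilpotent elements points in the (1,3) direction. If it vanishes,
  their simple root entries are proportional and a combination of the two points there. So dimension
  two already forces the (1,3) root vector.\<close>

lemma unipotent_part_cases:
  obtains (zero) "\<And>u v w. ut 0 0 0 u v w \<in> lie \<Longrightarrow> u = 0 \<and> v = 0 \<and> w = 0"
  | (line) u v w where "ut 0 0 0 u v w \<in> lie" "u \<noteq> 0 \<or> v \<noteq> 0 \<or> w \<noteq> 0"
      "\<And>u' v' w'. ut 0 0 0 u' v' w' \<in> lie \<Longrightarrow> \<exists>k. u' = k * u \<and> v' = k * v \<and> w' = k * w"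
  | (plane) u v where "\<And>w. ut 0 0 0 0 0 w \<in> lie" "\<And>w. ut 0 0 0 u v w \<in> lie" "u \<noteq> 0 \<or> v \<noteq> 0"
proof (cases "\<exists>u v w. ut 0 0 0 u v w \<in> lie \<and> (u \<noteq> 0 \<or> v \<noteq> 0 \<or> w \<noteq> 0)")
  case False
  then show ?thesis using zero by blast
next
  case True
  then obtain u v w where W: "ut 0 0 0 u v w \<in> lie" "u \<noteq> 0 \<or> v \<noteq> 0 \<or> w \<noteq> 0" by blast
  show ?thesis
  proof (cases "\<forall>u' v' w'. ut 0 0 0 u' v' w' \<in> lie \<longrightarrow> (\<exists>k. u' = k * u \<and> v' = k * v \<and> w' = k * w)")
    case True
    then show ?thesis using line W by blast
  next
    case False
    then obtain u' v' w' where W': "ut 0 0 0 u' v' w' \<in> lie" "\<nexists>k. u' = k * u \<and> v' = k * v \<and> w' = k * w" by blast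
    have "\<exists>r. r \<noteq> 0 \<and> ut 0 0 0 0 0 r \<in> lie"
    proof (cases "u * v' - u' * v = 0")
      case False
      then show ?thesis using lie_bracket_unip[OF W(1) W'(1)] by blast
    next
      case True
      show ?thesis
      proof (cases "u = 0 \<and> v = 0")
        case True
        then show ?thesis using W by auto
      next
        case False
        then obtain k where k: "u' = k * u" "v' = k * v"
        proof (cases "u = 0")
          case True
          with False have "v \<noteq> 0" by simp
          with True \<open>u * v' - u' * v = 0\<close> show ?thesis by (intro that[of "v' / v"]) auto
        next
          case False
          with \<open>u * v' - u' * v = 0\<close> show ?thesis by (intro that[of "u' / u"]) (auto simp: field_simps)
        qed
        have "ut 0 0 0 0 0 (w' + (- k) * w) \<in> lie" using lie_comb[OF W'(1) W(1), of "- k"] k by simp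
        moreover have "w' + (- k) * w \<noteq> 0" using W'(2) k by auto
        ultimately show ?thesis by blast
      qed
    qed
    then have e13: "ut 0 0 0 0 0 r \<in> lie" for r using lie_E13 by blast
    have "\<exists>u v w. ut 0 0 0 u v w \<in> lie \<and> (u \<noteq> 0 \<or> v \<noteq> 0)"
    proof (cases "u = 0 \<and> v = 0")
      case True
      then have "w \<noteq> 0" using W(2) by simp
      then have "u' \<noteq> 0 \<or> v' \<noteq> 0" using W'(2) True by (metis mult_zero_right nonzero_eq_divide_eq)
      then show ?thesis using W'(1) by blast
    qed (use W in blast)
    then obtain u v w where uv: "ut 0 0 0 u v w \<in> lie" "u \<noteq> 0 \<or> v \<noteq> 0" by blast
    have "ut 0 0 0 u v r \<in> lie" for r
      using lie_comb[OF uv(1) e13[of "r - w"], of 1] by simp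
    then show ?thesis using plane e13 uv(2) by blast
  qed
qed

lemma coarsely_dense_of_plane:
  assumes "\<And>w. ut 0 0 0 0 0 w \<in> lie" "ut 0 0 0 u v w \<in> lie" "u \<noteq> 0" "v \<noteq> 0"
  shows "coarsely_dense H" "ut 0 0 0 1 (v / u) 0 \<in> lie"
proof -
  have "ut 0 0 0 1 (v / u) (w / u) \<in> lie" using lie_scale[OF assms(2), of "1 / u"] assms(3) by simp
  from lie_comb[OF this assms(1)[of "- (w / u)"], of 1] show W: "ut 0 0 0 1 (v / u) 0 \<in> lie" by simp
  show "coarsely_dense H"
  proof (rule coarsely_dense_unipotent[of "v / u"])
    show "ut 1 1 1 s (v / u * s) t \<in> H" for s t
      using two_exp_subset[OF W assms(1)[of 1]] unfolding two_exp_unipotent by blast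
  qed (use assms in simp)
qed

lemma dim_ge_3_of_plane:
  assumes "ut a b c u0 v0 w0 \<in> lie" "a \<noteq> 0 \<or> b \<noteq> 0 \<or> c \<noteq> 0" "ut 0 0 0 0 0 1 \<in> lie" "ut 0 0 0 u v w \<in> lie" "u \<noteq> 0 \<or> v \<noteq> 0"
  shows "3 \<le> dim lie"
  by (rule dim_ge_3[OF _ assms(1,3,4)])
    (use assms(2,5) in \<open>auto simp: ut_scale ut_add ut_zero ut_eq_iff\<close>)

text \<open>An element with both simple root entries nonzero either comes with the (1,3) root
  vector, which gives density, or spans the Lie algebra. If there is none, one simple root entry
  vanishes throughout.\<close>

lemma classification_unipotent:
  assumes z: "\<And>a b c u v w. ut a b c u v w \<in> lie \<Longrightarrow> a = 0 \<and> b = 0 \<and> c = 0"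
  shows "(coarsely_dense H \<longrightarrow> listed H) \<and> (dim lie \<ge> 3 \<longrightarrow> coarsely_dense H)"
proof -
  have rep: "\<exists>u v w. X = ut 0 0 0 u v w" if "X \<in> lie" for X
    using lieE[OF that] z that by metis
  show ?thesis
  proof (cases "\<exists>u v w. ut 0 0 0 u v w \<in> lie \<and> u \<noteq> 0 \<and> v \<noteq> 0")
    case True
    then obtain u v w where W: "ut 0 0 0 u v w \<in> lie" "u \<noteq> 0" "v \<noteq> 0" by blast
    show ?thesis
    proof (cases "ut 0 0 0 0 0 1 \<in> lie")
      case True
      then have e13: "ut 0 0 0 0 0 r \<in> lie" for r using lie_E13 by force
      note D = coarsely_dense_of_plane[OF e13 W]
      define p where "p = v / u"
      have p: "p \<noteq> 0" "ut 0 0 0 1 p 0 \<in> lie" using W D(2) by (auto simp: p_def)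
      have "listed H"
      proof (cases "\<forall>x y t. ut 0 0 0 x y t \<in> lie \<longrightarrow> y = p * x")
        case True
        have "lie \<subseteq> span {ut 0 0 0 1 p 0, ut 0 0 0 0 0 1}"
        proof
          fix X assume X: "X \<in> lie"
          then obtain x y t where x: "X = ut 0 0 0 x y t" using rep by blast
          then have "y = p * x" using True X by blast
          then have "X = x *\<^sub>R ut 0 0 0 1 p 0 + t *\<^sub>R ut 0 0 0 0 0 1" by (simp add: x ut_scale ut_add ut_eq_iff)
          then show "X \<in> span {ut 0 0 0 1 p 0, ut 0 0 0 0 0 1}" by (rule span2I)
        qed
        then have "H = two_exp (ut 0 0 0 1 p 0) (ut 0 0 0 0 0 1)"
          by (intro eq_two_exp conn closed_unipotent p e13 subgroup_unip) auto
        then show ?thesis using p unfolding listed_def by blast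
      next
        case False
        then obtain x y t where X: "ut 0 0 0 x y t \<in> lie" "y \<noteq> p * x" by blast
        have "3 \<le> dim lie"
        proof (rule dim_ge_3[OF _ p(2) e13[of 1] X(1)])
          fix r s q assume "r *\<^sub>R ut 0 0 0 1 p 0 + s *\<^sub>R ut 0 0 0 0 0 1 + q *\<^sub>R ut 0 0 0 x y t = 0"
          then have e: "r + q * x = 0" "r * p + q * y = 0" "s + q * t = 0"
            by (simp_all add: ut_scale ut_add ut_zero ut_eq_iff)
          then have "q * (y - p * x) = 0" by algebra
          then have "q = 0" using X(2) by simp
          then show "r = 0 \<and> s = 0 \<and> q = 0" using e by simp
        qed
        then show ?thesis unfolding listed_def by blast
      qed
      then show ?thesis using D(1) by blast
    next
      case False
      have proportional: "\<exists>k. u' = k * u \<and> v' = k * v \<and> w' = k * w" if W': "ut 0 0 0 u' v' w' \<in> lie" for u' v' w'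
      proof (cases rule: unipotent_part_cases)
        case zero
        then show ?thesis using W by blast
      next
        case (line a b c)
        obtain k where k: "u = k * a" "v = k * b" "w = k * c" using line(3)[OF W(1)] by blast
        obtain k' where k': "u' = k' * a" "v' = k' * b" "w' = k' * c" using line(3)[OF W'] by blast
        have "k \<noteq> 0" using k W by auto
        then show ?thesis using k k' by (intro exI[of _ "k' / k"]) simp
      next
        case (plane a b)
        then show ?thesis using False by blast
      qed
      have sub: "lie \<subseteq> span {ut 0 0 0 u v w, ut 0 0 0 0 0 0}"
      proof
        fix X assume X: "X \<in> lie"
        then obtain x y t where x: "X = ut 0 0 0 x y t" using rep by blast
        then obtain k where "x = k * u \<and> y = k * v \<and> t = k * w" using proportional X by blast
        then have "X = k *\<^sub>R ut 0 0 0 u v w + 0 *\<^sub>R ut 0 0 0 0 0 0" by (simp add: x ut_scale ut_add)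
        then show "X \<in> span {ut 0 0 0 u v w, ut 0 0 0 0 0 0}" by (rule span2I)
      qed
      have "\<not> coarsely_dense H"
      proof (rule not_coarsely_dense_two_exp[OF conn _ sub])
        show "subgroup (two_exp (ut 0 0 0 u v w) (ut 0 0 0 0 0 0)) SL3" by (rule subgroup_unip) simp
        show "\<not> coarsely_dense (two_exp (ut 0 0 0 u v w) (ut 0 0 0 0 0 0))"
          by (rule not_coarsely_dense_unip_line[OF W(2), of _ v w])
            (auto simp: two_exp_def ut_scale mexp_unip ut_mult)
      qed
      then show ?thesis using dim_le_2[OF sub] by simp
    qed
  next
    case False
    then have alt: "u = 0 \<or> v = 0" if "ut 0 0 0 u v w \<in> lie" for u v w using that by blast
    \<comment> \<open>A vector space is not the union of two proper subspaces.\<close>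
    have "(\<forall>u v w. ut 0 0 0 u v w \<in> lie \<longrightarrow> u = 0) \<or> (\<forall>u v w. ut 0 0 0 u v w \<in> lie \<longrightarrow> v = 0)"
    proof (rule ccontr)
      assume "\<not> ?thesis"
      then obtain u v w u' v' w' where W: "ut 0 0 0 u v w \<in> lie" "u \<noteq> 0" and W': "ut 0 0 0 u' v' w' \<in> lie" "v' \<noteq> 0" by blast
      have "v = 0" "u' = 0" using alt[OF W(1)] alt[OF W'(1)] W(2) W'(2) by auto
      moreover have "ut 0 0 0 (u + u') (v + v') (w + w') \<in> lie" using lie_comb[OF W(1) W'(1), of 1] by simp
      ultimately show False using alt W(2) W'(2) by fastforce
    qed
    then show ?thesis
    proof
      assume u0: "\<forall>u v w. ut 0 0 0 u v w \<in> lie \<longrightarrow> u = 0"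
      have sub: "lie \<subseteq> span {ut 0 0 0 0 1 0, ut 0 0 0 0 0 1}"
      proof
        fix X assume X: "X \<in> lie"
        then obtain x y t where x: "X = ut 0 0 0 x y t" using rep by blast
        then have "x = 0" using u0 X by blast
        then have "X = y *\<^sub>R ut 0 0 0 0 1 0 + t *\<^sub>R ut 0 0 0 0 0 1" by (simp add: x ut_scale ut_add)
        then show "X \<in> span {ut 0 0 0 0 1 0, ut 0 0 0 0 0 1}" by (rule span2I)
      qed
      have "\<not> coarsely_dense H"
      proof (rule not_coarsely_dense_two_exp[OF conn _ sub])
        show "\<not> coarsely_dense (two_exp (ut 0 0 0 0 1 0) (ut 0 0 0 0 0 1))"
          by (rule not_coarsely_dense_unip_23_13) (auto simp: two_exp_def ut_scale mexp_unip ut_mult)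
      qed (rule subgroup_unip, simp)
      then show ?thesis using dim_le_2[OF sub] by simp
    next
      assume v0: "\<forall>u v w. ut 0 0 0 u v w \<in> lie \<longrightarrow> v = 0"
      have sub: "lie \<subseteq> span {ut 0 0 0 1 0 0, ut 0 0 0 0 0 1}"
      proof
        fix X assume X: "X \<in> lie"
        then obtain x y t where x: "X = ut 0 0 0 x y t" using rep by blast
        then have "y = 0" using v0 X by blast
        then have "X = x *\<^sub>R ut 0 0 0 1 0 0 + t *\<^sub>R ut 0 0 0 0 0 1" by (simp add: x ut_scale ut_add)
        then show "X \<in> span {ut 0 0 0 1 0 0, ut 0 0 0 0 0 1}" by (rule span2I)
      qed
      have "\<not> coarsely_dense H"
      proof (rule not_coarsely_dense_two_exp[OF conn _ sub])
        show "\<not> coarsely_dense (two_exp (ut 0 0 0 1 0 0) (ut 0 0 0 0 0 1))"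
          by (rule not_coarsely_dense_unip_12_13) (auto simp: two_exp_def ut_scale mexp_unip ut_mult)
      qed (rule subgroup_unip, simp)
      then show ?thesis using dim_le_2[OF sub] by simp
    qed
  qed
qed

text \<open>Two independent diagonal elements span the Lie algebra of \<open>A_grp\<close>, so
  \<open>H\<close> contains \<open>A_grp\<close>; any further element makes the dimension at least
  three.\<close>

lemma classification_A:
  assumes "ut a b c 0 0 0 \<in> lie" "ut a' b' c' 0 0 0 \<in> lie" "a * b' \<noteq> a' * b"
  shows "(coarsely_dense H \<longrightarrow> listed H) \<and> (dim lie \<ge> 3 \<longrightarrow> coarsely_dense H)"
proof -
  have s: "c = - a - b" "c' = - a' - b'" using sum0[OF assms(1)] sum0[OF assms(2)] by linarith+
  define d where "d = a * b' - a' * b"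
  have d: "d \<noteq> 0" using assms(3) by (simp add: d_def)
  have al: "a_alg \<subseteq> lie"
  proof
    fix X assume "X \<in> a_alg"
    then obtain x y z where x: "x + y + z = 0" "X = ut x y z 0 0 0" using a_alg_iff by blast
    then have z: "z = - x - y" by linarith
    \<comment> \<open>Cramer's rule for the first two entries; the third follows because traces
      vanish.\<close>
    let ?k = "(x * b' - a' * y) / d" and ?l = "(a * y - x * b) / d"
    have "X = ?k *\<^sub>R ut a b c 0 0 0 + ?l *\<^sub>R ut a' b' c' 0 0 0"
      using d unfolding x(2) s z ut_scale ut_add ut_eq_iff
      by (simp add: divide_simps) (simp add: d_def algebra_simps)
    then show "X \<in> lie" using subspace_lie assms(1,2) by (simp add: subspace_add subspace_scale)
  qed
  have AH: "A_grp \<subseteq> H"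
  proof
    fix g assume "g \<in> A_grp"
    then obtain x y z where g: "x > 0" "y > 0" "z > 0" "x * y * z = 1" "g = ut x y z 0 0 0" using A_grp_iff by blast
    have "ln x + ln y + ln z = ln (x * y * z)" using g(1-3) by (simp add: ln_mult)
    then have "ut (ln x) (ln y) (ln z) 0 0 0 \<in> lie" using al a_alg_iff g(4) by (metis ln_one subsetD)
    from mexp_lie[OF this, of 1] show "g \<in> H" using g by (simp add: mexp_diag)
  qed
  have "listed H"
  proof (cases "lie \<subseteq> a_alg")
    case True
    have "closed_sg A_grp"
    proof (rule closed_sg.intro)
      show "subgroup A_grp SL3"
      proof (rule subgroup_SL3I)
        show "A_grp \<subseteq> carrier SL3" by (auto simp: A_grp_def)
        show "mat 1 \<in> A_grp" unfolding A_grp_iff ut_one by (intro exI[of _ 1]) simp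
      next
        fix g h assume "g \<in> A_grp" "h \<in> A_grp"
        then obtain x y z x' y' z' where g: "x > 0" "y > 0" "z > 0" "x * y * z = 1" "g = ut x y z 0 0 0"
          "x' > 0" "y' > 0" "z' > 0" "x' * y' * z' = 1" "h = ut x' y' z' 0 0 0" unfolding A_grp_iff by metis
        have "x * x' * (y * y') * (z * z') = (x * y * z) * (x' * y' * z')" by simp
        then show "g ** h \<in> A_grp" using g unfolding A_grp_iff
          by (intro exI[of _ "x * x'"] exI[of _ "y * y'"] exI[of _ "z * z'"]) (simp add: ut_mult)
      next
        fix g assume "g \<in> A_grp"
        then obtain x y z where g: "x > 0" "y > 0" "z > 0" "x * y * z = 1" "g = ut x y z 0 0 0" unfolding A_grp_iff by metis
        have "y * z * (x * z) * (x * y) = (x * y * z) * (x * y * z)" by simp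
        then show "adj3 g \<in> A_grp" using g unfolding A_grp_iff
          by (intro exI[of _ "y * z"] exI[of _ "x * z"] exI[of _ "x * y"]) (simp add: ut_adj3)
      qed
      show "closedin (top_of_set (carrier SL3)) A_grp"
        by (intro closed_subset closed_A_grp) (auto simp: A_grp_def)
    qed
    then have "H \<subseteq> A_grp" using True by (intro connected_subset conn) (auto simp: a_alg_def)
    then show ?thesis using AH unfolding listed_def by blast
  next
    case False
    then obtain X where X: "X \<in> lie" "X \<notin> a_alg" by blast
    then obtain x y z u v w where x: "X = ut x y z u v w" "x + y + z = 0" using lieE by metis
    have uvw: "u \<noteq> 0 \<or> v \<noteq> 0 \<or> w \<noteq> 0" using X(2) x a_alg_iff by auto
    have "3 \<le> dim lie"
    proof (rule dim_ge_3[OF _ assms(1,2) X(1)])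
      fix r s q assume "r *\<^sub>R ut a b c 0 0 0 + s *\<^sub>R ut a' b' c' 0 0 0 + q *\<^sub>R X = 0"
      then have e: "r * a + s * a' + q * x = 0" "r * b + s * b' + q * y = 0" "q * u = 0" "q * v = 0" "q * w = 0"
        by (simp_all add: x(1) ut_scale ut_add ut_zero ut_eq_iff)
      then have q: "q = 0" using uvw by auto
      have "r * d = 0" "s * d = 0" using e(1,2) q unfolding d_def by (simp, algebra)+
      then show "r = 0 \<and> s = 0 \<and> q = 0" using q d by simp
    qed
    then show ?thesis unfolding listed_def by blast
  qed
  then show ?thesis using coarsely_dense_A_grp[OF AH] by blast
qed

end

context AN_sg
begin

text \<open>With both simple root entries nonzero the unipotent part is dense by itself. Otherwise
  \<open>H\<close> contains the torus and the root groups of \<alpha>+\<beta> and of one simple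
  root.\<close>

lemma root_plane_coarsely_dense:
  assumes s: "a + b + c = 0" and T: "ut a b c 0 0 0 \<in> lie" "ut a b c 0 0 0 \<noteq> 0"
    and e: "\<And>w. ut 0 0 0 0 0 w \<in> lie" and uv: "\<And>w. ut 0 0 0 u v w \<in> lie" "u \<noteq> 0 \<or> v \<noteq> 0"
  shows "coarsely_dense H"
proof (cases "u \<noteq> 0 \<and> v \<noteq> 0")
  case True
  then show ?thesis using coarsely_dense_of_plane(1)[OF e uv(1)] by blast
next
  case False
  have r: "root_vec AlphaBeta \<in> lie" using e[of 1] by (simp add: root_vec_def)
  have one: "\<exists>\<omega>. root_vec \<omega> \<in> lie \<and> \<omega> \<noteq> AlphaBeta"
  proof (cases "u = 0")
    case True
    then have "v \<noteq> 0" using uv(2) by simp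
    then have "ut 0 0 0 0 1 0 \<in> lie" using lie_scale[OF uv(1)[of 0], of "1 / v"] True by simp
    then show ?thesis by (intro exI[of _ Beta]) (simp add: root_vec_def)
  next
    case u: False
    then have "v = 0" using False by simp
    then have "ut 0 0 0 1 0 0 \<in> lie" using lie_scale[OF uv(1)[of 0], of "1 / u"] u by simp
    then show ?thesis by (intro exI[of _ Alpha]) (simp add: root_vec_def)
  qed
  then obtain \<omega> where w: "root_vec \<omega> \<in> lie" "\<omega> \<noteq> AlphaBeta" by blast
  \<comment> \<open>The two roots omit different indices, and only one index can carry the strictly
    middle weight.\<close>
  have "\<not> other_weight \<omega> a b c \<or> \<not> other_weight AlphaBeta a b c"
    using w(2) by (cases \<omega>) (auto simp: strictly_between_def)
  then show ?thesis
    using coarsely_dense_root[OF s T(2) _ two_exp_subset[OF T(1) w(1)]]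
      coarsely_dense_root[OF s T(2) _ two_exp_subset[OF T(1) r]] by blast
qed

lemma root_line_listed:
  assumes s: "a + b + c = 0" and T: "ut a b c 0 0 0 \<in> lie" "ut a b c 0 0 0 \<noteq> 0"
    and w: "root_vec \<omega> \<in> lie" and sub: "lie \<subseteq> span {ut a b c 0 0 0, root_vec \<omega>}"
    and dense: "coarsely_dense H"
  shows "listed H"
proof -
  have eq: "H = two_exp (ut a b c 0 0 0) (root_vec \<omega>)"
    by (intro eq_two_exp conn subgroup_root[OF s] sub closed_root[OF s T(2)] T(1) w)
  then have "\<not> other_weight \<omega> a b c" using not_coarsely_dense_root[OF s] dense by metis
  then show ?thesis using eq s T(2) unfolding listed_def by blast
qed

text \<open>If some weight is strictly in the middle, the torus sits inside a non-dense group
  \<open>T U\<close>, with \<open>U\<close> the root group omitting that index; otherwise two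
  weights agree and the torus moves along walls.\<close>

lemma not_coarsely_dense_torus:
  assumes s: "a + b + c = 0" and sub: "lie \<subseteq> span {ut a b c 0 0 0}"
  shows "\<not> coarsely_dense H"
proof (cases "\<exists>\<omega>. other_weight \<omega> a b c")
  case True
  then obtain \<omega> where w: "other_weight \<omega> a b c" by blast
  have "lie \<subseteq> span {ut a b c 0 0 0, root_vec \<omega>}" using sub span_mono[of "{ut a b c 0 0 0}" "{ut a b c 0 0 0, root_vec \<omega>}"] by blast
  then show ?thesis
    by (rule not_coarsely_dense_two_exp[OF conn subgroup_root[OF s] _ not_coarsely_dense_root[OF s w]])
next
  case False
  then have "\<not> other_weight Alpha a b c" "\<not> other_weight Beta a b c" "\<not> other_weight AlphaBeta a b c" by blast+
  then have eqs: "a = b \<or> b = c \<or> a = c" by (auto simp: strictly_between_def)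
  have sub2: "lie \<subseteq> span {ut a b c 0 0 0, ut 0 0 0 0 0 0}"
    using sub span_mono[of "{ut a b c 0 0 0}" "{ut a b c 0 0 0, ut 0 0 0 0 0 0}"] by blast
  show ?thesis
  proof (rule not_coarsely_dense_two_exp[OF conn _ sub2])
    show "subgroup (two_exp (ut a b c 0 0 0) (ut 0 0 0 0 0 0)) SL3"
    proof (rule subgroup_two_exp)
      show "det (mexp (t *\<^sub>R ut a b c 0 0 0)) = 1" for t by (rule det_mexp_ut[OF s])
      show "det (mexp (t *\<^sub>R ut 0 0 0 0 0 0)) = 1" for t by (rule det_mexp_ut) simp
    qed (simp add: ut_scale mexp_diag ut_mult)
    show "\<not> coarsely_dense (two_exp (ut a b c 0 0 0) (ut 0 0 0 0 0 0))"
    proof (rule not_coarsely_dense_singular_diag)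
      fix h assume "h \<in> two_exp (ut a b c 0 0 0) (ut 0 0 0 0 0 0)"
      then obtain t where h: "h = ut (exp (t*a)) (exp (t*b)) (exp (t*c)) 0 0 0"
        by (auto simp: two_exp_def ut_scale mexp_diag ut_mult)
      consider "a = b" "c = -2 * a" | "b = c" "a = -2 * b" | "a = c" "b = -2 * a" using eqs s by linarith
      then show "\<exists>t. h = ut (exp t) (exp t) (exp (-2*t)) 0 0 0 \<or>
         h = ut (exp (-2*t)) (exp t) (exp t) 0 0 0 \<or> h = ut (exp t) (exp (-2*t)) (exp t) 0 0 0"
      proof cases
        case 1
        then show ?thesis unfolding h by (intro exI[of _ "t * a"] disjI1) (simp add: ut_eq_iff mult.left_commute)
      next
        case 2
        then show ?thesis unfolding h by (intro exI[of _ "t * b"] disjI2 disjI1) (simp add: ut_eq_iff mult.left_commute)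
      next
        case 3
        then show ?thesis unfolding h by (intro exI[of _ "t * a"] disjI2) (simp add: ut_eq_iff mult.left_commute)
      qed
    qed
  qed
qed

text \<open>If the nilpotent part is a line, the torus acts on it by a scalar \<open>l\<close>, so
  all roots with a nonzero entry in the spanning vector agree on the torus. Each pattern of nonzero
  entries then singles out one root or determines the torus.\<close>

lemma classification_torus:
  assumes T: "ut a b c 0 0 0 \<in> lie" "ut a b c 0 0 0 \<noteq> 0"
    and proportional: "\<And>a' b' c' u v w. ut a' b' c' u v w \<in> lie \<Longrightarrow> \<exists>k. a' = k * a \<and> b' = k * b \<and> c' = k * c"
  shows "(coarsely_dense H \<longrightarrow> listed H) \<and> (dim lie \<ge> 3 \<longrightarrow> coarsely_dense H)"
proof -
  have s: "a + b + c = 0" by (rule sum0[OF T(1)])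
  have nz: "a \<noteq> 0 \<or> b \<noteq> 0 \<or> c \<noteq> 0" using T(2) by (auto simp: ut_zero)
  have dec: "\<exists>k u v w. X = k *\<^sub>R ut a b c 0 0 0 + ut 0 0 0 u v w \<and> ut 0 0 0 u v w \<in> lie" if X: "X \<in> lie" for X
  proof -
    obtain a' b' c' u v w where x: "X = ut a' b' c' u v w" by (rule lieE[OF X])
    then obtain k where k: "a' = k * a" "b' = k * b" "c' = k * c" using proportional X by metis
    have "ut 0 0 0 u v w \<in> lie"
      using lie_comb[OF X[unfolded x] T(1), of "- k"] by (simp add: k)
    then show ?thesis by - (rule exI[of _ k], rule exI[of _ u], rule exI[of _ v], rule exI[of _ w], simp add: x k ut_scale ut_add ut_eq_iff)
  qed
  show ?thesis
  proof (cases rule: unipotent_part_cases)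
    case zero
    have sub: "lie \<subseteq> span {ut a b c 0 0 0}"
    proof
      fix X assume "X \<in> lie"
      then obtain k u v w where X: "X = k *\<^sub>R ut a b c 0 0 0 + ut 0 0 0 u v w" "ut 0 0 0 u v w \<in> lie" using dec by blast
      then have "X = k *\<^sub>R ut a b c 0 0 0" using zero[OF X(2)] by (simp add: ut_scale ut_add)
      then show "X \<in> span {ut a b c 0 0 0}" by (simp add: span_scale span_base)
    qed
    have "dim lie \<le> 2" using sub by (intro dim_le_2[of _ "ut a b c 0 0 0" "ut a b c 0 0 0"]) simp
    then show ?thesis using not_coarsely_dense_torus[OF s sub] by simp
  next
    case (line u v w)
    have sub: "lie \<subseteq> span {ut a b c 0 0 0, ut 0 0 0 u v w}"
    proof
      fix X assume "X \<in> lie"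
      then obtain k x y z where X: "X = k *\<^sub>R ut a b c 0 0 0 + ut 0 0 0 x y z" "ut 0 0 0 x y z \<in> lie" using dec by blast
      then obtain l where "x = l * u" "y = l * v" "z = l * w" using line(3) by blast
      then have "X = k *\<^sub>R ut a b c 0 0 0 + l *\<^sub>R ut 0 0 0 u v w" by (simp add: X ut_scale)
      then show "X \<in> span {ut a b c 0 0 0, ut 0 0 0 u v w}" by (rule span2I)
    qed
    have d2: "dim lie \<le> 2" by (rule dim_le_2[OF sub])
    have "ut 0 0 0 ((a-b) * u) ((b-c) * v) ((a-c) * w) \<in> lie"
      using bracket_lie[OF T(1) line(1)] by (simp add: ut_lie_bracket)
    then obtain l where l: "(a-b) * u = l * u" "(b-c) * v = l * v" "(a-c) * w = l * w" using line(3) by blast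
    have rescale: "lie \<subseteq> span {Y, W}" if "ut a b c 0 0 0 = r *\<^sub>R Y" "ut 0 0 0 u v w = q *\<^sub>R W" for Y W r q
    proof -
      have "span {ut a b c 0 0 0, ut 0 0 0 u v w} \<subseteq> span {Y, W}"
        using that by (intro span_minimal) (auto simp: span_scale span_base)
      then show ?thesis using sub by blast
    qed
    have rootcase: "coarsely_dense H \<longrightarrow> listed H" if q: "ut 0 0 0 u v w = q *\<^sub>R root_vec \<omega>" for \<omega> q
    proof
      assume dense: "coarsely_dense H"
      have q0: "q \<noteq> 0" using q line(2) by (auto simp flip: ut_zero) (auto simp: ut_zero ut_eq_iff)
      have "(1 / q) *\<^sub>R ut 0 0 0 u v w \<in> lie" by (rule subspace_scale[OF subspace_lie line(1)])
      then have "root_vec \<omega> \<in> lie" using q q0 by simp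
      moreover have "lie \<subseteq> span {ut a b c 0 0 0, root_vec \<omega>}" by (rule rescale[of 1 _ q]) (simp_all add: q)
      ultimately show "listed H" using root_line_listed[OF s T _ _ dense] by blast
    qed
    consider "u \<noteq> 0" "v = 0" "w = 0" | "u = 0" "v \<noteq> 0" "w = 0" | "u = 0" "v = 0" "w \<noteq> 0"
      | "u \<noteq> 0" "v \<noteq> 0" | "u \<noteq> 0" "v = 0" "w \<noteq> 0" | "u = 0" "v \<noteq> 0" "w \<noteq> 0" using line(2) by blast
    then have "coarsely_dense H \<longrightarrow> listed H"
    proof cases
      case 1
      then show ?thesis by (intro rootcase[of u Alpha]) (simp add: root_vec_def ut_scale)
    next
      case 2
      then show ?thesis by (intro rootcase[of v Beta]) (simp add: root_vec_def ut_scale)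
    next
      case 3
      then show ?thesis by (intro rootcase[of w AlphaBeta]) (simp add: root_vec_def ut_scale)
    next
      case 4
      \<comment> \<open>Equal simple roots give the torus diag(a, 0, -a); there \<alpha>+\<beta>
        takes a different value, so \<open>w\<close> must vanish.\<close>
      then have lab: "l = a - b" "l = b - c" using l by auto
      then have bac: "b = 0" "c = - a" using s by linarith+
      have "a \<noteq> 0" using nz bac by auto
      have "w = 0"
      proof (rule ccontr)
        assume "w \<noteq> 0"
        then have "l = a - c" using l by auto
        then show False using lab bac \<open>a \<noteq> 0\<close> by linarith
      qed
      have sub3: "lie \<subseteq> span {ut 1 0 (-1) 0 0 0, ut 0 0 0 u v 0}"
        by (rule rescale[of a _ 1]) (simp_all add: bac \<open>w = 0\<close> ut_scale)
      have "\<not> coarsely_dense H"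
      proof (rule not_coarsely_dense_two_exp[OF conn subgroup_orthogonal sub3])
        show "\<not> coarsely_dense (two_exp (ut 1 0 (- 1) 0 0 0) (ut 0 0 0 u v 0))"
        proof (rule not_coarsely_dense_orthogonal[OF 4])
          fix h assume "h \<in> two_exp (ut 1 0 (- 1) 0 0 0) (ut 0 0 0 u v 0)"
          then obtain t s where "h = mexp (t *\<^sub>R ut 1 0 (-1) 0 0 0) ** mexp (s *\<^sub>R ut 0 0 0 u v 0)" by (auto simp: two_exp_def)
          then have "h = ut (exp t) 1 (exp (- t)) (u * s * exp t) (v * s) (u * v * s\<^sup>2 / 2 * exp t)"
            by (simp add: ut_scale mexp_diag mexp_unip ut_mult ut_eq_iff power2_eq_square)
          then show "\<exists>s t. h = ut (exp t) 1 (exp (- t)) (u * s * exp t) (v * s) (u * v * s\<^sup>2 / 2 * exp t)" by blast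
        qed
      qed
      then show ?thesis by blast
    next
      case 5
      \<comment> \<open>\<alpha> and \<alpha>+\<beta> agree, that is, \<beta> vanishes on the
        torus.\<close>
      then have "l = a - b" "l = a - c" using l by auto
      then have bac: "c = b" "a = -2 * b" using s by linarith+
      have b0: "b \<noteq> 0" using nz bac by auto
      define p where "p = w / u"
      have "H = two_exp (ut (-2) 1 1 0 0 0) (ut 0 0 0 1 0 p)"
      proof (rule eq_two_exp[OF conn subgroup_ker_beta _ closed_ker_beta])
        show "lie \<subseteq> span {ut (-2) 1 1 0 0 0, ut 0 0 0 1 0 p}"
          by (rule rescale[of b _ u]) (use 5 in \<open>simp_all add: bac p_def ut_scale ut_eq_iff\<close>)
        show "ut (-2) 1 1 0 0 0 \<in> lie" using lie_scale[OF T(1), of "1 / b"] b0 by (simp add: bac)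
        show "ut 0 0 0 1 0 p \<in> lie" using lie_scale[OF line(1), of "1 / u"] 5 by (simp add: p_def)
      qed
      moreover have "p \<noteq> 0" using 5 by (simp add: p_def)
      ultimately show ?thesis unfolding listed_def by blast
    next
      case 6
      \<comment> \<open>\<beta> and \<alpha>+\<beta> agree, that is, \<alpha> vanishes on the
        torus.\<close>
      then have "l = b - c" "l = a - c" using l by auto
      then have bac: "b = a" "c = -2 * a" using s by linarith+
      have a0: "a \<noteq> 0" using nz bac by auto
      define p where "p = w / v"
      have "H = two_exp (ut 1 1 (-2) 0 0 0) (ut 0 0 0 0 1 p)"
      proof (rule eq_two_exp[OF conn subgroup_ker_alpha _ closed_ker_alpha])
        show "lie \<subseteq> span {ut 1 1 (-2) 0 0 0, ut 0 0 0 0 1 p}"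
          by (rule rescale[of a _ v]) (use 6 in \<open>simp_all add: bac p_def ut_scale ut_eq_iff\<close>)
        show "ut 1 1 (-2) 0 0 0 \<in> lie" using lie_scale[OF T(1), of "1 / a"] a0 by (simp add: bac)
        show "ut 0 0 0 0 1 p \<in> lie" using lie_scale[OF line(1), of "1 / v"] 6 by (simp add: p_def)
      qed
      moreover have "p \<noteq> 0" using 6 by (simp add: p_def)
      ultimately show ?thesis unfolding listed_def by blast
    qed
    then show ?thesis using d2 by simp
  next
    case (plane u v)
    have "coarsely_dense H" by (rule root_plane_coarsely_dense[OF s T plane])
    moreover have "3 \<le> dim lie" by (rule dim_ge_3_of_plane[OF T(1) nz plane(1) plane(2)[of 0] plane(3)])
    ultimately show ?thesis unfolding listed_def by blast
  qed
qed

text \<open>The bracket with the twisted element kills the (1,2) direction and, since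
  \<open>g\<close> is nonzero, is a Jordan block of eigenvalue 3 on the other two. So the only
  invariant line besides the excluded one is the (1,3) direction, which is not enough for density; a
  larger nilpotent part gives dimension three and density.\<close>

lemma classification_twisted_alpha:
  assumes Y: "ut 1 1 (-2) g 0 0 \<in> lie" and E: "ut 0 0 0 1 0 0 \<notin> lie" and g: "g \<noteq> 0"
    and eq: "\<And>a b c u v w. ut a b c u v w \<in> lie \<Longrightarrow> a = b"
  shows "(coarsely_dense H \<longrightarrow> listed H) \<and> (dim lie \<ge> 3 \<longrightarrow> coarsely_dense H)"
proof -
  have dec: "\<exists>k u v w. X = k *\<^sub>R ut 1 1 (-2) g 0 0 + ut 0 0 0 u v w \<and> ut 0 0 0 u v w \<in> lie" if X: "X \<in> lie" for X
  proof -
    obtain a b c u v w where x: "X = ut a b c u v w" "a + b + c = 0" by (rule lieE[OF X])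
    have k: "b = a" "c = -2 * a" using eq[OF X[unfolded x]] x(2) by auto
    have "ut 0 0 0 (u - a * g) v w \<in> lie"
      using lie_comb[OF X[unfolded x] Y, of "- a"] by (simp add: k)
    then show ?thesis by - (rule exI[of _ a], rule exI[of _ "u - a * g"], rule exI[of _ v], rule exI[of _ w], simp add: x k ut_scale ut_add ut_eq_iff)
  qed
  have small: ?thesis if sub: "\<And>u v w. ut 0 0 0 u v w \<in> lie \<Longrightarrow> u = 0 \<and> v = 0"
  proof -
    have sub2: "lie \<subseteq> span {ut 1 1 (-2) g 0 0, ut 0 0 0 0 0 1}"
    proof
      fix X assume "X \<in> lie"
      then obtain k u v w where X: "X = k *\<^sub>R ut 1 1 (-2) g 0 0 + ut 0 0 0 u v w" "ut 0 0 0 u v w \<in> lie" using dec by blast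
      then have "X = k *\<^sub>R ut 1 1 (-2) g 0 0 + w *\<^sub>R ut 0 0 0 0 0 1" using sub[OF X(2)] by (simp add: X(1) ut_scale)
      then show "X \<in> span {ut 1 1 (-2) g 0 0, ut 0 0 0 0 0 1}" by (rule span2I)
    qed
    have "\<not> coarsely_dense H"
    proof (rule not_coarsely_dense_two_exp[OF conn subgroup_twisted_alpha sub2], rule not_coarsely_dense_twisted_alpha[OF g])
      fix h assume "h \<in> two_exp (ut 1 1 (-2) g 0 0) (ut 0 0 0 0 0 1)"
      then obtain t s where "h = mexp (t *\<^sub>R ut 1 1 (-2) g 0 0) ** mexp (s *\<^sub>R ut 0 0 0 0 0 1)" by (auto simp: two_exp_def)
      then have "h = ut (exp t) (exp t) (exp (-2*t)) (g * t * exp t) 0 (exp t * s)"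
        by (simp add: ut_scale mexp_ker_alpha mexp_unip ut_mult ut_eq_iff mult.commute)
      then show "\<exists>t s. h = ut (exp t) (exp t) (exp (-2*t)) (g * t * exp t) 0 s" by blast
    qed
    then show ?thesis using dim_le_2[OF sub2] by simp
  qed
  show ?thesis
  proof (cases rule: unipotent_part_cases)
    case zero
    then show ?thesis by (intro small) blast
  next
    case (line u v w)
    have "ut 0 0 0 0 (3 * v) (3 * w + g * v) \<in> lie"
      using bracket_lie[OF Y line(1)] by (simp add: ut_lie_bracket)
    then obtain l where l: "0 = l * u" "3 * v = l * v" "3 * w + g * v = l * w" using line(3) by blast
    have u0: "u = 0"
    proof (rule ccontr)
      assume u: "u \<noteq> 0"
      then have "l = 0" using l by simp
      then have "v = 0" "w = 0" using l by auto
      then show False using lie_scale[OF line(1), of "1 / u"] u E by simp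
    qed
    have v0: "v = 0"
    proof (rule ccontr)
      assume v: "v \<noteq> 0"
      then have "l = 3" using l by simp
      then show False using l v g by simp
    qed
    show ?thesis
    proof (rule small)
      fix x y z assume "ut 0 0 0 x y z \<in> lie"
      from line(3)[OF this] show "x = 0 \<and> y = 0" using u0 v0 by auto
    qed
  next
    case (plane u v)
    have "coarsely_dense H"
    proof (cases "u = 0")
      case False
      show ?thesis
      proof (cases "v = 0")
        case True
        then show ?thesis using lie_scale[OF plane(2)[of 0], of "1 / u"] False E by simp
      next
        case v: False
        then show ?thesis using coarsely_dense_of_plane(1)[OF plane(1) plane(2)] False by blast
      qed
    next
      case True
      then have v: "v \<noteq> 0" using plane(3) by simp
      have e23: "ut 0 0 0 0 s r \<in> lie" for s r
        using lie_scale[OF plane(2)[of "v * r / s"], of "s / v"] True v plane(1)[of r] by (cases "s = 0") simp_all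
      show ?thesis
      proof (rule coarsely_dense_twisted_alpha[OF g])
        fix t s
        \<comment> \<open>The (1,3) entry of the second factor cancels the one that the twist
          produces.\<close>
        have "mexp (t *\<^sub>R ut 1 1 (-2) g 0 0) ** mexp (1 *\<^sub>R ut 0 0 0 0 (s / exp t) (- (g * t * (s / exp t)))) \<in> H"
          by (intro mult_H mexp_lie Y e23)
        moreover have "mexp (t *\<^sub>R ut 1 1 (-2) g 0 0) ** mexp (1 *\<^sub>R ut 0 0 0 0 (s / exp t) (- (g * t * (s / exp t))))
            = ut (exp t) (exp t) (exp (-2*t)) (g * t * exp t) s 0"
          by (simp add: ut_scale mexp_ker_alpha mexp_unip ut_mult ut_eq_iff mult.commute)
        ultimately show "ut (exp t) (exp t) (exp (-2*t)) (g * t * exp t) s 0 \<in> H" by simp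
      qed
    qed
    moreover have "3 \<le> dim lie" by (rule dim_ge_3_of_plane[OF Y _ plane(1) plane(2)[of 0] plane(3)]) simp
    ultimately show ?thesis unfolding listed_def by blast
  qed
qed

text \<open>The case of \<alpha> with the simple roots exchanged: the Jordan block now has
  eigenvalue -3 and lives on the (1,2) and (1,3) directions.\<close>

lemma classification_twisted_beta:
  assumes Y: "ut (-2) 1 1 0 g 0 \<in> lie" and E: "ut 0 0 0 0 1 0 \<notin> lie" and g: "g \<noteq> 0"
    and eq: "\<And>a b c u v w. ut a b c u v w \<in> lie \<Longrightarrow> b = c"
  shows "(coarsely_dense H \<longrightarrow> listed H) \<and> (dim lie \<ge> 3 \<longrightarrow> coarsely_dense H)"
proof -
  have dec: "\<exists>k u v w. X = k *\<^sub>R ut (-2) 1 1 0 g 0 + ut 0 0 0 u v w \<and> ut 0 0 0 u v w \<in> lie" if X: "X \<in> lie" for X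
  proof -
    obtain a b c u v w where x: "X = ut a b c u v w" "a + b + c = 0" by (rule lieE[OF X])
    have k: "c = b" "a = -2 * b" using eq[OF X[unfolded x]] x(2) by auto
    have "ut 0 0 0 u (v - b * g) w \<in> lie"
      using lie_comb[OF X[unfolded x] Y, of "- b"] by (simp add: k)
    then show ?thesis by - (rule exI[of _ b], rule exI[of _ u], rule exI[of _ "v - b * g"], rule exI[of _ w], simp add: x k ut_scale ut_add ut_eq_iff)
  qed
  have small: ?thesis if sub: "\<And>u v w. ut 0 0 0 u v w \<in> lie \<Longrightarrow> u = 0 \<and> v = 0"
  proof -
    have sub2: "lie \<subseteq> span {ut (-2) 1 1 0 g 0, ut 0 0 0 0 0 1}"
    proof
      fix X assume "X \<in> lie"
      then obtain k u v w where X: "X = k *\<^sub>R ut (-2) 1 1 0 g 0 + ut 0 0 0 u v w" "ut 0 0 0 u v w \<in> lie" using dec by blast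
      then have "X = k *\<^sub>R ut (-2) 1 1 0 g 0 + w *\<^sub>R ut 0 0 0 0 0 1" using sub[OF X(2)] by (simp add: X(1) ut_scale)
      then show "X \<in> span {ut (-2) 1 1 0 g 0, ut 0 0 0 0 0 1}" by (rule span2I)
    qed
    have "\<not> coarsely_dense H"
    proof (rule not_coarsely_dense_two_exp[OF conn subgroup_twisted_beta sub2], rule not_coarsely_dense_twisted_beta[OF g])
      fix h assume "h \<in> two_exp (ut (-2) 1 1 0 g 0) (ut 0 0 0 0 0 1)"
      then obtain t s where "h = mexp (t *\<^sub>R ut (-2) 1 1 0 g 0) ** mexp (s *\<^sub>R ut 0 0 0 0 0 1)" by (auto simp: two_exp_def)
      then have "h = ut (exp (-2*t)) (exp t) (exp t) 0 (g * t * exp t) (exp (-2*t) * s)"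
        by (simp add: ut_scale mexp_ker_beta mexp_unip ut_mult ut_eq_iff mult.commute)
      then show "\<exists>t s. h = ut (exp (-2*t)) (exp t) (exp t) 0 (g * t * exp t) s" by blast
    qed
    then show ?thesis using dim_le_2[OF sub2] by simp
  qed
  show ?thesis
  proof (cases rule: unipotent_part_cases)
    case zero
    then show ?thesis by (intro small) blast
  next
    case (line u v w)
    have "ut 0 0 0 (-3 * u) 0 (-3 * w - u * g) \<in> lie"
      using bracket_lie[OF Y line(1)] by (simp add: ut_lie_bracket)
    then obtain l where l: "-3 * u = l * u" "0 = l * v" "-3 * w - u * g = l * w" using line(3) by blast
    have v0: "v = 0"
    proof (rule ccontr)
      assume v: "v \<noteq> 0"
      then have "l = 0" using l by simp
      then have "u = 0" "w = 0" using l by auto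
      then show False using lie_scale[OF line(1), of "1 / v"] v E by simp
    qed
    have u0: "u = 0"
    proof (rule ccontr)
      assume u: "u \<noteq> 0"
      then have "l = -3" using l(1) by (metis mult_right_cancel)
      then show False using l u g by simp
    qed
    show ?thesis
    proof (rule small)
      fix x y z assume "ut 0 0 0 x y z \<in> lie"
      from line(3)[OF this] show "x = 0 \<and> y = 0" using u0 v0 by auto
    qed
  next
    case (plane u v)
    have "coarsely_dense H"
    proof (cases "v = 0")
      case False
      show ?thesis
      proof (cases "u = 0")
        case True
        then show ?thesis using lie_scale[OF plane(2)[of 0], of "1 / v"] False E by simp
      next
        case u: False
        then show ?thesis using coarsely_dense_of_plane(1)[OF plane(1) plane(2)] False by blast
      qed
    next
      case True
      then have u: "u \<noteq> 0" using plane(3) by simp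
      have e12: "ut 0 0 0 1 0 0 \<in> lie"
        using lie_scale[OF plane(2)[of 0], of "1 / u"] True u by simp
      show ?thesis
      proof (rule coarsely_dense_twisted_beta[OF g])
        fix t s
        have "mexp (t *\<^sub>R ut (-2) 1 1 0 g 0) ** mexp ((s / exp (-2*t)) *\<^sub>R ut 0 0 0 1 0 0) \<in> H"
          by (intro mult_H mexp_lie Y e12)
        moreover have "mexp (t *\<^sub>R ut (-2) 1 1 0 g 0) ** mexp ((s / exp (-2*t)) *\<^sub>R ut 0 0 0 1 0 0)
            = ut (exp (-2*t)) (exp t) (exp t) s (g * t * exp t) 0"
          by (simp add: ut_scale mexp_ker_beta mexp_unip ut_mult ut_eq_iff mult.commute)
        ultimately show "ut (exp (-2*t)) (exp t) (exp t) s (g * t * exp t) 0 \<in> H" by simp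
      qed
    qed
    moreover have "3 \<le> dim lie" by (rule dim_ge_3_of_plane[OF Y _ plane(1) plane(2)[of 0] plane(3)]) simp
    ultimately show ?thesis unfolding listed_def by blast
  qed
qed

text \<open>The bracket with the twisted element has eigenvalues 3, -3 and 0 on the three root
  directions, the last of which is excluded. A nilpotent part of dimension two would contain it, so
  at most the line of \<alpha> or that of \<beta> remains, and neither gives density.\<close>

lemma classification_twisted_alpha_beta:
  assumes Y: "ut 1 (-2) 1 0 0 g \<in> lie" and E: "ut 0 0 0 0 0 1 \<notin> lie" and g: "g \<noteq> 0"
    and eq: "\<And>a b c u v w. ut a b c u v w \<in> lie \<Longrightarrow> a = c"
  shows "(coarsely_dense H \<longrightarrow> listed H) \<and> (dim lie \<ge> 3 \<longrightarrow> coarsely_dense H)"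
proof -
  have dec: "\<exists>k u v w. X = k *\<^sub>R ut 1 (-2) 1 0 0 g + ut 0 0 0 u v w \<and> ut 0 0 0 u v w \<in> lie" if X: "X \<in> lie" for X
  proof -
    obtain a b c u v w where x: "X = ut a b c u v w" "a + b + c = 0" by (rule lieE[OF X])
    have k: "c = a" "b = -2 * a" using eq[OF X[unfolded x]] x(2) by auto
    have "ut 0 0 0 u v (w - a * g) \<in> lie"
      using lie_comb[OF X[unfolded x] Y, of "- a"] by (simp add: k)
    then show ?thesis by - (rule exI[of _ a], rule exI[of _ u], rule exI[of _ v], rule exI[of _ "w - a * g"], simp add: x k ut_scale ut_add ut_eq_iff)
  qed
  have small: ?thesis if sub: "\<And>x y z. ut 0 0 0 x y z \<in> lie \<Longrightarrow> \<exists>r. ut 0 0 0 x y z = r *\<^sub>R W"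
    and W: "subgroup (two_exp (ut 1 (-2) 1 0 0 g) W) SL3" "\<not> coarsely_dense (two_exp (ut 1 (-2) 1 0 0 g) W)" for W
  proof -
    have sub2: "lie \<subseteq> span {ut 1 (-2) 1 0 0 g, W}"
    proof
      fix X assume "X \<in> lie"
      then obtain k u v w where X: "X = k *\<^sub>R ut 1 (-2) 1 0 0 g + ut 0 0 0 u v w" "ut 0 0 0 u v w \<in> lie" using dec by blast
      then obtain r where "X = k *\<^sub>R ut 1 (-2) 1 0 0 g + r *\<^sub>R W" using sub by metis
      then show "X \<in> span {ut 1 (-2) 1 0 0 g, W}" by (rule span2I)
    qed
    show ?thesis using not_coarsely_dense_two_exp[OF conn W(1) sub2 W(2)] dim_le_2[OF sub2] by simp
  qed
  have d12: "\<not> coarsely_dense (two_exp (ut 1 (-2) 1 0 0 g) (ut 0 0 0 1 0 0))"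
  proof (rule not_coarsely_dense_twisted_alpha_beta_12[OF g])
    fix h assume "h \<in> two_exp (ut 1 (-2) 1 0 0 g) (ut 0 0 0 1 0 0)"
    then obtain t s where "h = mexp (t *\<^sub>R ut 1 (-2) 1 0 0 g) ** mexp (s *\<^sub>R ut 0 0 0 1 0 0)" by (auto simp: two_exp_def)
    then have "h = ut (exp t) (exp (-2*t)) (exp t) (exp t * s) 0 (g * t * exp t)"
      by (simp add: ut_scale mexp_ker_alpha_beta mexp_unip ut_mult ut_eq_iff mult.commute)
    then show "\<exists>t s. h = ut (exp t) (exp (-2*t)) (exp t) s 0 (g * t * exp t)" by blast
  qed
  have d23: "\<not> coarsely_dense (two_exp (ut 1 (-2) 1 0 0 g) (ut 0 0 0 0 1 0))"
  proof (rule not_coarsely_dense_twisted_alpha_beta_23[OF g])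
    fix h assume "h \<in> two_exp (ut 1 (-2) 1 0 0 g) (ut 0 0 0 0 1 0)"
    then obtain t s where "h = mexp (t *\<^sub>R ut 1 (-2) 1 0 0 g) ** mexp (s *\<^sub>R ut 0 0 0 0 1 0)" by (auto simp: two_exp_def)
    then have "h = ut (exp t) (exp (-2*t)) (exp t) 0 (exp (-2*t) * s) (g * t * exp t)"
      by (simp add: ut_scale mexp_ker_alpha_beta mexp_unip ut_mult ut_eq_iff mult.commute)
    then show "\<exists>t s. h = ut (exp t) (exp (-2*t)) (exp t) 0 s (g * t * exp t)" by blast
  qed
  show ?thesis
  proof (cases rule: unipotent_part_cases)
    case zero
    show ?thesis
    proof (rule small[OF _ subgroup_twisted_alpha_beta_12 d12])
      fix x y z assume "ut 0 0 0 x y z \<in> lie"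
      from zero[OF this] show "\<exists>r. ut 0 0 0 x y z = r *\<^sub>R ut 0 0 0 1 0 0" by (intro exI[of _ 0]) (simp add: ut_zero)
    qed
  next
    case (line u v w)
    have "ut 0 0 0 (3 * u) (-3 * v) 0 \<in> lie"
      using bracket_lie[OF Y line(1)] by (simp add: ut_lie_bracket)
    then obtain l where l: "3 * u = l * u" "-3 * v = l * v" "0 = l * w" using line(3) by blast
    consider "u \<noteq> 0" "v = 0" "w = 0" | "u = 0" "v \<noteq> 0" "w = 0"
    proof (cases "u = 0")
      case False
      then have "l = 3" using l by simp
      then have "v = 0" "w = 0" using l by auto
      then show ?thesis using that False by blast
    next
      case True
      show ?thesis
      proof (cases "v = 0")
        case False
        then have "l = -3" using l(2) by (metis mult_right_cancel)
        then have "w = 0" using l by auto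
        then show ?thesis using that True False by blast
      next
        case v: True
        then have "w \<noteq> 0" using True line(2) by simp
        then show ?thesis using lie_scale[OF line(1), of "1 / w"] True v E by simp
      qed
    qed
    then show ?thesis
    proof cases
      case 1
      show ?thesis
      proof (rule small[OF _ subgroup_twisted_alpha_beta_12 d12])
        fix x y z assume "ut 0 0 0 x y z \<in> lie"
        from line(3)[OF this] show "\<exists>r. ut 0 0 0 x y z = r *\<^sub>R ut 0 0 0 1 0 0"
          using 1 by (intro exI[of _ x]) (auto simp: ut_scale ut_eq_iff)
      qed
    next
      case 2
      show ?thesis
      proof (rule small[OF _ subgroup_twisted_alpha_beta_23 d23])
        fix x y z assume "ut 0 0 0 x y z \<in> lie"
        from line(3)[OF this] show "\<exists>r. ut 0 0 0 x y z = r *\<^sub>R ut 0 0 0 0 1 0"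
          using 2 by (intro exI[of _ y]) (auto simp: ut_scale ut_eq_iff)
      qed
    qed
  next
    case (plane u v)
    then show ?thesis using E by blast
  qed
qed

text \<open>If no root vanishes on the whole Lie algebra, diagonal parts of its elements belong to
  it. Otherwise a multiple \<open>g\<close> of that root vector may stay attached to the torus; it
  disappears if \<open>g\<close> is 0 or if the root vector itself belongs to the Lie algebra, and
  the twisted cases are what is left.\<close>

theorem classification:
  "(coarsely_dense H \<longrightarrow> listed H) \<and> (dim lie \<ge> 3 \<longrightarrow> coarsely_dense H)"
proof (cases "\<exists>a b c x y z. ut a b c x y z \<in> lie \<and> (a \<noteq> 0 \<or> b \<noteq> 0 \<or> c \<noteq> 0)")
  case False
  then show ?thesis by (intro classification_unipotent) blast
next
  case True
  then obtain a b c x y z where X: "ut a b c x y z \<in> lie" "a \<noteq> 0 \<or> b \<noteq> 0 \<or> c \<noteq> 0" by blast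
  have s: "a + b + c = 0" by (rule sum0[OF X(1)])
  consider (alpha) "\<And>a b c u v w. ut a b c u v w \<in> lie \<Longrightarrow> a = b"
    | (beta) "\<And>a b c u v w. ut a b c u v w \<in> lie \<Longrightarrow> b = c"
    | (alpha_beta) "\<And>a b c u v w. ut a b c u v w \<in> lie \<Longrightarrow> a = c"
    | (regular) "\<exists>X\<in>lie. X$1$1 \<noteq> X$2$2" "\<exists>X\<in>lie. X$2$2 \<noteq> X$3$3" "\<exists>X\<in>lie. X$1$1 \<noteq> X$3$3"
    by (metis ut_nth)
  then show ?thesis
  proof cases
    case regular
    note D = diag_part_lie[OF regular]
    show ?thesis
    proof (cases "\<forall>a' b' c' u v w. ut a' b' c' u v w \<in> lie \<longrightarrow> a * b' = a' * b")
      case False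
      then obtain a' b' c' u v w where "ut a' b' c' u v w \<in> lie" "a * b' \<noteq> a' * b" by blast
      then show ?thesis using classification_A[OF D[OF X(1)] D] by blast
    next
      case True
      show ?thesis
      proof (rule classification_torus[OF D[OF X(1)]])
        show "ut a b c 0 0 0 \<noteq> 0" using X(2) by (auto simp: ut_zero ut_eq_iff)
        fix a' b' c' u v w assume X': "ut a' b' c' u v w \<in> lie"
        have e: "a * b' = a' * b" using True X' by blast
        have s': "a' + b' + c' = 0" by (rule sum0[OF X'])
        have ab: "a \<noteq> 0 \<or> b \<noteq> 0" using X(2) s by auto
        show "\<exists>k. a' = k * a \<and> b' = k * b \<and> c' = k * c"
        proof (cases "a = 0")
          case True
          then have b0: "b \<noteq> 0" using ab by simp
          have "a' = 0" using e True b0 by simp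
          moreover have "c = - b" "c' = - b'" using s s' True \<open>a' = 0\<close> by linarith+
          ultimately show ?thesis using True b0 by (intro exI[of _ "b' / b"]) simp
        next
          case False
          have "b' = a' / a * b" using e False by (simp add: field_simps)
          moreover have "c = - a - b" "c' = - a' - b'" using s s' by linarith+
          ultimately show ?thesis using False by (intro exI[of _ "a' / a"]) (simp add: right_diff_distrib)
        qed
      qed
    qed
  next
    case alpha
    have a0: "a \<noteq> 0" using alpha[OF X(1)] s X(2) by auto
    have "\<exists>\<gamma>. ut 1 1 (-2) \<gamma> 0 0 \<in> lie"
      by (rule centralized_diag_lie_alpha[OF _ X(1) a0]) (erule alpha)
    then obtain g where g: "ut 1 1 (-2) g 0 0 \<in> lie" by blast
    show ?thesis
    proof (cases "g \<noteq> 0 \<and> ut 0 0 0 1 0 0 \<notin> lie")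
      case True
      then show ?thesis by (intro classification_twisted_alpha[OF g]) (simp_all, erule alpha)
    next
      case False
      have "ut 1 1 (-2) 0 0 0 \<in> lie"
        using False g lie_comb[OF g, of 0 0 0 1 0 0 "- g"] by (cases "g = 0") simp_all
      then show ?thesis
      proof (rule classification_torus)
        fix a' b' c' u v w assume X': "ut a' b' c' u v w \<in> lie"
        show "\<exists>k. a' = k * 1 \<and> b' = k * 1 \<and> c' = k * - 2"
          using alpha[OF X'] sum0[OF X'] by (intro exI[of _ a']) auto
      qed (simp add: ut_zero ut_eq_iff)
    qed
  next
    case beta
    have a0: "a \<noteq> 0" using beta[OF X(1)] s X(2) by auto
    have "\<exists>\<gamma>. ut (-2) 1 1 0 \<gamma> 0 \<in> lie"
      by (rule centralized_diag_lie_beta[OF _ X(1) a0]) (erule beta)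
    then obtain g where g: "ut (-2) 1 1 0 g 0 \<in> lie" by blast
    show ?thesis
    proof (cases "g \<noteq> 0 \<and> ut 0 0 0 0 1 0 \<notin> lie")
      case True
      then show ?thesis by (intro classification_twisted_beta[OF g]) (simp_all, erule beta)
    next
      case False
      have "ut (-2) 1 1 0 0 0 \<in> lie"
        using False g lie_comb[OF g, of 0 0 0 0 1 0 "- g"] by (cases "g = 0") simp_all
      then show ?thesis
      proof (rule classification_torus)
        fix a' b' c' u v w assume X': "ut a' b' c' u v w \<in> lie"
        show "\<exists>k. a' = k * - 2 \<and> b' = k * 1 \<and> c' = k * 1"
          using beta[OF X'] sum0[OF X'] by (intro exI[of _ b']) auto
      qed (simp add: ut_zero ut_eq_iff)
    qed
  next
    case alpha_beta
    have a0: "a \<noteq> 0" using alpha_beta[OF X(1)] s X(2) by auto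
    have "\<exists>\<gamma>. ut 1 (-2) 1 0 0 \<gamma> \<in> lie"
      by (rule centralized_diag_lie_alpha_beta[OF _ X(1) a0]) (erule alpha_beta)
    then obtain g where g: "ut 1 (-2) 1 0 0 g \<in> lie" by blast
    show ?thesis
    proof (cases "g \<noteq> 0 \<and> ut 0 0 0 0 0 1 \<notin> lie")
      case True
      then show ?thesis by (intro classification_twisted_alpha_beta[OF g]) (simp_all, erule alpha_beta)
    next
      case False
      have "ut 1 (-2) 1 0 0 0 \<in> lie"
        using False g lie_comb[OF g, of 0 0 0 0 0 1 "- g"] by (cases "g = 0") simp_all
      then show ?thesis
      proof (rule classification_torus)
        fix a' b' c' u v w assume X': "ut a' b' c' u v w \<in> lie"
        show "\<exists>k. a' = k * 1 \<and> b' = k * - 2 \<and> c' = k * 1"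
          using alpha_beta[OF X'] sum0[OF X'] by (intro exI[of _ a']) auto
      qed (simp add: ut_zero ut_eq_iff)
    qed
  qed
qed

lemma listed_coarsely_dense:
  assumes "listed H" shows "coarsely_dense H"
  using assms unfolding listed_def
proof (elim disjE exE conjE)
  assume "3 \<le> dim lie"
  then show ?thesis using classification by blast
next
  assume "H = A_grp"
  then show ?thesis by (intro coarsely_dense_A_grp) simp
next
  fix p assume "p \<noteq> 0" "H = two_exp (ut 0 0 0 1 p 0) (ut 0 0 0 0 0 1)"
  then show ?thesis by (intro coarsely_dense_unipotent[of p]) (auto simp: two_exp_unipotent)
next
  fix p assume "H = two_exp (ut 1 1 (-2) 0 0 0) (ut 0 0 0 0 1 p)"
  then show ?thesis by (intro coarsely_dense_ker_alpha[of p]) (auto simp: two_exp_ker_alpha)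
next
  fix p assume "H = two_exp (ut (-2) 1 1 0 0 0) (ut 0 0 0 1 0 p)"
  then show ?thesis by (intro coarsely_dense_ker_beta[of p]) (auto simp: two_exp_ker_beta)
next
  fix a b c \<omega> assume "a + b + c = 0" "ut a b c 0 0 0 \<noteq> 0" "\<not> other_weight \<omega> a b c"
    "H = two_exp (ut a b c 0 0 0) (root_vec \<omega>)"
  then show ?thesis by (intro coarsely_dense_root[of a b c \<omega>]) auto
qed

end

text \<open>A generator of the one-dimensional Lie algebra turns the condition on its ray into one
  on the order of three numbers.\<close>

lemma torus_line:
  "(\<exists>\<tt> \<omega>. subspace \<tt> \<and> \<tt> \<subseteq> a_alg \<and> dim \<tt> = 1 \<and>
         H = mexp ` \<tt> \<odot> root_group \<omega> \<and> ray_not_in_region \<omega> \<tt>) \<longleftrightarrow>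
   (\<exists>a b c \<omega>. a + b + c = 0 \<and> ut a b c 0 0 0 \<noteq> 0 \<and> \<not> other_weight \<omega> a b c \<and>
         H = two_exp (ut a b c 0 0 0) (root_vec \<omega>))" (is "?L \<longleftrightarrow> ?R")
proof
  assume ?L
  then obtain \<tt> \<omega> where t: "subspace \<tt>" "\<tt> \<subseteq> a_alg" "dim \<tt> = 1"
    "H = mexp ` \<tt> \<odot> root_group \<omega>" "ray_not_in_region \<omega> \<tt>" by blast
  obtain B where B: "B \<subseteq> \<tt>" "independent B" "\<tt> \<subseteq> span B" "card B = dim \<tt>" using basis_exists by blast
  then obtain \<tau> where tau: "B = {\<tau>}" using t(3) by (metis card_1_singletonE)
  have span: "\<tt> = span {\<tau>}"
    using B(3) span_minimal[OF B(1) t(1)] unfolding tau by (rule equalityI)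
  have "\<tau> \<noteq> 0" using B(2) tau by auto
  have "\<tau> \<in> a_alg" using B(1) tau t(2) by blast
  then obtain a b c where abc: "a + b + c = 0" "\<tau> = ut a b c 0 0 0" using a_alg_iff by blast
  have nz: "ut a b c 0 0 0 \<noteq> 0" using \<open>\<tau> \<noteq> 0\<close> abc(2) by simp
  have "H = two_exp (ut a b c 0 0 0) (root_vec \<omega>)" using t(4) unfolding span set_prod_root_group abc(2) .
  moreover have "\<not> other_weight \<omega> a b c"
    using t(5) ray_not_in_region_ut[OF abc(1) nz] unfolding span abc(2) by simp
  ultimately show ?R using abc(1) nz by blast
next
  assume ?R
  then obtain a b c \<omega> where r: "a + b + c = 0" "ut a b c 0 0 0 \<noteq> 0" "\<not> other_weight \<omega> a b c"
    "H = two_exp (ut a b c 0 0 0) (root_vec \<omega>)" by blast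
  have "span {ut a b c 0 0 0} \<subseteq> a_alg"
    using r(1) a_alg_iff by (intro span_minimal subspace_a_alg) blast
  moreover have "dim (span {ut a b c 0 0 0}) = 1" using r(2) by (simp add: dim_span dim_eq_card_independent)
  ultimately show ?L using r by (intro exI[of _ "span {ut a b c 0 0 0}"] exI[of _ \<omega>])
      (simp add: set_prod_root_group ray_not_in_region_ut)
qed

theorem theorem4p5:
  fixes H :: "(real^3^3) set"
  assumes "subgroup H SL3"
    and "closedin (top_of_set (carrier SL3)) H"
    and "connected H"
    and "H \<subseteq> A_grp \<odot> N_grp"
    and "compatible_with_A H"
  shows "cartan_decomposition_subgroup H \<longleftrightarrow>
      dim (lie_algebra H) \<ge> 3
    \<or> H = A_grp
    \<or> (\<exists>p::real. p \<noteq> 0 \<and>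
         H = {vector [vector [1, s, t], vector [0, 1, p * s], vector [0, 0, 1]] | s t. True})
    \<or> (\<exists>p::real. p \<noteq> 0 \<and>
         H = {vector [vector [exp t, 0, p * s], vector [0, exp t, s],
                      vector [0, 0, exp (- 2 * t)]] | s t. True})
    \<or> (\<exists>p::real. p \<noteq> 0 \<and>
         H = {vector [vector [exp (- 2 * t), s, p * s], vector [0, exp t, 0],
                      vector [0, 0, exp t]] | s t. True})
    \<or> (\<exists>\<tt> \<omega>. subspace \<tt> \<and> \<tt> \<subseteq> a_alg \<and> dim \<tt> = 1 \<and>
         H = mexp ` \<tt> \<odot> root_group \<omega> \<and> ray_not_in_region \<omega> \<tt>)"
proof -
  interpret AN_sg H
    using assms by (intro AN_sg.intro closed_sg.intro AN_sg_axioms.intro)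
  have ut: "vector [vector [a, u, w], vector [0, b, v], vector [0, 0, c]] = ut a b c u v w" for a b c u v w
    by (simp add: ut_def mk_def)
  have swap: "{f s t | s t. True} = {f s t | t s. True}" for f :: "real \<Rightarrow> real \<Rightarrow> mat3" by blast
  have "cartan_decomposition_subgroup H \<longleftrightarrow> listed H"
    using cds_iff_coarsely_dense[OF assms(1-3)] classification listed_coarsely_dense by blast
  then show ?thesis
    unfolding listed_def torus_line ut two_exp_unipotent two_exp_ker_alpha two_exp_ker_beta
      swap[of "\<lambda>s t. ut (exp t) (exp t) (exp (- 2 * t)) 0 s (_ * s)"]
      swap[of "\<lambda>s t. ut (exp (- 2 * t)) (exp t) (exp t) s 0 (_ * s)"] .
qed

end
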